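(* Let $\pi:M\to B$ be a Donaldson's adiabatic fibration and $P\to M$ a principal bundle (usually with structure group $U(r)$ or $PU(r)$). If $(A,\Phi)$ is an adiabatic $G_2$ monopole on $P$, then $d_A\Phi$ vanishes necessarily, so adiabatic $G_2$ monopoles are actually equivalent to adiabatic $G_2$ instantons.
   Context: **Donaldson's adiabatic fibration.** $B$ is a contractible oriented 3-manifold, $\pi:M\to B$ a smooth fibre bundle with fibres $M_b$ diffeomorphic to the (compact) K3 manifold, $H\subset TM$ an Ehresmann connection. $H$ induces a bigrading $\Omega^{p,q}$ of forms ($p$ horizontal, $q$ vertical degree) and $d=d_f+d_H+F_H$ with parts of bidegree $(0,1),(1,0),(2,-1)$. The data are $\underline\omega\in\Omega^{1,2}$, $\underline\lambda\in\Omega^{3,0}$, $\underline\Theta\in\Omega^{2,2}$, $\underline\mu\in\Omega^{0,4}$ which at each point, in suitable coframes $dt_i$ (of $T_b^*B$) and $dx_j$ (vertical), have the form $\underline\omega=\sum_i\omega_i dt_i$, $\underline\lambda=-dt_1dt_2dt_3$, $\underline\Theta=-\sum_{cyc}\omega_i dt_jdt_k$, $\underline\mu=\frac12\omega_1^2$ with $\omega_1=dx_1dx_2+dx_3dx_4$, $\omega_2=dx_1dx_3-dx_2dx_4$, $\omega_3=dx_1dx_4+dx_2dx_3$, and satisfy $d_f\underline\omega=0$, $d_H\underline\omega=0$, $d_f\underline\lambda=0$, $d_H\underline\mu=0$, $d_f\underline\Theta=0$, $d_H\underline\Theta=0$. The fibres carry the hyperkähler metric $\sum dx_j^2$, with Hodge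 star $*_4$ (orientation $\underline\mu$). **Adiabatic $G_2$ instanton:** a connection $A$ on $P\to M$ with $F_A\wedge\underline\Theta=0$. **Adiabatic $G_2$ monopole:** a pair of a connection $A$ on $P\to M$ and a Higgs field $\Phi$, i.e. a section of $\mathrm{ad}(P)$, with $F_A\wedge\underline\Theta+*_4(d_A\Phi)^{(0,1)}\wedge\underline\lambda=0$, where $(d_A\Phi)^{(0,1)}$ is the vertical component of $d_A\Phi$.
   Formalization: Only the vertical component of d_AΦ is shown to vanish (all of d_AΦ need not: take a trivial U(1)-bundle, A flat, Φ = i times a nonconstant function pulled back from B), and the structure group is assumed compact, since the claim fails for some noncompact groups. *)

theory Defs
  imports "HOL-Analysis.Analysis"
begin

section \<open>Smooth manifolds\<close>

text \<open>
  Manifolds are embedded submanifolds of Euclidean spaces, as in Milnor's Topology from the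
  Differentiable Viewpoint; by Whitney's theorem this loses no generality. A map on an arbitrary
  subset of a Euclidean space is smooth if it locally extends to a smooth map on an open set.
\<close>

primrec Ck_on :: "nat \<Rightarrow> 'a::euclidean_space set \<Rightarrow> ('a \<Rightarrow> 'v::real_normed_vector) \<Rightarrow> bool" where
  "Ck_on 0 U f \<longleftrightarrow> continuous_on U f"
| "Ck_on (Suc k) U f \<longleftrightarrow>
     f differentiable_on U \<and> (\<forall>v. Ck_on k U (\<lambda>x. frechet_derivative f (at x) v))"

definition smooth_on :: "'a::euclidean_space set \<Rightarrow> ('a \<Rightarrow> 'v::real_normed_vector) \<Rightarrow> bool" where
  "smooth_on S f \<longleftrightarrow>
     (\<forall>x\<in>S. \<exists>W g. open W \<and> x \<in> W \<and> (\<forall>k. Ck_on k W g) \<and> (\<forall>y\<in>S \<inter> W. g y = f y))"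

definition diffeo ::
  "'a::euclidean_space set \<Rightarrow> 'c::euclidean_space set \<Rightarrow> ('a \<Rightarrow> 'c) \<Rightarrow> bool" where
  "diffeo S T f \<longleftrightarrow> bij_betw f S T \<and> smooth_on S f \<and> smooth_on T (inv_into S f)"

text \<open>A \<open>d\<close>-dimensional linear subspace of the ambient space plays the role of the model space.\<close>

definition manifold :: "nat \<Rightarrow> 'a::euclidean_space set \<Rightarrow> bool" where
  "manifold d S \<longleftrightarrow>
     (\<forall>x\<in>S. \<exists>W (L :: 'a set) U f. open W \<and> x \<in> W \<and> subspace L \<and> dim L = d \<and>
        openin (top_of_set L) U \<and> diffeo (S \<inter> W) U f)"

definition tangent_space :: "'a::euclidean_space set \<Rightarrow> 'a \<Rightarrow> 'a set" where
  "tangent_space S x =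
     {v. \<exists>c \<epsilon>. \<epsilon> > 0 \<and> smooth_on {-\<epsilon><..<\<epsilon>} c \<and> c ` {-\<epsilon><..<\<epsilon>} \<subseteq> S \<and> c (0::real) = x \<and>
        (c has_vector_derivative v) (at 0)}"

text \<open>
  The differential at \<open>x\<close> of a smooth map on the manifold \<open>S\<close>. The derivative within \<open>S\<close> is unique
  only in directions tangent to \<open>S\<close>, so this is to be applied to tangent vectors.
\<close>

definition mdiff ::
  "'a::euclidean_space set \<Rightarrow> ('a \<Rightarrow> 'v::real_normed_vector) \<Rightarrow> 'a \<Rightarrow> 'a \<Rightarrow> 'v" where
  "mdiff S f x = frechet_derivative f (at x within S)"

section \<open>Differential forms\<close>

text \<open>
  An alternating \<open>k\<close>-linear map takes its arguments as a sequence, of which it uses the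
  entries \<open>0, \<dots>, k - 1\<close>.
\<close>

definition altform :: "nat \<Rightarrow> ((nat \<Rightarrow> 'a::real_vector) \<Rightarrow> 'v::real_vector) \<Rightarrow> bool" where
  "altform k a \<longleftrightarrow>
     (\<forall>v w. (\<forall>i<k. v i = w i) \<longrightarrow> a v = a w) \<and>
     (\<forall>v. \<forall>i<k. linear (\<lambda>u. a (v(i := u)))) \<and>
     (\<forall>v i j. i < j \<and> j < k \<and> v i = v j \<longrightarrow> a v = 0)"

definition wedge ::
  "nat \<Rightarrow> nat \<Rightarrow> ((nat \<Rightarrow> 'a) \<Rightarrow> 'v::real_vector) \<Rightarrow> ((nat \<Rightarrow> 'a) \<Rightarrow> real) \<Rightarrow> (nat \<Rightarrow> 'a) \<Rightarrow> 'v" where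
  "wedge p q a b v =
     (1 / (fact p * fact q)) *\<^sub>R
     (\<Sum>\<sigma> | \<sigma> permutes {..<p + q}.
        (of_int (sign \<sigma>) * b (\<lambda>i. v (\<sigma> (p + i)))) *\<^sub>R a (\<lambda>i. v (\<sigma> i)))"

text \<open>
  A \<open>k\<close>-form on a manifold \<open>S\<close> is represented by a smooth family of alternating maps on the ambient
  space, of which only the values on tangent vectors are relevant: every form on \<open>S\<close> arises in
  this way (compose with the orthogonal projections to the tangent spaces), and all identities
  between forms below are required on tangent vectors only.
\<close>

definition form ::
  "'a::euclidean_space set \<Rightarrow> nat \<Rightarrow> ('a \<Rightarrow> (nat \<Rightarrow> 'a) \<Rightarrow> 'v::real_normed_vector) \<Rightarrow> bool" where
  "form S k \<alpha> \<longleftrightarrow> (\<forall>x\<in>S. altform k (\<alpha> x)) \<and> (\<forall>v. smooth_on S (\<lambda>x. \<alpha> x v))"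

text \<open>
  The exterior derivative of a \<open>k\<close>-form, with the constant vector fields of the ambient space in
  the usual formula. On tangent vectors it is the exterior derivative of the restriction of
  \<open>\<alpha>\<close> to \<open>S\<close>, since \<open>d\<close> commutes with the pullback of a local extension along the inclusion.
\<close>

definition ext_deriv ::
  "'a::euclidean_space set \<Rightarrow> nat \<Rightarrow> ('a \<Rightarrow> (nat \<Rightarrow> 'a) \<Rightarrow> 'v::real_normed_vector) \<Rightarrow>
     'a \<Rightarrow> (nat \<Rightarrow> 'a) \<Rightarrow> 'v" where
  "ext_deriv S k \<alpha> x v =
     (\<Sum>i\<le>k. (-1) ^ i *\<^sub>R mdiff S (\<lambda>y. \<alpha> y (\<lambda>j. if j < i then v j else v (Suc j))) x (v i))"

section \<open>The K3 manifold and fibre bundles\<close>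

text \<open>
  The Fermat quartic \<open>z\<^sub>1\<^sup>4 + z\<^sub>2\<^sup>4 + z\<^sub>3\<^sup>4 + z\<^sub>4\<^sup>4 = 0\<close> in the complex projective space
  of dimension three, which is embedded in the matrices by sending the line through a unit
  vector \<open>z\<close> to the projection \<open>z z\<^sup>*\<close>. All complex K3 surfaces are diffeomorphic to it.
\<close>

definition K3 :: "(complex^4^4) set" where
  "K3 = {(\<chi> i j. z $ i * cnj (z $ j)) | z :: complex^4. norm z = 1 \<and> (\<Sum>i\<in>UNIV. z $ i ^ 4) = 0}"

definition fibre_bundle ::
  "'m::euclidean_space set \<Rightarrow> 'b::euclidean_space set \<Rightarrow> 'f::euclidean_space set \<Rightarrow>
     ('m \<Rightarrow> 'b) \<Rightarrow> bool" where
  "fibre_bundle M B F \<pi> \<longleftrightarrow>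
     smooth_on M \<pi> \<and> \<pi> ` M \<subseteq> B \<and>
     (\<forall>b\<in>B. \<exists>U \<psi>. open U \<and> b \<in> U \<and>
        diffeo {x \<in> M. \<pi> x \<in> U} ((B \<inter> U) \<times> F) (\<lambda>x. (\<pi> x, \<psi> x)))"

section \<open>Donaldson's adiabatic fibrations\<close>

text \<open>
  The orientation of the base is given by a nowhere vanishing 3-form, of which only the sign matters.
\<close>

record ('m, 'b) adiabatic_data =
  tot :: "'m set"
  base :: "'b set"
  orient :: "'b \<Rightarrow> (nat \<Rightarrow> 'b) \<Rightarrow> real"
  proj :: "'m \<Rightarrow> 'b"
  horiz :: "'m \<Rightarrow> 'm set"
  omega :: "'m \<Rightarrow> (nat \<Rightarrow> 'm) \<Rightarrow> real"
  lam :: "'m \<Rightarrow> (nat \<Rightarrow> 'm) \<Rightarrow> real"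
  Theta :: "'m \<Rightarrow> (nat \<Rightarrow> 'm) \<Rightarrow> real"
  mu :: "'m \<Rightarrow> (nat \<Rightarrow> 'm) \<Rightarrow> real"

definition vert ::
  "('m::euclidean_space, 'b::euclidean_space) adiabatic_data \<Rightarrow> 'm \<Rightarrow> 'm set" where
  "vert D x = {v \<in> tangent_space (tot D) x. mdiff (tot D) (proj D) x v = 0}"

definition ehresmann ::
  "('m::euclidean_space, 'b::euclidean_space) adiabatic_data \<Rightarrow> bool" where
  "ehresmann D \<longleftrightarrow>
     (\<forall>x\<in>tot D. subspace (horiz D x) \<and> horiz D x \<subseteq> tangent_space (tot D) x \<and>
        (\<forall>v\<in>tangent_space (tot D) x. \<exists>!h. h \<in> horiz D x \<and> v - h \<in> vert D x)) \<and>
     (\<forall>x\<in>tot D. \<exists>W X. open W \<and> x \<in> W \<and> (\<forall>i<3::nat. smooth_on (tot D \<inter> W) (X i)) \<and>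
        (\<forall>y\<in>tot D \<inter> W. horiz D y = span {X i y | i. i < 3}))"

definition hpart ::
  "('m::euclidean_space, 'b::euclidean_space) adiabatic_data \<Rightarrow> 'm \<Rightarrow> 'm \<Rightarrow> 'm" where
  "hpart D x v = (THE h. h \<in> horiz D x \<and> v - h \<in> vert D x)"

definition vpart ::
  "('m::euclidean_space, 'b::euclidean_space) adiabatic_data \<Rightarrow> 'm \<Rightarrow> 'm \<Rightarrow> 'm" where
  "vpart D x v = v - hpart D x v"

text \<open>
  The component of bidegree \<open>(p, q)\<close>, with horizontal degree \<open>p\<close> and vertical degree \<open>q\<close>, of a
  \<open>(p + q)\<close>-form \<open>a\<close> on the tangent space at \<open>x\<close>.
\<close>

definition bicomp ::
  "('m::euclidean_space, 'b::euclidean_space) adiabatic_data \<Rightarrow> 'm \<Rightarrow> nat \<Rightarrow> nat \<Rightarrow>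
     ((nat \<Rightarrow> 'm) \<Rightarrow> 'v::real_vector) \<Rightarrow> (nat \<Rightarrow> 'm) \<Rightarrow> 'v" where
  "bicomp D x p q a v =
     (\<Sum>I | I \<subseteq> {..<p + q} \<and> card I = p.
        a (\<lambda>i. if i \<in> I then hpart D x (v i) else vpart D x (v i)))"

definition Omega ::
  "('m::euclidean_space, 'b::euclidean_space) adiabatic_data \<Rightarrow> nat \<Rightarrow> nat \<Rightarrow>
     ('m \<Rightarrow> (nat \<Rightarrow> 'm) \<Rightarrow> real) set" where
  "Omega D p q =
     {\<alpha>. form (tot D) (p + q) \<alpha> \<and>
        (\<forall>x\<in>tot D. \<forall>v. (\<forall>i. v i \<in> tangent_space (tot D) x) \<longrightarrow> bicomp D x p q (\<alpha> x) v = \<alpha> x v)}"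

text \<open>The parts of bidegree \<open>(0, 1)\<close> and \<open>(1, 0)\<close> of the exterior derivative on forms in \<open>\<Omega>\<^sup>p\<^sup>,\<^sup>q\<close>.\<close>

definition d_f ::
  "('m::euclidean_space, 'b::euclidean_space) adiabatic_data \<Rightarrow> nat \<Rightarrow> nat \<Rightarrow>
     ('m \<Rightarrow> (nat \<Rightarrow> 'm) \<Rightarrow> real) \<Rightarrow> 'm \<Rightarrow> (nat \<Rightarrow> 'm) \<Rightarrow> real" where
  "d_f D p q \<alpha> x = bicomp D x p (q + 1) (ext_deriv (tot D) (p + q) \<alpha> x)"

definition d_H ::
  "('m::euclidean_space, 'b::euclidean_space) adiabatic_data \<Rightarrow> nat \<Rightarrow> nat \<Rightarrow>
     ('m \<Rightarrow> (nat \<Rightarrow> 'm) \<Rightarrow> real) \<Rightarrow> 'm \<Rightarrow> (nat \<Rightarrow> 'm) \<Rightarrow> real" where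
  "d_H D p q \<alpha> x = bicomp D x (p + 1) q (ext_deriv (tot D) (p + q) \<alpha> x)"

definition zero_form ::
  "('m::euclidean_space, 'b::euclidean_space) adiabatic_data \<Rightarrow>
     ('m \<Rightarrow> (nat \<Rightarrow> 'm) \<Rightarrow> real) \<Rightarrow> bool" where
  "zero_form D \<alpha> \<longleftrightarrow>
     (\<forall>x\<in>tot D. \<forall>v. (\<forall>i. v i \<in> tangent_space (tot D) x) \<longrightarrow> \<alpha> x v = 0)"

text \<open>A basis of the dual of \<open>L\<close>; the functionals are extended arbitrarily to the ambient space.\<close>

definition coframe :: "'a::euclidean_space set \<Rightarrow> nat \<Rightarrow> (nat \<Rightarrow> 'a \<Rightarrow> real) \<Rightarrow> bool" where
  "coframe L n \<theta> \<longleftrightarrow>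
     dim L = n \<and> (\<forall>i<n. linear (\<theta> i)) \<and> (\<forall>v\<in>L. (\<forall>i<n. \<theta> i v = 0) \<longrightarrow> v = 0)"

abbreviation covec :: "('a \<Rightarrow> real) \<Rightarrow> (nat \<Rightarrow> 'a) \<Rightarrow> real" where
  "covec \<theta> \<equiv> (\<lambda>v. \<theta> (v 0))"

text \<open>The forms \<open>\<omega>\<^sub>1, \<omega>\<^sub>2, \<omega>\<^sub>3\<close>, where the indices of the forms and of the \<open>dx\<^sub>j\<close> are shifted by one.\<close>

definition hk_form :: "(nat \<Rightarrow> 'a \<Rightarrow> real) \<Rightarrow> nat \<Rightarrow> (nat \<Rightarrow> 'a) \<Rightarrow> real" where
  "hk_form dx i v =
    (let w = (\<lambda>j k. wedge 1 1 (covec (dx j)) (covec (dx k)) v)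
     in if i = 0 then w 0 1 + w 2 3
        else if i = 1 then w 0 2 - w 1 3
        else w 0 3 + w 1 2)"

text \<open>The coframes in which the data at \<open>x\<close> have the standard form; \<open>t i\<close> is \<open>dt\<^sub>i\<close> pulled back to \<open>M\<close>.\<close>

definition adapted ::
  "('m::euclidean_space, 'b::euclidean_space) adiabatic_data \<Rightarrow> 'm \<Rightarrow>
     (nat \<Rightarrow> 'b \<Rightarrow> real) \<Rightarrow> (nat \<Rightarrow> 'm \<Rightarrow> real) \<Rightarrow> bool" where
  "adapted D x dt dx \<longleftrightarrow>
     coframe (tangent_space (base D) (proj D x)) 3 dt \<and>
     coframe (vert D x) 4 dx \<and> (\<forall>j<4. \<forall>h\<in>horiz D x. dx j h = 0) \<and>
     (let t = (\<lambda>i. covec (\<lambda>u. dt i (mdiff (tot D) (proj D) x u))); w = hk_form dx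
      in \<forall>v. (\<forall>i. v i \<in> tangent_space (tot D) x) \<longrightarrow>
        omega D x v = (\<Sum>i<3. wedge 2 1 (w i) (t i) v) \<and>
        lam D x v = - wedge 2 1 (wedge 1 1 (t 0) (t 1)) (t 2) v \<and>
        Theta D x v = - (wedge 2 2 (w 0) (wedge 1 1 (t 1) (t 2)) v
                       + wedge 2 2 (w 1) (wedge 1 1 (t 2) (t 0)) v
                       + wedge 2 2 (w 2) (wedge 1 1 (t 0) (t 1)) v) \<and>
        mu D x v = 1 / 2 * wedge 2 2 (w 0) (w 0) v)"

definition adiabatic_fibration ::
  "('m::euclidean_space, 'b::euclidean_space) adiabatic_data \<Rightarrow> bool" where
  "adiabatic_fibration D \<longleftrightarrow>
     manifold 3 (base D) \<and> contractible (base D) \<and>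
     form (base D) 3 (orient D) \<and>
     (\<forall>b\<in>base D. \<exists>v. (\<forall>i. v i \<in> tangent_space (base D) b) \<and> orient D b v \<noteq> 0) \<and>
     manifold 7 (tot D) \<and> fibre_bundle (tot D) (base D) K3 (proj D) \<and> ehresmann D \<and>
     omega D \<in> Omega D 1 2 \<and> lam D \<in> Omega D 3 0 \<and> Theta D \<in> Omega D 2 2 \<and> mu D \<in> Omega D 0 4 \<and>
     (\<forall>x\<in>tot D. \<exists>dt dx. adapted D x dt dx) \<and>
     zero_form D (d_f D 1 2 (omega D)) \<and> zero_form D (d_H D 1 2 (omega D)) \<and>
     zero_form D (d_f D 3 0 (lam D)) \<and> zero_form D (d_H D 0 4 (mu D)) \<and>
     zero_form D (d_f D 2 2 (Theta D)) \<and> zero_form D (d_H D 2 2 (Theta D))"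

text \<open>
  Two adapted coframes at \<open>x\<close> differ on the fibre by an element of \<open>SO(4)\<close>, so the hyperkaehler
  metric does not depend on the choice.
\<close>

definition fibre_metric ::
  "('m::euclidean_space, 'b::euclidean_space) adiabatic_data \<Rightarrow> 'm \<Rightarrow> 'm \<Rightarrow> 'm \<Rightarrow> real" where
  "fibre_metric D x u v =
     (let dx = (SOME dx. \<exists>dt. adapted D x dt dx) in \<Sum>j<4. dx j u * dx j v)"

text \<open>
  The Hodge star of the fibre metric on vertical 1-forms, by the index formula
  \<open>(* a)(u, v, w) = \<Sum>\<^sub>j a(e\<^sub>j) \<mu>(e\<^sub>j, u, v, w)\<close> in an orthonormal frame; it is independent of the frame
  and does not change if the latter reverses the orientation.
\<close>

definition star4 ::
  "('m::euclidean_space, 'b::euclidean_space) adiabatic_data \<Rightarrow> 'm \<Rightarrow>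
     ((nat \<Rightarrow> 'm) \<Rightarrow> 'v::real_vector) \<Rightarrow> (nat \<Rightarrow> 'm) \<Rightarrow> 'v" where
  "star4 D x a v =
     (let e = (SOME e :: nat \<Rightarrow> 'm. (\<forall>j<4. e j \<in> vert D x) \<and>
                 (\<forall>i<4. \<forall>j<4. fibre_metric D x (e i) (e j) = (if i = j then 1 else 0)))
      in \<Sum>j<4. mu D x (case_nat (e j) v) *\<^sub>R a (\<lambda>_. e j))"

section \<open>Principal bundles, connections and Higgs fields\<close>

definition cadj :: "complex^'n^'n \<Rightarrow> complex^'n^'n" where
  "cadj g = (\<chi> i j. cnj (g $ j $ i))"

text \<open>
  Compact Lie groups, as closed Lie subgroups of a unitary group; every compact Lie group has such a
  faithful representation.
\<close>

definition compact_lie_group :: "(complex^'n::finite^'n) set \<Rightarrow> bool" where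
  "compact_lie_group G \<longleftrightarrow>
     closed G \<and> (\<exists>d. manifold d G) \<and> mat 1 \<in> G \<and>
     (\<forall>g\<in>G. cadj g ** g = mat 1 \<and> g ** cadj g = mat 1 \<and> cadj g \<in> G) \<and>
     (\<forall>g\<in>G. \<forall>h\<in>G. g ** h \<in> G)"

definition lie_algebra :: "(complex^'n::finite^'n) set \<Rightarrow> (complex^'n^'n) set" where
  "lie_algebra G = tangent_space G (mat 1)"

definition bracket :: "complex^'n::finite^'n \<Rightarrow> complex^'n^'n \<Rightarrow> complex^'n^'n" where
  "bracket X Y = X ** Y - Y ** X"

record ('p, 'm, 'n) bundle_data =
  grp :: "(complex^'n^'n) set"
  ptot :: "'p set"
  pproj :: "'p \<Rightarrow> 'm"
  act :: "'p \<Rightarrow> complex^'n^'n \<Rightarrow> 'p"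

definition principal_bundle ::
  "('p::euclidean_space, 'm::euclidean_space, 'n::finite) bundle_data \<Rightarrow> 'm set \<Rightarrow> bool" where
  "principal_bundle Q M \<longleftrightarrow>
     compact_lie_group (grp Q) \<and> (\<exists>d. manifold d (ptot Q)) \<and>
     smooth_on (ptot Q) (pproj Q) \<and> pproj Q ` ptot Q \<subseteq> M \<and>
     smooth_on (ptot Q \<times> grp Q) (\<lambda>(p, g). act Q p g) \<and>
     (\<forall>p\<in>ptot Q. \<forall>g\<in>grp Q. act Q p g \<in> ptot Q \<and> pproj Q (act Q p g) = pproj Q p) \<and>
     (\<forall>p\<in>ptot Q. act Q p (mat 1) = p \<and>
        (\<forall>g\<in>grp Q. \<forall>h\<in>grp Q. act Q (act Q p g) h = act Q p (g ** h))) \<and>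
     (\<forall>x\<in>M. \<exists>U \<psi>. open U \<and> x \<in> U \<and>
        diffeo {p \<in> ptot Q. pproj Q p \<in> U} ((M \<inter> U) \<times> grp Q) (\<lambda>p. (pproj Q p, \<psi> p)) \<and>
        (\<forall>p\<in>ptot Q. \<forall>g\<in>grp Q. pproj Q p \<in> U \<longrightarrow> \<psi> (act Q p g) = \<psi> p ** g))"

definition connection ::
  "('p::euclidean_space, 'm::euclidean_space, 'n::finite) bundle_data \<Rightarrow>
     ('p \<Rightarrow> (nat \<Rightarrow> 'p) \<Rightarrow> complex^'n^'n) \<Rightarrow> bool" where
  "connection Q A \<longleftrightarrow>
     form (ptot Q) 1 A \<and>
     (\<forall>p\<in>ptot Q. \<forall>u\<in>tangent_space (ptot Q) p. A p (\<lambda>_. u) \<in> lie_algebra (grp Q)) \<and>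
     (\<forall>p\<in>ptot Q. \<forall>\<xi>\<in>lie_algebra (grp Q). A p (\<lambda>_. mdiff (grp Q) (act Q p) (mat 1) \<xi>) = \<xi>) \<and>
     (\<forall>p\<in>ptot Q. \<forall>g\<in>grp Q. \<forall>u\<in>tangent_space (ptot Q) p.
        A (act Q p g) (\<lambda>_. mdiff (ptot Q) (\<lambda>q. act Q q g) p u) = cadj g ** A p (\<lambda>_. u) ** g)"

text \<open>Sections of \<open>ad(P)\<close>, as equivariant functions on \<open>P\<close>.\<close>

definition higgs_field ::
  "('p::euclidean_space, 'm::euclidean_space, 'n::finite) bundle_data \<Rightarrow>
     ('p \<Rightarrow> complex^'n^'n) \<Rightarrow> bool" where
  "higgs_field Q \<Phi> \<longleftrightarrow>
     smooth_on (ptot Q) \<Phi> \<and> (\<forall>p\<in>ptot Q. \<Phi> p \<in> lie_algebra (grp Q)) \<and>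
     (\<forall>p\<in>ptot Q. \<forall>g\<in>grp Q. \<Phi> (act Q p g) = cadj g ** \<Phi> p ** g)"

text \<open>
  Forms on \<open>M\<close> with values in \<open>ad(P)\<close> correspond to basic forms \<open>\<alpha>\<close> on \<open>P\<close>; a point \<open>p\<close> of \<open>P\<close> over \<open>x\<close>
  identifies the fibre of \<open>ad(P)\<close> at \<open>x\<close> with the Lie algebra, and \<open>descend Q A \<alpha> p\<close> is the resulting
  Lie algebra valued form on the tangent space of \<open>M\<close> at \<open>x\<close>. Using horizontal lifts is immaterial,
  as \<open>\<alpha>\<close> vanishes on vertical vectors.
\<close>

definition hlift ::
  "('p::euclidean_space, 'm::euclidean_space, 'n::finite) bundle_data \<Rightarrow>
     ('p \<Rightarrow> (nat \<Rightarrow> 'p) \<Rightarrow> complex^'n^'n) \<Rightarrow> 'p \<Rightarrow> 'm \<Rightarrow> 'p" where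
  "hlift Q A p u =
     (THE h. h \<in> tangent_space (ptot Q) p \<and> A p (\<lambda>_. h) = 0 \<and> mdiff (ptot Q) (pproj Q) p h = u)"

definition descend ::
  "('p::euclidean_space, 'm::euclidean_space, 'n::finite) bundle_data \<Rightarrow>
     ('p \<Rightarrow> (nat \<Rightarrow> 'p) \<Rightarrow> complex^'n^'n) \<Rightarrow> ('p \<Rightarrow> (nat \<Rightarrow> 'p) \<Rightarrow> complex^'n^'n) \<Rightarrow>
     'p \<Rightarrow> (nat \<Rightarrow> 'm) \<Rightarrow> complex^'n^'n" where
  "descend Q A \<alpha> p v = \<alpha> p (\<lambda>i. hlift Q A p (v i))"

text \<open>\<open>F\<^sub>A = dA + [A \<and> A] / 2\<close> and \<open>d\<^sub>A \<Phi> = d\<Phi> + [A, \<Phi>]\<close> as forms on \<open>P\<close>, and then on \<open>M\<close>.\<close>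

definition curvature_on_P ::
  "('p::euclidean_space, 'm::euclidean_space, 'n::finite) bundle_data \<Rightarrow>
     ('p \<Rightarrow> (nat \<Rightarrow> 'p) \<Rightarrow> complex^'n^'n) \<Rightarrow> 'p \<Rightarrow> (nat \<Rightarrow> 'p) \<Rightarrow> complex^'n^'n" where
  "curvature_on_P Q A p v =
     ext_deriv (ptot Q) 1 A p v + bracket (A p (\<lambda>_. v 0)) (A p (\<lambda>_. v 1))"

definition cov_deriv_on_P ::
  "('p::euclidean_space, 'm::euclidean_space, 'n::finite) bundle_data \<Rightarrow>
     ('p \<Rightarrow> (nat \<Rightarrow> 'p) \<Rightarrow> complex^'n^'n) \<Rightarrow> ('p \<Rightarrow> complex^'n^'n) \<Rightarrow>
     'p \<Rightarrow> (nat \<Rightarrow> 'p) \<Rightarrow> complex^'n^'n" where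
  "cov_deriv_on_P Q A \<Phi> p v = mdiff (ptot Q) \<Phi> p (v 0) + bracket (A p (\<lambda>_. v 0)) (\<Phi> p)"

definition curvature ::
  "('p::euclidean_space, 'm::euclidean_space, 'n::finite) bundle_data \<Rightarrow>
     ('p \<Rightarrow> (nat \<Rightarrow> 'p) \<Rightarrow> complex^'n^'n) \<Rightarrow> 'p \<Rightarrow> (nat \<Rightarrow> 'm) \<Rightarrow> complex^'n^'n" where
  "curvature Q A = descend Q A (curvature_on_P Q A)"

definition cov_deriv ::
  "('p::euclidean_space, 'm::euclidean_space, 'n::finite) bundle_data \<Rightarrow>
     ('p \<Rightarrow> (nat \<Rightarrow> 'p) \<Rightarrow> complex^'n^'n) \<Rightarrow> ('p \<Rightarrow> complex^'n^'n) \<Rightarrow>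
     'p \<Rightarrow> (nat \<Rightarrow> 'm) \<Rightarrow> complex^'n^'n" where
  "cov_deriv Q A \<Phi> = descend Q A (cov_deriv_on_P Q A \<Phi>)"

definition vert_cov_deriv ::
  "('m::euclidean_space, 'b::euclidean_space) adiabatic_data \<Rightarrow>
     ('p::euclidean_space, 'm, 'n::finite) bundle_data \<Rightarrow>
     ('p \<Rightarrow> (nat \<Rightarrow> 'p) \<Rightarrow> complex^'n^'n) \<Rightarrow> ('p \<Rightarrow> complex^'n^'n) \<Rightarrow>
     'p \<Rightarrow> (nat \<Rightarrow> 'm) \<Rightarrow> complex^'n^'n" where
  "vert_cov_deriv D Q A \<Phi> p = bicomp D (pproj Q p) 0 1 (cov_deriv Q A \<Phi> p)"

definition zero_ad_form ::
  "('p::euclidean_space, 'm::euclidean_space, 'n::finite) bundle_data \<Rightarrow> 'm set \<Rightarrow>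
     ('p \<Rightarrow> (nat \<Rightarrow> 'm) \<Rightarrow> complex^'n^'n) \<Rightarrow> bool" where
  "zero_ad_form Q M \<alpha> \<longleftrightarrow>
     (\<forall>p\<in>ptot Q. \<forall>v. (\<forall>i. v i \<in> tangent_space M (pproj Q p)) \<longrightarrow> \<alpha> p v = 0)"

definition adiabatic_instanton ::
  "('m::euclidean_space, 'b::euclidean_space) adiabatic_data \<Rightarrow>
     ('p::euclidean_space, 'm, 'n::finite) bundle_data \<Rightarrow>
     ('p \<Rightarrow> (nat \<Rightarrow> 'p) \<Rightarrow> complex^'n^'n) \<Rightarrow> bool" where
  "adiabatic_instanton D Q A \<longleftrightarrow>
     connection Q A \<and>
     zero_ad_form Q (tot D) (\<lambda>p. wedge 2 4 (curvature Q A p) (Theta D (pproj Q p)))"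

definition adiabatic_monopole ::
  "('m::euclidean_space, 'b::euclidean_space) adiabatic_data \<Rightarrow>
     ('p::euclidean_space, 'm, 'n::finite) bundle_data \<Rightarrow>
     ('p \<Rightarrow> (nat \<Rightarrow> 'p) \<Rightarrow> complex^'n^'n) \<Rightarrow> ('p \<Rightarrow> complex^'n^'n) \<Rightarrow> bool" where
  "adiabatic_monopole D Q A \<Phi> \<longleftrightarrow>
     connection Q A \<and> higgs_field Q \<Phi> \<and>
     zero_ad_form Q (tot D) (\<lambda>p v.
       wedge 2 4 (curvature Q A p) (Theta D (pproj Q p)) v +
       wedge 3 3 (star4 D (pproj Q p) (vert_cov_deriv D Q A \<Phi> p)) (lam D (pproj Q p)) v)"

end

theory Submission
  imports Defs
begin

text \<open>
  The fibres are compact and \<open>\<Theta>\<close> is closed: the parts of \<open>d\<Theta>\<close> of bidegree \<open>(2, 3)\<close> and \<open>(3, 2)\<close>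
  vanish by assumption and the others because of the shape of \<open>\<Theta>\<close>. Together with the Bianchi identity,
  \<open>d \<langle>\<Phi>, F\<^sub>A\<rangle> \<and> \<Theta> = \<langle>d\<^sub>A\<Phi> \<and> F\<^sub>A\<rangle> \<and> \<Theta>\<close>, and by the monopole equation this is, up to a
  non-zero constant, \<open>|(d\<^sub>A\<Phi>)\<^sup>(\<^sup>0\<^sup>,\<^sup>1\<^sup>)|\<^sup>2 \<mu> \<and> \<lambda>\<close>. The monopole equation also identifies the
  6-form \<open>\<langle>\<Phi>, F\<^sub>A\<rangle> \<and> \<Theta>\<close> with the contraction of \<open>\<mu> \<and> \<lambda>\<close> with a multiple of the vertical gradient
  of \<open>|\<Phi>|\<^sup>2\<close>. So a vertical vector field has a non-negative divergence, which must vanish: multiply it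
  with the pullback of a bump function on the base, whose derivative annihilates vertical vectors and
  which has compact support since the projection is proper, and integrate over \<open>M\<close>. Only the density
  \<open>|\<mu> \<and> \<lambda>|\<close> is used, so that no orientations are involved.
\<close>

section \<open>Calculus of smooth maps\<close>

text \<open>The orthonormal frames behind the Hodge star are chosen independently at each point, so
  the vertical gradient \<open>vgrad\<close> has no visible regularity. Its coordinate expression
  \<open>Xc\<close> is therefore built from the curvature and \<Theta>, which are smooth, and
  \<open>S_eq\<close> identifies the two. The pairing \<open>S\<close> takes a matrix valued 1-form
  \<kappa>: with \<kappa> = \<Phi> dx_i it gives the components of the field, with \<kappa> = d_A
  \<Phi> its divergence. The constants count shuffles: 15 for splitting six slots as 2 + 4, 20 for 3
  + 3, and the contraction of the 4-form \<mu> contributes 4. Forms are families on the ambient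
  space and \<open>mdiff\<close> is a chosen derivative, meaningful on tangent vectors only.
  Computations are therefore moved to open sets by pulling back along charts, curves and local
  sections. The integration is done chart by chart, with two layers of weights, because the terms
  that cancel arise in different charts. The equation involves only the vertical component of d_A
  \<Phi>, and it is this component that is shown to vanish.\<close>

abbreviation dd :: "('a::real_normed_vector \<Rightarrow> 'v::real_normed_vector) \<Rightarrow> 'a \<Rightarrow> 'a \<Rightarrow> 'v" where
  "dd f x v \<equiv> frechet_derivative f (at x) v"

lemma dd_eqI: "(f has_derivative f') (at x) \<Longrightarrow> dd f x v = f' v"
  using frechet_derivative_at by metis

lemma Ck_on_Suc_imp: "open U \<Longrightarrow> Ck_on (Suc k) U f \<Longrightarrow> Ck_on k U f"
proof (induction k arbitrary: f)
  case 0
  then show ?case by (auto simp: differentiable_imp_continuous_on)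
next
  case (Suc k)
  show ?case
    using Suc.prems Suc.IH[OF \<open>open U\<close>] by auto
qed

lemma Ck_on_cong:
  assumes "open U" "\<And>x. x \<in> U \<Longrightarrow> f x = g x"
  shows "Ck_on k U f \<longleftrightarrow> Ck_on k U g"
  using assms(2)
proof (induction k arbitrary: f g)
  case 0
  then show ?case by (auto intro: continuous_on_cong)
next
  case (Suc k)
  have eq: "frechet_derivative f (at x) = frechet_derivative g (at x)" if "x \<in> U" for x
  proof -
    have "(f has_derivative D) (at x) \<longleftrightarrow> (g has_derivative D) (at x)" for D
      using Suc.prems that assms(1)
      by (auto elim!: has_derivative_transform_within_open)
    then show ?thesis by (simp add: frechet_derivative_def)
  qed
  have "f differentiable_on U \<longleftrightarrow> g differentiable_on U"
    using Suc.prems unfolding differentiable_on_def differentiable_def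
    by (metis has_derivative_transform)
  moreover have "Ck_on k U (\<lambda>x. frechet_derivative f (at x) v) \<longleftrightarrow> Ck_on k U (\<lambda>x. frechet_derivative g (at x) v)" for v
    by (rule Suc.IH) (simp add: eq)
  ultimately show ?case by simp
qed

lemma Ck_on_local:
  assumes "\<And>x. x \<in> U \<Longrightarrow> \<exists>W. open W \<and> x \<in> W \<and> Ck_on k W f"
  shows "Ck_on k U f"
  using assms
proof (induction k arbitrary: f)
  case 0
  have "continuous (at x within U) f" if x: "x \<in> U" for x
  proof -
    obtain W where "open W" "x \<in> W" "continuous_on W f" using 0[OF x] by auto
    then have "continuous (at x) f" using continuous_on_eq_continuous_at by blast
    then show ?thesis by (rule continuous_at_imp_continuous_at_within)
  qed
  then show ?case by (simp add: continuous_on_eq_continuous_within)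
next
  case (Suc k)
  have "f differentiable (at x within U)" if x: "x \<in> U" for x
  proof -
    obtain W where W: "open W" "x \<in> W" "f differentiable_on W" using Suc.prems[OF x] by auto
    then have "f differentiable (at x)" by (simp add: differentiable_on_eq_differentiable_at)
    then show ?thesis by (rule differentiable_at_withinI)
  qed
  moreover have "Ck_on k U (\<lambda>x. frechet_derivative f (at x) v)" for v
    by (rule Suc.IH) (use Suc.prems in fastforce)
  ultimately show ?case by (simp add: differentiable_on_def)
qed

lemma Ck_on_subset:
  assumes "open U" "Ck_on k U f" "V \<subseteq> U" shows "Ck_on k V f"
  by (rule Ck_on_local) (use assms in blast)

lemma Ck_on_const: "Ck_on k U (\<lambda>x. c)"
  by (induction k arbitrary: c) (auto simp: frechet_derivative_const)

lemma frechet_derivative_bounded_linear_compose: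
  assumes "bounded_linear L" "f differentiable (at x)"
  shows "frechet_derivative (\<lambda>x. L (f x)) (at x) v = L (frechet_derivative f (at x) v)"
proof -
  have "((\<lambda>x. L (f x)) has_derivative (\<lambda>v. L (frechet_derivative f (at x) v))) (at x)"
    by (rule bounded_linear.has_derivative[OF assms(1)]) (use assms(2) in \<open>simp add: frechet_derivative_works[symmetric]\<close>)
  then show ?thesis by (rule dd_eqI)
qed

lemma Ck_on_bounded_linear_compose:
  assumes "bounded_linear L" "open U"
  shows "Ck_on k U f \<Longrightarrow> Ck_on k U (\<lambda>x. L (f x))"
proof (induction k arbitrary: f)
  case 0
  then show ?case using assms by (auto intro: bounded_linear.continuous_on)
next
  case (Suc k)
  have d: "f differentiable (at x)" if "x \<in> U" for x
    using Suc.prems that assms(2) by (auto simp: differentiable_on_eq_differentiable_at)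
  have "(\<lambda>x. L (f x)) differentiable (at x)" if "x \<in> U" for x
    using d[OF that] bounded_linear.has_derivative[OF assms(1)] unfolding differentiable_def by metis
  moreover have "Ck_on k U (\<lambda>x. frechet_derivative (\<lambda>x. L (f x)) (at x) v)" for v
  proof -
    have "Ck_on k U (\<lambda>x. L (frechet_derivative f (at x) v))"
      by (rule Suc.IH) (use Suc.prems in auto)
    then show ?thesis
      using Ck_on_cong[OF assms(2), of "\<lambda>x. frechet_derivative (\<lambda>x. L (f x)) (at x) v" "\<lambda>x. L (frechet_derivative f (at x) v)"]
        frechet_derivative_bounded_linear_compose[OF assms(1) d] by simp
  qed
  ultimately show ?case using assms(2) by (simp add: differentiable_on_eq_differentiable_at)
qed

lemma Ck_on_add:
  assumes "open U"
  shows "Ck_on k U f \<Longrightarrow> Ck_on k U g \<Longrightarrow> Ck_on k U (\<lambda>x. f x + g x)"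
proof (induction k arbitrary: f g)
  case 0
  then show ?case by (auto intro: continuous_intros)
next
  case (Suc k)
  have d: "f differentiable (at x)" "g differentiable (at x)" if "x \<in> U" for x
    using Suc.prems that assms by (auto simp: differentiable_on_eq_differentiable_at)
  have eq: "frechet_derivative (\<lambda>x. f x + g x) (at x) v = frechet_derivative f (at x) v + frechet_derivative g (at x) v"
    if "x \<in> U" for x v
    by (rule dd_eqI) (intro has_derivative_add d[OF that, unfolded frechet_derivative_works])
  have "Ck_on k U (\<lambda>x. frechet_derivative (\<lambda>x. f x + g x) (at x) v)" for v
    using Ck_on_cong[OF assms eq[where v=v], where k=k] Suc by simp
  then show ?case using d assms by (simp add: differentiable_on_eq_differentiable_at)
qed

lemma Ck_on_bilinear:
  assumes p: "bounded_bilinear p" and "open U"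
  shows "Ck_on k U f \<Longrightarrow> Ck_on k U g \<Longrightarrow> Ck_on k U (\<lambda>x. p (f x) (g x))"
proof (induction k arbitrary: f g)
  case 0
  then show ?case using bounded_bilinear.continuous_on[OF p] by auto
next
  case (Suc k)
  have d: "(f has_derivative frechet_derivative f (at x)) (at x)" "(g has_derivative frechet_derivative g (at x)) (at x)" if "x \<in> U" for x
    using Suc.prems that assms(2) by (auto simp: differentiable_on_eq_differentiable_at frechet_derivative_works[symmetric])
  have d': "((\<lambda>x. p (f x) (g x)) has_derivative
     (\<lambda>v. p (f x) (frechet_derivative g (at x) v) + p (frechet_derivative f (at x) v) (g x))) (at x)" if "x \<in> U" for x
    using bounded_bilinear.FDERIV[OF p d[OF that]] .
  have eq: "frechet_derivative (\<lambda>x. p (f x) (g x)) (at x) v =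
     p (f x) (frechet_derivative g (at x) v) + p (frechet_derivative f (at x) v) (g x)" if "x \<in> U" for x v
    using dd_eqI[OF d'[OF that]] by simp
  have "Ck_on k U (\<lambda>x. p (f x) (frechet_derivative g (at x) v) + p (frechet_derivative f (at x) v) (g x))" for v
    by (intro Ck_on_add Suc.IH) (use Suc.prems Ck_on_Suc_imp[OF assms(2)] assms(2) in auto)
  then have "Ck_on k U (\<lambda>x. frechet_derivative (\<lambda>x. p (f x) (g x)) (at x) v)" for v
    using Ck_on_cong[OF assms(2) eq[where v=v], where k=k] by simp
  moreover have "(\<lambda>x. p (f x) (g x)) differentiable_on U"
    using d' assms(2) unfolding differentiable_on_eq_differentiable_at[OF assms(2)] differentiable_def by blast
  ultimately show ?case by simp
qed

lemma Ck_on_sum: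
  assumes "open U" "\<And>i. i \<in> I \<Longrightarrow> Ck_on k U (f i)"
  shows "Ck_on k U (\<lambda>x. \<Sum>i\<in>I. f i x)"
proof (cases "finite I")
  case True
  then show ?thesis using assms(2)
    by (induction I) (auto intro: Ck_on_add[OF assms(1)] Ck_on_const)
qed (simp add: Ck_on_const)

lemma Ck_on_compose:
  fixes g :: "'a::euclidean_space \<Rightarrow> 'b::euclidean_space" and f :: "'b \<Rightarrow> 'v::real_normed_vector"
  assumes U: "open U" and V: "open V" and gV: "\<And>x. x \<in> U \<Longrightarrow> g x \<in> V" 
  shows "Ck_on k U g \<Longrightarrow> Ck_on k V f \<Longrightarrow> Ck_on k U (\<lambda>x. f (g x))"
proof (induction k arbitrary: f)
  case 0
  then show ?case using gV by (auto intro: continuous_on_compose2)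
next
  case (Suc k)
  have dg: "(g has_derivative frechet_derivative g (at x)) (at x)" if "x \<in> U" for x
    using Suc.prems that U by (auto simp: differentiable_on_eq_differentiable_at frechet_derivative_works[symmetric])
  have df: "(f has_derivative frechet_derivative f (at x)) (at x)" if "x \<in> V" for x
    using Suc.prems that V by (auto simp: differentiable_on_eq_differentiable_at frechet_derivative_works[symmetric])
  have d': "((\<lambda>x. f (g x)) has_derivative (\<lambda>v. frechet_derivative f (at (g x)) (frechet_derivative g (at x) v))) (at x)"
    if "x \<in> U" for x
    using has_derivative_compose[OF dg[OF that] df[OF gV[OF that]]] .
  \<comment> \<open>\<open>Ck_on\<close> controls derivatives along constant vectors only. The
    moving vector dg(v) is therefore expanded in the basis, which leaves scalar coefficients times
    derivatives of f along fixed directions.\<close>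
  have eq: "frechet_derivative (\<lambda>x. f (g x)) (at x) v =
      (\<Sum>b\<in>Basis. (frechet_derivative g (at x) v \<bullet> b) *\<^sub>R frechet_derivative f (at (g x)) b)" if x: "x \<in> U" for x v
  proof -
    interpret L: linear "frechet_derivative f (at (g x))"
      using df[OF gV[OF x]] has_derivative_linear by blast
    have "frechet_derivative f (at (g x)) (frechet_derivative g (at x) v)
      = frechet_derivative f (at (g x)) (\<Sum>b\<in>Basis. (frechet_derivative g (at x) v \<bullet> b) *\<^sub>R b)"
      by (simp add: euclidean_representation)
    then show ?thesis
      using dd_eqI[OF d'[OF x]] by (simp add: L.sum L.scale)
  qed
  have "Ck_on k U (\<lambda>x. \<Sum>b\<in>Basis. (frechet_derivative g (at x) v \<bullet> b) *\<^sub>R frechet_derivative f (at (g x)) b)" for v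
    by (intro Ck_on_sum U Ck_on_bilinear[OF bounded_bilinear_scaleR] Suc.IH
        Ck_on_bounded_linear_compose[OF bounded_linear_inner_left])
      (use Suc.prems Ck_on_Suc_imp[OF U] in auto)
  then have "Ck_on k U (\<lambda>x. frechet_derivative (\<lambda>x. f (g x)) (at x) v)" for v
    using Ck_on_cong[OF U eq[where v=v], where k=k] by simp
  moreover have "(\<lambda>x. f (g x)) differentiable_on U"
    using d' unfolding differentiable_on_eq_differentiable_at[OF U] differentiable_def by blast
  ultimately show ?case by simp
qed

text \<open>Openness is built in, so that derivatives \<open>at\<close> a point of U depend only on
  the values of the function on U.\<close>

definition Cinf :: "'a::euclidean_space set \<Rightarrow> ('a \<Rightarrow> 'v::real_normed_vector) \<Rightarrow> bool" where
  "Cinf U f \<longleftrightarrow> open U \<and> (\<forall>k. Ck_on k U f)"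

lemma Cinf_open: "Cinf U f \<Longrightarrow> open U"
  by (simp add: Cinf_def)

lemma Cinf_deriv: "Cinf U f \<Longrightarrow> Cinf U (\<lambda>x. dd f x v)"
  unfolding Cinf_def using Ck_on.simps(2) by blast

lemma Cinf_differentiable: "Cinf U f \<Longrightarrow> x \<in> U \<Longrightarrow> f differentiable (at x)"
  unfolding Cinf_def using Ck_on.simps(2)[of 0] differentiable_on_eq_differentiable_at by blast

lemma Cinf_has_derivative: "Cinf U f \<Longrightarrow> x \<in> U \<Longrightarrow> (f has_derivative dd f x) (at x)"
  using Cinf_differentiable frechet_derivative_works by blast

lemma Cinf_linear: "Cinf U f \<Longrightarrow> x \<in> U \<Longrightarrow> linear (dd f x)"
  using Cinf_has_derivative has_derivative_linear by blast

lemma Cinf_continuous_on: "Cinf U f \<Longrightarrow> continuous_on U f"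
  unfolding Cinf_def using Ck_on.simps(1) by blast

lemma Cinf_cong: "(\<And>x. x \<in> U \<Longrightarrow> f x = g x) \<Longrightarrow> Cinf U f \<longleftrightarrow> Cinf U g"
  unfolding Cinf_def using Ck_on_cong by blast

lemma Cinf_subset: "Cinf U f \<Longrightarrow> open V \<Longrightarrow> V \<subseteq> U \<Longrightarrow> Cinf V f"
  unfolding Cinf_def using Ck_on_subset by blast

lemma Cinf_local:
  "open U \<Longrightarrow> (\<And>x. x \<in> U \<Longrightarrow> \<exists>W. x \<in> W \<and> Cinf W f) \<Longrightarrow> Cinf U f"
  unfolding Cinf_def using Ck_on_local by metis

lemma Cinf_const: "open U \<Longrightarrow> Cinf U (\<lambda>x. c)"
  by (simp add: Cinf_def Ck_on_const)

lemma Cinf_add: "Cinf U f \<Longrightarrow> Cinf U g \<Longrightarrow> Cinf U (\<lambda>x. f x + g x)"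
  by (simp add: Cinf_def Ck_on_add)

lemma Cinf_blinear: "bounded_linear L \<Longrightarrow> Cinf U f \<Longrightarrow> Cinf U (\<lambda>x. L (f x))"
  by (simp add: Cinf_def Ck_on_bounded_linear_compose)

lemma Cinf_minus: "Cinf U f \<Longrightarrow> Cinf U (\<lambda>x. - f x)"
  by (rule Cinf_blinear[OF bounded_linear_minus[OF bounded_linear_ident]])

lemma Cinf_diff: "Cinf U f \<Longrightarrow> Cinf U g \<Longrightarrow> Cinf U (\<lambda>x. f x - g x)"
  using Cinf_add[OF _ Cinf_minus, of U f g] by simp

lemma Cinf_bilinear: "bounded_bilinear p \<Longrightarrow> Cinf U f \<Longrightarrow> Cinf U g \<Longrightarrow> Cinf U (\<lambda>x. p (f x) (g x))"
  by (simp add: Cinf_def Ck_on_bilinear)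

lemmas Cinf_scaleR = Cinf_bilinear[OF bounded_bilinear_scaleR]
  and Cinf_mult = Cinf_bilinear[OF bounded_bilinear_mult]
  and Cinf_inner = Cinf_bilinear[OF bounded_bilinear_inner]

lemma Cinf_sum: "open U \<Longrightarrow> (\<And>i. i \<in> I \<Longrightarrow> Cinf U (f i)) \<Longrightarrow> Cinf U (\<lambda>x. \<Sum>i\<in>I. f i x)"
  by (simp add: Cinf_def Ck_on_sum)

lemma Cinf_compose:
  fixes g :: "'a::euclidean_space \<Rightarrow> 'b::euclidean_space"
  shows "Cinf U g \<Longrightarrow> Cinf V f \<Longrightarrow> (\<And>x. x \<in> U \<Longrightarrow> g x \<in> V) \<Longrightarrow> Cinf U (\<lambda>x. f (g x))"
  unfolding Cinf_def by (metis Ck_on_compose)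

lemma Ck_on_ident: "open U \<Longrightarrow> Ck_on k U (\<lambda>x. x)"
  by (cases k) (auto simp: frechet_derivative_ident Ck_on_const)

lemma Cinf_ident: "open U \<Longrightarrow> Cinf U (\<lambda>x. x)"
  by (simp add: Cinf_def Ck_on_ident)

lemma Cinf_linear_map: "linear (f::'a::euclidean_space \<Rightarrow> 'v::real_normed_vector) \<Longrightarrow> open U \<Longrightarrow> Cinf U f"
  using Cinf_blinear[OF _ Cinf_ident] linear_conv_bounded_linear by blast

lemma Cinf_Pair: "Cinf U f \<Longrightarrow> Cinf U g \<Longrightarrow> Cinf U (\<lambda>x. (f x, g x))"
  using Cinf_add[OF Cinf_blinear[of "\<lambda>a. (a, 0)"] Cinf_blinear[of "\<lambda>b. (0, b)"]]
  by (simp add: bounded_linear_Pair bounded_linear_ident bounded_linear_zero)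

lemma dd_bilinear:
  assumes p: "bounded_bilinear p" and "f differentiable (at x)" "g differentiable (at x)"
  shows "dd (\<lambda>x. p (f x) (g x)) x v = p (f x) (dd g x v) + p (dd f x v) (g x)"
  using dd_eqI[OF bounded_bilinear.FDERIV[OF p assms(2,3)[unfolded frechet_derivative_works]]] by simp

lemma dd_compose:
  assumes "g differentiable (at x)" "f differentiable (at (g x))"
  shows "dd (\<lambda>x. f (g x)) x v = dd f (g x) (dd g x v)"
  using dd_eqI[OF has_derivative_compose[OF assms[unfolded frechet_derivative_works]]] by simp

lemma dd_cong:
  assumes "open U" "x \<in> U" "\<And>y. y \<in> U \<Longrightarrow> f y = g y"
  shows "dd f x v = dd g x v"
proof -
  have "(f has_derivative D) (at x) \<longleftrightarrow> (g has_derivative D) (at x)" for D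
    using assms by (auto elim!: has_derivative_transform_within_open)
  then show ?thesis by (simp add: frechet_derivative_def)
qed

subsection \<open>Symmetry of second derivatives\<close>

text \<open>The mean value theorem is applied to the second difference first in direction u, then in
  direction v. The second difference itself is symmetric in u and v.\<close>

lemma second_difference_mvt:
  fixes f :: "'a::euclidean_space \<Rightarrow> real"
  assumes f: "Cinf U f" and h: "h > 0"
    and U: "\<And>s t. 0 \<le> s \<Longrightarrow> s \<le> h \<Longrightarrow> 0 \<le> t \<Longrightarrow> t \<le> h \<Longrightarrow> x + s *\<^sub>R u + t *\<^sub>R v \<in> U"
  obtains s t where "0 < s" "s < h" "0 < t" "t < h"
    "f (x + h *\<^sub>R u + h *\<^sub>R v) - f (x + h *\<^sub>R u) - (f (x + h *\<^sub>R v) - f x)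
      = h * h * dd (\<lambda>y. dd f y u) (x + s *\<^sub>R u + t *\<^sub>R v) v"
proof -
  define g where "g s = f (x + s *\<^sub>R u + h *\<^sub>R v) - f (x + s *\<^sub>R u)" for s
  define g' where "g' s = dd f (x + s *\<^sub>R u + h *\<^sub>R v) u - dd f (x + s *\<^sub>R u) u" for s
  have der: "((\<lambda>s. F (x + s *\<^sub>R u + c)) has_real_derivative dd F (x + s *\<^sub>R u + c) u) (at s)"
    if "Cinf U F" "x + s *\<^sub>R u + c \<in> U" for F s c u x
  proof -
    have "((\<lambda>s. F (x + s *\<^sub>R u + c)) has_derivative (\<lambda>r. dd F (x + s *\<^sub>R u + c) (r *\<^sub>R u))) (at s)"
      by (rule has_derivative_compose[where g = F and f = "\<lambda>s. x + s *\<^sub>R u + c", OF _ Cinf_has_derivative[OF that]])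
        (auto intro!: derivative_eq_intros)
    moreover have "dd F (x + s *\<^sub>R u + c) (r *\<^sub>R u) = r * dd F (x + s *\<^sub>R u + c) u" for r
      using linear_scale[OF Cinf_linear[OF that]] by simp
    ultimately show ?thesis by (simp add: has_field_derivative_def mult.commute fun_eq_iff mult_commute_abs)
  qed
  have gd: "(g has_real_derivative g' s) (at s)" if "0 \<le> s" "s \<le> h" for s
    unfolding g_def g'_def
    using DERIV_diff[OF der[OF f U[OF that], of h] der[OF f, of x s u 0]] U[OF that, of 0] U[OF that, of h] h by simp
  obtain s where s: "0 < s" "s < h" "g h - g 0 = (h - 0) * g' s"
    using MVT2[of 0 h g g'] gd h by blast
  have "((\<lambda>t. dd f (x + s *\<^sub>R u + t *\<^sub>R v) u) has_real_derivative dd (\<lambda>y. dd f y u) (x + s *\<^sub>R u + t *\<^sub>R v) v) (at t)"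
    if "0 \<le> t" "t \<le> h" for t
    using der[OF Cinf_deriv[OF f], of "x + s *\<^sub>R u" t v 0] U[of s t] s that by simp
  then obtain t where t: "0 < t" "t < h" "dd f (x + s *\<^sub>R u + h *\<^sub>R v) u - dd f (x + s *\<^sub>R u + 0 *\<^sub>R v) u
      = (h - 0) * dd (\<lambda>y. dd f y u) (x + s *\<^sub>R u + t *\<^sub>R v) v"
    using MVT2[of 0 h "\<lambda>t. dd f (x + s *\<^sub>R u + t *\<^sub>R v) u" "\<lambda>t. dd (\<lambda>y. dd f y u) (x + s *\<^sub>R u + t *\<^sub>R v) v"] h by blast
  have "f (x + h *\<^sub>R u + h *\<^sub>R v) - f (x + h *\<^sub>R u) - (f (x + h *\<^sub>R v) - f x)
      = h * h * dd (\<lambda>y. dd f y u) (x + s *\<^sub>R u + t *\<^sub>R v) v"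
    using s(3) t(3) by (simp add: g_def g'_def)
  then show ?thesis using that s t by blast
qed

text \<open>Evaluating the symmetric second difference in both orders gives equal mixed derivatives
  at two points near x. Both points tend to x with h, and the mixed derivatives are
  continuous.\<close>

lemma second_derivative_symmetric_real:
  fixes f :: "'a::euclidean_space \<Rightarrow> real"
  assumes f: "Cinf U f" and x: "x \<in> U"
  shows "dd (\<lambda>y. dd f y u) x v = dd (\<lambda>y. dd f y v) x u"
proof -
  obtain r where r: "r > 0" "ball x r \<subseteq> U" using Cinf_open[OF f] x openE by blast
  define P where "P = (\<lambda>y. dd (\<lambda>y. dd f y u) y v)"
  define Q where "Q = (\<lambda>y. dd (\<lambda>y. dd f y v) y u)"
  have cont: "isCont P x" "isCont Q x"
    unfolding P_def Q_def
    using Cinf_continuous_on[OF Cinf_deriv[OF Cinf_deriv[OF f]]] x Cinf_open[OF f]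
    by (auto simp: continuous_on_eq_continuous_at)
  have "\<bar>P x - Q x\<bar> \<le> e" if e: "e > 0" for e
  proof -
    obtain d1 where d1: "d1 > 0" "\<And>y. dist y x < d1 \<Longrightarrow> dist (P y) (P x) < e/2"
      using cont(1) e unfolding continuous_at by (metis LIM_zero_iff half_gt_zero tendstoD continuous_at_eps_delta cont(1))
    obtain d2 where d2: "d2 > 0" "\<And>y. dist y x < d2 \<Longrightarrow> dist (Q y) (Q x) < e/2"
      using cont(2) e by (metis half_gt_zero continuous_at_eps_delta)
    \<comment> \<open>Keeps the whole parallelogram of side h inside the ball in U and inside both
      continuity radii; the summand 1 avoids division by zero when u = v = 0.\<close>
    define h where "h = min r (min d1 d2) / (norm u + norm v + 1)"
    have n: "norm u + norm v + 1 > 0" by (smt (verit) norm_ge_zero)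
    have h: "h > 0" using r d1 d2 n by (simp add: h_def)
    have small: "dist (x + s *\<^sub>R u + t *\<^sub>R v) x < min r (min d1 d2)" if "0 \<le> s" "s \<le> h" "0 \<le> t" "t \<le> h" for s t
    proof -
      have "dist (x + s *\<^sub>R u + t *\<^sub>R v) x \<le> s * norm u + t * norm v"
        using norm_triangle_ineq[of "s *\<^sub>R u" "t *\<^sub>R v"] that by (simp add: dist_norm)
      also have "\<dots> \<le> h * norm u + h * norm v" using that by (intro add_mono mult_right_mono) auto
      also have "\<dots> < h * (norm u + norm v + 1)" using h by (simp add: algebra_simps)
      also have "\<dots> = min r (min d1 d2)" using n by (simp add: h_def)
      finally show ?thesis .
    qed
    have U1: "x + s *\<^sub>R u + t *\<^sub>R v \<in> U" if "0 \<le> s" "s \<le> h" "0 \<le> t" "t \<le> h" for s t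
      using small[OF that] r(2) by (auto simp: dist_commute)
    have U2: "x + s *\<^sub>R v + t *\<^sub>R u \<in> U" if "0 \<le> s" "s \<le> h" "0 \<le> t" "t \<le> h" for s t
      using U1[of t s] that by (simp add: algebra_simps)
    obtain s t where st: "0 < s" "s < h" "0 < t" "t < h"
      "f (x + h *\<^sub>R u + h *\<^sub>R v) - f (x + h *\<^sub>R u) - (f (x + h *\<^sub>R v) - f x) = h * h * P (x + s *\<^sub>R u + t *\<^sub>R v)"
      using second_difference_mvt[OF f h U1] unfolding P_def by blast
    obtain s' t' where st': "0 < s'" "s' < h" "0 < t'" "t' < h"
      "f (x + h *\<^sub>R v + h *\<^sub>R u) - f (x + h *\<^sub>R v) - (f (x + h *\<^sub>R u) - f x) = h * h * Q (x + s' *\<^sub>R v + t' *\<^sub>R u)"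
      using second_difference_mvt[OF f h U2] unfolding Q_def by blast
    have "h * h * P (x + s *\<^sub>R u + t *\<^sub>R v) = h * h * Q (x + s' *\<^sub>R v + t' *\<^sub>R u)"
      using st(5) st'(5) by (simp add: algebra_simps)
    then have "P (x + s *\<^sub>R u + t *\<^sub>R v) = Q (x + t' *\<^sub>R u + s' *\<^sub>R v)" using h by (simp add: algebra_simps)
    moreover have "dist (P (x + s *\<^sub>R u + t *\<^sub>R v)) (P x) < e/2" using d1(2) small[of s t] st by simp
    moreover have "dist (Q (x + t' *\<^sub>R u + s' *\<^sub>R v)) (Q x) < e/2" using d2(2) small[of t' s'] st' by simp
    ultimately show ?thesis unfolding dist_real_def by linarith
  qed
  then have "P x = Q x" by (metis abs_le_zero_iff dense_ge right_minus_eq)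
  then show ?thesis by (simp add: P_def Q_def)
qed

lemma second_derivative_symmetric:
  fixes f :: "'a::euclidean_space \<Rightarrow> 'v::euclidean_space"
  assumes f: "Cinf U f" and x: "x \<in> U"
  shows "dd (\<lambda>y. dd f y u) x v = dd (\<lambda>y. dd f y v) x u"
proof (rule euclidean_eqI)
  fix b :: 'v assume "b \<in> Basis"
  have fb: "Cinf U (\<lambda>y. f y \<bullet> b)" by (rule Cinf_blinear[OF bounded_linear_inner_left f])
  have 1: "dd (\<lambda>y. f y \<bullet> b) y w = dd f y w \<bullet> b" if "y \<in> U" for y w
    by (rule frechet_derivative_bounded_linear_compose[OF bounded_linear_inner_left Cinf_differentiable[OF f that]])
  have 2: "dd (\<lambda>y. dd f y w \<bullet> b) x z = dd (\<lambda>y. dd f y w) x z \<bullet> b" for w z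
    by (rule frechet_derivative_bounded_linear_compose[OF bounded_linear_inner_left Cinf_differentiable[OF Cinf_deriv[OF f] x]])
  have 3: "dd (\<lambda>y. dd (\<lambda>y. f y \<bullet> b) y w) x z = dd (\<lambda>y. dd f y w \<bullet> b) x z" for w z
    by (rule dd_cong[OF Cinf_open[OF f] x]) (simp add: 1)
  show "dd (\<lambda>y. dd f y u) x v \<bullet> b = dd (\<lambda>y. dd f y v) x u \<bullet> b"
    using second_derivative_symmetric_real[OF fb x, of u v] by (simp add: 3 2)
qed

section \<open>Alternating maps\<close>

abbreviation tp :: "'a \<Rightarrow> 'a \<Rightarrow> 'a \<Rightarrow> 'a" where "tp \<equiv> Transposition.transpose"

abbreviation sgnp :: "(nat \<Rightarrow> nat) \<Rightarrow> real" where "sgnp \<sigma> \<equiv> of_int (sign \<sigma>)"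

text \<open>The multilinear part of \<open>altform\<close>: products of forms, before
  antisymmetrisation, are multilinear without being alternating.\<close>

definition mlin :: "nat \<Rightarrow> ((nat \<Rightarrow> 'a::real_vector) \<Rightarrow> 'v::real_vector) \<Rightarrow> bool" where
  "mlin k a \<longleftrightarrow>
     (\<forall>v w. (\<forall>i<k. v i = w i) \<longrightarrow> a v = a w) \<and> (\<forall>v. \<forall>i<k. linear (\<lambda>u. a (v(i := u))))"

lemma mlin_cong: "mlin k a \<Longrightarrow> (\<And>i. i < k \<Longrightarrow> v i = w i) \<Longrightarrow> a v = a w"
  unfolding mlin_def by blast

lemma mlin_linear: "mlin k a \<Longrightarrow> i < k \<Longrightarrow> linear (\<lambda>u. a (v(i := u)))"
  unfolding mlin_def by blast

lemma altform_mlin: "altform k a \<Longrightarrow> mlin k a"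
  unfolding altform_def mlin_def by blast

lemmas altform_cong = mlin_cong[OF altform_mlin]
  and altform_linear = mlin_linear[OF altform_mlin]

lemma altform_repeat: "altform k a \<Longrightarrow> i < k \<Longrightarrow> j < k \<Longrightarrow> i \<noteq> j \<Longrightarrow> v i = v j \<Longrightarrow> a v = 0"
  unfolding altform_def by (metis nat_neq_iff)

lemma altformI: "mlin k a \<Longrightarrow> (\<And>v i j. i < j \<Longrightarrow> j < k \<Longrightarrow> v i = v j \<Longrightarrow> a v = 0) \<Longrightarrow> altform k a"
  unfolding altform_def mlin_def by blast

lemma mlin_zero_slot: "mlin k a \<Longrightarrow> i < k \<Longrightarrow> v i = 0 \<Longrightarrow> a v = 0"
  using linear_0[OF mlin_linear[of k a i v]] by (metis fun_upd_triv)

text \<open>Polarisation of the vanishing on repeated arguments, with the slots i and j both set to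
  \<open>v i + v j\<close>.\<close>

lemma altform_swap:
  assumes a: "altform k a" and ij: "i < k" "j < k" "i \<noteq> j"
  shows "a (v \<circ> tp i j) = - a v"
proof -
  let ?A = "\<lambda>x y. a (v(i := x, j := y))"
  have l1: "linear (\<lambda>x. ?A x y)" for y
    using altform_linear[OF a ij(1), of "v(j := y)"] ij(3) by (simp add: fun_upd_twist)
  have l2: "linear (\<lambda>y. ?A x y)" for x
    using altform_linear[OF a ij(2)] .
  have z: "?A x x = 0" for x
    using altform_repeat[OF a ij] ij(3) by simp
  have "0 = ?A (v i + v j) (v i + v j)" using z by simp
  also have "\<dots> = ?A (v i) (v i) + ?A (v i) (v j) + (?A (v j) (v i) + ?A (v j) (v j))"
    by (simp add: linear_add[OF l1] linear_add[OF l2])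
  finally have "?A (v j) (v i) = - ?A (v i) (v j)" using z[of "v i"] z[of "v j"] by (simp add: eq_neg_iff_add_eq_0 add.commute)
  moreover have "v \<circ> tp i j = v(i := v j, j := v i)"
    using ij(3) by (auto simp: fun_eq_iff Transposition.transpose_def)
  moreover have "v(i := v i, j := v j) = v" by auto
  ultimately show ?thesis by simp
qed

lemma permutation_lessThan: "\<sigma> permutes {..<n::nat} \<Longrightarrow> permutation \<sigma>"
  using permutation_permutes by blast

lemma sgnp_compose:
  "permutation \<sigma> \<Longrightarrow> permutation \<tau> \<Longrightarrow> sgnp (\<sigma> \<circ> \<tau>) = sgnp \<sigma> * sgnp \<tau>"
  by (simp add: sign_compose)

lemma sgnp_idem [simp]: "sgnp \<sigma> * sgnp \<sigma> = 1"
  by (metis of_int_1 of_int_mult sign_idempotent)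

lemma sgnp_tp: "i \<noteq> j \<Longrightarrow> sgnp (tp i j) = - 1"
  by (simp add: sign_swap_id)

lemma altform_permute:
  assumes a: "altform k a" and \<sigma>: "\<sigma> permutes {..<k}"
  shows "a (v \<circ> \<sigma>) = sgnp \<sigma> *\<^sub>R a v"
  using \<sigma> finite_lessThan
proof (induction arbitrary: v rule: permutes_induct)
  case id
  then show ?case by simp
next
  case (swap i j p)
  have "a (v \<circ> (tp i j \<circ> p)) = a ((v \<circ> tp i j) \<circ> p)" by (simp add: comp_assoc)
  also have "\<dots> = sgnp p *\<^sub>R (- a v)"
    using swap.IH[of "v \<circ> tp i j"] altform_swap[OF a, of i j v] swap.hyps by (metis lessThan_iff)
  also have "\<dots> = sgnp (tp i j \<circ> p) *\<^sub>R a v"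
    using swap.hyps permutation_lessThan[OF \<open>p permutes {..<k}\<close>]
    by (simp add: sgnp_compose permutation_swap_id sgnp_tp)
  finally show ?case .
qed

text \<open>Vanishing is tested on a spanning set by linearity, one slot at a time; the slots
  outside J stay frozen, so that vectors of different kinds can share a tuple.\<close>

lemma mlin_span_zero:
  assumes a: "mlin k a" and J: "J \<subseteq> {..<k}"
    and v: "\<And>i. i \<in> J \<Longrightarrow> v i \<in> span B"
    and z: "\<And>w. (\<And>i. i \<in> J \<Longrightarrow> w i \<in> B) \<Longrightarrow> (\<And>i. i \<notin> J \<Longrightarrow> w i = v i) \<Longrightarrow> a w = 0"
  shows "a v = 0"
proof -
  have "finite J" using J finite_subset by blast
  then show ?thesis using J v z
  proof (induction J arbitrary: v)
    case empty
    then show ?case by blast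
  next
    case (insert j J)
    have "linear (\<lambda>u. a (v(j := u)))" using mlin_linear[OF a] insert.prems by simp
    moreover have "a (v(j := b)) = 0" if b: "b \<in> B" for b
    proof (rule insert.IH)
      show "J \<subseteq> {..<k}" using insert.prems by simp
      show "(v(j := b)) i \<in> span B" if "i \<in> J" for i
        using insert.prems(2)[of i] that insert.hyps by auto
      show "a w = 0" if "\<And>i. i \<in> J \<Longrightarrow> w i \<in> B" "\<And>i. i \<notin> J \<Longrightarrow> w i = (v(j := b)) i" for w
        using insert.prems(3)[of w] that b insert.hyps by (metis fun_upd_other fun_upd_same insert_iff)
    qed
    ultimately have "a (v(j := v j)) = 0"
      using linear_eq_0_on_span insert.prems(2)[of j] by blast
    then show ?case by simp
  qed
qed

text \<open>Pigeonhole: after reduction to a basis of L the slots in J outnumber the basis vectors,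
  so one of them repeats.\<close>

lemma altform_dim_zero:
  fixes a :: "(nat \<Rightarrow> 'a::euclidean_space) \<Rightarrow> 'v::real_vector"
  assumes a: "altform k a" and J: "J \<subseteq> {..<k}" "dim L < card J" and L: "\<And>i. i \<in> J \<Longrightarrow> v i \<in> L"
  shows "a v = 0"
proof -
  obtain B where B: "B \<subseteq> L" "independent B" "L \<subseteq> span B" "card B = dim L"
    using basis_exists by blast
  have fB: "finite B" using B independent_imp_finite by blast
  show ?thesis
  proof (rule mlin_span_zero[OF altform_mlin[OF a] J(1), where B = B])
    show "v i \<in> span B" if "i \<in> J" for i using L[OF that] B by blast
    fix w assume w: "\<And>i. i \<in> J \<Longrightarrow> w i \<in> B"
    have "\<not> inj_on w J"
      using card_inj_on_le[of w J B] w fB J(2) B(4) by (metis image_subsetI leD)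
    then obtain i j where "i \<in> J" "j \<in> J" "i \<noteq> j" "w i = w j" unfolding inj_on_def by blast
    then show "a w = 0" using altform_repeat[OF a, of i j w] J by auto
  qed
qed

text \<open>On tuples of vectors from b, an alternating form of top degree is either zero by
  repetition or, up to sign, its value on b.\<close>

lemma altform_top_zero:
  fixes a :: "(nat \<Rightarrow> 'a::euclidean_space) \<Rightarrow> 'v::real_vector"
  assumes a: "altform n a" and b: "inj_on b {..<n}" and span: "span (b ` {..<n}) = UNIV" and z: "a b = 0"
  shows "a v = 0"
proof (rule mlin_span_zero[OF altform_mlin[OF a] order_refl, where B = "b ` {..<n}"])
  show "v i \<in> span (b ` {..<n})" for i using span by simp
  fix w assume w: "\<And>i. i \<in> {..<n} \<Longrightarrow> w i \<in> b ` {..<n}"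
  show "a w = 0"
  proof (cases "inj_on w {..<n}")
    case False
    then show ?thesis using altform_repeat[OF a] unfolding inj_on_def by auto
  next
    case True
    define \<sigma> where "\<sigma> i = (if i < n then inv_into {..<n} b (w i) else i)" for i
    have \<sigma>1: "\<sigma> i < n" "b (\<sigma> i) = w i" if "i < n" for i
      using w[of i] that inv_into_into[of "w i" b "{..<n}"] by (auto simp: \<sigma>_def f_inv_into_f)
    have "inj_on \<sigma> {..<n}" using True \<sigma>1 by (metis inj_onI inj_onD lessThan_iff)
    moreover have "\<sigma> ` {..<n} \<subseteq> {..<n}" using \<sigma>1 by auto
    ultimately have "bij_betw \<sigma> {..<n} {..<n}" by (simp add: bij_betw_def endo_inj_surj)
    then have p: "\<sigma> permutes {..<n}" by (rule bij_imp_permutes) (simp add: \<sigma>_def)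
    have "a w = a (b \<circ> \<sigma>)" by (rule altform_cong[OF a]) (simp add: \<sigma>1)
    then show ?thesis using altform_permute[OF a p] z by simp
  qed
qed

lemma mlin_lincomb:
  "mlin k a \<Longrightarrow> mlin k b \<Longrightarrow> mlin k (\<lambda>v. r *\<^sub>R a v + s *\<^sub>R b v)"
  unfolding mlin_def by (auto intro!: linear_compose_add linear_compose_scale_right) metis

lemma altform_lincomb:
  "altform k a \<Longrightarrow> altform k b \<Longrightarrow> altform k (\<lambda>v. r *\<^sub>R a v + s *\<^sub>R b v)"
proof (rule altformI)
  assume a: "altform k a" and b: "altform k b"
  show "mlin k (\<lambda>v. r *\<^sub>R a v + s *\<^sub>R b v)" using a b by (intro mlin_lincomb altform_mlin)
  show "r *\<^sub>R a v + s *\<^sub>R b v = 0" if "i < j" "j < k" "v i = v j" for v i j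
    using altform_repeat[OF a, of i j v] altform_repeat[OF b, of i j v] that by simp
qed

lemma altform_linear_map:
  assumes a: "altform k a" and L: "linear L"
  shows "altform k (\<lambda>v. a (\<lambda>i. L (v i)))"
proof (rule altformI)
  have "linear (\<lambda>u. a (\<lambda>j. L ((v(i := u)) j)))" if "i < k" for v i
  proof -
    have "(\<lambda>u. a (\<lambda>j. L ((v(i := u)) j))) = (\<lambda>u. a ((\<lambda>j. L (v j))(i := u))) \<circ> L"
      by (auto simp: fun_eq_iff intro!: arg_cong[of _ _ a])
    then show ?thesis using linear_compose[OF L altform_linear[OF a that]] by simp
  qed
  then show "mlin k (\<lambda>v. a (\<lambda>i. L (v i)))"
    unfolding mlin_def by (auto intro: altform_cong[OF a])
  show "a (\<lambda>i. L (v i)) = 0" if "i < j" "j < k" "v i = v j" for v i j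
    using altform_repeat[OF a, of i j "\<lambda>i. L (v i)"] that by simp
qed

text \<open>The difference of \<open>a\<close> and its value on the standard basis times the
  determinant is alternating of top degree and vanishes on that basis, hence everywhere. The
  bijection \<open>e\<close> numbers the coordinates, since forms read slots in \<open>nat\<close>
  while determinants are indexed by the type \<open>'n\<close>.\<close>

lemma altform_det:
  fixes a :: "(nat \<Rightarrow> real^'n) \<Rightarrow> real"
  assumes a: "altform CARD('n) a" and e: "bij_betw e {..<CARD('n)} (UNIV :: 'n set)" and L: "linear L"
  shows "a (\<lambda>i. L (axis (e i) 1)) = det (matrix L) * a (\<lambda>i. axis (e i) 1)"
proof -
  let ?n = "CARD('n)"
  define e' where "e' = inv_into {..<?n} e"
  have e'1: "e' j < ?n" "e (e' j) = j" for j
    using e inv_into_into[of j e "{..<?n}"] f_inv_into_f[of j e "{..<?n}"]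
    by (auto simp: e'_def bij_betw_def)
  have e'2: "e' (e i) = i" if "i < ?n" for i
    using e that by (auto simp: e'_def bij_betw_def)
  define b where "b i = (axis (e i) 1 :: real^'n)" for i
  define d where "d v = det ((\<chi> j. v (e' j)) :: real^'n^'n)" for v
  have upd: "(\<chi> j. (v(i := u)) (e' j)) = (\<chi> j. if j = e i then u else v (e' j))" if "i < ?n" for v i u
    using e'1 e'2 that by (auto simp: vec_eq_iff)
  have "linear (\<lambda>u. d (v(i := u)))" if "i < ?n" for v i
  proof (rule linearI)
    fix x y :: "real^'n" and r :: real
    show "d (v(i := x + y)) = d (v(i := x)) + d (v(i := y))"
      unfolding d_def upd[OF that] using det_row_add[of "e i" "\<lambda>_. x" "\<lambda>_. y" "\<lambda>j. v (e' j)"] .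
    have rs: "r *s x = r *\<^sub>R x" by (simp add: vec_eq_iff)
    show "d (v(i := r *\<^sub>R x)) = r *\<^sub>R d (v(i := x))"
      unfolding d_def upd[OF that] real_scaleR_def
      by (rule det_row_mul[of "e i" r "\<lambda>_. x" "\<lambda>j. v (e' j)", unfolded rs])
  qed
  moreover have "d v = d w" if "\<forall>i<?n. v i = w i" for v w
    using that e'1 by (simp add: d_def)
  moreover have "d v = 0" if "i < j" "j < ?n" "v i = v j" for v i j
  proof -
    have "e i \<noteq> e j" using that e'2 by (metis less_trans nat_neq_iff)
    then show ?thesis unfolding d_def
      by (rule det_identical_rows) (use that e'2 in \<open>auto simp: row_def vec_eq_iff\<close>)
  qed
  ultimately have d: "altform ?n d" unfolding altform_def by blast
  have db: "d b = 1"
  proof -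
    have "(\<chi> j. b (e' j)) = mat 1"
      by (simp add: b_def e'1 vec_eq_iff mat_def axis_def)
    then show ?thesis by (simp add: d_def)
  qed
  have "altform ?n (\<lambda>v. 1 *\<^sub>R a v + (- a b) *\<^sub>R d v)" by (rule altform_lincomb[OF a d])
  then have "1 *\<^sub>R a v + (- a b) *\<^sub>R d v = 0" for v
  proof (rule altform_top_zero[where b = b])
    show "inj_on b {..<?n}" using e by (auto simp: b_def inj_on_def axis_eq_axis bij_betw_def)
    have "b ` {..<?n} = (Basis :: (real^'n) set)"
      using e by (auto simp: b_def Basis_vec_def bij_betw_def image_iff) (metis UNIV_I imageE lessThan_iff)
    then show "span (b ` {..<?n}) = UNIV" by simp
    show "1 *\<^sub>R a b + (- a b) *\<^sub>R d b = 0" by (simp add: db)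
  qed
  then have "a (\<lambda>i. L (b i)) = a b * d (\<lambda>i. L (b i))" by (metis add.commute eq_neg_iff_add_eq_0 minus_mult_left real_scaleR_def scaleR_minus_left scaleR_one mult_1 minus_minus)
  moreover have "(\<chi> j. L (b (e' j))) = Finite_Cartesian_Product.transpose (matrix L)"
    by (simp add: vec_eq_iff matrix_def Finite_Cartesian_Product.transpose_def b_def e'1)
  ultimately show ?thesis by (simp add: d_def b_def[symmetric] det_transpose mult.commute)
qed

text \<open>The index set I collects the slots that receive x. The induction expands the first m
  slots and leaves the others as sums. It serves to split vectors into horizontal and vertical
  parts.\<close>

lemma mlin_add_expand:
  assumes a: "mlin k a"
  shows "a (\<lambda>i. x i + y i) = (\<Sum>I\<in>Pow {..<k}. a (\<lambda>i. if i \<in> I then x i else y i))"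
proof -
  have "a (\<lambda>i. x i + y i) =
    (\<Sum>I\<in>Pow {..<m}. a (\<lambda>i. if i < m then if i \<in> I then x i else y i else x i + y i))" if "m \<le> k" for m
    using that
  proof (induction m)
    case 0
    then show ?case by simp
  next
    case (Suc m)
    let ?w = "\<lambda>m I i. if i < m then if i \<in> I then x i else y i else x i + y i"
    have step: "a (?w m I) = a (?w (Suc m) (insert m I)) + a (?w (Suc m) I)" if I: "I \<subseteq> {..<m}" for I
    proof -
      have "m \<notin> I" using I by auto
      then have "?w (Suc m) (insert m I) = (?w m I)(m := x m)" "?w (Suc m) I = (?w m I)(m := y m)"
         "?w m I = (?w m I)(m := x m + y m)"
        by (auto simp: fun_eq_iff less_Suc_eq)
      then show ?thesis
        using linear_add[OF mlin_linear[OF a, of m "?w m I"], of "x m" "y m"] Suc.prems by simp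
    qed
    have inj: "inj_on (insert m) (Pow {..<m})"
      by (intro inj_onI) (metis PowD Diff_insert_absorb lessThan_iff less_irrefl subsetD)
    have disj: "Pow {..<m} \<inter> insert m ` Pow {..<m} = {}" by auto
    have "a (\<lambda>i. x i + y i) = (\<Sum>I\<in>Pow {..<m}. a (?w (Suc m) (insert m I)) + a (?w (Suc m) I))"
      using Suc step by simp
    also have "\<dots> = (\<Sum>I\<in>insert m ` Pow {..<m}. a (?w (Suc m) I)) + (\<Sum>I\<in>Pow {..<m}. a (?w (Suc m) I))"
      by (simp add: sum.distrib sum.reindex[OF inj])
    also have "\<dots> = (\<Sum>I\<in>Pow {..<Suc m}. a (?w (Suc m) I))"
      using disj by (simp add: lessThan_Suc Pow_insert sum.union_disjoint add.commute)
    finally show ?case .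
  qed
  from this[OF order_refl] have "a (\<lambda>i. x i + y i) =
      (\<Sum>I\<in>Pow {..<k}. a (\<lambda>i. if i < k then if i \<in> I then x i else y i else x i + y i))" .
  also have "\<dots> = (\<Sum>I\<in>Pow {..<k}. a (\<lambda>i. if i \<in> I then x i else y i))"
    by (intro sum.cong refl mlin_cong[OF a]) simp
  finally show ?thesis .
qed

section \<open>Alternating sums\<close>

text \<open>Antisymmetrisation without a normalising factorial. A product of several forms becomes
  one integrand that reads disjoint slots, so a wedge product of three factors is a single sum and
  all factorials stay explicit.\<close>

definition alt_sum :: "nat \<Rightarrow> ((nat \<Rightarrow> 'a) \<Rightarrow> 'v::real_vector) \<Rightarrow> (nat \<Rightarrow> 'a) \<Rightarrow> 'v" where
  "alt_sum n T v = (\<Sum>\<sigma> | \<sigma> permutes {..<n}. sgnp \<sigma> *\<^sub>R T (v \<circ> \<sigma>))"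

lemma alt_sum_cong: "(\<And>\<sigma>. \<sigma> permutes {..<n} \<Longrightarrow> T (v \<circ> \<sigma>) = T' (w \<circ> \<sigma>)) \<Longrightarrow> alt_sum n T v = alt_sum n T' w"
  unfolding alt_sum_def by (rule sum.cong) auto

lemma alt_sum_sum: "alt_sum n (\<lambda>u. \<Sum>i\<in>I. T i u) v = (\<Sum>i\<in>I. alt_sum n (T i) v)"
  unfolding alt_sum_def scaleR_sum_right by (rule sum.swap)

lemma alt_sum_add: "alt_sum n (\<lambda>u. T u + T' u) v = alt_sum n T v + alt_sum n T' v"
  by (simp add: alt_sum_def scaleR_add_right sum.distrib)

lemma alt_sum_linear: "linear L \<Longrightarrow> alt_sum n (\<lambda>u. L (T u)) v = L (alt_sum n T v)"
  by (simp add: alt_sum_def linear_sum linear_scale)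

lemma alt_sum_scaleR: "alt_sum n (\<lambda>u. c *\<^sub>R T u) v = c *\<^sub>R alt_sum n T v"
  by (rule alt_sum_linear) (rule linear_scale_self)

lemma alt_sum_mult: "alt_sum n (\<lambda>u. c * T u) v = c * alt_sum n T v" for c :: real
  using alt_sum_scaleR[of n c T v] by simp

lemma alt_sum_reindex:
  assumes \<rho>: "\<rho> permutes {..<n}"
  shows "alt_sum n (\<lambda>u. T (u \<circ> \<rho>)) v = sgnp \<rho> *\<^sub>R alt_sum n T v"
proof -
  have "alt_sum n T v = (\<Sum>\<sigma> | \<sigma> permutes {..<n}. sgnp (\<sigma> \<circ> \<rho>) *\<^sub>R T (v \<circ> (\<sigma> \<circ> \<rho>)))"
    unfolding alt_sum_def by (rule sum_permutations_compose_right[OF \<rho>])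
  also have "\<dots> = (\<Sum>\<sigma> | \<sigma> permutes {..<n}. sgnp \<rho> *\<^sub>R (sgnp \<sigma> *\<^sub>R T ((v \<circ> \<sigma>) \<circ> \<rho>)))"
    using \<rho> by (intro sum.cong) (auto simp: sgnp_compose permutation_lessThan comp_assoc)
  also have "\<dots> = sgnp \<rho> *\<^sub>R alt_sum n (\<lambda>u. T (u \<circ> \<rho>)) v"
    by (simp add: alt_sum_def scaleR_sum_right)
  finally show ?thesis by simp
qed

text \<open>Reindexing by a permutation from C and multiplying by its sign leaves the alternation
  unchanged. So the alternation of the signed sum is \<open>card C\<close> times that of T.\<close>

lemma alt_sum_zero:
  assumes "finite C" "C \<noteq> {}" "\<And>c. c \<in> C \<Longrightarrow> p c permutes {..<n}"
    and z: "\<And>u. (\<Sum>c\<in>C. sgnp (p c) *\<^sub>R T (u \<circ> p c)) = 0"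
  shows "alt_sum n T v = 0"
proof -
  have "0 = alt_sum n (\<lambda>u. \<Sum>c\<in>C. sgnp (p c) *\<^sub>R T (u \<circ> p c)) v"
    by (simp add: z alt_sum_def)
  also have "\<dots> = (\<Sum>c\<in>C. sgnp (p c) *\<^sub>R alt_sum n (\<lambda>u. T (u \<circ> p c)) v)"
    by (simp add: alt_sum_sum alt_sum_scaleR)
  also have "\<dots> = (\<Sum>c\<in>C. alt_sum n T v)"
    by (rule sum.cong) (simp_all add: alt_sum_reindex assms)
  also have "\<dots> = real (card C) *\<^sub>R alt_sum n T v" by (simp add: sum_constant_scaleR)
  finally show ?thesis using assms by simp
qed

lemma alt_sum_altform:
  assumes T: "mlin n T" shows "altform n (alt_sum n T)"
proof (rule altformI)
  have "linear (\<lambda>u. alt_sum n T (v(i := u)))" if "i < n" for v i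
  proof -
    have "linear (\<lambda>u. sgnp \<sigma> *\<^sub>R T (v(i := u) \<circ> \<sigma>))" if \<sigma>: "\<sigma> permutes {..<n}" for \<sigma>
    proof -
      have "v(i := u) \<circ> \<sigma> = (v \<circ> \<sigma>)(inv \<sigma> i := u)" for u
        using permutes_inverses[OF \<sigma>] by (auto simp: fun_eq_iff)
      moreover have "inv \<sigma> i < n" using permutes_in_image[OF permutes_inv[OF \<sigma>]] \<open>i < n\<close> by auto
      ultimately show ?thesis
        using mlin_linear[OF T, of "inv \<sigma> i" "v \<circ> \<sigma>"] by (simp add: linear_compose_scale_right)
    qed
    then show ?thesis unfolding alt_sum_def by (intro linear_compose_sum) auto
  qed
  moreover have "alt_sum n T v = alt_sum n T w" if "\<forall>i<n. v i = w i" for v w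
  proof (rule alt_sum_cong)
    fix \<sigma> :: "nat \<Rightarrow> nat" assume "\<sigma> permutes {..<n}"
    then show "T (v \<circ> \<sigma>) = T (w \<circ> \<sigma>)"
      using that permutes_in_image by (intro mlin_cong[OF T]) fastforce
  qed
  ultimately show "mlin n (alt_sum n T)" unfolding mlin_def by blast
  show "alt_sum n T v = 0" if "i < j" "j < n" "v i = v j" for v i j
  proof -
    have p: "tp i j permutes {..<n}" using that by (intro permutes_swap_id) auto
    have v: "v \<circ> tp i j = v" using that by (auto simp: fun_eq_iff Transposition.transpose_def)
    have "alt_sum n T v = (\<Sum>\<sigma> | \<sigma> permutes {..<n}. sgnp (tp i j \<circ> \<sigma>) *\<^sub>R T (v \<circ> (tp i j \<circ> \<sigma>)))"
      unfolding alt_sum_def by (rule setum_permutations_compose_left[OF p])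
    also have "\<dots> = (\<Sum>\<sigma> | \<sigma> permutes {..<n}. - (sgnp \<sigma> *\<^sub>R T (v \<circ> \<sigma>)))"
      using that by (intro sum.cong) (auto simp: sgnp_compose permutation_lessThan permutation_swap_id sgnp_tp v comp_assoc[symmetric])
    also have "\<dots> = - alt_sum n T v" by (simp add: alt_sum_def sum_negf)
    finally have "2 *\<^sub>R alt_sum n T v = 0" by (metis add.right_inverse scaleR_2)
    then show ?thesis by simp
  qed
qed

lemma mlin_prod:
  fixes a :: "(nat \<Rightarrow> 'a::real_vector) \<Rightarrow> 'v::real_vector" and b :: "(nat \<Rightarrow> 'a) \<Rightarrow> real"
  assumes a: "mlin p a" and b: "mlin q b"
  shows "mlin (p + q) (\<lambda>v. b (\<lambda>i. v (p + i)) *\<^sub>R a v)"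
  unfolding mlin_def
proof (intro conjI allI impI)
  show "b (\<lambda>i. v (p + i)) *\<^sub>R a v = b (\<lambda>i. w (p + i)) *\<^sub>R a w" if "\<forall>i<p + q. v i = w i" for v w
    using that mlin_cong[OF a, of v w] mlin_cong[OF b, of "\<lambda>i. v (p + i)" "\<lambda>i. w (p + i)"] by simp
  fix v i assume i: "i < p + q"
  show "linear (\<lambda>u. b (\<lambda>j. (v(i := u)) (p + j)) *\<^sub>R a (v(i := u)))"
  proof (cases "i < p")
    case True
    then have "(\<lambda>j. (v(i := u)) (p + j)) = (\<lambda>j. v (p + j))" for u by auto
    then show ?thesis using mlin_linear[OF a True] by (simp add: linear_compose_scale_right)
  next
    case False
    then have "p + j = i \<longleftrightarrow> j = i - p" for j by linarith
    then have "(\<lambda>j. (v(i := u)) (p + j)) = (\<lambda>j. v (p + j))(i - p := u)" for u by (simp add: fun_eq_iff)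
    moreover have "a (v(i := u)) = a v" for u using False by (intro mlin_cong[OF a]) auto
    moreover have "linear (\<lambda>u. b ((\<lambda>j. v (p + j))(i - p := u)))" using False i by (intro mlin_linear[OF b]) auto
    ultimately show ?thesis
      by (simp add: linear_iff scaleR_add_left)
  qed
qed

section \<open>Antisymmetrisation of wedge products\<close>

definition shiftp :: "nat \<Rightarrow> (nat \<Rightarrow> nat) \<Rightarrow> nat \<Rightarrow> nat" where
  "shiftp k \<sigma> i = (if i < k then i else k + \<sigma> (i - k))"

lemma shiftp:
  assumes \<sigma>: "\<sigma> permutes {..<m}"
  shows "shiftp k \<sigma> permutes {..<k + m}" "sgnp (shiftp k \<sigma>) = sgnp \<sigma>"
proof -
  have inj: "inj_on ((+) k) {..<m}" by simp
  have im: "(+) k ` {..<m} = {k..<k + m}" by (simp add: lessThan_atLeast0 add.commute)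
  have eq: "shiftp k \<sigma> = map_permutation {..<m} ((+) k) \<sigma>"
  proof
    fix i
    show "shiftp k \<sigma> i = map_permutation {..<m} ((+) k) \<sigma> i"
    proof (cases "i \<in> {k..<k + m}")
      case True
      then obtain j where "i = k + j" "j < m" by (metis atLeastLessThan_iff le_Suc_ex nat_add_left_cancel_less)
      then show ?thesis using map_permutation_apply[OF inj, of j \<sigma>] by (simp add: shiftp_def)
    next
      case False
      then have "shiftp k \<sigma> i = i" using permutes_not_in[OF \<sigma>, of "i - k"] by (auto simp: shiftp_def)
      then show ?thesis using False unfolding map_permutation_def restrict_id_def im by auto
    qed
  qed
  have "map_permutation {..<m} ((+) k) \<sigma> permutes {k..<k + m}"
    by (rule map_permutation_permutes[OF _ \<sigma>]) (simp add: bij_betw_def im)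
  then show "shiftp k \<sigma> permutes {..<k + m}"
    unfolding eq by (rule permutes_subset) auto
  show "sgnp (shiftp k \<sigma>) = sgnp \<sigma>"
    unfolding eq by (simp add: sign_map_permutation[OF inj \<sigma>])
qed

text \<open>An antisymmetrisation over the last m slots is absorbed by the outer one: each inner
  permutation contributes the same amount, which gives the factor m!.\<close>

lemma alt_sum_nested:
  "alt_sum (k + m) (\<lambda>u. \<Sum>\<sigma> | \<sigma> permutes {..<m}. sgnp \<sigma> *\<^sub>R G (u \<circ> shiftp k \<sigma>)) v
     = fact m *\<^sub>R alt_sum (k + m) G v"
proof -
  have "alt_sum (k + m) (\<lambda>u. \<Sum>\<sigma> | \<sigma> permutes {..<m}. sgnp \<sigma> *\<^sub>R G (u \<circ> shiftp k \<sigma>)) v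
     = (\<Sum>\<sigma> | \<sigma> permutes {..<m}. sgnp \<sigma> *\<^sub>R alt_sum (k + m) (\<lambda>u. G (u \<circ> shiftp k \<sigma>)) v)"
    by (simp add: alt_sum_sum alt_sum_scaleR)
  also have "\<dots> = (\<Sum>\<sigma> | \<sigma> permutes {..<m}. alt_sum (k + m) G v)"
    by (intro sum.cong refl) (simp add: alt_sum_reindex shiftp)
  also have "\<dots> = fact m *\<^sub>R alt_sum (k + m) G v"
    by (simp add: sum_constant_scaleR card_permutations)
  finally show ?thesis .
qed

text \<open>The wedge product is itself an antisymmetrisation over p + q slots, so the nested one is
  absorbed and the number of (p, q)-shuffles remains. \<open>L\<close> pairs the value with what the
  first slot carries.\<close>

lemma alt_sum_wedge:
  fixes a :: "(nat \<Rightarrow> 'a) \<Rightarrow> 'v::real_vector" and L :: "'a \<Rightarrow> 'v \<Rightarrow> 'w::real_vector"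
  assumes L: "\<And>x. linear (L x)"
  shows "alt_sum (1 + (p + q)) (\<lambda>u. L (u 0) (wedge p q a b (\<lambda>i. u (Suc i)))) v
     = (fact (p + q) / (fact p * fact q)) *\<^sub>R
       alt_sum (1 + (p + q)) (\<lambda>u. b (\<lambda>i. u (1 + p + i)) *\<^sub>R L (u 0) (a (\<lambda>i. u (1 + i)))) v"
proof -
  let ?G = "\<lambda>u. b (\<lambda>i. u (1 + p + i)) *\<^sub>R L (u 0) (a (\<lambda>i. u (1 + i)))"
  have eq: "L (u 0) (wedge p q a b (\<lambda>i. u (Suc i)))
    = (1 / (fact p * fact q)) *\<^sub>R (\<Sum>\<sigma> | \<sigma> permutes {..<p + q}. sgnp \<sigma> *\<^sub>R ?G (u \<circ> shiftp 1 \<sigma>))"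
    for u
    unfolding wedge_def linear_scale[OF L] linear_sum[OF L]
    by (simp add: shiftp_def scaleR_scaleR comp_def)
  show ?thesis
    using alt_sum_nested[of 1 "p + q" ?G v] by (simp add: eq alt_sum_scaleR)
qed

text \<open>Composition with this cycle puts the entry i first and keeps the order of the others;
  its sign supplies the alternating signs of the exterior derivative.\<close>

definition cyc :: "nat \<Rightarrow> nat \<Rightarrow> nat" where
  "cyc i j = (if j = 0 then i else if j \<le> i then j - 1 else j)"

lemma cyc_Suc: "cyc (Suc i) = tp i (Suc i) \<circ> cyc i"
  by (auto simp: cyc_def fun_eq_iff Transposition.transpose_def)

lemma cyc:
  assumes "i < n"
  shows "cyc i permutes {..<n}" "sgnp (cyc i) = (-1) ^ i"
proof -
  have "cyc i permutes {..<n} \<and> sgnp (cyc i) = (-1) ^ i"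
    using assms
  proof (induction i)
    case 0
    have "cyc 0 = id" by (auto simp: cyc_def fun_eq_iff)
    then show ?case using permutes_id by (metis of_int_1 power_0 sign_id)
  next
    case (Suc i)
    have "tp i (Suc i) permutes {..<n}" using Suc.prems by (intro permutes_swap_id) auto
    moreover have "cyc i permutes {..<n}" "sgnp (cyc i) = (-1) ^ i" using Suc by auto
    ultimately show ?case unfolding cyc_Suc
      using permutes_compose sgnp_compose[OF permutation_swap_id permutation_lessThan] by (metis mult_minus1 n_not_Suc_n power_Suc sgnp_tp)
  qed
  then show "cyc i permutes {..<n}" "sgnp (cyc i) = (-1) ^ i" by auto
qed

lemma cyc_comp: "(u \<circ> cyc i) (Suc j) = (if j < i then u j else u (Suc j))"
  by (auto simp: cyc_def)

text \<open>The cosets of the stabiliser of \<open>0\<close> in the symmetric group are represented by cycles.\<close>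

lemma alt_sum_cosets:
  assumes T: "\<And>u \<rho>. \<rho> permutes {..<k} \<Longrightarrow> T (u \<circ> shiftp 1 \<rho>) = sgnp \<rho> *\<^sub>R T u"
  shows "alt_sum (Suc k) T v = fact k *\<^sub>R (\<Sum>i\<le>k. (-1) ^ i *\<^sub>R T (v \<circ> cyc i))"
proof -
  let ?P = "{\<rho>. \<rho> permutes {..<k}}" and ?Q = "{\<tau>. \<tau> permutes {..<Suc k}}"
  let ?f = "\<lambda>(i, \<rho>). cyc i \<circ> shiftp 1 \<rho>"
  have f0: "?f (i, \<rho>) 0 = i" for i \<rho> by (simp add: shiftp_def cyc_def)
  have pm: "?f (i, \<rho>) \<in> ?Q" if "i \<le> k" "\<rho> \<in> ?P" for i \<rho>
    using permutes_compose[of "shiftp 1 \<rho>" "{..<Suc k}" "cyc i"] shiftp(1)[of \<rho> k 1] cyc(1)[of i "Suc k"] that by simp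
  have inj: "inj_on ?f ({..k} \<times> ?P)"
  proof (rule inj_onI)
    fix x y assume xy: "x \<in> {..k} \<times> ?P" "y \<in> {..k} \<times> ?P" "?f x = ?f y"
    obtain i \<rho> j \<rho>' where e: "x = (i, \<rho>)" "y = (j, \<rho>')" by (metis surj_pair)
    have ij: "i = j" using xy(3) e f0 by metis
    have "inj (cyc i)" using cyc(1)[of i "Suc k"] xy e permutes_inj by fastforce
    then have "shiftp 1 \<rho> = shiftp 1 \<rho>'"
      using xy(3) e ij by (auto simp: fun_eq_iff inj_def)
    then have "\<rho> m = \<rho>' m" for m by (metis (no_types) shiftp_def add_diff_cancel_left' add_left_cancel not_add_less1)
    then show "x = y" using e ij by auto
  qed
  have fin: "finite ?P" "finite ?Q" by (simp_all add: finite_permutations)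
  \<comment> \<open>The (k + 1) k! composites are pairwise distinct, so counting shows that they
    exhaust the permutations.\<close>
  have "?f ` ({..k} \<times> ?P) = ?Q"
  proof (rule card_subset_eq[OF fin(2)])
    show "?f ` ({..k} \<times> ?P) \<subseteq> ?Q" using pm by fast
    show "card (?f ` ({..k} \<times> ?P)) = card ?Q"
      using card_image[OF inj] by (simp add: card_cartesian_product card_permutations)
  qed
  then have im: "?Q = ?f ` ({..k} \<times> ?P)" by (rule sym)
  have "alt_sum (Suc k) T v = (\<Sum>\<sigma>\<in>?f ` ({..k} \<times> ?P). sgnp \<sigma> *\<^sub>R T (v \<circ> \<sigma>))"
    unfolding alt_sum_def by (rule sum.cong[OF im refl])
  also have "\<dots> = (\<Sum>x\<in>{..k} \<times> ?P. sgnp (?f x) *\<^sub>R T (v \<circ> ?f x))"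
    by (rule sum.reindex[OF inj, unfolded comp_def[of _ ?f]])
  also have "\<dots> = (\<Sum>(i, \<rho>)\<in>{..k} \<times> ?P. sgnp (cyc i \<circ> shiftp 1 \<rho>) *\<^sub>R T (v \<circ> (cyc i \<circ> shiftp 1 \<rho>)))"
    by (rule sum.cong[OF refl]) (simp split: prod.split)
  also have "\<dots> = (\<Sum>(i, \<rho>)\<in>{..k} \<times> ?P. (-1) ^ i *\<^sub>R T (v \<circ> cyc i))"
  proof (rule sum.cong[OF refl])
    fix x assume "x \<in> {..k} \<times> ?P"
    then obtain i \<rho> where x: "x = (i, \<rho>)" and i: "i \<in> {..k}" and \<rho>: "\<rho> permutes {..<k}" by blast
    have i': "i < Suc k" using i by simp
    have "sgnp (cyc i \<circ> shiftp 1 \<rho>) = (-1) ^ i * sgnp \<rho>"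
      unfolding sgnp_compose[OF permutation_lessThan[OF cyc(1)[OF i']] permutation_lessThan[OF shiftp(1)[OF \<rho>]]]
        cyc(2)[OF i'] shiftp(2)[OF \<rho>] ..
    moreover have "T (v \<circ> (cyc i \<circ> shiftp 1 \<rho>)) = sgnp \<rho> *\<^sub>R T (v \<circ> cyc i)"
      using T[OF \<rho>, of "v \<circ> cyc i"] by (simp add: comp_assoc)
    ultimately have "sgnp (cyc i \<circ> shiftp 1 \<rho>) *\<^sub>R T (v \<circ> (cyc i \<circ> shiftp 1 \<rho>)) = (-1) ^ i *\<^sub>R T (v \<circ> cyc i)"
      by (simp only: scaleR_scaleR mult.assoc sgnp_idem mult_1_right)
    then show "(case x of (i, \<rho>) \<Rightarrow> sgnp (cyc i \<circ> shiftp 1 \<rho>) *\<^sub>R T (v \<circ> (cyc i \<circ> shiftp 1 \<rho>)))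
        = (case x of (i, \<rho>) \<Rightarrow> (-1) ^ i *\<^sub>R T (v \<circ> cyc i))"
      unfolding x by simp
  qed
  also have "\<dots> = fact k *\<^sub>R (\<Sum>i\<le>k. (-1) ^ i *\<^sub>R T (v \<circ> cyc i))"
    by (simp add: sum.cartesian_product[symmetric] sum_constant_scaleR card_permutations scaleR_sum_right)
  finally show ?thesis .
qed

section \<open>Contractions of alternating sums\<close>

text \<open>Cramer's rule: in the basis expansion of w, every term except the one along
  \<open>b i\<close> repeats a vector.\<close>

lemma altform_replace:
  fixes b :: "nat \<Rightarrow> 'e::euclidean_space" and \<beta> :: "(nat \<Rightarrow> 'e) \<Rightarrow> real"
  assumes \<beta>: "altform n \<beta>" and b: "bij_betw b {..<n} Basis" and i: "i < n"
  shows "\<beta> (b(i := w)) = (w \<bullet> b i) * \<beta> b"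
proof -
  have w: "w = (\<Sum>m<n. (w \<bullet> b m) *\<^sub>R b m)"
    using euclidean_representation[of w] sum.reindex_bij_betw[OF b, of "\<lambda>x. (w \<bullet> x) *\<^sub>R x"] by simp
  have "\<beta> (b(i := w)) = (\<Sum>m<n. (w \<bullet> b m) * \<beta> (b(i := b m)))"
    by (subst w) (simp add: linear_sum[OF altform_linear[OF \<beta> i]] linear_scale[OF altform_linear[OF \<beta> i]])
  also have "\<dots> = (\<Sum>m<n. if m = i then (w \<bullet> b i) * \<beta> b else 0)"
  proof (rule sum.cong[OF refl])
    fix m assume "m \<in> {..<n}"
    then show "(w \<bullet> b m) * \<beta> (b(i := b m)) = (if m = i then (w \<bullet> b i) * \<beta> b else 0)"
      using altform_repeat[OF \<beta> i, of m "b(i := b m)"] by auto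
  qed
  also have "\<dots> = (w \<bullet> b i) * \<beta> b" using i by simp
  finally show ?thesis .
qed

text \<open>
  Contracting \<open>\<kappa> \<and> \<mu> \<and> \<eta>\<close>, which vanishes for reasons of degree, with a vector \<open>w\<close> annihilated by
  \<open>\<eta>\<close> gives \<open>\<kappa>(w) \<mu> \<and> \<eta> = \<kappa> \<and> \<iota>\<^sub>w \<mu> \<and> \<eta>\<close>.
\<close>

lemma alt_sum_contract:
  fixes b :: "nat \<Rightarrow> 'e::euclidean_space" and \<mu> \<eta> :: "(nat \<Rightarrow> 'e) \<Rightarrow> real"
  assumes b: "bij_betw b {..<Suc p + q} Basis" and \<kappa>: "linear \<kappa>"
    and \<mu>: "altform (Suc p) \<mu>" and \<eta>: "altform q \<eta>"
    and w: "\<And>u i. i < q \<Longrightarrow> u i = w \<Longrightarrow> \<eta> u = 0"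
  shows "real (Suc p) * alt_sum (Suc p + q)
      (\<lambda>u. \<kappa> (u 0) * (\<mu> (case_nat w (\<lambda>i. u (Suc i))) * \<eta> (\<lambda>i. u (Suc p + i)))) b
    = \<kappa> w * alt_sum (Suc p + q) (\<lambda>u. \<mu> u * \<eta> (\<lambda>i. u (Suc p + i))) b"
proof -
  let ?n = "Suc p + q"
  define T where "T u = \<mu> u * \<eta> (\<lambda>i. u (Suc p + i))" for u
  have mT: "mlin ?n T"
    using mlin_prod[OF altform_mlin[OF \<mu>] altform_mlin[OF \<eta>]] by (simp add: T_def[abs_def] mult.commute)
  define \<beta> where "\<beta> = alt_sum ?n T"
  have \<beta>: "altform ?n \<beta>" unfolding \<beta>_def by (rule alt_sum_altform[OF mT])
  have wsum: "w = (\<Sum>m<?n. (w \<bullet> b m) *\<^sub>R b m)"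
    using euclidean_representation[of w] sum.reindex_bij_betw[OF b, of "\<lambda>x. (w \<bullet> x) *\<^sub>R x"] by simp
  have "\<kappa> w = (\<Sum>m<?n. (w \<bullet> b m) * \<kappa> (b m))"
    by (subst wsum) (simp add: linear_sum[OF \<kappa>] linear_scale[OF \<kappa>] linear_add[OF \<kappa>])
  \<comment> \<open>Putting w into each slot in turn, weighted by \<kappa> of the vector it
    replaces, recovers \<kappa>(w) by Cramer's rule.\<close>
  then have "\<kappa> w * \<beta> b = (\<Sum>i<?n. \<kappa> (b i) * \<beta> (b(i := w)))"
    by (simp add: altform_replace[OF \<beta> b] sum_distrib_left distrib_left mult_ac cong: sum.cong_simp)
  also have "\<dots> = (\<Sum>\<sigma> | \<sigma> permutes {..<?n}. sgnp \<sigma> * (\<Sum>i<?n. \<kappa> (b i) * T (b(i := w) \<circ> \<sigma>)))"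
    unfolding \<beta>_def alt_sum_def sum_distrib_left by (subst sum.swap) (simp add: mult_ac)
  also have "\<dots> = (\<Sum>\<sigma> | \<sigma> permutes {..<?n}. sgnp \<sigma> * (\<Sum>m<?n. \<kappa> ((b \<circ> \<sigma>) m) * T ((b \<circ> \<sigma>)(m := w))))"
  proof (rule sum.cong[OF refl])
    fix \<sigma> :: "nat \<Rightarrow> nat" assume "\<sigma> \<in> {\<sigma>. \<sigma> permutes {..<?n}}"
    then have \<sigma>: "\<sigma> permutes {..<?n}" by simp
    have "b(\<sigma> m := w) \<circ> \<sigma> = (b \<circ> \<sigma>)(m := w)" for m
      using permutes_inj[OF \<sigma>] by (auto simp: fun_eq_iff inj_def)
    then show "sgnp \<sigma> * (\<Sum>i<?n. \<kappa> (b i) * T (b(i := w) \<circ> \<sigma>)) =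
        sgnp \<sigma> * (\<Sum>m<?n. \<kappa> ((b \<circ> \<sigma>) m) * T ((b \<circ> \<sigma>)(m := w)))"
      using sum.reindex_bij_betw[OF permutes_imp_bij[OF \<sigma>], of "\<lambda>i. \<kappa> (b i) * T (b(i := w) \<circ> \<sigma>)"] by simp
  qed
  also have "\<dots> = alt_sum ?n (\<lambda>u. \<Sum>m<?n. \<kappa> (u m) * T (u(m := w))) b"
    by (simp add: alt_sum_def)
  also have "\<dots> = (\<Sum>m<?n. alt_sum ?n (\<lambda>u. \<kappa> (u m) * T (u(m := w))) b)"
    by (rule alt_sum_sum)
  also have "\<dots> = (\<Sum>m<Suc p. alt_sum ?n (\<lambda>u. \<kappa> (u m) * T (u(m := w))) b)"
  proof (rule sum.mono_neutral_right)
    show "\<forall>m\<in>{..<?n} - {..<Suc p}. alt_sum ?n (\<lambda>u. \<kappa> (u m) * T (u(m := w))) b = 0"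
    proof
      fix m assume m: "m \<in> {..<?n} - {..<Suc p}"
      have "m - Suc p < q" using m by auto
      then have "T (u(m := w)) = 0" for u
        using w[of "m - Suc p" "\<lambda>i. (u(m := w)) (Suc p + i)"] m by (simp add: T_def)
      then show "alt_sum ?n (\<lambda>u. \<kappa> (u m) * T (u(m := w))) b = 0" by (simp add: alt_sum_def)
    qed
  qed auto
  \<comment> \<open>All slots of \<mu> contribute equally: moving slot m to the front changes the
    sign of the alternation and also that of \<mu>.\<close>
  also have "\<dots> = (\<Sum>m<Suc p. alt_sum ?n (\<lambda>u. \<kappa> (u 0) * T (u(0 := w))) b)"
  proof (rule sum.cong[OF refl])
    fix m assume m: "m \<in> {..<Suc p}"
    show "alt_sum ?n (\<lambda>u. \<kappa> (u m) * T (u(m := w))) b = alt_sum ?n (\<lambda>u. \<kappa> (u 0) * T (u(0 := w))) b"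
    proof (cases "m = 0")
      case False
      have pm: "tp 0 m permutes {..<?n}" using m by (intro permutes_swap_id) auto
      have "T ((u \<circ> tp 0 m)(m := w)) = - T (u(0 := w))" for u
      proof -
        have e: "(u \<circ> tp 0 m)(m := w) = u(0 := w) \<circ> tp 0 m"
          using False by (auto simp: fun_eq_iff Transposition.transpose_def)
        have "\<mu> (u(0 := w) \<circ> tp 0 m) = - \<mu> (u(0 := w))"
          using altform_swap[OF \<mu>, of 0 m] m False by simp
        moreover have "(\<lambda>i. (u(0 := w) \<circ> tp 0 m) (Suc p + i)) = (\<lambda>i. (u(0 := w)) (Suc p + i))"
          using m by (auto simp: fun_eq_iff Transposition.transpose_def)
        ultimately show ?thesis unfolding e T_def by simp
      qed
      then have "alt_sum ?n (\<lambda>u. \<kappa> ((u \<circ> tp 0 m) m) * T ((u \<circ> tp 0 m)(m := w))) b =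
          - alt_sum ?n (\<lambda>u. \<kappa> (u 0) * T (u(0 := w))) b"
        using alt_sum_mult[of ?n "-1" "\<lambda>u. \<kappa> (u 0) * T (u(0 := w))" b] by simp
      then show ?thesis
        using alt_sum_reindex[OF pm, of "\<lambda>u. \<kappa> (u m) * T (u(m := w))" b] False by (simp add: sgnp_tp)
    qed simp
  qed
  also have "\<dots> = real (Suc p) * alt_sum ?n (\<lambda>u. \<kappa> (u 0) * T (u(0 := w))) b" by simp
  also have "alt_sum ?n (\<lambda>u. \<kappa> (u 0) * T (u(0 := w))) b =
     alt_sum ?n (\<lambda>u. \<kappa> (u 0) * (\<mu> (case_nat w (\<lambda>i. u (Suc i))) * \<eta> (\<lambda>i. u (Suc p + i)))) b"
  proof (rule alt_sum_cong)
    fix \<sigma>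
    have "(\<lambda>u. u(0 := w)) = (\<lambda>u. case_nat w (\<lambda>i. u (Suc i)))" by (auto simp: fun_eq_iff split: nat.split)
    then have e: "u(0 := w) = case_nat w (\<lambda>i. u (Suc i))" for u :: "nat \<Rightarrow> 'e" by (rule fun_cong)
    show "\<kappa> ((b \<circ> \<sigma>) 0) * T ((b \<circ> \<sigma>)(0 := w)) = \<kappa> ((b \<circ> \<sigma>) 0) *
       (\<mu> (case_nat w (\<lambda>i. (b \<circ> \<sigma>) (Suc i))) * \<eta> (\<lambda>i. (b \<circ> \<sigma>) (Suc p + i)))"
      unfolding T_def e by simp
  qed
  finally show ?thesis unfolding \<beta>_def T_def[abs_def] by simp
qed

text \<open>A permutation that moves one of the first p vectors into a slot of \<eta> contributes
  zero. The others preserve both blocks, and their signs cancel against those produced by \<mu> and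
  \<eta>, so the sum is a positive multiple of the product.\<close>

lemma alt_sum_block_nonzero:
  fixes \<mu> \<eta> :: "(nat \<Rightarrow> 'e::real_vector) \<Rightarrow> real"
  assumes \<mu>: "altform p \<mu>" and \<eta>: "altform q \<eta>"
    and z: "\<And>u j i. j < q \<Longrightarrow> i < p \<Longrightarrow> u j = v i \<Longrightarrow> \<eta> u = 0"
    and nz: "\<mu> v \<noteq> 0" "\<eta> (\<lambda>i. v (p + i)) \<noteq> 0"
  shows "alt_sum (p + q) (\<lambda>u. \<mu> u * \<eta> (\<lambda>i. u (p + i))) v \<noteq> 0"
proof -
  let ?T = "\<lambda>u. \<mu> u * \<eta> (\<lambda>i. u (p + i))" and ?P = "{\<sigma>. \<sigma> permutes {..<p + q}}"
  let ?A = "{\<sigma> \<in> ?P. \<forall>j<q. p \<le> \<sigma> (p + j)}"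
  have fin: "finite ?P" by (simp add: finite_permutations)
  have "alt_sum (p + q) ?T v = (\<Sum>\<sigma>\<in>?A. sgnp \<sigma> * ?T (v \<circ> \<sigma>))"
    unfolding alt_sum_def real_scaleR_def
  proof (rule sum.mono_neutral_right[OF fin])
    show "\<forall>\<sigma>\<in>?P - ?A. sgnp \<sigma> * ?T (v \<circ> \<sigma>) = 0"
    proof
      fix \<sigma> assume "\<sigma> \<in> ?P - ?A"
      then obtain j where j: "j < q" "\<sigma> (p + j) < p" by auto
      then have "\<eta> (\<lambda>i. (v \<circ> \<sigma>) (p + i)) = 0" by (intro z[of j "\<sigma> (p + j)"]) auto
      then show "sgnp \<sigma> * ?T (v \<circ> \<sigma>) = 0" by simp
    qed
  qed auto
  also have "\<dots> = (\<Sum>\<sigma>\<in>?A. ?T v)"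
  proof (rule sum.cong[OF refl])
    fix \<sigma> assume "\<sigma> \<in> ?A"
    then have \<sigma>: "\<sigma> permutes {..<p + q}" and ge: "\<And>j. j < q \<Longrightarrow> p \<le> \<sigma> (p + j)" by auto
    define \<rho> where "\<rho> j = (if j < q then \<sigma> (p + j) - p else j)" for j
    have lt: "\<sigma> (p + j) < p + q" if "j < q" for j using permutes_in_image[OF \<sigma>, of "p + j"] that by simp
    have inj\<sigma>: "x = y" if "\<sigma> x = \<sigma> y" for x y using permutes_inj[OF \<sigma>] that by (rule injD)
    have "inj_on \<rho> {..<q}"
    proof (rule inj_onI)
      fix x y assume "x \<in> {..<q}" "y \<in> {..<q}" "\<rho> x = \<rho> y"
      then have "\<sigma> (p + x) = \<sigma> (p + y)" using ge[of x] ge[of y] by (simp add: \<rho>_def)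
      then have "p + x = p + y" by (rule inj\<sigma>)
      then show "x = y" by simp
    qed
    moreover have "\<rho> ` {..<q} \<subseteq> {..<q}" using lt ge by (force simp: \<rho>_def)
    ultimately have "bij_betw \<rho> {..<q} {..<q}" by (simp add: bij_betw_def endo_inj_surj)
    then have \<rho>: "\<rho> permutes {..<q}" by (rule bij_imp_permutes) (simp add: \<rho>_def)
    have s\<rho>: "shiftp p \<rho> permutes {..<p + q}" "sgnp (shiftp p \<rho>) = sgnp \<rho>" using shiftp[OF \<rho>] by auto
    \<comment> \<open>Removing the action on the second block leaves a permutation of the first
      block; this factors the sign of \<sigma>.\<close>
    define \<tau> where "\<tau> = \<sigma> \<circ> inv (shiftp p \<rho>)"
    have \<tau>n: "\<tau> permutes {..<p + q}" unfolding \<tau>_def by (rule permutes_compose[OF permutes_inv[OF s\<rho>(1)] \<sigma>])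
    have \<sigma>\<tau>: "\<sigma> = \<tau> \<circ> shiftp p \<rho>"
      unfolding \<tau>_def comp_assoc using permutes_inv_o(2)[OF s\<rho>(1)] by simp
    have "\<tau> x = x" if x: "x \<in> {..<p + q} - {..<p}" for x
    proof -
      obtain y where y: "x = \<rho> y + p" "y < q"
      proof -
        have "x - p \<in> {..<q}" using x by auto
        then obtain y where "y \<in> {..<q}" "x - p = \<rho> y"
          using permutes_image[OF \<rho>] by (metis imageE)
        then show ?thesis using that[of y] x by auto
      qed
      have "shiftp p \<rho> (p + y) = x" using y by (simp add: shiftp_def)
      then have "\<tau> x = \<sigma> (p + y)" using \<sigma>\<tau> by (metis comp_apply)
      also have "\<dots> = x" using y ge[OF y(2)] by (simp add: \<rho>_def)
      finally show ?thesis .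
    qed
    then have \<tau>: "\<tau> permutes {..<p}" using permutes_superset[OF \<tau>n] by blast
    have "\<mu> (v \<circ> \<sigma>) = \<mu> (v \<circ> \<tau>)" by (rule altform_cong[OF \<mu>]) (simp add: \<sigma>\<tau> shiftp_def)
    then have m: "\<mu> (v \<circ> \<sigma>) = sgnp \<tau> * \<mu> v" using altform_permute[OF \<mu> \<tau>] by simp
    have "\<eta> (\<lambda>i. (v \<circ> \<sigma>) (p + i)) = \<eta> ((\<lambda>i. v (p + i)) \<circ> \<rho>)"
    proof (rule altform_cong[OF \<eta>])
      fix i assume "i < q"
      then show "(v \<circ> \<sigma>) (p + i) = ((\<lambda>i. v (p + i)) \<circ> \<rho>) i" using ge[of i] by (simp add: \<rho>_def)
    qed
    then have l: "\<eta> (\<lambda>i. (v \<circ> \<sigma>) (p + i)) = sgnp \<rho> * \<eta> (\<lambda>i. v (p + i))" using altform_permute[OF \<eta> \<rho>] by simp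
    have s: "sgnp \<sigma> = sgnp \<tau> * sgnp \<rho>"
      unfolding \<sigma>\<tau> sgnp_compose[OF permutation_lessThan[OF \<tau>n] permutation_lessThan[OF s\<rho>(1)]] s\<rho>(2) ..
    have "sgnp \<sigma> * ?T (v \<circ> \<sigma>) = (sgnp \<tau> * sgnp \<tau>) * (sgnp \<rho> * sgnp \<rho>) * ?T v"
      unfolding m l s by (simp only: mult_ac)
    then show "sgnp \<sigma> * ?T (v \<circ> \<sigma>) = ?T v" by (simp only: sgnp_idem mult_1)
  qed
  also have "\<dots> = real (card ?A) * ?T v" by simp
  finally have "alt_sum (p + q) ?T v = real (card ?A) * ?T v" .
  moreover have "card ?A \<noteq> 0"
  proof -
    have "finite ?A" by (rule finite_subset[OF _ fin]) auto
    moreover have "id \<in> ?A" by (simp add: permutes_id)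
    ultimately have "card ?A > 0" using card_gt_0_iff by blast
    then show ?thesis by simp
  qed
  ultimately show ?thesis using nz by simp
qed

text \<open>The signed sum over the cycles of the slots 0 to k is the shape of the Bianchi identity
  (k = 2) and of the closedness of a k-form (k = 4 for \<Theta>).\<close>

lemma alt_sum_closed:
  assumes "k < n" and z: "\<And>u. (\<Sum>i\<le>k. (-1) ^ i *\<^sub>R T (u \<circ> cyc i)) = 0"
  shows "alt_sum n T v = 0"
proof (rule alt_sum_zero[where C = "{..k}" and p = cyc])
  show "(\<Sum>c\<in>{..k}. sgnp (cyc c) *\<^sub>R T (u \<circ> cyc c)) = 0" for u
  proof -
    have "(\<Sum>c\<in>{..k}. sgnp (cyc c) *\<^sub>R T (u \<circ> cyc c)) = (\<Sum>i\<le>k. (-1) ^ i *\<^sub>R T (u \<circ> cyc i))"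
      using assms(1) by (intro sum.cong refl) (simp add: cyc(2)[of _ n])
    then show ?thesis using z by simp
  qed
qed (use assms(1) in \<open>auto intro!: cyc(1)\<close>)

text \<open>In the integrand to be treated, slot 0 carries a derivative, slots 1 and 2 belong to the
  curvature and slots 3 to 6 to \<Theta>. This permutation lets \<Theta> read the slots 1 to 4, so
  that cycles of the slots 0 to 4 express its closedness.\<close>

definition blockp :: "nat \<Rightarrow> nat" where
  "blockp i = (if i = 0 then 0 else if i < 3 then i + 4 else if i < 7 then i - 2 else i)"

lemma blockp: "blockp permutes {..<7}"
proof (rule bij_imp_permutes)
  have "inj_on blockp {..<7}" by (rule inj_onI) (auto simp: blockp_def split: if_splits)
  moreover have "blockp ` {..<7} \<subseteq> {..<7}" by (auto simp: blockp_def)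
  ultimately show "bij_betw blockp {..<7} {..<7}" by (simp add: bij_betw_def endo_inj_surj)
qed (simp add: blockp_def)

lemma alt_sum_blockp: "alt_sum 7 (\<lambda>u. T (u \<circ> blockp)) v = 0 \<Longrightarrow> alt_sum 7 T v = 0"
  by (simp add: alt_sum_reindex[OF blockp])

subsection \<open>The standard forms\<close>

lemma sum_permutations_2:
  "(\<Sum>\<sigma> | \<sigma> permutes {..<2}. f \<sigma>) = f id + f (tp 0 (Suc 0))" for f :: "(nat \<Rightarrow> nat) \<Rightarrow> 'v::comm_monoid_add"
proof -
  have s: "{..<2::nat} = insert 0 {Suc 0}" by auto
  have f: "finite {Suc 0}" "0 \<notin> {Suc 0}" by auto
  show ?thesis unfolding s sum_over_permutations_insert[OF f] permutes_sing by simp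
qed

lemma wedge_1_1: "wedge 1 1 (covec a) (covec b) v = a (v 0) * b (v 1) - a (v 1) * b (v 0)"
proof -
  have t: "{..<1 + 1::nat} = {..<2}" by simp
  show ?thesis
    unfolding wedge_def t sum_permutations_2 by (simp add: sgnp_tp)
qed

lemma permutes_3: "{..<3::nat} = insert 0 (insert 1 {2})" by auto

lemma permutes_4: "{..<4::nat} = insert 0 (insert 1 (insert 2 {3}))" by auto

lemma wedge_2_1_dual:
  assumes "\<And>i j. i < 3 \<Longrightarrow> j < 3 \<Longrightarrow> \<theta> i (h j) = (if i = j then 1 else 0 :: real)"
  shows "wedge 2 1 (wedge 1 1 (covec (\<theta> 0)) (covec (\<theta> 1))) (covec (\<theta> 2)) h = 1"
proof -
  have t: "{..<2 + 1::nat} = {..<3}" by simp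
  have f: "0 \<notin> {1, 2::nat}" "1 \<notin> {2::nat}" "finite {1, 2::nat}" "finite {2::nat}" by auto
  show ?thesis
    unfolding wedge_def[of 2 1] t permutes_3 wedge_1_1
      sum_over_permutations_insert[OF f(3,1)] sum_over_permutations_insert[OF f(4,2)] permutes_sing
    by (simp add: assms sign_swap_id permutation_swap_id sign_compose Transposition.transpose_def)
qed

text \<open>The square of \<omega>_1 is 2 dx_1 dx_2 dx_3 dx_4; with the factor 1/2 in \<mu> a dual
  frame has unit volume.\<close>

lemma wedge_2_2_dual:
  assumes d: "\<And>i j. i < 4 \<Longrightarrow> j < 4 \<Longrightarrow> dx i (e j) = (if i = j then 1 else 0 :: real)"
  shows "wedge 2 2 (hk_form dx 0) (hk_form dx 0) e = 2"
proof -
  have t: "{..<2 + 2::nat} = {..<4}" by simp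
  have f: "0 \<notin> {1, 2, 3::nat}" "1 \<notin> {2, 3::nat}" "2 \<notin> {3::nat}" "finite {1, 2, 3::nat}" "finite {2, 3::nat}" "finite {3::nat}" by auto
  have w: "hk_form dx 0 v = (dx 0 (v 0) * dx 1 (v 1) - dx 0 (v 1) * dx 1 (v 0)) + (dx 2 (v 0) * dx 3 (v 1) - dx 2 (v 1) * dx 3 (v 0))" for v
    by (simp add: hk_form_def Let_def wedge_1_1 del: One_nat_def)
  show ?thesis
    unfolding wedge_def[of 2 2] t permutes_4 w
      sum_over_permutations_insert[OF f(4,1)] sum_over_permutations_insert[OF f(5,2)]
      sum_over_permutations_insert[OF f(6,3)] permutes_sing
    by (simp add: d sign_swap_id permutation_swap_id permutation_compose sign_compose Transposition.transpose_def)
qed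

section \<open>The divergence theorem on an embedded manifold\<close>

lemma compact_support_integrable:
  fixes f :: "'a::euclidean_space \<Rightarrow> real"
  assumes "continuous_on UNIV f" "compact C" "\<And>x. x \<notin> C \<Longrightarrow> f x = 0"
  shows "integrable lborel f" "f absolutely_integrable_on UNIV"
proof -
  have "(\<lambda>x. indicator C x *\<^sub>R f x) = f" using assms(3) by (auto simp: fun_eq_iff indicator_def)
  then show i: "integrable lborel f"
    using borel_integrable_compact[OF assms(2) continuous_on_subset[OF assms(1) subset_UNIV]] by simp
  have "f \<in> lborel \<rightarrow>\<^sub>M borel" using i by (rule borel_measurable_integrable)
  then have "integrable lebesgue f" using i by (simp add: integrable_completion)
  then show "f absolutely_integrable_on UNIV" by (simp add: set_integrable_def)
qed

lemma derivative_zero_off_support: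
  assumes "closed C" "\<And>y. y \<notin> C \<Longrightarrow> h y = 0" "x \<notin> C" "(h has_derivative D) (at x)"
  shows "D v = 0"
proof -
  have "(h has_derivative (\<lambda>_. 0)) (at x)"
    by (rule has_derivative_transform_within_open[of "\<lambda>_. 0" _ x UNIV "- C"]) (use assms in auto)
  then show ?thesis using has_derivative_unique[OF assms(4)] by metis
qed

text \<open>Lebesgue measure is translation invariant, so h and its translates along e have equal
  integrals. The difference quotients converge uniformly to the derivative, and everything is
  supported in one fixed ball.\<close>

lemma integral_directional_derivative_zero:
  fixes h :: "'a::euclidean_space \<Rightarrow> real"
  assumes der: "\<And>x. (h has_derivative h' x) (at x)" and cont: "continuous_on UNIV (\<lambda>x. h' x e)"
    and C: "compact C" "\<And>x. x \<notin> C \<Longrightarrow> h x = 0"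
  shows "integral UNIV (\<lambda>x. h' x e) = 0"
proof -
  define g where "g x = h' x e" for x
  have ch: "continuous_on UNIV h"
    by (rule continuous_at_imp_continuous_on) (use der has_derivative_continuous in blast)
  have g0: "g x = 0" if "x \<notin> C" for x
    unfolding g_def using derivative_zero_off_support[OF compact_imp_closed[OF C(1)] C(2) that der] by simp
  have ig: "integrable lborel g" and ih: "integrable lborel h"
    using compact_support_integrable[OF _ C(1)] cont ch g0 C(2) by (auto simp: g_def)
  obtain R where R: "R > 0" "C \<subseteq> ball 0 R" using compact_imp_bounded[OF C(1)] bounded_subset_ballD by blast
  \<comment> \<open>Contains the supports of h and of all its translates by t e with t at most
    1.\<close>
  define C' where "C' = cball (0::'a) (R + norm e)"
  have ucont: "\<exists>d>0. \<forall>x y. dist x y < d \<longrightarrow> \<bar>g x - g y\<bar> < \<epsilon>" if "\<epsilon> > 0" for \<epsilon>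
  proof -
    have "uniformly_continuous_on (cball 0 (R + 1)) g"
      using cont by (intro compact_uniformly_continuous) (auto simp: g_def intro: continuous_on_subset)
    then obtain d where d: "d > 0" "\<And>x y. x \<in> cball 0 (R + 1) \<Longrightarrow> y \<in> cball 0 (R + 1) \<Longrightarrow> dist y x < d \<Longrightarrow> dist (g y) (g x) < \<epsilon>"
      using \<open>\<epsilon> > 0\<close> unfolding uniformly_continuous_on_def by blast
    have "\<bar>g x - g y\<bar> < \<epsilon>" if xy: "dist x y < min d 1" for x y
    proof (cases "x \<in> cball 0 (R + 1) \<and> y \<in> cball 0 (R + 1)")
      case True
      then show ?thesis using d(2)[of y x] xy by (simp add: dist_real_def)
    next
      case False
      have "norm x > R \<and> norm y > R"
        using False xy norm_triangle_ineq2[of x y] norm_triangle_ineq2[of y x] by (auto simp: dist_norm norm_minus_commute)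
      then have "x \<notin> C" "y \<notin> C" using R by auto
      then show ?thesis using g0 \<open>\<epsilon> > 0\<close> by simp
    qed
    then show ?thesis using d(1) by (intro exI[of _ "min d 1"]) auto
  qed
  have "\<bar>integral\<^sup>L lborel g\<bar> \<le> \<epsilon> * measure lborel C'" if \<epsilon>: "\<epsilon> > 0" for \<epsilon>
  proof -
    obtain d where d: "d > 0" "\<And>x y. dist x y < d \<Longrightarrow> \<bar>g x - g y\<bar> < \<epsilon>" using ucont[OF \<epsilon>] by blast
    define t where "t = min 1 (d / (norm e + 1) / 2)"
    have t: "0 < t" "t \<le> 1" using d(1) by (auto simp: t_def intro!: divide_pos_pos add_nonneg_pos)
    have td: "t * norm e < d"
    proof -
      have "t * norm e \<le> d / (norm e + 1) / 2 * (norm e + 1)"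
        unfolding t_def using d(1) by (intro mult_mono) auto
      also have "\<dots> = d / 2"
      proof -
        have "d / c / 2 * c = d / 2" if "c \<noteq> 0" for c :: real using that by simp
        moreover have "norm e + 1 \<noteq> 0" using norm_ge_zero[of e] by linarith
        ultimately show ?thesis by blast
      qed
      finally show ?thesis using d(1) by simp
    qed
    \<comment> \<open>The first order Taylor remainder. As the translates of h have equal integrals,
      its integral is -t times that of g, while it is bounded by t times an arbitrarily small
      number.\<close>
    define F where "F x = h (t *\<^sub>R e + x) - h x - t * g x" for x
    have shift: "integrable lborel (\<lambda>x. h (t *\<^sub>R e + x))" "integral\<^sup>L lborel (\<lambda>x. h (t *\<^sub>R e + x)) = integral\<^sup>L lborel h"
    proof -
      have m: "h \<in> borel_measurable borel" using ih by auto
      show "integrable lborel (\<lambda>x. h (t *\<^sub>R e + x))"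
        using ih integrable_distr_eq[of "(+) (t *\<^sub>R e)" lborel borel h] m by (simp add: lborel_distr_plus)
      show "integral\<^sup>L lborel (\<lambda>x. h (t *\<^sub>R e + x)) = integral\<^sup>L lborel h"
        using integral_distr[of "(+) (t *\<^sub>R e)" lborel borel h] m by (simp add: lborel_distr_plus)
    qed
    have Fi: "integrable lborel F" unfolding F_def using shift ih ig by auto
    have FI: "integral\<^sup>L lborel F = - t * integral\<^sup>L lborel g"
      unfolding F_def using shift ih ig by simp
    have Fb: "\<bar>F x\<bar> \<le> indicator C' x * (t * \<epsilon>)" for x
    proof (cases "x \<in> C'")
      case False
      then have n: "norm x > R + norm e" by (simp add: C'_def)
      have "norm (t *\<^sub>R e) \<le> norm e" using t by (simp add: mult_left_le_one_le)
      then have "norm (t *\<^sub>R e + x) > R" using n norm_triangle_ineq2[of x "- (t *\<^sub>R e)"] by (simp add: add.commute)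
      moreover have "norm x > R" using n norm_ge_zero[of e] by linarith
      ultimately have "x \<notin> C" "t *\<^sub>R e + x \<notin> C" using R by auto
      then have "F x = 0" using C(2) g0 by (simp add: F_def)
      then show ?thesis using t \<epsilon> by simp
    next
      case True
      have "((\<lambda>s. h (s *\<^sub>R e + x)) has_real_derivative g (s *\<^sub>R e + x)) (at s)" for s
      proof -
        have "((\<lambda>s. h (s *\<^sub>R e + x)) has_derivative (\<lambda>r. h' (s *\<^sub>R e + x) (r *\<^sub>R e))) (at s)"
          by (rule has_derivative_compose[where g = h and f = "\<lambda>s. s *\<^sub>R e + x", OF _ der])
            (auto intro!: derivative_eq_intros)
        moreover have "h' (s *\<^sub>R e + x) (r *\<^sub>R e) = r * g (s *\<^sub>R e + x)" for r
          unfolding g_def using linear_scale[OF has_derivative_linear[OF der]] by simp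
        ultimately show ?thesis by (simp add: has_field_derivative_def mult_commute_abs)
      qed
      then obtain s where s: "0 < s" "s < t" "h (t *\<^sub>R e + x) - h (0 *\<^sub>R e + x) = (t - 0) * g (s *\<^sub>R e + x)"
        using MVT2[of 0 t "\<lambda>s. h (s *\<^sub>R e + x)" "\<lambda>s. g (s *\<^sub>R e + x)"] t by blast
      have "dist (s *\<^sub>R e + x) x = s * norm e" using s by (simp add: dist_norm)
      also have "\<dots> \<le> t * norm e" using s by (intro mult_right_mono) auto
      finally have "\<bar>g (s *\<^sub>R e + x) - g x\<bar> < \<epsilon>" using d(2) td by simp
      moreover have "F x = t * (g (s *\<^sub>R e + x) - g x)" using s(3) by (simp add: F_def algebra_simps)
      ultimately show ?thesis using t True by (simp add: abs_mult)
    qed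
    have "\<bar>integral\<^sup>L lborel F\<bar> \<le> integral\<^sup>L lborel (\<lambda>x. indicator C' x * (t * \<epsilon>))"
    proof (rule order_trans[OF integral_abs_bound], rule integral_mono)
      show "integrable lborel (\<lambda>x. indicator C' x * (t * \<epsilon>))"
        unfolding C'_def using emeasure_bounded_finite[of "cball (0::'a) (R + norm e)"]
        by (intro integrable_mult_left integrable_real_indicator) auto
    qed (use Fb Fi in auto)
    also have "\<dots> = measure lborel C' * (t * \<epsilon>)" by (simp add: C'_def)
    finally have "t * \<bar>integral\<^sup>L lborel g\<bar> \<le> t * (\<epsilon> * measure lborel C')"
      unfolding FI using t by (simp add: abs_mult mult_ac)
    then show ?thesis using t by simp
  qed
  then have b: "\<bar>integral\<^sup>L lborel g\<bar> \<le> \<epsilon> * measure lborel C'" if "\<epsilon> > 0" for \<epsilon> using that by blast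
  have "\<bar>integral\<^sup>L lborel g\<bar> \<le> 0 + \<delta>" if "\<delta> > 0" for \<delta>
  proof -
    have m: "measure lborel C' \<ge> 0" by simp
    have "\<bar>integral\<^sup>L lborel g\<bar> \<le> \<delta> / (measure lborel C' + 1) * measure lborel C'"
      using b[of "\<delta> / (measure lborel C' + 1)"] that m by simp
    also have "\<dots> \<le> \<delta> / (measure lborel C' + 1) * (measure lborel C' + 1)"
      using that m by (intro mult_left_mono divide_nonneg_nonneg) linarith+
    also have "\<dots> = \<delta>"
    proof -
      have "d / c * c = d" if "c \<noteq> 0" for c d :: real using that by simp
      moreover have "measure lborel C' + 1 \<noteq> 0" using m by linarith
      ultimately show ?thesis by blast
    qed
    finally show ?thesis by simp
  qed
  then have "\<bar>integral\<^sup>L lborel g\<bar> \<le> 0" by (rule field_le_epsilon)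
  then have "integral UNIV g = 0" using integral_lborel[OF ig] by simp
  then show ?thesis by (simp add: g_def[abs_def])
qed

section \<open>Divergences with compact support in an open set\<close>

lemma continuous_on_zero_extension:
  fixes f :: "'a::euclidean_space \<Rightarrow> real"
  assumes "open V" "compact C" "C \<subseteq> V" "continuous_on V f" "\<And>y. y \<in> V \<Longrightarrow> y \<notin> C \<Longrightarrow> f y = 0"
  shows "continuous_on UNIV (\<lambda>y. if y \<in> V then f y else 0)"
proof -
  have "continuous_on (V \<union> - C) (\<lambda>y. if y \<in> V then f y else 0)"
  proof (rule continuous_on_open_Un[OF assms(1)])
    show "open (- C)" using assms(2) by (simp add: compact_imp_closed open_Compl)
    show "continuous_on V (\<lambda>y. if y \<in> V then f y else 0)" using assms(4) by (simp cong: continuous_on_cong)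
    show "continuous_on (- C) (\<lambda>y. if y \<in> V then f y else 0)"
      by (rule continuous_on_eq[of _ "\<lambda>_. 0"]) (use assms(5) in auto)
  qed
  moreover have "V \<union> - C = UNIV" using assms(3) by auto
  ultimately show ?thesis by simp
qed

lemma absolutely_integrable_compact_support:
  fixes f :: "'a::euclidean_space \<Rightarrow> real"
  assumes "open V" "compact C" "C \<subseteq> V" "continuous_on V f" "\<And>y. y \<in> V \<Longrightarrow> y \<notin> C \<Longrightarrow> f y = 0"
  shows "f absolutely_integrable_on V"
proof -
  have "(\<lambda>y. if y \<in> V then f y else 0) absolutely_integrable_on UNIV"
    by (rule compact_support_integrable(2)[OF continuous_on_zero_extension[OF assms] assms(2)]) (use assms(5) in auto)
  then show ?thesis by (simp only: absolutely_integrable_restrict_UNIV)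
qed

lemma integral_divergence_zero:
  fixes Z :: "'a::euclidean_space \<Rightarrow> 'a"
  assumes V: "open V" "compact C" "C \<subseteq> V"
    and der: "\<And>y. y \<in> V \<Longrightarrow> (Z has_derivative Z' y) (at y)"
    and cont: "\<And>v. continuous_on V (\<lambda>y. Z' y v)"
    and z: "\<And>y. y \<in> V \<Longrightarrow> y \<notin> C \<Longrightarrow> Z y = 0"
  shows "integral V (\<lambda>y. \<Sum>b\<in>Basis. Z' y b \<bullet> b) = 0"
proof -
  have clC: "closed C" using V(2) compact_imp_closed by blast
  have z': "Z' y v = 0" if "y \<in> V" "y \<notin> C" for y v
  proof -
    have "(Z has_derivative (\<lambda>_. 0)) (at y)"
      by (rule has_derivative_transform_within_open[of "\<lambda>_. 0" _ y UNIV "V - C"])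
        (use that z V clC in \<open>auto simp: open_Diff\<close>)
    then show ?thesis using has_derivative_unique[OF der[OF that(1)]] by metis
  qed
  have ai: "(\<lambda>y. Z' y b \<bullet> b) absolutely_integrable_on V" for b
    by (rule absolutely_integrable_compact_support[OF V]) (use cont z' in \<open>auto intro!: continuous_intros\<close>)
  have "integral V (\<lambda>y. Z' y b \<bullet> b) = 0" for b
  proof -
    define h where "h y = (if y \<in> V then Z y \<bullet> b else 0)" for y
    define h' where "h' y v = (if y \<in> V then Z' y v \<bullet> b else 0)" for y v
    have "(h has_derivative h' y) (at y)" for y
    proof (cases "y \<in> V")
      case True
      have "((\<lambda>y. Z y \<bullet> b) has_derivative (\<lambda>v. Z' y v \<bullet> b)) (at y)"
        by (rule has_derivative_inner_left[OF der[OF True]])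
      then have "(h has_derivative (\<lambda>v. Z' y v \<bullet> b)) (at y)"
        by (rule has_derivative_transform_within_open[OF _ V(1) True]) (simp add: h_def)
      then show ?thesis using True by (simp add: h'_def[abs_def])
    next
      case False
      then have "y \<notin> C" using V(3) by auto
      have "(h has_derivative (\<lambda>_. 0)) (at y)"
        by (rule has_derivative_transform_within_open[of "\<lambda>_. 0" _ y UNIV "- C"])
          (use clC z \<open>y \<notin> C\<close> in \<open>auto simp: h_def\<close>)
      then show ?thesis using False by (simp add: h'_def[abs_def])
    qed
    moreover have "continuous_on UNIV (\<lambda>y. h' y b)"
      unfolding h'_def by (rule continuous_on_zero_extension[OF V]) (use cont z' in \<open>auto intro!: continuous_intros\<close>)
    moreover have "h y = 0" if "y \<notin> C" for y using that z by (simp add: h_def)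
    ultimately have "integral UNIV (\<lambda>y. h' y b) = 0"
      using integral_directional_derivative_zero[OF _ _ V(2)] by blast
    then show ?thesis by (simp only: h'_def Henstock_Kurzweil_Integration.integral_restrict_UNIV)
  qed
  then show ?thesis
    using ai by (subst Henstock_Kurzweil_Integration.integral_sum) (auto simp: absolutely_integrable_on_def)
qed

text \<open>\<open>\<phi> i\<close> parametrises the part of M in the open set \<open>W i\<close>,
  and \<open>f i\<close> is its inverse, extended to the ambient space so that transition maps can
  be differentiated. The top form \<beta> enters integrals through its absolute value \<nu>, a
  density.\<close>

locale density_atlas =
  fixes M :: "'m::euclidean_space set" and V :: "'i \<Rightarrow> (real^'n::{finite,wellorder}) set"
    and \<phi> :: "'i \<Rightarrow> real^'n::_ \<Rightarrow> 'm" and \<phi>' :: "'i \<Rightarrow> real^'n::_ \<Rightarrow> real^'n::_ \<Rightarrow> 'm"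
    and W :: "'i \<Rightarrow> 'm set" and f :: "'i \<Rightarrow> 'm \<Rightarrow> real^'n::_"
    and \<beta> :: "'m \<Rightarrow> (nat \<Rightarrow> 'm) \<Rightarrow> real" and e :: "nat \<Rightarrow> 'n"
  assumes e: "bij_betw e {..<CARD('n)} UNIV"
    and V: "open (V i)" and W: "open (W i)" and img: "\<phi> i ` V i = M \<inter> W i"
    and inv: "y \<in> V i \<Longrightarrow> f i (\<phi> i y) = y"
    and der: "y \<in> V i \<Longrightarrow> (\<phi> i has_derivative \<phi>' i y) (at y)"
    and df: "z \<in> W i \<Longrightarrow> f i differentiable (at z)"
    and alt: "y \<in> V i \<Longrightarrow> altform CARD('n) (\<lambda>u. \<beta> (\<phi> i y) (\<lambda>k. \<phi>' i y (u k)))"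
    and nz: "y \<in> V i \<Longrightarrow> \<beta> (\<phi> i y) (\<lambda>k. \<phi>' i y (axis (e k) 1)) \<noteq> 0"
    and cont\<beta>: "continuous_on (V i) (\<lambda>y. \<beta> (\<phi> i y) (\<lambda>k. \<phi>' i y (axis (e k) 1)))"
begin

definition \<nu> :: "'i \<Rightarrow> real^'n::_ \<Rightarrow> real" where
  "\<nu> i y = \<bar>\<beta> (\<phi> i y) (\<lambda>k. \<phi>' i y (axis (e k) 1))\<bar>"

lemma \<nu>_pos: "y \<in> V i \<Longrightarrow> \<nu> i y > 0"
  using nz by (simp add: \<nu>_def)

lemma continuous_\<nu>: "continuous_on (V i) (\<nu> i)"
  unfolding \<nu>_def[abs_def] using cont\<beta> by (rule continuous_on_rabs)

lemma \<phi>_M: "y \<in> V i \<Longrightarrow> \<phi> i y \<in> M" "y \<in> V i \<Longrightarrow> \<phi> i y \<in> W i"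
  using img by auto

lemma f_V: "x \<in> M \<Longrightarrow> x \<in> W i \<Longrightarrow> f i x \<in> V i" "x \<in> M \<Longrightarrow> x \<in> W i \<Longrightarrow> \<phi> i (f i x) = x"
proof -
  assume "x \<in> M" "x \<in> W i"
  then obtain y where "y \<in> V i" "x = \<phi> i y" using img by (metis IntI imageE)
  then show "f i x \<in> V i" "\<phi> i (f i x) = x" using inv by auto
qed

lemma continuous_\<phi>: "continuous_on (V i) (\<phi> i)"
  using der has_derivative_continuous continuous_at_imp_continuous_on by metis

definition overlap :: "'i \<Rightarrow> 'i \<Rightarrow> (real^'n::_) set" where
  "overlap i j = {y \<in> V i. \<phi> i y \<in> W j}"

lemma overlap_open: "open (overlap i j)"
proof -
  have "overlap i j = V i \<inter> \<phi> i -` W j" by (auto simp: overlap_def)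
  then show ?thesis using continuous_open_preimage[OF continuous_\<phi> V W] by metis
qed

abbreviation trans :: "'i \<Rightarrow> 'i \<Rightarrow> real^'n::_ \<Rightarrow> real^'n::_" where
  "trans i j y \<equiv> f j (\<phi> i y)"

lemma trans: "y \<in> overlap i j \<Longrightarrow> trans i j y \<in> overlap j i" "y \<in> overlap i j \<Longrightarrow> \<phi> j (trans i j y) = \<phi> i y"
  "y \<in> overlap i j \<Longrightarrow> trans j i (trans i j y) = y"
  using f_V \<phi>_M inv by (auto simp: overlap_def)

lemma trans_image: "trans i j ` overlap i j = overlap j i"
proof
  show "overlap j i \<subseteq> trans i j ` overlap i j"
  proof
    fix y assume y: "y \<in> overlap j i"
    show "y \<in> trans i j ` overlap i j" using image_eqI[where f = "trans i j" and x = "trans j i y", OF trans(3)[OF y, symmetric] trans(1)[OF y]] .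
  qed
qed (use trans(1) in auto)

lemma trans_differentiable: "y \<in> overlap i j \<Longrightarrow> (trans i j) differentiable (at y)"
  using differentiable_compose[of "f j" "\<phi> i" y] df[of "\<phi> i y" j] der[of y i]
  by (auto simp: overlap_def differentiable_def)

lemma trans_derivative:
  assumes "y \<in> overlap i j"
  shows "(trans i j has_derivative dd (trans i j) y) (at y)"
    "\<phi>' i y v = \<phi>' j (trans i j y) (dd (trans i j) y v)"
proof -
  show d: "(trans i j has_derivative dd (trans i j) y) (at y)"
    using trans_differentiable[OF assms] frechet_derivative_works by blast
  have "trans i j y \<in> V j" using trans(1)[OF assms] by (simp add: overlap_def)
  then have "((\<lambda>y. \<phi> j (trans i j y)) has_derivative (\<lambda>v. \<phi>' j (trans i j y) (dd (trans i j) y v))) (at y)"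
    by (rule has_derivative_compose[OF d der])
  then have "(\<phi> i has_derivative (\<lambda>v. \<phi>' j (trans i j y) (dd (trans i j) y v))) (at y)"
    by (rule has_derivative_transform_within_open[OF _ overlap_open assms]) (simp add: trans)
  moreover have "y \<in> V i" using assms by (simp add: overlap_def)
  ultimately show "\<phi>' i y v = \<phi>' j (trans i j y) (dd (trans i j) y v)"
    using has_derivative_unique[OF der] by metis
qed

text \<open>The chain rule relates the differentials of the two parametrisations by a linear map,
  and a form of top degree turns that map into its determinant.\<close>

lemma \<nu>_trans:
  assumes y: "y \<in> overlap i j"
  shows "\<nu> i y = \<bar>det (matrix (dd (trans i j) y))\<bar> * \<nu> j (trans i j y)"
proof -
  let ?z = "trans i j y"
  have z: "?z \<in> V j" using trans(1)[OF y] by (simp add: overlap_def)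
  have L: "linear (dd (trans i j) y)" using trans_derivative(1)[OF y] has_derivative_linear by blast
  have "\<beta> (\<phi> i y) (\<lambda>k. \<phi>' i y (axis (e k) 1)) = \<beta> (\<phi> j ?z) (\<lambda>k. \<phi>' j ?z (dd (trans i j) y (axis (e k) 1)))"
    using trans_derivative(2)[OF y] trans(2)[OF y] by simp
  also have "\<dots> = det (matrix (dd (trans i j) y)) * \<beta> (\<phi> j ?z) (\<lambda>k. \<phi>' j ?z (axis (e k) 1))"
    by (rule altform_det[OF alt[OF z] e L])
  finally show ?thesis by (simp add: \<nu>_def abs_mult)
qed

definition I :: "'i \<Rightarrow> ('m \<Rightarrow> real) \<Rightarrow> real" where
  "I i r = integral (V i) (\<lambda>y. \<nu> i y * r (\<phi> i y))"

lemma f_continuous: "C \<subseteq> W i \<Longrightarrow> continuous_on C (f i)"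
  using df differentiable_imp_continuous_within continuous_at_imp_continuous_on by (metis subsetD)

lemma chart_compact:
  assumes "compact C" "C \<subseteq> M" "C \<subseteq> W i"
  shows "compact (f i ` C)" "f i ` C \<subseteq> V i" "y \<in> V i \<Longrightarrow> y \<notin> f i ` C \<Longrightarrow> \<phi> i y \<notin> C"
    "C \<subseteq> W j \<Longrightarrow> f i ` C \<subseteq> overlap i j"
proof -
  show "compact (f i ` C)" using compact_continuous_image[OF f_continuous assms(1)] assms by blast
  show "f i ` C \<subseteq> V i" using assms f_V(1) by blast
  show "\<phi> i y \<notin> C" if "y \<in> V i" "y \<notin> f i ` C" using inv[OF that(1)] that(2) by (metis imageI)
  show "f i ` C \<subseteq> overlap i j" if "C \<subseteq> W j"
  proof
    fix y assume "y \<in> f i ` C"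
    then obtain x where x: "x \<in> C" "y = f i x" by blast
    then have "x \<in> M" "x \<in> W i" "x \<in> W j" using assms that by auto
    then show "y \<in> overlap i j" using f_V[of x i] x by (simp add: overlap_def)
  qed
qed

text \<open>The support of r lies in both charts, so either integral restricts to the overlap, where
  the transformation law of \<nu> is exactly the Jacobian factor of the change of variables.\<close>

lemma I_change_chart:
  assumes C: "compact C" "C \<subseteq> M" "C \<subseteq> W i" "C \<subseteq> W j"
    and r: "continuous_on (V j) (\<lambda>y. r (\<phi> j y))" "\<And>x. x \<in> M \<Longrightarrow> x \<notin> C \<Longrightarrow> r x = 0"
  shows "I i r = I j r"
proof -
  define F where "F k y = \<nu> k y * r (\<phi> k y)" for k y
  have restrict: "integral (V k) (F k) = integral (overlap k l) (F k)" if "C \<subseteq> W l" for k l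
  proof -
    have "(if y \<in> V k then F k y else 0) = (if y \<in> overlap k l then F k y else 0)" for y
    proof (cases "y \<in> V k \<and> y \<notin> overlap k l")
      case True
      then have "\<phi> k y \<notin> C" using that by (auto simp: overlap_def)
      then have "F k y = 0" using r(2)[OF \<phi>_M(1)] True by (simp add: F_def)
      then show ?thesis by simp
    qed (auto simp: overlap_def)
    then have "integral UNIV (\<lambda>y. if y \<in> V k then F k y else 0) = integral UNIV (\<lambda>y. if y \<in> overlap k l then F k y else 0)"
      by simp
    then show ?thesis by (simp only: Henstock_Kurzweil_Integration.integral_restrict_UNIV)
  qed
  have ai: "F j absolutely_integrable_on overlap j i"
  proof (rule absolutely_integrable_compact_support[OF overlap_open])
    show "compact (f j ` C)" "f j ` C \<subseteq> overlap j i" using chart_compact[of C j] C by auto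
    show "continuous_on (overlap j i) (F j)"
      unfolding F_def by (rule continuous_on_subset[of "V j"])
        (auto simp: overlap_def intro!: continuous_on_mult continuous_\<nu> r(1))
    show "F j y = 0" if "y \<in> overlap j i" "y \<notin> f j ` C" for y
      using that r(2)[OF \<phi>_M(1)] chart_compact(3)[OF C(1,2,4)] by (auto simp: overlap_def F_def)
  qed
  \<comment> \<open>The change of variables is applied to integrands with values in
    \<open>real^1\<close>; the real integrals are recovered from the single component.\<close>
  let ?v = "\<lambda>t::real. vec t :: real^1"
  have bl: "bounded_linear ?v" by (simp add: linear_conv_bounded_linear[symmetric] linear_vec)
  have aiv: "(?v \<circ> F j) absolutely_integrable_on (trans i j ` overlap i j)"
    unfolding trans_image by (rule absolutely_integrable_linear[OF ai bl])
  have d: "(trans i j has_derivative dd (trans i j) y) (at y within overlap i j)" if "y \<in> overlap i j" for y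
    using trans_derivative(1)[OF that] has_derivative_at_withinI by blast
  have inj: "inj_on (trans i j) (overlap i j)" by (rule inj_on_inverseI) (rule trans(3))
  have meas: "overlap i j \<in> sets lebesgue" using overlap_open borel_open by auto
  have eq: "\<bar>det (matrix (dd (trans i j) y))\<bar> *\<^sub>R (?v \<circ> F j) (trans i j y) = (?v \<circ> F i) y" if "y \<in> overlap i j" for y
    using \<nu>_trans[OF that] trans(2)[OF that] by (simp add: F_def vec_eq_iff mult_ac)
  have "integral (trans i j ` overlap i j) (?v \<circ> F j) = integral (overlap i j) (\<lambda>y. \<bar>det (matrix (dd (trans i j) y))\<bar> *\<^sub>R (?v \<circ> F j) (trans i j y))"
    by (rule integral_change_of_variables[OF meas d inj disjI1[OF aiv]])
  also have "\<dots> = integral (overlap i j) (?v \<circ> F i)"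
    by (rule Henstock_Kurzweil_Integration.integral_cong[OF eq])
  finally have eqv: "integral (overlap j i) (?v \<circ> F j) = integral (overlap i j) (?v \<circ> F i)" by (simp add: trans_image)
  have "(\<lambda>y. \<bar>det (matrix (dd (trans i j) y))\<bar> *\<^sub>R (?v \<circ> F j) (trans i j y)) absolutely_integrable_on overlap i j"
    using absolutely_integrable_change_of_variables[OF meas d inj] aiv by blast
  then have "(?v \<circ> F i) absolutely_integrable_on overlap i j"
    by (rule absolutely_integrable_spike[OF _ negligible_empty]) (use eq in auto)
  then have "((\<lambda>x. x $ 1) \<circ> (?v \<circ> F i)) absolutely_integrable_on overlap i j"
    by (rule absolutely_integrable_linear) (rule bounded_linear_vec_nth)
  then have "F i integrable_on overlap i j" by (simp add: comp_def absolutely_integrable_on_def)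
  moreover have "F j integrable_on overlap j i" using ai by (simp add: absolutely_integrable_on_def)
  ultimately have "?v (integral (overlap j i) (F j)) = ?v (integral (overlap i j) (F i))"
    using eqv by (simp add: integral_linear[OF _ bl])
  then have "integral (overlap j i) (F j) = integral (overlap i j) (F i)" by (simp add: vec_eq_iff)
  then show ?thesis
    using restrict[OF C(3), of j] restrict[OF C(4), of i] by (simp add: I_def F_def[abs_def])
qed

text \<open>With S the sum of the \<zeta> i, the weights \<zeta> i N / S add up to N where S is
  nonzero. Integrating the divergence of weight times X i over chart i shows that the weighted
  divergence of X i has minus the integral of the derivative of the weight along Y. These
  derivatives add up to that of N along Y, which is zero. As they are integrated in different
  charts, each is cut once more by \<zeta> k / S and moved to chart k, where the sum over i cancels.
  So nonnegative functions have total integral zero.\<close>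

theorem divergence_nonneg_imp_zero:
  fixes \<zeta> :: "'i \<Rightarrow> 'm \<Rightarrow> real" and N :: "'m \<Rightarrow> real" and X :: "'i \<Rightarrow> real^'n::_ \<Rightarrow> real^'n::_"
  assumes J: "finite J" and K: "compact K" "K \<subseteq> M"
    and Cl: "\<And>i. i \<in> J \<Longrightarrow> closed (Cl i)" "\<And>i. i \<in> J \<Longrightarrow> Cl i \<subseteq> W i"
      "\<And>i x. i \<in> J \<Longrightarrow> x \<notin> Cl i \<Longrightarrow> \<zeta> i x = 0"
    and \<zeta>: "\<And>i x. i \<in> J \<Longrightarrow> (\<zeta> i has_derivative \<zeta>' i x) (at x)"
      "\<And>i v. i \<in> J \<Longrightarrow> continuous_on UNIV (\<lambda>x. \<zeta>' i x v)" "\<And>i x. i \<in> J \<Longrightarrow> \<zeta> i x \<ge> 0"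
    and cover: "\<And>x. x \<in> K \<Longrightarrow> \<exists>i\<in>J. \<zeta> i x > 0"
    and N: "\<And>x. x \<in> M \<Longrightarrow> (N has_derivative N' x) (at x within M)" "\<And>x. x \<in> M \<Longrightarrow> N x \<ge> 0"
      "\<And>x. x \<in> M \<Longrightarrow> x \<notin> K \<Longrightarrow> N x = 0" "\<And>x. x \<in> M \<Longrightarrow> N' x (Y x) = 0"
      "\<And>i v. i \<in> J \<Longrightarrow> continuous_on (V i) (\<lambda>y. N' (\<phi> i y) (\<phi>' i y v))"
    and \<phi>': "\<And>i v. i \<in> J \<Longrightarrow> continuous_on (V i) (\<lambda>y. \<phi>' i y v)"
    and X: "\<And>i y. i \<in> J \<Longrightarrow> y \<in> V i \<Longrightarrow> (X i has_derivative X' i y) (at y)"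
      "\<And>i v. i \<in> J \<Longrightarrow> continuous_on (V i) (\<lambda>y. X' i y v)"
      "\<And>i y. i \<in> J \<Longrightarrow> y \<in> V i \<Longrightarrow> \<phi>' i y (X i y) = \<nu> i y *\<^sub>R Y (\<phi> i y)"
      "\<And>i y. i \<in> J \<Longrightarrow> y \<in> V i \<Longrightarrow> 0 \<le> (\<Sum>b\<in>Basis. X' i y b \<bullet> b)"
    and iJ: "i \<in> J" "y \<in> V i"
  shows "\<zeta> i (\<phi> i y) * N (\<phi> i y) * (\<Sum>b\<in>Basis. X' i y b \<bullet> b) = 0"
proof -
  define S where "S x = (\<Sum>i\<in>J. \<zeta> i x)" for x
  define S' where "S' x v = (\<Sum>i\<in>J. \<zeta>' i x v)" for x v
  have dS: "(S has_derivative S' x) (at x)" for x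
    unfolding S_def[abs_def] S'_def[abs_def] by (rule has_derivative_sum) (rule \<zeta>(1))
  have cS: "continuous_on UNIV S"
    by (rule continuous_at_imp_continuous_on) (use dS has_derivative_continuous in blast)
  have cS': "continuous_on UNIV (\<lambda>x. S' x v)" for v
    unfolding S'_def by (rule continuous_on_sum) (rule \<zeta>(2))
  have S0: "S x \<ge> 0" for x unfolding S_def by (rule sum_nonneg) (rule \<zeta>(3))
  have SK: "S x \<noteq> 0" if "x \<in> K" for x
  proof -
    obtain i where i: "i \<in> J" "\<zeta> i x > 0" using cover[OF \<open>x \<in> K\<close>] by blast
    have "\<zeta> i x \<le> S x" unfolding S_def using J i(1) \<zeta>(3) by (intro member_le_sum) auto
    then show ?thesis using i by simp
  qed
  have c\<zeta>: "continuous_on UNIV (\<zeta> i)" if "i \<in> J" for i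
    by (rule continuous_at_imp_continuous_on) (use \<zeta>(1)[OF that] has_derivative_continuous in blast)
  \<comment> \<open>A point of M where S vanishes lies outside K, and N is zero on M near it; the
    default value 0 of the quotient, and of H', is then the right one.\<close>
  define H where "H x = N x / S x" for x
  define H' where "H' x v = (if S x = 0 then 0 else N' x v / S x - N x * S' x v / (S x * S x))" for x v
  have clK: "closed K" using K(1) by (rule compact_imp_closed)
  have dH: "(H has_derivative H' x) (at x within M)" if x: "x \<in> M" for x
  proof (cases "S x = 0")
    case True
    then have "x \<in> M \<inter> - K" using x SK by blast
    then have xK: "x \<in> - K" by blast
    obtain d where d: "d > 0" "ball x d \<subseteq> - K" using xK clK openE[of "- K" x] by (auto simp: open_Compl)
    have "((\<lambda>_. 0) has_derivative (\<lambda>_. 0)) (at x within M)" by simp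
    then have "(H has_derivative (\<lambda>_. 0)) (at x within M)"
    proof (rule has_derivative_transform_within[OF _ d(1) \<open>x \<in> M\<close>])
      show "0 = H x'" if "x' \<in> M" "dist x' x < d" for x'
        using d(2) that N(3)[OF that(1)] by (force simp: H_def dist_commute)
    qed
    then show ?thesis using True by (simp add: H'_def[abs_def])
  next
    case False
    have "((\<lambda>x. N x / S x) has_derivative (\<lambda>v. - N x * (inverse (S x) * S' x v * inverse (S x)) + N' x v / S x)) (at x within M)"
      by (rule has_derivative_divide[OF N(1)[OF x] has_derivative_at_withinI[OF dS] False])
    moreover have "- N x * (inverse (S x) * S' x v * inverse (S x)) + N' x v / S x = H' x v" for v
      using False by (simp add: H'_def field_simps)
    ultimately show ?thesis by (simp add: H_def[abs_def])
  qed
  have H0: "H x = 0" if "x \<in> M" "x \<notin> K" for x using N(3)[OF that] by (simp add: H_def)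
  define g where "g i x = \<zeta> i x * H x" for i x
  define g' where "g' i x v = \<zeta> i x * H' x v + \<zeta>' i x v * H x" for i x v
  have dg: "(g i has_derivative g' i x) (at x within M)" if "i \<in> J" "x \<in> M" for i x
    unfolding g_def[abs_def] g'_def[abs_def]
    by (rule has_derivative_mult[OF has_derivative_at_withinI[OF \<zeta>(1)[OF that(1)]] dH[OF that(2)]])
  have chart: "((\<lambda>y. F (\<phi> k y)) has_derivative (\<lambda>v. F' (\<phi> k y) (\<phi>' k y v))) (at y)"
    if "\<And>x. x \<in> M \<Longrightarrow> (F has_derivative F' x) (at x within M)" "y \<in> V k" for F :: "'m \<Rightarrow> real" and F' k y
  proof -
    have "((\<lambda>y. F (\<phi> k y)) has_derivative (\<lambda>v. F' (\<phi> k y) (\<phi>' k y v))) (at y within V k)"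
      by (rule has_derivative_in_compose2[where t = M and g = F and g' = F'])
        (use that \<phi>_M der[OF that(2)] has_derivative_at_withinI in auto)
    then show ?thesis using at_within_open[OF that(2) V] by simp
  qed
  \<comment> \<open>The open sets where S is nonzero and where the point is outside K cover the
    chart, because S is positive on K. So quotients by S have to be examined on the first set
    only.\<close>
  have cut: "continuous_on (V k) F" if "continuous_on {y \<in> V k. S (\<phi> k y) \<noteq> 0} F"
      "\<And>y. y \<in> V k \<Longrightarrow> \<phi> k y \<notin> K \<Longrightarrow> F y = 0" for k and F :: "real^'n::_ \<Rightarrow> real"
  proof -
    have cS\<phi>: "continuous_on (V k) (\<lambda>y. S (\<phi> k y))"
      by (rule continuous_on_compose2[OF cS continuous_\<phi>]) auto
    have "{y \<in> V k. S (\<phi> k y) \<noteq> 0} = V k \<inter> (\<lambda>y. S (\<phi> k y)) -` (- {0})" by auto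
    then have o1: "open {y \<in> V k. S (\<phi> k y) \<noteq> 0}"
      using continuous_open_preimage[OF cS\<phi> V, of "- {0}"] by (simp add: open_Compl)
    have "{y \<in> V k. \<phi> k y \<notin> K} = V k \<inter> \<phi> k -` (- K)" by auto
    then have o2: "open {y \<in> V k. \<phi> k y \<notin> K}"
      using continuous_open_preimage[OF continuous_\<phi> V, of "- K"] clK by (simp add: open_Compl)
    have "continuous_on {y \<in> V k. \<phi> k y \<notin> K} F"
      by (rule continuous_on_eq[of _ "\<lambda>_. 0"]) (use that(2) in auto)
    then have "continuous_on ({y \<in> V k. S (\<phi> k y) \<noteq> 0} \<union> {y \<in> V k. \<phi> k y \<notin> K}) F"
      by (rule continuous_on_open_Un[OF o1 o2 that(1)])
    moreover have "{y \<in> V k. S (\<phi> k y) \<noteq> 0} \<union> {y \<in> V k. \<phi> k y \<notin> K} = V k" using SK by auto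
    ultimately show ?thesis by simp
  qed
  have c\<phi>: "continuous_on A (\<lambda>y. F (\<phi> k y))" if "continuous_on UNIV F" "A \<subseteq> V k" for F :: "'m \<Rightarrow> real" and A k
    using continuous_on_compose2[OF that(1) continuous_on_subset[OF continuous_\<phi> that(2)]] by simp
  have cN: "continuous_on A (\<lambda>y. N (\<phi> k y))" if "A \<subseteq> V k" for A k
  proof -
    have "continuous_on (V k) (\<lambda>y. N (\<phi> k y))"
      by (rule continuous_at_imp_continuous_on) (use chart[of N N'] N(1) has_derivative_continuous in blast)
    then show ?thesis using that by (rule continuous_on_subset)
  qed
  \<comment> \<open>Continuity in the base point is given for constant vectors; a basis expansion
    extends it to a moving vector.\<close>
  have cd: "continuous_on A (\<lambda>y. D (\<phi> k y) (w y))"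
    if "A \<subseteq> V k" "\<And>v. continuous_on UNIV (\<lambda>x. D x v)" "\<And>x. linear (D x)" "continuous_on A w"
    for A k and w :: "real^'n::_ \<Rightarrow> 'm" and D :: "'m \<Rightarrow> 'm \<Rightarrow> real"
  proof -
    have eq: "D x u = (\<Sum>b\<in>Basis. (u \<bullet> b) * D x b)" for x u
    proof -
      have "D x u = D x (\<Sum>b\<in>Basis. (u \<bullet> b) *\<^sub>R b)" by (simp add: euclidean_representation)
      then show ?thesis by (simp add: linear_sum[OF that(3)] linear_scale[OF that(3)])
    qed
    have c: "continuous_on A (\<lambda>y. \<Sum>b\<in>Basis. (w y \<bullet> b) * D (\<phi> k y) b)"
      by (intro continuous_intros c\<phi>[OF that(2) that(1)] that(4))
    show ?thesis by (rule continuous_on_eq[OF c]) (rule eq[symmetric])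
  qed
  have lin\<zeta>: "linear (\<zeta>' i x)" if "i \<in> J" for i x using \<zeta>(1)[OF that] has_derivative_linear by blast
  have linS: "linear (S' x)" for x using dS has_derivative_linear by blast
  \<comment> \<open>A derivative within M is determined along M only, so its vanishing off K is
    stated for vectors coming from a chart.\<close>
  have N'0: "N' (\<phi> k y) (\<phi>' k y v) = 0" if "y \<in> V k" "\<phi> k y \<notin> K" for k y v
  proof -
    have "{y \<in> V k. \<phi> k y \<notin> K} = V k \<inter> \<phi> k -` (- K)" by auto
    then have o2: "open {y \<in> V k. \<phi> k y \<notin> K}"
      using continuous_open_preimage[OF continuous_\<phi> V, of "- K"] clK by (simp add: open_Compl)
    have "((\<lambda>y. N (\<phi> k y)) has_derivative (\<lambda>_. 0)) (at y)"
      by (rule has_derivative_transform_within_open[of "\<lambda>_. 0" _ _ _ "{y \<in> V k. \<phi> k y \<notin> K}"])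
        (use that o2 N(3) \<phi>_M in auto)
    then show ?thesis using has_derivative_unique[OF chart[of N N', OF N(1) that(1)]] by metis
  qed
  have cH: "continuous_on (V k) (\<lambda>y. H (\<phi> k y))" for k
    by (rule continuous_at_imp_continuous_on) (use chart[of H H'] dH has_derivative_continuous in blast)
  have cH': "continuous_on (V k) (\<lambda>y. H' (\<phi> k y) (\<phi>' k y v))" if k: "k \<in> J" for k v
  proof (rule cut)
    let ?A = "{y \<in> V k. S (\<phi> k y) \<noteq> 0}"
    have "continuous_on ?A (\<lambda>y. N' (\<phi> k y) (\<phi>' k y v) / S (\<phi> k y) -
        N (\<phi> k y) * S' (\<phi> k y) (\<phi>' k y v) / (S (\<phi> k y) * S (\<phi> k y)))"
      by (intro continuous_intros continuous_on_subset[OF N(5)[OF k]] cN c\<phi>[OF cS] cd[where D = S'] cS' linS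
          continuous_on_subset[OF \<phi>'[OF k]]) auto
    then show "continuous_on ?A (\<lambda>y. H' (\<phi> k y) (\<phi>' k y v))"
      by (rule continuous_on_eq) (simp add: H'_def)
    show "H' (\<phi> k y) (\<phi>' k y v) = 0" if "y \<in> V k" "\<phi> k y \<notin> K" for y
      using N'0[OF that] N(3)[OF \<phi>_M(1)[OF that(1)] that(2)] by (simp add: H'_def)
  qed
  define r where "r i x = g' i x (Y x)" for i x
  have H'Y: "H' x (Y x) = - N x * S' x (Y x) / (S x * S x)" if "x \<in> M" for x
    using N(4)[OF that] by (simp add: H'_def)
  have rform: "r i x = \<zeta>' i x (Y x) * N x / S x - \<zeta> i x * N x * S' x (Y x) / (S x * S x)" if "x \<in> M" for i x
    using H'Y[OF that] by (simp add: r_def g'_def H_def)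
  have r0: "r i x = 0" if "i \<in> J" "x \<in> M" "x \<notin> K \<inter> Cl i" for i x
  proof (cases "x \<in> K")
    case False
    then show ?thesis using N(3)[OF that(2)] by (simp add: rform[OF that(2)])
  next
    case True
    then have x: "x \<notin> Cl i" using that(3) by blast
    have "\<zeta>' i x v = 0" for v
      by (rule derivative_zero_off_support[OF Cl(1)[OF that(1)] Cl(3)[OF that(1)] x \<zeta>(1)[OF that(1)]])
    then show ?thesis using Cl(3)[OF that(1) x] by (simp add: rform[OF that(2)])
  qed
  \<comment> \<open>Y carries no regularity assumption of its own: it is recovered from the
    continuous field \<open>X k\<close> by dividing by the positive density.\<close>
  have cY: "continuous_on (V k) (\<lambda>y. Y (\<phi> k y))" if k: "k \<in> J" for k
  proof -
    have lin: "linear (\<phi>' k y)" if "y \<in> V k" for y using der[OF that] has_derivative_linear by blast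
    have cX: "continuous_on (V k) (X k)"
      by (rule continuous_at_imp_continuous_on) (use X(1)[OF k] has_derivative_continuous in blast)
    have "Y (\<phi> k y) = (1 / \<nu> k y) *\<^sub>R (\<Sum>b\<in>Basis. (X k y \<bullet> b) *\<^sub>R \<phi>' k y b)" if y: "y \<in> V k" for y
    proof -
      have "\<phi>' k y (X k y) = \<phi>' k y (\<Sum>b\<in>Basis. (X k y \<bullet> b) *\<^sub>R b)" by (simp add: euclidean_representation)
      then have s: "(\<Sum>b\<in>Basis. (X k y \<bullet> b) *\<^sub>R \<phi>' k y b) = \<nu> k y *\<^sub>R Y (\<phi> k y)"
        using X(3)[OF k y] by (simp add: linear_sum[OF lin[OF y]] linear_scale[OF lin[OF y]])
      show ?thesis unfolding s using \<nu>_pos[OF y] by simp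
    qed
    moreover have "continuous_on (V k) (\<lambda>y. (1 / \<nu> k y) *\<^sub>R (\<Sum>b\<in>Basis. (X k y \<bullet> b) *\<^sub>R \<phi>' k y b))"
      using \<nu>_pos[of _ k] by (intro continuous_intros continuous_\<nu> cX \<phi>' k) fastforce
    ultimately show ?thesis by (simp cong: continuous_on_cong)
  qed
  have cr: "continuous_on {y \<in> V k. S (\<phi> k y) \<noteq> 0} (\<lambda>y. r i (\<phi> k y))" if "i \<in> J" "k \<in> J" for i k
  proof -
    let ?A = "{y \<in> V k. S (\<phi> k y) \<noteq> 0}"
    have "continuous_on ?A (\<lambda>y. \<zeta>' i (\<phi> k y) (Y (\<phi> k y)) * N (\<phi> k y) / S (\<phi> k y)
        - \<zeta> i (\<phi> k y) * N (\<phi> k y) * S' (\<phi> k y) (Y (\<phi> k y)) / (S (\<phi> k y) * S (\<phi> k y)))"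
      by (intro continuous_intros cN c\<phi>[OF cS] c\<phi>[OF c\<zeta>] cd[where D = S'] cd[where D = "\<zeta>' i"] cS' linS lin\<zeta> \<zeta>(2) that
          continuous_on_subset[OF cY[OF that(2)]]) auto
    then show ?thesis by (rule continuous_on_eq) (use \<phi>_M in \<open>auto simp: rform\<close>)
  qed
  \<comment> \<open>The second cut: the term becomes supported in the charts i and k at once and can
    be integrated in either.\<close>
  define rr where "rr i k x = \<zeta> k x * r i x / S x" for i k x
  have crr: "continuous_on (V l) (\<lambda>y. rr i k (\<phi> l y))" if "i \<in> J" "k \<in> J" "l \<in> J" for i k l
  proof (rule cut)
    show "continuous_on {y \<in> V l. S (\<phi> l y) \<noteq> 0} (\<lambda>y. rr i k (\<phi> l y))"
      unfolding rr_def by (intro continuous_intros c\<phi>[OF cS] c\<phi>[OF c\<zeta>] cr that) auto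
    show "rr i k (\<phi> l y) = 0" if "y \<in> V l" "\<phi> l y \<notin> K" for y
      using r0[OF \<open>i \<in> J\<close> \<phi>_M(1)[OF that(1)]] that by (simp add: rr_def)
  qed
  define C where "C i k = K \<inter> Cl i \<inter> Cl k" for i k
  have C: "compact (C i k)" "C i k \<subseteq> M" "C i k \<subseteq> W i" "C i k \<subseteq> W k" if "i \<in> J" "k \<in> J" for i k
    using K Cl(1,2) that by (auto simp: C_def intro!: compact_Int_closed)
  have rr0: "rr i k x = 0" if "i \<in> J" "k \<in> J" "x \<in> M" "x \<notin> C i k" for i k x
    using r0[OF that(1,3)] Cl(3)[OF that(2)] that(4) by (auto simp: rr_def C_def)
  have irr: "(\<lambda>y. \<nu> l y * rr i k (\<phi> l y)) integrable_on V l" if "i \<in> J" "k \<in> J" "l = i \<or> l = k" for i k l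
  proof -
    have l: "l \<in> J" "C i k \<subseteq> W l" using that C(3,4)[OF that(1,2)] by blast+
    have "(\<lambda>y. \<nu> l y * rr i k (\<phi> l y)) absolutely_integrable_on V l"
    proof (rule absolutely_integrable_compact_support[OF V chart_compact(1,2)[OF C(1,2)[OF that(1,2)] l(2)]])
      show "continuous_on (V l) (\<lambda>y. \<nu> l y * rr i k (\<phi> l y))"
        by (intro continuous_intros continuous_\<nu> crr that l)
      show "\<nu> l y * rr i k (\<phi> l y) = 0" if y: "y \<in> V l" "y \<notin> f l ` C i k" for y
        using rr0[OF \<open>i \<in> J\<close> \<open>k \<in> J\<close> \<phi>_M(1)[OF y(1)]] chart_compact(3)[OF C(1,2)[OF \<open>i \<in> J\<close> \<open>k \<in> J\<close>] l(2) y] by simp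
    qed
    then show ?thesis by (simp add: absolutely_integrable_on_def)
  qed
  have rsum: "r i x = (\<Sum>k\<in>J. rr i k x)" if "x \<in> M" for i x
  proof (cases "S x = 0")
    case True
    then show ?thesis by (simp add: rform[OF that] rr_def)
  next
    case False
    have "(\<Sum>k\<in>J. rr i k x) = S x * r i x / S x" by (simp add: rr_def S_def sum_distrib_right sum_divide_distrib)
    then show ?thesis using False by simp
  qed
  \<comment> \<open>The \<zeta>' i sum to S' and the \<zeta> i to S, so after summation over i the
    two fractions in \<open>rform\<close> cancel.\<close>
  have rsum0: "(\<Sum>i\<in>J. rr i k x) = 0" if "x \<in> M" for k x
  proof -
    have "(\<Sum>i\<in>J. r i x) = (\<Sum>i\<in>J. \<zeta>' i x (Y x)) * N x / S x - (\<Sum>i\<in>J. \<zeta> i x) * N x * S' x (Y x) / (S x * S x)"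
      by (simp add: rform[OF that] sum_subtractf sum_distrib_right sum_divide_distrib)
    also have "\<dots> = 0" by (cases "S x = 0") (simp_all add: S_def[symmetric] S'_def[symmetric])
    finally have "\<zeta> k x * (\<Sum>i\<in>J. r i x) / S x = 0" by simp
    then show ?thesis by (simp add: rr_def sum_distrib_left sum_divide_distrib)
  qed
  have Ir: "I i (r i) = (\<Sum>k\<in>J. I i (rr i k))" if "i \<in> J" for i
  proof -
    have "I i (r i) = integral (V i) (\<lambda>y. \<Sum>k\<in>J. \<nu> i y * rr i k (\<phi> i y))"
      unfolding I_def by (rule Henstock_Kurzweil_Integration.integral_cong) (simp add: rsum \<phi>_M sum_distrib_left)
    also have "\<dots> = (\<Sum>k\<in>J. I i (rr i k))"
      unfolding I_def by (rule Henstock_Kurzweil_Integration.integral_sum[OF J]) (use irr that in blast)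
    finally show ?thesis .
  qed
  \<comment> \<open>The summand with indices i and k is moved from chart i to chart k; after
    exchanging the sums, each inner sum lives in one chart.\<close>
  have "(\<Sum>i\<in>J. I i (r i)) = (\<Sum>i\<in>J. \<Sum>k\<in>J. I k (rr i k))"
    using I_change_chart[OF C crr rr0] by (intro sum.cong refl) (auto simp: Ir intro!: sum.cong)
  also have "\<dots> = (\<Sum>k\<in>J. \<Sum>i\<in>J. I k (rr i k))" by (rule sum.swap)
  also have "\<dots> = (\<Sum>k\<in>J. 0)"
  proof (rule sum.cong[OF refl])
    fix k assume k: "k \<in> J"
    have "(\<Sum>i\<in>J. I k (rr i k)) = integral (V k) (\<lambda>y. \<Sum>i\<in>J. \<nu> k y * rr i k (\<phi> k y))"
      unfolding I_def by (rule Henstock_Kurzweil_Integration.integral_sum[OF J, symmetric]) (use irr k in blast)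
    also have "\<dots> = integral (V k) (\<lambda>y. 0)"
      by (rule Henstock_Kurzweil_Integration.integral_cong) (simp add: rsum0 \<phi>_M sum_distrib_left[symmetric])
    finally show "(\<Sum>i\<in>J. I k (rr i k)) = 0" by simp
  qed
  finally have Isum: "(\<Sum>i\<in>J. I i (r i)) = 0" by simp
  define T where "T i y = g i (\<phi> i y) * (\<Sum>b\<in>Basis. X' i y b \<bullet> b)" for i y
  have K': "compact (K \<inter> Cl i)" "K \<inter> Cl i \<subseteq> M" "K \<inter> Cl i \<subseteq> W i" if "i \<in> J" for i
    using C[OF that that] by (simp_all add: C_def Int_assoc)
  have g0: "g i x = 0" if "i \<in> J" "x \<in> M" "x \<notin> K \<inter> Cl i" for i x
    using H0[OF that(2)] Cl(3)[OF that(1)] that(3) by (auto simp: g_def)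
  have cT: "continuous_on (V i) (T i)" if "i \<in> J" for i
    unfolding T_def g_def by (intro continuous_intros X(2) cH c\<phi>[OF c\<zeta>] that order_refl)
  have T0: "T i y = 0" if "i \<in> J" "y \<in> V i" "y \<notin> f i ` (K \<inter> Cl i)" for i y
    using g0[OF that(1) \<phi>_M(1)[OF that(2)]] chart_compact(3)[OF K'[OF that(1)] that(2,3)] by (simp add: T_def)
  have Tpos: "0 \<le> T i y" if "i \<in> J" "y \<in> V i" for i y
    unfolding T_def g_def H_def using that S0 N(2)[OF \<phi>_M(1)[OF that(2)]] \<zeta>(3) X(4) by simp
  have iT: "T i integrable_on V i" if "i \<in> J" for i
    using absolutely_integrable_compact_support[OF V chart_compact(1,2)[OF K'[OF that]] cT[OF that] T0[OF that]]
    by (simp add: absolutely_integrable_on_def)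
  \<comment> \<open>Integration by parts in a chart: the product rule splits the divergence of
    weight times field into T i and \<nu> times the derivative of the weight along Y.\<close>
  have TI: "integral (V i) (T i) = - I i (r i)" if i: "i \<in> J" for i
  proof -
    define Z where "Z y = g i (\<phi> i y) *\<^sub>R X i y" for y
    define Z' where "Z' y v = g i (\<phi> i y) *\<^sub>R X' i y v + g' i (\<phi> i y) (\<phi>' i y v) *\<^sub>R X i y" for y v
    have cX: "continuous_on (V i) (X i)"
      by (rule continuous_at_imp_continuous_on) (use X(1)[OF i] has_derivative_continuous in blast)
    have dZ: "(Z has_derivative Z' y) (at y)" if "y \<in> V i" for y
      unfolding Z_def[abs_def] Z'_def[abs_def]
      by (rule has_derivative_scaleR[OF chart[of "g i" "g' i", OF dg[OF i] that] X(1)[OF i that]])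
    have cZ': "continuous_on (V i) (\<lambda>y. Z' y v)" for v
      unfolding Z'_def g'_def g_def
      by (intro continuous_intros X(2) cX cH cH' c\<phi>[OF c\<zeta>] cd[where D = "\<zeta>' i"] \<zeta>(2) lin\<zeta> \<phi>' i order_refl)
    have Z0: "Z y = 0" if "y \<in> V i" "y \<notin> f i ` (K \<inter> Cl i)" for y
      using g0[OF i \<phi>_M(1)[OF that(1)]] chart_compact(3)[OF K'[OF i] that] by (simp add: Z_def)
    have "0 = integral (V i) (\<lambda>y. \<Sum>b\<in>Basis. Z' y b \<bullet> b)"
      using integral_divergence_zero[OF V chart_compact(1,2)[OF K'[OF i]] dZ cZ' Z0] by simp
    also have "\<dots> = integral (V i) (\<lambda>y. T i y + (\<Sum>k\<in>J. \<nu> i y * rr i k (\<phi> i y)))"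
    proof (rule Henstock_Kurzweil_Integration.integral_cong)
      fix y assume y: "y \<in> V i"
      have lg: "linear (\<lambda>v. g' i (\<phi> i y) (\<phi>' i y v))"
        using chart[of "g i" "g' i", OF dg[OF i] y] has_derivative_linear by blast
      have lg': "linear (g' i (\<phi> i y))" using dg[OF i \<phi>_M(1)[OF y]] has_derivative_linear by blast
      have "(\<Sum>b\<in>Basis. g' i (\<phi> i y) (\<phi>' i y b) * (X i y \<bullet> b)) = g' i (\<phi> i y) (\<phi>' i y (\<Sum>b\<in>Basis. (X i y \<bullet> b) *\<^sub>R b))"
        by (simp add: linear_sum[OF lg] linear_scale[OF lg] mult.commute)
      also have "\<dots> = \<nu> i y * r i (\<phi> i y)"
        by (simp add: euclidean_representation X(3)[OF i y] r_def linear_scale[OF lg'])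
      finally have "(\<Sum>b\<in>Basis. g' i (\<phi> i y) (\<phi>' i y b) * (X i y \<bullet> b)) = (\<Sum>k\<in>J. \<nu> i y * rr i k (\<phi> i y))"
        using rsum[OF \<phi>_M(1)[OF y]] by (simp add: sum_distrib_left)
      then show "(\<Sum>b\<in>Basis. Z' y b \<bullet> b) = T i y + (\<Sum>k\<in>J. \<nu> i y * rr i k (\<phi> i y))"
        by (simp add: Z'_def T_def inner_add_left sum.distrib sum_distrib_left)
    qed
    also have "\<dots> = integral (V i) (T i) + integral (V i) (\<lambda>y. \<Sum>k\<in>J. \<nu> i y * rr i k (\<phi> i y))"
      by (rule Henstock_Kurzweil_Integration.integral_add[OF iT[OF i]])
        (rule integrable_sum[OF J], use irr i in blast)
    also have "integral (V i) (\<lambda>y. \<Sum>k\<in>J. \<nu> i y * rr i k (\<phi> i y)) = I i (r i)"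
      unfolding I_def by (rule Henstock_Kurzweil_Integration.integral_cong) (simp add: rsum \<phi>_M sum_distrib_left)
    finally show ?thesis by simp
  qed
  have Tn: "0 \<le> integral (V i) (T i)" if "i \<in> J" for i
    using Henstock_Kurzweil_Integration.integral_nonneg[OF iT[OF that]] Tpos[OF that] by blast
  have "(\<Sum>i\<in>J. integral (V i) (T i)) = 0" using TI Isum by (simp add: sum_negf)
  then have Ti0: "integral (V i) (T i) = 0" using sum_nonneg_eq_0_iff[OF J, of "\<lambda>i. integral (V i) (T i)"] Tn iJ(1) by blast
  let ?F = "\<lambda>y. if y \<in> V i then T i y else 0"
  have cF: "continuous_on UNIV ?F"
    by (rule continuous_on_zero_extension[OF V chart_compact(1,2)[OF K'[OF iJ(1)]] cT[OF iJ(1)] T0[OF iJ(1)]])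
  have F0: "integral UNIV ?F = 0" using Ti0 by (simp only: Henstock_Kurzweil_Integration.integral_restrict_UNIV)
  have iF: "?F integrable_on UNIV" using iT[OF iJ(1)] by (simp only: Henstock_Kurzweil_Integration.integrable_restrict_UNIV)
  have Fp: "0 \<le> ?F y" for y using Tpos[OF iJ(1)] by simp
  \<comment> \<open>A box around y with nonempty interior, on which a continuous nonnegative
    function of integral zero vanishes.\<close>
  let ?Q = "cbox (y - One) (y + One)"
  have cQ: "continuous_on ?Q ?F" using continuous_on_subset[OF cF] by blast
  have iQ: "?F integrable_on ?Q" using integrable_continuous[OF cQ] .
  have "integral ?Q ?F \<le> integral UNIV ?F" by (rule integral_subset_le[OF subset_UNIV iQ iF]) (use Fp in blast)
  moreover have "0 \<le> integral ?Q ?F" by (rule Henstock_Kurzweil_Integration.integral_nonneg[OF iQ Fp])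
  ultimately have "integral ?Q ?F = 0" unfolding F0 by (rule antisym)
  then have "(?F has_integral 0) ?Q" using iQ has_integral_iff by blast
  then have "?F y = 0"
  proof (rule has_integral_0_cbox_imp_0[OF cQ Fp])
    show "box (y - One) (y + One) \<noteq> {}" by (simp add: box_ne_empty inner_add_left inner_diff_left)
    show "y \<in> ?Q" by (simp add: mem_box inner_add_left inner_diff_left)
  qed
  then have "T i y = 0" using iJ(2) by simp
  then show ?thesis
  proof -
    \<comment> \<open>Passes from the weight N / S back to N: where S is zero, so is N.\<close>
    have "S (\<phi> i y) = 0 \<Longrightarrow> N (\<phi> i y) = 0" using SK N(3)[OF \<phi>_M(1)[OF iJ(2)]] by blast
    then show ?thesis using \<open>T i y = 0\<close> by (auto simp: T_def g_def H_def)
  qed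
qed

end

section \<open>Smooth maps on subsets and tangent spaces\<close>

lemma smooth_onE:
  assumes "smooth_on S f" "x \<in> S"
  obtains W g where "x \<in> W" "Cinf W g" "\<And>y. y \<in> S \<Longrightarrow> y \<in> W \<Longrightarrow> g y = f y"
  using assms unfolding smooth_on_def Cinf_def by (metis IntI)

lemma smooth_onI:
  "(\<And>x. x \<in> S \<Longrightarrow> \<exists>W g. x \<in> W \<and> Cinf W g \<and> (\<forall>y\<in>S \<inter> W. g y = f y)) \<Longrightarrow> smooth_on S f"
  unfolding smooth_on_def Cinf_def by blast

lemma Cinf_smooth_on: "Cinf U f \<Longrightarrow> S \<subseteq> U \<Longrightarrow> smooth_on S f"
  by (rule smooth_onI) blast

lemma smooth_on_open: "open U \<Longrightarrow> smooth_on U f \<Longrightarrow> Cinf U f"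
proof (rule Cinf_local)
  fix x assume U: "open U" "smooth_on U f" "x \<in> U"
  obtain W g where W: "x \<in> W" "Cinf W g" "\<And>y. y \<in> U \<Longrightarrow> y \<in> W \<Longrightarrow> g y = f y" by (rule smooth_onE[OF U(2,3)]) blast
  have "Cinf (U \<inter> W) g" using W Cinf_open U(1) by (intro Cinf_subset[OF W(2)]) auto
  then have "Cinf (U \<inter> W) f" using W(3) Cinf_cong[of "U \<inter> W" g f] by simp
  then show "\<exists>W. x \<in> W \<and> Cinf W f" using U(3) W(1) by blast
qed

lemma smooth_on_has_derivative:
  assumes f: "smooth_on S f" and x: "x \<in> S"
  shows "(f has_derivative mdiff S f x) (at x within S)"
proof -
  obtain W g where W: "x \<in> W" "Cinf W g" "\<And>y. y \<in> S \<Longrightarrow> y \<in> W \<Longrightarrow> g y = f y" by (rule smooth_onE[OF assms]) blast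
  obtain r where r: "r > 0" "ball x r \<subseteq> W" using openE[OF Cinf_open[OF W(2)] W(1)] .
  have "(g has_derivative dd g x) (at x within S)"
    using has_derivative_at_withinI[OF Cinf_has_derivative[OF W(2,1)]] .
  then have "(f has_derivative dd g x) (at x within S)"
    by (rule has_derivative_transform_within[OF _ r(1) x]) (use r W(3) in \<open>auto simp: dist_commute subset_iff\<close>)
  then show ?thesis
    unfolding mdiff_def using frechet_derivative_works differentiable_def by blast
qed

lemma mdiff_linear: "smooth_on S f \<Longrightarrow> x \<in> S \<Longrightarrow> linear (mdiff S f x)"
  using smooth_on_has_derivative has_derivative_linear by blast

lemma smooth_on_continuous: "smooth_on S f \<Longrightarrow> continuous_on S f"
  unfolding continuous_on_eq_continuous_within
  using smooth_on_has_derivative has_derivative_continuous by blast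

lemma smooth_on_compose:
  fixes f :: "'a::euclidean_space \<Rightarrow> 'b::euclidean_space"
  assumes f: "smooth_on S f" and g: "smooth_on T g" and ST: "\<And>x. x \<in> S \<Longrightarrow> f x \<in> T"
  shows "smooth_on S (\<lambda>x. g (f x))"
proof (rule smooth_onI)
  fix x assume x: "x \<in> S"
  obtain W f1 where W: "x \<in> W" "Cinf W f1" "\<And>y. y \<in> S \<Longrightarrow> y \<in> W \<Longrightarrow> f1 y = f y" by (rule smooth_onE[OF f x]) blast
  obtain W' g1 where W': "f x \<in> W'" "Cinf W' g1" "\<And>y. y \<in> T \<Longrightarrow> y \<in> W' \<Longrightarrow> g1 y = g y" by (rule smooth_onE[OF g ST[OF x]]) blast
  let ?W = "W \<inter> f1 -` W'"
  have o: "open ?W"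
    using continuous_open_preimage[OF Cinf_continuous_on[OF W(2)] Cinf_open[OF W(2)] Cinf_open[OF W'(2)]] .
  have A: "Cinf ?W (\<lambda>x. g1 (f1 x))"
    by (rule Cinf_compose[OF Cinf_subset[OF W(2) o] W'(2)]) auto
  have B: "x \<in> ?W" using W(1) W(3)[OF x W(1)] W'(1) by simp
  have C: "g1 (f1 y) = g (f y)" if "y \<in> S \<inter> ?W" for y
    using W(3)[of y] W'(3)[of "f y"] ST[of y] that by auto
  show "\<exists>W g1. x \<in> W \<and> Cinf W g1 \<and> (\<forall>y\<in>S \<inter> W. g1 y = g (f y))"
    by (intro exI[of _ ?W] exI[of _ "\<lambda>x. g1 (f1 x)"] conjI ballI A B C)
qed

lemma smooth_on_Pair: "smooth_on S f \<Longrightarrow> smooth_on S g \<Longrightarrow> smooth_on S (\<lambda>x. (f x, g x))"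
proof (rule smooth_onI)
  fix x assume S: "smooth_on S f" "smooth_on S g" "x \<in> S"
  obtain W f1 where W: "x \<in> W" "Cinf W f1" "\<And>y. y \<in> S \<Longrightarrow> y \<in> W \<Longrightarrow> f1 y = f y" by (rule smooth_onE[OF S(1,3)]) blast
  obtain W' g1 where W': "x \<in> W'" "Cinf W' g1" "\<And>y. y \<in> S \<Longrightarrow> y \<in> W' \<Longrightarrow> g1 y = g y" by (rule smooth_onE[OF S(2,3)]) blast
  have o: "open (W \<inter> W')" using Cinf_open[OF W(2)] Cinf_open[OF W'(2)] by (rule open_Int)
  have "Cinf (W \<inter> W') (\<lambda>x. (f1 x, g1 x))"
    using Cinf_Pair[OF Cinf_subset[OF W(2) o] Cinf_subset[OF W'(2) o]] by simp
  then show "\<exists>W h. x \<in> W \<and> Cinf W h \<and> (\<forall>y\<in>S \<inter> W. h y = (f y, g y))"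
    using W W' by (intro exI[of _ "W \<inter> W'"] exI[of _ "\<lambda>x. (f1 x, g1 x)"]) auto
qed

lemma smooth_on_const: "smooth_on S (\<lambda>x. c)"
  by (rule Cinf_smooth_on[OF Cinf_const[OF open_UNIV]]) simp

lemma smooth_on_linear: "linear f \<Longrightarrow> smooth_on S f"
  by (rule Cinf_smooth_on[OF Cinf_linear_map[OF _ open_UNIV]]) auto

lemma Cinf_pull:
  fixes q :: "'e::euclidean_space \<Rightarrow> 'a::euclidean_space"
  assumes "Cinf U q" "\<And>y. y \<in> U \<Longrightarrow> q y \<in> S" "smooth_on S f"
  shows "Cinf U (\<lambda>y. f (q y))"
  using smooth_on_compose[OF Cinf_smooth_on[OF assms(1) order_refl] assms(3,2)]
  by (simp add: smooth_on_open Cinf_open[OF assms(1)])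

lemma pull_has_derivative:
  fixes q :: "'e::euclidean_space \<Rightarrow> 'a::euclidean_space"
  assumes q: "Cinf U q" "\<And>y. y \<in> U \<Longrightarrow> q y \<in> S" and f: "\<And>x. x \<in> S \<Longrightarrow> (f has_derivative f' x) (at x within S)" and y: "y \<in> U"
  shows "((\<lambda>z. f (q z)) has_derivative (\<lambda>v. f' (q y) (dd q y v))) (at y)"
proof -
  have "((\<lambda>z. f (q z)) has_derivative (\<lambda>v. f' (q y) (dd q y v))) (at y within U)"
    by (rule has_derivative_in_compose2[where t = S and g = f and g' = f'])
      (use q f y has_derivative_at_withinI[OF Cinf_has_derivative[OF q(1) y]] in auto)
  then show ?thesis using at_within_open[OF y Cinf_open[OF q(1)]] by simp
qed

text \<open>The chain rule holds for whichever derivative within S \<open>mdiff\<close> has chosen,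
  while the left-hand side is an ordinary derivative. So \<open>mdiff\<close> is determined on
  velocities of maps into S, and this is how it is evaluated from here on.\<close>

lemma dd_pull:
  fixes q :: "'e::euclidean_space \<Rightarrow> 'a::euclidean_space"
  assumes "Cinf U q" "\<And>y. y \<in> U \<Longrightarrow> q y \<in> S" "smooth_on S f" "y \<in> U"
  shows "dd (\<lambda>z. f (q z)) y v = mdiff S f (q y) (dd q y v)"
  by (rule dd_eqI, rule pull_has_derivative[OF assms(1,2) _ assms(4)])
    (use smooth_on_has_derivative[OF assms(3)] in auto)

section \<open>Tangent vectors as velocities of curves\<close>

lemma tangent_spaceE:
  assumes "v \<in> tangent_space S x"
  obtains U c where "Cinf U c" "(0::real) \<in> U" "\<And>t. t \<in> U \<Longrightarrow> c t \<in> S" "c 0 = x" "dd c 0 1 = v"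
proof -
  obtain c \<epsilon> where c: "\<epsilon> > 0" "smooth_on {-\<epsilon><..<\<epsilon>} c" "c ` {-\<epsilon><..<\<epsilon>} \<subseteq> S" "c (0::real) = x"
    "(c has_vector_derivative v) (at 0)" using assms unfolding tangent_space_def by blast
  have "dd c 0 1 = v" using dd_eqI[OF c(5)[unfolded has_vector_derivative_def], of 1] by simp
  moreover have "Cinf {-\<epsilon><..<\<epsilon>} c" by (rule smooth_on_open[OF open_greaterThanLessThan c(2)])
  moreover have "c t \<in> S" if "t \<in> {-\<epsilon><..<\<epsilon>}" for t using c(3) that by blast
  ultimately show ?thesis using that[of "{-\<epsilon><..<\<epsilon>}" c] c(1,4) by simp
qed

lemma tangent_spaceI:
  assumes c: "Cinf U c" "(0::real) \<in> U" "\<And>t. t \<in> U \<Longrightarrow> c t \<in> S"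
  shows "dd c 0 1 \<in> tangent_space S (c 0)"
proof -
  obtain e where e: "e > 0" "ball 0 e \<subseteq> U" using openE[OF Cinf_open[OF c(1)] c(2)] .
  have sub: "{-e<..<e} \<subseteq> U" using e(2) by (auto simp: subset_iff dist_real_def)
  have "(c has_derivative dd c 0) (at 0)" by (rule Cinf_has_derivative[OF c(1,2)])
  moreover have "dd c 0 t = t *\<^sub>R dd c 0 1" for t
    using linear_scale[OF Cinf_linear[OF c(1,2)], of t 1] by simp
  then have "dd c 0 = (\<lambda>t. t *\<^sub>R dd c 0 1)" by (rule ext)
  ultimately have "(c has_vector_derivative dd c 0 1) (at 0)" unfolding has_vector_derivative_def by metis
  then show ?thesis unfolding tangent_space_def
    using e(1) sub c(3) Cinf_smooth_on[OF c(1) sub] by blast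
qed

lemma line_Cinf: "open U \<Longrightarrow> Cinf U (\<lambda>t::real. y + t *\<^sub>R v)"
  by (intro Cinf_add Cinf_const Cinf_blinear[OF bounded_linear_scaleR_left] Cinf_ident)

lemma dd_line: "dd (\<lambda>t::real. y + t *\<^sub>R v) s r = r *\<^sub>R v"
  by (rule dd_eqI) (auto intro!: derivative_eq_intros)

lemma tangent_push:
  fixes q :: "'e::euclidean_space \<Rightarrow> 'a::euclidean_space"
  assumes q: "Cinf U q" "\<And>y. y \<in> U \<Longrightarrow> q y \<in> S" and y: "y \<in> U"
  shows "dd q y v \<in> tangent_space S (q y)"
proof -
  let ?l = "\<lambda>t::real. y + t *\<^sub>R v"
  have o: "open (?l -` U)" using Cinf_open[OF q(1)] by (intro continuous_open_vimage continuous_intros) auto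
  have c: "Cinf (?l -` U) (\<lambda>t. q (?l t))" by (rule Cinf_compose[OF line_Cinf[OF o] q(1)]) auto
  have "dd (\<lambda>t. q (?l t)) 0 1 \<in> tangent_space S (q (?l 0))"
    by (rule tangent_spaceI[OF c]) (use y q(2) in auto)
  moreover have "dd (\<lambda>t. q (?l t)) 0 1 = dd q (?l 0) (dd ?l 0 1)"
    by (rule dd_compose) (use Cinf_differentiable[OF line_Cinf[OF o]] Cinf_differentiable[OF q(1)] y in auto)
  ultimately show ?thesis by (simp add: dd_line)
qed

subsection \<open>Local parametrisations\<close>

text \<open>The model space of a chart is a linear subspace L of the ambient space. \<open>P\<close>
  records which parametrisation l of L, with right inverse l' on L, is available: an isometry from
  \<open>real^'n\<close> for charts, or a map of the ambient space fixing L when only the dimension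
  as a number is known.\<close>

lemma manifold_param:
  fixes S :: "'a::euclidean_space set" and P :: "('e::euclidean_space \<Rightarrow> 'a) \<Rightarrow> ('a \<Rightarrow> 'e) \<Rightarrow> bool"
  assumes S: "manifold d S" and x: "x \<in> S"
    and ex: "\<And>L :: 'a set. subspace L \<Longrightarrow> dim L = d \<Longrightarrow>
       \<exists>(l :: 'e \<Rightarrow> 'a) l'. linear l \<and> linear l' \<and> range l \<subseteq> L \<and> (\<forall>z\<in>L. l (l' z) = z) \<and> P l l'"
  obtains V W and \<phi> :: "'e \<Rightarrow> 'a" and g where "Cinf V \<phi>" "Cinf W g" "x \<in> W" "\<phi> ` V = S \<inter> W"
    "\<And>z. z \<in> S \<Longrightarrow> z \<in> W \<Longrightarrow> g z \<in> V \<and> \<phi> (g z) = z"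
    "\<And>y. y \<in> V \<Longrightarrow> \<exists>l l'. P l l' \<and> g (\<phi> y) = l' (l y)"
proof -
  obtain W0 and L :: "'a set" and U f where W0: "open W0" "x \<in> W0" and L: "subspace L" "dim L = d"
    and U: "openin (top_of_set L) U" and diff: "diffeo (S \<inter> W0) U f"
    using S x unfolding manifold_def by blast
  obtain l :: "'e \<Rightarrow> 'a" and l' where l: "linear l" "linear l'" "range l \<subseteq> L" "\<And>z. z \<in> L \<Longrightarrow> l (l' z) = z" "P l l'"
    using ex[OF L] by blast
  obtain U' where U': "open U'" "U = U' \<inter> L" using U by (metis openin_open Int_commute)
  define h where "h = inv_into (S \<inter> W0) f"
  have bij: "bij_betw f (S \<inter> W0) U" and sf: "smooth_on (S \<inter> W0) f" and sh: "smooth_on U h"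
    using diff by (auto simp: diffeo_def h_def)
  have hf: "h (f z) = z" "f z \<in> U" if "z \<in> S \<inter> W0" for z
    using bij that by (auto simp: h_def bij_betw_def)
  have fh: "f (h u) = u" "h u \<in> S \<inter> W0" if "u \<in> U" for u
    using bij that f_inv_into_f[of u f "S \<inter> W0"] inv_into_into[of u f "S \<inter> W0"] by (auto simp: h_def bij_betw_def)
  obtain W1 g0 where g0: "x \<in> W1" "Cinf W1 g0" "\<And>y. y \<in> S \<inter> W0 \<Longrightarrow> y \<in> W1 \<Longrightarrow> g0 y = f y"
    using smooth_onE[OF sf] x W0 by blast
  obtain O0 h0 where h0: "f x \<in> O0" "Cinf O0 h0" "\<And>u. u \<in> U \<Longrightarrow> u \<in> O0 \<Longrightarrow> h0 u = h u"
    using smooth_onE[OF sh hf(2)] x W0 by blast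
  define V1 where "V1 = l -` (O0 \<inter> U')"
  have cl: "continuous_on A l" for A using l(1) by (simp add: linear_continuous_on linear_conv_bounded_linear)
  have oV1: "open V1" unfolding V1_def using U' Cinf_open[OF h0(2)] cl by (intro open_vimage) auto
  define \<phi> where "\<phi> y = h0 (l y)" for y
  have C1: "Cinf V1 \<phi>" unfolding \<phi>_def
    by (rule Cinf_compose[OF Cinf_linear_map[OF l(1) oV1] h0(2)]) (simp add: V1_def)
  \<comment> \<open>The domains V and W are cut down to where the smooth extensions g0 and h0
    represent the diffeomorphism and its inverse.\<close>
  define V where "V = V1 \<inter> \<phi> -` (W1 \<inter> W0)"
  have oV: "open V" unfolding V_def
    by (intro continuous_open_preimage[OF Cinf_continuous_on[OF C1] oV1] open_Int W0(1) Cinf_open[OF g0(2)])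
  have CV: "Cinf V \<phi>" by (rule Cinf_subset[OF C1 oV]) (simp add: V_def)
  define W where "W = W0 \<inter> (W1 \<inter> g0 -` (O0 \<inter> U'))"
  have oW: "open W" unfolding W_def
    by (intro open_Int W0(1) continuous_open_preimage[OF Cinf_continuous_on[OF g0(2)] Cinf_open[OF g0(2)]] Cinf_open[OF h0(2)] U'(1))
  define g where "g z = l' (g0 z)" for z
  have Cg: "Cinf W g" unfolding g_def
    by (rule Cinf_blinear) (use l(2) Cinf_subset[OF g0(2) oW] in \<open>auto simp: W_def linear_conv_bounded_linear\<close>)
  have xW: "x \<in> W"
    using g0 W0 h0(1) hf[of x] x U'(2) by (auto simp: W_def)
  have VU: "l y \<in> U \<and> l y \<in> O0 \<and> \<phi> y = h (l y)" if "y \<in> V" for y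
    using that l(3) U'(2) h0(3)[of "l y"] by (auto simp: V_def V1_def \<phi>_def)
  have a: "g z \<in> V \<and> \<phi> (g z) = z" if z: "z \<in> S" "z \<in> W" for z
  proof -
    have zz: "z \<in> S \<inter> W0" "z \<in> W1" "g0 z = f z" using z g0(3)[of z] by (auto simp: W_def)
    have u: "f z \<in> U" "h (f z) = z" using hf[OF zz(1)] by auto
    have fO: "f z \<in> O0" "f z \<in> U'" using z zz by (auto simp: W_def)
    have lz: "l (g z) = f z" unfolding g_def zz(3) using l(4) u(1) U'(2) by blast
    then have "\<phi> (g z) = z" using h0(3)[OF u(1) fO(1)] u(2) by (simp add: \<phi>_def)
    then show ?thesis using zz fO lz by (simp add: V_def V1_def)
  qed
  have b: "\<phi> y \<in> S \<inter> W" "g (\<phi> y) = l' (l y)" if y: "y \<in> V" for y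
  proof -
    have u: "l y \<in> U" "l y \<in> O0" "\<phi> y = h (l y)" using VU[OF y] by auto
    have p: "\<phi> y \<in> S \<inter> W0" "\<phi> y \<in> W1" using fh[OF u(1)] u(3) y by (auto simp: V_def)
    have g: "g0 (\<phi> y) = l y" using g0(3)[OF p] fh(1)[OF u(1)] u(3) by simp
    show "\<phi> y \<in> S \<inter> W" using p g u U'(2) by (auto simp: W_def)
    show "g (\<phi> y) = l' (l y)" by (simp add: g_def g)
  qed
  have "\<phi> ` V = S \<inter> W"
  proof
    show "\<phi> ` V \<subseteq> S \<inter> W" using b(1) by blast
    show "S \<inter> W \<subseteq> \<phi> ` V" using a by (metis IntD1 IntD2 image_eqI subsetI)
  qed
  moreover have "\<exists>l l'. P l l' \<and> g (\<phi> y) = l' (l y)" if "y \<in> V" for y using b(2)[OF that] l(5) by blast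
  ultimately show ?thesis using that[OF CV Cg xW _ a] by blast
qed

text \<open>A curve in S through x is the image under \<phi> of its composite with g, so its
  velocity lies in the range of the differential. No injectivity of \<phi> enters.\<close>

lemma param_tangent:
  assumes \<phi>: "Cinf V \<phi>" and g: "Cinf W g" and im: "\<phi> ` V = S \<inter> W"
    and inv: "\<And>z. z \<in> S \<Longrightarrow> z \<in> W \<Longrightarrow> g z \<in> V \<and> \<phi> (g z) = z" and x: "x \<in> S" "x \<in> W"
  shows "tangent_space S x = range (dd \<phi> (g x))"
proof
  have gx: "g x \<in> V" "\<phi> (g x) = x" using inv[OF x] by auto
  show "range (dd \<phi> (g x)) \<subseteq> tangent_space S x"
    using tangent_push[OF \<phi> _ gx(1), of S] im gx(2) by auto
  show "tangent_space S x \<subseteq> range (dd \<phi> (g x))"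
  proof
    fix v assume "v \<in> tangent_space S x"
    then obtain U c where c: "Cinf U c" "(0::real) \<in> U" "\<And>t. t \<in> U \<Longrightarrow> c t \<in> S" "c 0 = x" "dd c 0 1 = v"
      by (rule tangent_spaceE) blast
    let ?U = "U \<inter> c -` W"
    have oU: "open ?U" using continuous_open_preimage[OF Cinf_continuous_on[OF c(1)] Cinf_open[OF c(1)] Cinf_open[OF g]] .
    have c': "Cinf ?U c" by (rule Cinf_subset[OF c(1) oU]) simp
    have gc: "Cinf ?U (\<lambda>t. g (c t))" by (rule Cinf_compose[OF c' g]) simp
    have 0: "0 \<in> ?U" using c x by simp
    have "v = dd c 0 1" using c by simp
    also have "\<dots> = dd (\<lambda>t. \<phi> (g (c t))) 0 1" by (rule dd_cong[OF oU 0]) (use c inv in auto)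
    also have "\<dots> = dd \<phi> (g (c 0)) (dd (\<lambda>t. g (c t)) 0 1)"
      by (rule dd_compose) (use Cinf_differentiable[OF gc 0] Cinf_differentiable[OF \<phi>] gx c(4) in auto)
    finally show "v \<in> range (dd \<phi> (g x))" using c(4) by auto
  qed
qed

lemma subspace_tangent_space:
  assumes S: "manifold d S" and x: "x \<in> S"
  shows "subspace (tangent_space S x)"
proof -
  \<comment> \<open>A linear map of the ambient space into L that fixes L serves as a
    parametrisation, in general not injective; the tangent space is still the range of the
    differential.\<close>
  have ex: "\<exists>(l :: 'a \<Rightarrow> 'a) l'. linear l \<and> linear l' \<and> range l \<subseteq> L \<and> (\<forall>z\<in>L. l (l' z) = z) \<and> True"
    if L: "subspace L" for L :: "'a set"
  proof -
    obtain p where "range p \<subseteq> L" "linear p" "\<forall>z\<in>L. p (id z) = z"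
      using linear_exists_left_inverse_on[OF linear_id L inj_on_id] by blast
    then show ?thesis by (intro exI[of _ p] exI[of _ p]) simp
  qed
  obtain V W and \<phi> :: "'a \<Rightarrow> 'a" and g where "Cinf V \<phi>" "Cinf W g" "x \<in> W" "\<phi> ` V = S \<inter> W"
    "\<And>z. z \<in> S \<Longrightarrow> z \<in> W \<Longrightarrow> g z \<in> V \<and> \<phi> (g z) = z"
    by (rule manifold_param[OF S x, where P = "\<lambda>(l :: 'a \<Rightarrow> 'a) l'. True", OF ex]) (assumption, (assumption)?, rule that)
  then have "tangent_space S x = range (dd \<phi> (g x))" "g x \<in> V" using param_tangent[of V \<phi> W g S x] x by auto
  then show ?thesis using \<open>Cinf V \<phi>\<close> Cinf_linear linear_subspace_image[OF _ subspace_UNIV] by metis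
qed

text \<open>The parameter domain is shrunk to a ball and thereby connected: later the sign of the
  volume form has to be constant on it.\<close>

lemma chart_exists:
  fixes S :: "'a::euclidean_space set"
  assumes S: "manifold CARD('n) S" and x: "x \<in> S" and O: "open O'" "x \<in> O'"
  obtains r W and \<phi> :: "real^'n \<Rightarrow> 'a" and g where "r > 0" "Cinf (ball (g x) r) \<phi>" "Cinf W g" "x \<in> W" "W \<subseteq> O'"
    "\<phi> ` ball (g x) r = S \<inter> W" "\<And>y. y \<in> ball (g x) r \<Longrightarrow> g (\<phi> y) = y"
    "\<And>z. z \<in> S \<Longrightarrow> z \<in> W \<Longrightarrow> g z \<in> ball (g x) r \<and> \<phi> (g z) = z"
    "\<And>z. z \<in> S \<Longrightarrow> z \<in> W \<Longrightarrow> tangent_space S z = range (dd \<phi> (g z))"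
    "\<And>y. y \<in> ball (g x) r \<Longrightarrow> inj (dd \<phi> y)"
proof -
  have ex: "\<exists>(l :: real^'n \<Rightarrow> 'a) l'. linear l \<and> linear l' \<and> range l \<subseteq> L \<and> (\<forall>z\<in>L. l (l' z) = z) \<and> (\<forall>y. l' (l y) = y)"
    if L: "subspace L" "dim L = CARD('n)" for L :: "'a set"
  proof -
    have "dim (UNIV :: (real^'n) set) = dim L" using L(2) by (simp add: dim_UNIV)
    then obtain l l' where "linear l" "linear l'" "l ` (UNIV :: (real^'n) set) = L"
        "\<And>y. y \<in> UNIV \<Longrightarrow> l' (l y) = y" "\<And>z. z \<in> L \<Longrightarrow> l (l' z) = z"
      using isometries_subspaces[OF subspace_UNIV L(1)] by metis
    then show ?thesis by (intro exI[of _ l] exI[of _ l']) auto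
  qed
  obtain V W and \<phi> :: "real^'n \<Rightarrow> 'a" and g where p: "Cinf V \<phi>" "Cinf W g" "x \<in> W" "\<phi> ` V = S \<inter> W"
    "\<And>z. z \<in> S \<Longrightarrow> z \<in> W \<Longrightarrow> g z \<in> V \<and> \<phi> (g z) = z" "\<And>y. y \<in> V \<Longrightarrow> \<exists>(l :: real^'n \<Rightarrow> 'a) l'. (\<forall>y. l' (l y) = y) \<and> g (\<phi> y) = l' (l y)"
    by (rule manifold_param[OF S x, where P = "\<lambda>(l :: real^'n \<Rightarrow> 'a) l'. \<forall>y. l' (l y) = y", OF ex]) (assumption, (assumption)?, rule that)
  have gx: "g x \<in> V" "\<phi> (g x) = x" using p(5)[OF x p(3)] by auto
  have oV: "open (V \<inter> \<phi> -` O')" using continuous_open_preimage[OF Cinf_continuous_on[OF p(1)] Cinf_open[OF p(1)] O(1)] .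
  obtain r where r: "r > 0" "ball (g x) r \<subseteq> V \<inter> \<phi> -` O'" using openE[OF oV, of "g x"] gx O(2) by auto
  define W' where "W' = W \<inter> g -` ball (g x) r"
  have oW': "open W'" unfolding W'_def
    using continuous_open_preimage[OF Cinf_continuous_on[OF p(2)] Cinf_open[OF p(2)] open_ball] .
  define W2 where "W2 = W' \<inter> O'"
  have oW2: "open W2" using oW' O(1) by (simp add: W2_def open_Int)
  have C1: "Cinf (ball (g x) r) \<phi>" by (rule Cinf_subset[OF p(1)]) (use r in auto)
  have C2: "Cinf W2 g" by (rule Cinf_subset[OF p(2) oW2]) (auto simp: W2_def W'_def)
  have xW: "x \<in> W2" using p(3) r(1) O(2) by (simp add: W2_def W'_def)
  have inv: "g (\<phi> y) = y" if "y \<in> ball (g x) r" for y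
  proof -
    have "y \<in> V" using r(2) that by blast
    then show ?thesis using p(6) by metis
  qed
  have im1: "\<phi> y \<in> S \<inter> W2" if y: "y \<in> ball (g x) r" for y
  proof -
    have "y \<in> V" "\<phi> y \<in> O'" using r(2) y by auto
    moreover have "\<phi> y \<in> S \<inter> W" using p(4) \<open>y \<in> V\<close> by blast
    ultimately show ?thesis using inv[OF y] y by (simp add: W2_def W'_def)
  qed
  have inv2: "g z \<in> ball (g x) r \<and> \<phi> (g z) = z" if "z \<in> S" "z \<in> W2" for z
    using p(5)[OF that(1)] that(2) by (auto simp: W2_def W'_def)
  have im: "\<phi> ` ball (g x) r = S \<inter> W2"
  proof
    show "\<phi> ` ball (g x) r \<subseteq> S \<inter> W2" using im1 by blast
    show "S \<inter> W2 \<subseteq> \<phi> ` ball (g x) r" using inv2 by (metis IntD1 IntD2 image_eqI subsetI)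
  qed
  have T: "tangent_space S z = range (dd \<phi> (g z))" if "z \<in> S" "z \<in> W2" for z
    by (rule param_tangent[OF C1 C2 im inv2 that])
  have "inj (dd \<phi> y)" if y: "y \<in> ball (g x) r" for y
  proof -
    have "dd g (\<phi> y) (dd \<phi> y v) = v" for v
    proof -
      have "dd (\<lambda>z. g (\<phi> z)) y v = dd g (\<phi> y) (dd \<phi> y v)"
        by (rule dd_compose[OF Cinf_differentiable[OF C1 y] Cinf_differentiable[OF C2]]) (use im1[OF y] in auto)
      moreover have "dd (\<lambda>z. g (\<phi> z)) y v = dd (\<lambda>z. z) y v" by (rule dd_cong[OF open_ball y]) (rule inv)
      ultimately show ?thesis by (simp add: frechet_derivative_ident)
    qed
    then show ?thesis by (metis injI)
  qed
  then show ?thesis using that[OF r(1) C1 C2 xW _ im inv inv2 T] by (simp add: W2_def)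
qed

section \<open>Naturality of the exterior derivative\<close>

lemma mlin_expand_slot:
  fixes a :: "(nat \<Rightarrow> 'a::euclidean_space) \<Rightarrow> 'v::real_vector"
  assumes "mlin k a" "m < k"
  shows "a (v(m := u)) = (\<Sum>b\<in>Basis. (u \<bullet> b) *\<^sub>R a (v(m := b)))"
proof -
  have "a (v(m := u)) = a (v(m := \<Sum>b\<in>Basis. (u \<bullet> b) *\<^sub>R b))" by (simp add: euclidean_representation)
  then show ?thesis
    by (simp add: linear_sum[OF mlin_linear[OF assms]] linear_scale[OF mlin_linear[OF assms]])
qed

text \<open>The product rule for a form whose coefficients and arguments both vary. The induction
  lets one more slot move at a time and expands that slot in the basis, so that its motion sits in
  scalar coefficients.\<close>

lemma mlin_family_derivative:
  fixes \<gamma> :: "'e::euclidean_space \<Rightarrow> (nat \<Rightarrow> 'a::euclidean_space) \<Rightarrow> 'v::real_normed_vector"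
  assumes U: "y \<in> U" "\<And>z. z \<in> U \<Longrightarrow> mlin k (\<gamma> z)" "\<And>v. Cinf U (\<lambda>z. \<gamma> z v)"
    and w: "\<And>j. j < k \<Longrightarrow> ((\<lambda>z. w z j) has_derivative w' j) (at y)"
  shows "((\<lambda>z. \<gamma> z (w z)) has_derivative
     (\<lambda>h. dd (\<lambda>z. \<gamma> z (w y)) y h + (\<Sum>l<k. \<gamma> y ((w y)(l := w' l h))))) (at y)"
proof -
  have oU: "open U" using Cinf_open[OF U(3)] .
  have "((\<lambda>z. \<gamma> z (w z)) has_derivative
     (\<lambda>h. dd (\<lambda>z. \<gamma> z (w y)) y h + (\<Sum>l<m. \<gamma> y ((w y)(l := w' l h))))) (at y)"
    if "m \<le> k" "\<And>j z. m \<le> j \<Longrightarrow> w z j = w y j" "\<And>j. j < m \<Longrightarrow> ((\<lambda>z. w z j) has_derivative w' j) (at y)" for m w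
    using that
  proof (induction m arbitrary: w)
    case 0
    then have "(\<lambda>z. \<gamma> z (w z)) = (\<lambda>z. \<gamma> z (w y))" by (intro ext arg_cong2[of _ _ _ _ \<gamma>]) auto
    then show ?case using Cinf_has_derivative[OF U(3) U(1)] by simp
  next
    case (Suc m)
    have mk: "m < k" using Suc.prems by simp
    have IH: "((\<lambda>z. \<gamma> z ((w z)(m := b))) has_derivative
      (\<lambda>h. dd (\<lambda>z. \<gamma> z ((w y)(m := b))) y h + (\<Sum>l<m. \<gamma> y (((w y)(m := b))(l := w' l h))))) (at y)" for b
    proof (rule Suc.IH)
      show "((w z)(m := b)) j = ((w y)(m := b)) j" if "m \<le> j" for j z
        using Suc.prems(2)[of j z] that by auto
      show "((\<lambda>z. ((w z)(m := b)) j) has_derivative w' j) (at y)" if "j < m" for j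
        using Suc.prems(3)[of j] that by simp
    qed (use mk in simp)
    have wm: "((\<lambda>z. w z m) has_derivative w' m) (at y)" using Suc.prems(3) by simp
    let ?D = "\<lambda>h. \<Sum>b\<in>Basis. (w y m \<bullet> b) *\<^sub>R (dd (\<lambda>z. \<gamma> z ((w y)(m := b))) y h + (\<Sum>l<m. \<gamma> y (((w y)(m := b))(l := w' l h))))
        + (w' m h \<bullet> b) *\<^sub>R \<gamma> y ((w y)(m := b))"
    have "((\<lambda>z. \<Sum>b\<in>Basis. (w z m \<bullet> b) *\<^sub>R \<gamma> z ((w z)(m := b))) has_derivative ?D) (at y)"
      by (rule has_derivative_sum, rule has_derivative_scaleR[OF has_derivative_inner_left[OF wm] IH])
    then have "((\<lambda>z. \<gamma> z (w z)) has_derivative ?D) (at y)"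
    proof (rule has_derivative_transform_within_open[OF _ oU U(1)])
      show "(\<Sum>b\<in>Basis. (w z m \<bullet> b) *\<^sub>R \<gamma> z ((w z)(m := b))) = \<gamma> z (w z)" if "z \<in> U" for z
        using mlin_expand_slot[OF U(2)[OF that] mk, of "w z" "w z m"] by simp
    qed
    moreover have "?D h = dd (\<lambda>z. \<gamma> z (w y)) y h + (\<Sum>l<Suc m. \<gamma> y ((w y)(l := w' l h)))" for h
    proof -
      have 1: "dd (\<lambda>z. \<gamma> z (w y)) y h = (\<Sum>b\<in>Basis. (w y m \<bullet> b) *\<^sub>R dd (\<lambda>z. \<gamma> z ((w y)(m := b))) y h)"
      proof -
        have "dd (\<lambda>z. \<gamma> z (w y)) y h = dd (\<lambda>z. \<Sum>b\<in>Basis. (w y m \<bullet> b) *\<^sub>R \<gamma> z ((w y)(m := b))) y h"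
          by (rule dd_cong[OF oU U(1)]) (use mlin_expand_slot[OF U(2) mk, of _ "w y" "w y m"] in simp)
        also have "\<dots> = (\<Sum>b\<in>Basis. (w y m \<bullet> b) *\<^sub>R dd (\<lambda>z. \<gamma> z ((w y)(m := b))) y h)"
          by (rule dd_eqI) (intro has_derivative_sum has_derivative_scaleR_right Cinf_has_derivative[OF U(3) U(1)])
        finally show ?thesis .
      qed
      have 2: "\<gamma> y ((w y)(l := w' l h)) = (\<Sum>b\<in>Basis. (w y m \<bullet> b) *\<^sub>R \<gamma> y (((w y)(m := b))(l := w' l h)))" if "l < m" for l
        using mlin_expand_slot[OF U(2)[OF U(1)] mk, of "(w y)(l := w' l h)" "w y m"] that
        by (simp add: fun_upd_twist[of l m])
      have 3: "\<gamma> y ((w y)(m := w' m h)) = (\<Sum>b\<in>Basis. (w' m h \<bullet> b) *\<^sub>R \<gamma> y ((w y)(m := b)))"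
        by (rule mlin_expand_slot[OF U(2)[OF U(1)] mk])
      have "(\<Sum>l<m. \<gamma> y ((w y)(l := w' l h))) = (\<Sum>b\<in>Basis. (w y m \<bullet> b) *\<^sub>R (\<Sum>l<m. \<gamma> y (((w y)(m := b))(l := w' l h))))"
        unfolding scaleR_sum_right by (subst sum.swap) (simp add: 2)
      then show ?thesis by (simp add: 1 3 scaleR_add_right sum.distrib)
    qed
    ultimately show ?case by (simp only:)
  qed
  note P = this
  \<comment> \<open>The claim proved by induction wants the slots from k on to be constant; \<gamma>
    does not read them.\<close>
  let ?w = "\<lambda>z j. if j < k then w z j else 0"
  have e: "\<gamma> z ((w z')) = \<gamma> z (?w z')" if "z \<in> U" for z z' by (rule mlin_cong[OF U(2)[OF that]]) simp
  have "((\<lambda>z. \<gamma> z (?w z)) has_derivative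
     (\<lambda>h. dd (\<lambda>z. \<gamma> z (?w y)) y h + (\<Sum>l<k. \<gamma> y ((?w y)(l := w' l h))))) (at y)"
    by (rule P) (use w in auto)
  moreover have "dd (\<lambda>z. \<gamma> z (?w y)) y h = dd (\<lambda>z. \<gamma> z (w y)) y h" for h
    by (rule dd_cong[OF oU U(1)]) (simp add: e)
  moreover have "\<gamma> y ((?w y)(l := w' l h)) = \<gamma> y ((w y)(l := w' l h))" for l h
    by (rule mlin_cong[OF U(2)[OF U(1)]]) simp
  ultimately have "((\<lambda>z. \<gamma> z (?w z)) has_derivative
     (\<lambda>h. dd (\<lambda>z. \<gamma> z (w y)) y h + (\<Sum>l<k. \<gamma> y ((w y)(l := w' l h))))) (at y)" by simp
  then show ?thesis
    by (rule has_derivative_transform_within_open[OF _ oU U(1)]) (simp add: e)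
qed

lemma mlin_family_Cinf:
  fixes \<gamma> :: "'e::euclidean_space \<Rightarrow> (nat \<Rightarrow> 'a::euclidean_space) \<Rightarrow> 'v::real_normed_vector"
  assumes U: "\<And>z. z \<in> U \<Longrightarrow> mlin k (\<gamma> z)" "\<And>v. Cinf U (\<lambda>z. \<gamma> z v)"
    and w: "\<And>j. j < k \<Longrightarrow> Cinf U (\<lambda>z. w z j)"
  shows "Cinf U (\<lambda>z. \<gamma> z (w z))"
proof -
  have oU: "open U" using Cinf_open[OF U(2)] .
  have P: "Cinf U (\<lambda>z. \<gamma> z (\<lambda>j. if j < m then w z j else u j))" if "m \<le> k" for m u
    using that
  proof (induction m arbitrary: u)
    case 0
    then show ?case using U(2) by simp
  next
    case (Suc m)
    have mk: "m < k" using Suc.prems by simp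
    have e: "\<gamma> z (\<lambda>j. if j < Suc m then w z j else u j) =
       (\<Sum>b\<in>Basis. (w z m \<bullet> b) *\<^sub>R \<gamma> z (\<lambda>j. if j < m then w z j else (u(m := b)) j))" if "z \<in> U" for z
    proof -
      have e1: "(\<lambda>j. if j < Suc m then w z j else u j) = (\<lambda>j. if j < m then w z j else u j)(m := w z m)"
        by (auto simp: fun_eq_iff)
      have e2: "(\<lambda>j. if j < m then w z j else (u(m := b)) j) = (\<lambda>j. if j < m then w z j else u j)(m := b)" for b
        by (auto simp: fun_eq_iff)
      show ?thesis unfolding e1 e2 by (rule mlin_expand_slot[OF U(1)[OF that] mk])
    qed
    have "Cinf U (\<lambda>z. \<Sum>b\<in>Basis. (w z m \<bullet> b) *\<^sub>R \<gamma> z (\<lambda>j. if j < m then w z j else (u(m := b)) j))"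
      using Suc.IH mk by (intro Cinf_sum[OF oU] Cinf_scaleR Cinf_blinear[OF bounded_linear_inner_left] w) auto
    then show ?case by (rule Cinf_cong[THEN iffD2, rotated]) (rule e)
  qed
  have "\<gamma> z (w z) = \<gamma> z (\<lambda>j. if j < k then w z j else 0)" if "z \<in> U" for z
    by (rule mlin_cong[OF U(1)[OF that]]) simp
  then show ?thesis using P[of k "\<lambda>_. 0"] Cinf_cong[of U "\<lambda>z. \<gamma> z (w z)" "\<lambda>z. \<gamma> z (\<lambda>j. if j < k then w z j else 0)"] by simp
qed

lemma form_altform: "form S k \<alpha> \<Longrightarrow> x \<in> S \<Longrightarrow> altform k (\<alpha> x)"
  by (simp add: form_def)

lemma form_smooth: "form S k \<alpha> \<Longrightarrow> smooth_on S (\<lambda>x. \<alpha> x v)"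
  by (simp add: form_def)

lemma form_pull_Cinf:
  fixes q :: "'e::euclidean_space \<Rightarrow> 'a::euclidean_space"
  assumes \<alpha>: "form S k \<alpha>" and q: "Cinf U q" "\<And>y. y \<in> U \<Longrightarrow> q y \<in> S" and w: "\<And>j. j < k \<Longrightarrow> Cinf U (\<lambda>z. w z j)"
  shows "Cinf U (\<lambda>z. \<alpha> (q z) (w z))"
  by (rule mlin_family_Cinf[where \<gamma> = "\<lambda>z. \<alpha> (q z)" and k = k])
    (use altform_mlin form_altform[OF \<alpha>] q w Cinf_pull[OF q form_smooth[OF \<alpha>]] in auto)

text \<open>Differentiating the pulled back form gives T1, where only the coefficients move, and the
  terms T2, where one of the vectors \<open>dd q z (u j)\<close> moves. T2 contains a second
  derivative of q, which is symmetric in its two directions, so alternation removes it. By the coset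
  formula both sides of the claim are alternations, of T and of T1.\<close>

theorem ext_deriv_pullback:
  fixes q :: "'e::euclidean_space \<Rightarrow> 'a::euclidean_space" and \<alpha> :: "'a \<Rightarrow> (nat \<Rightarrow> 'a) \<Rightarrow> 'v::real_normed_vector"
  assumes \<alpha>: "form S k \<alpha>" and q: "Cinf U q" "\<And>y. y \<in> U \<Longrightarrow> q y \<in> S" and y: "y \<in> U"
  shows "(\<Sum>i\<le>k. (-1) ^ i *\<^sub>R dd (\<lambda>z. \<alpha> (q z) (\<lambda>j. dd q z (if j < i then u j else u (Suc j)))) y (u i))
     = ext_deriv S k \<alpha> (q y) (\<lambda>j. dd q y (u j))"
proof -
  define T where "T u = dd (\<lambda>z. \<alpha> (q z) (\<lambda>j. dd q z (u (Suc j)))) y (u 0)" for u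
  define T1 where "T1 u = dd (\<lambda>z. \<alpha> (q z) (\<lambda>j. dd q y (u (Suc j)))) y (u 0)" for u
  define T2 where "T2 l u = \<alpha> (q y) ((\<lambda>j. dd q y (u (Suc j)))(l := dd (\<lambda>z. dd q z (u (Suc l))) y (u 0)))" for l u
  have alt: "altform k (\<alpha> (q z))" if "z \<in> U" for z using form_altform[OF \<alpha> q(2)[OF that]] .
  have C: "Cinf U (\<lambda>z. \<alpha> (q z) v)" for v by (rule Cinf_pull[OF q form_smooth[OF \<alpha>]])
  have C': "Cinf U (\<lambda>z. \<alpha> (q z) (\<lambda>j. dd q z (v j)))" for v
    by (rule form_pull_Cinf[OF \<alpha> q(1)]) (use q Cinf_deriv in auto)
  have TT: "T u = T1 u + (\<Sum>l<k. T2 l u)" for u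
    unfolding T_def T1_def T2_def
    by (rule dd_eqI, rule mlin_family_derivative[where U = U])
      (use y altform_mlin[OF alt] C Cinf_has_derivative[OF Cinf_deriv[OF q(1)] y] in auto)
  have scale: "dd (\<lambda>z. c *\<^sub>R F z) y h = c *\<^sub>R dd F y h" if "Cinf U F" for c F h
    by (rule dd_eqI) (rule has_derivative_scaleR_right[OF Cinf_has_derivative[OF that y]])
  have perm: "\<alpha> (q z) (\<lambda>j. D ((u \<circ> shiftp 1 \<rho>) (Suc j))) = sgnp \<rho> *\<^sub>R \<alpha> (q z) (\<lambda>j. D (u (Suc j)))"
    if "\<rho> permutes {..<k}" "z \<in> U" for \<rho> u z D
  proof -
    have "(\<lambda>j. D ((u \<circ> shiftp 1 \<rho>) (Suc j))) = (\<lambda>j. D (u (Suc j))) \<circ> \<rho>"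
      by (simp add: fun_eq_iff shiftp_def)
    then show ?thesis using altform_permute[OF alt[OF that(2)] that(1)] by metis
  qed
  have Tperm: "T (u \<circ> shiftp 1 \<rho>) = sgnp \<rho> *\<^sub>R T u" if "\<rho> permutes {..<k}" for u \<rho>
  proof -
    have "T (u \<circ> shiftp 1 \<rho>) = dd (\<lambda>z. sgnp \<rho> *\<^sub>R \<alpha> (q z) (\<lambda>j. dd q z (u (Suc j)))) y ((u \<circ> shiftp 1 \<rho>) 0)"
      unfolding T_def by (rule dd_cong[OF Cinf_open[OF q(1)] y]) (rule perm[OF that])
    then show ?thesis using scale[OF C'] by (simp add: T_def shiftp_def)
  qed
  have T1perm: "T1 (u \<circ> shiftp 1 \<rho>) = sgnp \<rho> *\<^sub>R T1 u" if "\<rho> permutes {..<k}" for u \<rho>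
  proof -
    have "T1 (u \<circ> shiftp 1 \<rho>) = dd (\<lambda>z. sgnp \<rho> *\<^sub>R \<alpha> (q z) (\<lambda>j. dd q y (u (Suc j)))) y ((u \<circ> shiftp 1 \<rho>) 0)"
      unfolding T1_def by (rule dd_cong[OF Cinf_open[OF q(1)] y]) (rule perm[OF that])
    then show ?thesis using scale[OF C] by (simp add: T1_def shiftp_def)
  qed
  have T2z: "alt_sum (Suc k) (T2 l) u = 0" if l: "l < k" for l
  proof -
    have p: "tp 0 (Suc l) permutes {..<Suc k}" using l by (intro permutes_swap_id) auto
    have inv: "T2 l (u \<circ> tp 0 (Suc l)) = T2 l u" for u
    proof -
      have "(\<lambda>j. dd q y ((u \<circ> tp 0 (Suc l)) (Suc j)))(l := dd (\<lambda>z. dd q z ((u \<circ> tp 0 (Suc l)) (Suc l))) y ((u \<circ> tp 0 (Suc l)) 0))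
        = (\<lambda>j. dd q y (u (Suc j)))(l := dd (\<lambda>z. dd q z (u (Suc l))) y (u 0))"
        using second_derivative_symmetric[OF q(1) y] by (auto simp: fun_eq_iff Transposition.transpose_def)
      then show ?thesis unfolding T2_def by (rule arg_cong)
    qed
    have "alt_sum (Suc k) (\<lambda>u. T2 l (u \<circ> tp 0 (Suc l))) u = sgnp (tp 0 (Suc l)) *\<^sub>R alt_sum (Suc k) (T2 l) u"
      by (rule alt_sum_reindex[OF p])
    then have "alt_sum (Suc k) (T2 l) u = - alt_sum (Suc k) (T2 l) u"
      unfolding inv sgnp_tp[OF Zero_not_Suc] scaleR_minus1_left .
    then have "2 *\<^sub>R alt_sum (Suc k) (T2 l) u = 0" by (metis add.right_inverse scaleR_2)
    then show ?thesis by simp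
  qed
  have Tu: "T (u \<circ> cyc i) = dd (\<lambda>z. \<alpha> (q z) (\<lambda>j. dd q z (if j < i then u j else u (Suc j)))) y (u i)" for i
    unfolding T_def cyc_comp by (simp add: cyc_def)
  have T1u: "T1 (u \<circ> cyc i) = mdiff S (\<lambda>x. \<alpha> x (\<lambda>j. if j < i then dd q y (u j) else dd q y (u (Suc j)))) (q y) (dd q y (u i))" for i
  proof -
    have "(\<lambda>j. dd q y (if j < i then u j else u (Suc j))) = (\<lambda>j. if j < i then dd q y (u j) else dd q y (u (Suc j)))" by auto
    then show ?thesis unfolding T1_def cyc_comp
      using dd_pull[OF q form_smooth[OF \<alpha>] y] by (simp add: cyc_def)
  qed
  have "fact k *\<^sub>R (\<Sum>i\<le>k. (-1) ^ i *\<^sub>R T (u \<circ> cyc i)) = alt_sum (Suc k) T u"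
    by (rule alt_sum_cosets[OF Tperm, symmetric])
  also have "\<dots> = alt_sum (Suc k) (\<lambda>u. T1 u + (\<Sum>l<k. T2 l u)) u" by (simp add: TT[abs_def])
  also have "\<dots> = alt_sum (Suc k) T1 u" by (simp add: alt_sum_add alt_sum_sum T2z)
  also have "\<dots> = fact k *\<^sub>R (\<Sum>i\<le>k. (-1) ^ i *\<^sub>R T1 (u \<circ> cyc i))"
    by (rule alt_sum_cosets[OF T1perm])
  finally have "(\<Sum>i\<le>k. (-1) ^ i *\<^sub>R T (u \<circ> cyc i)) = (\<Sum>i\<le>k. (-1) ^ i *\<^sub>R T1 (u \<circ> cyc i))" by simp
  then show ?thesis by (simp add: Tu T1u ext_deriv_def)
qed

section \<open>Connections and Higgs fields in terms of arbitrary lifts\<close>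

lemma bounded_bilinear_matrix_mult: "bounded_bilinear ((**) :: complex^'n^'n \<Rightarrow> complex^'n^'n \<Rightarrow> complex^'n^'n)"
  unfolding bilinear_conv_bounded_bilinear[symmetric] bilinear_def
  by (auto intro!: linearI simp: vec_eq_iff matrix_matrix_mult_def algebra_simps sum.distrib scaleR_sum_right)

interpretation mat: bounded_bilinear "(**) :: complex^'n^'n \<Rightarrow> complex^'n^'n \<Rightarrow> complex^'n^'n"
  by (rule bounded_bilinear_matrix_mult)

lemma bounded_linear_cadj: "bounded_linear (cadj :: complex^'n^'n \<Rightarrow> complex^'n^'n)"
  unfolding linear_conv_bounded_linear[symmetric]
  by (auto intro!: linearI simp: vec_eq_iff cadj_def)

lemma cadj_one: "cadj (mat 1) = mat 1"
  by (simp add: vec_eq_iff cadj_def mat_def)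

lemma bounded_bilinear_bracket: "bounded_bilinear (bracket :: complex^'n^'n \<Rightarrow> complex^'n^'n \<Rightarrow> complex^'n^'n)"
  unfolding bilinear_conv_bounded_bilinear[symmetric] bilinear_def bracket_def
  by (auto intro!: linearI simp: mat.add_left mat.add_right mat.scaleR_left mat.scaleR_right algebra_simps)

interpretation br: bounded_bilinear "bracket :: complex^'n^'n \<Rightarrow> complex^'n^'n \<Rightarrow> complex^'n^'n"
  by (rule bounded_bilinear_bracket)

lemma bracket_antisym: "bracket X Y = - bracket Y X"
  by (simp add: bracket_def)

locale bundle_connection =
  fixes Q :: "('p::euclidean_space, 'm::euclidean_space, 'n::finite) bundle_data" and M :: "'m set"
    and A :: "'p \<Rightarrow> (nat \<Rightarrow> 'p) \<Rightarrow> complex^'n^'n"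
  assumes princ: "principal_bundle Q M" and conn: "connection Q A"
begin

abbreviation "P \<equiv> ptot Q"
abbreviation "G \<equiv> grp Q"
abbreviation "pr \<equiv> pproj Q"
abbreviation "ac \<equiv> act Q"
abbreviation "a p h \<equiv> A p (\<lambda>_. h)"

lemma grp: "mat 1 \<in> G" "g \<in> G \<Longrightarrow> cadj g ** g = mat 1" "g \<in> G \<Longrightarrow> g ** cadj g = mat 1"
  "g \<in> G \<Longrightarrow> cadj g \<in> G" "g \<in> G \<Longrightarrow> h \<in> G \<Longrightarrow> g ** h \<in> G" "\<exists>d. manifold d G"
  using princ unfolding principal_bundle_def compact_lie_group_def by blast+

lemma P_facts: "\<exists>d. manifold d P" "smooth_on P pr" "p \<in> P \<Longrightarrow> pr p \<in> M"
  "smooth_on (P \<times> G) (\<lambda>(p, g). ac p g)" "p \<in> P \<Longrightarrow> g \<in> G \<Longrightarrow> ac p g \<in> P" "p \<in> P \<Longrightarrow> g \<in> G \<Longrightarrow> pr (ac p g) = pr p"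
  "p \<in> P \<Longrightarrow> ac p (mat 1) = p"
  using princ unfolding principal_bundle_def by auto

lemma trivialisation:
  assumes "x \<in> M"
  obtains U \<psi> where "open U" "x \<in> U" "diffeo {p \<in> P. pr p \<in> U} ((M \<inter> U) \<times> G) (\<lambda>p. (pr p, \<psi> p))"
    "\<And>p g. p \<in> P \<Longrightarrow> g \<in> G \<Longrightarrow> pr p \<in> U \<Longrightarrow> \<psi> (ac p g) = \<psi> p ** g"
proof -
  have "\<forall>x\<in>M. \<exists>U \<psi>. open U \<and> x \<in> U \<and>
        diffeo {p \<in> P. pr p \<in> U} ((M \<inter> U) \<times> G) (\<lambda>p. (pr p, \<psi> p)) \<and>
        (\<forall>p\<in>P. \<forall>g\<in>G. pr p \<in> U \<longrightarrow> \<psi> (ac p g) = \<psi> p ** g)"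
    using princ unfolding principal_bundle_def by blast
  then obtain U \<psi> where "open U \<and> x \<in> U \<and> diffeo {p \<in> P. pr p \<in> U} ((M \<inter> U) \<times> G) (\<lambda>p. (pr p, \<psi> p)) \<and>
        (\<forall>p\<in>P. \<forall>g\<in>G. pr p \<in> U \<longrightarrow> \<psi> (ac p g) = \<psi> p ** g)" using assms by blast
  then show ?thesis using that by blast
qed

lemma connD: "form P 1 A" "p \<in> P \<Longrightarrow> u \<in> tangent_space P p \<Longrightarrow> a p u \<in> lie_algebra G"
  "p \<in> P \<Longrightarrow> \<xi> \<in> lie_algebra G \<Longrightarrow> a p (mdiff G (ac p) (mat 1) \<xi>) = \<xi>"
  "p \<in> P \<Longrightarrow> g \<in> G \<Longrightarrow> u \<in> tangent_space P p \<Longrightarrow>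
     a (ac p g) (mdiff P (\<lambda>q. ac q g) p u) = cadj g ** a p u ** g"
  using conn unfolding connection_def by blast+

lemma tangent_P_subspace: "p \<in> P \<Longrightarrow> subspace (tangent_space P p)"
  using P_facts(1) subspace_tangent_space by blast

lemma lie_subspace: "subspace (lie_algebra G)"
  unfolding lie_algebra_def using grp(1,6) subspace_tangent_space by blast

lemma a_linear: "p \<in> P \<Longrightarrow> linear (a p)"
proof -
  assume p: "p \<in> P"
  have "(\<lambda>u. A p ((\<lambda>_. 0)(0 := u))) = a p"
    by (rule ext, rule altform_cong[OF form_altform[OF connD(1) p]]) simp
  then show ?thesis using altform_linear[OF form_altform[OF connD(1) p], of 0 "\<lambda>_. 0"] by simp
qed

lemma A_a: "p \<in> P \<Longrightarrow> A p v = a p (v 0)"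
  by (rule altform_cong[OF form_altform[OF connD(1)]]) auto

lemma act_smooth: "p \<in> P \<Longrightarrow> smooth_on G (ac p)" "g \<in> G \<Longrightarrow> smooth_on P (\<lambda>q. ac q g)"
proof -
  assume p: "p \<in> P"
  have "smooth_on G (\<lambda>g. (\<lambda>(p, g). ac p g) (p, g))"
    by (rule smooth_on_compose[OF smooth_on_Pair[OF smooth_on_const smooth_on_linear[OF linear_ident]] P_facts(4)])
      (use p in auto)
  then show "smooth_on G (ac p)" by simp
next
  assume g: "g \<in> G"
  have "smooth_on P (\<lambda>q. (\<lambda>(p, g). ac p g) (q, g))"
    by (rule smooth_on_compose[OF smooth_on_Pair[OF smooth_on_linear[OF linear_ident] smooth_on_const] P_facts(4)])
      (use g in auto)
  then show "smooth_on P (\<lambda>q. ac q g)" by simp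
qed

text \<open>The fundamental vector field of the right action.\<close>

definition X :: "'p \<Rightarrow> complex^'n^'n \<Rightarrow> 'p" where
  "X p \<xi> = mdiff G (ac p) (mat 1) \<xi>"

lemma lieE:
  assumes "\<xi> \<in> lie_algebra G"
  obtains U \<gamma> where "Cinf U \<gamma>" "(0::real) \<in> U" "\<And>t. t \<in> U \<Longrightarrow> \<gamma> t \<in> G" "\<gamma> 0 = mat 1" "dd \<gamma> 0 1 = \<xi>"
  using assms unfolding lie_algebra_def by (rule tangent_spaceE) (rule that)

lemma X_curve:
  assumes p: "p \<in> P" and \<gamma>: "Cinf U \<gamma>" "(0::real) \<in> U" "\<And>t. t \<in> U \<Longrightarrow> \<gamma> t \<in> G" "\<gamma> 0 = mat 1"
  shows "X p (dd \<gamma> 0 1) = dd (\<lambda>t. ac p (\<gamma> t)) 0 1"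
  unfolding X_def using dd_pull[OF \<gamma>(1,3) act_smooth(1)[OF p] \<gamma>(2), of 1] \<gamma>(4) by simp

lemma X_linear: "p \<in> P \<Longrightarrow> linear (X p)"
  unfolding X_def[abs_def] by (rule mdiff_linear[OF act_smooth(1) grp(1)])

lemma X_props:
  assumes p: "p \<in> P" and \<xi>: "\<xi> \<in> lie_algebra G"
  shows "X p \<xi> \<in> tangent_space P p" "a p (X p \<xi>) = \<xi>" "mdiff P pr p (X p \<xi>) = 0"
proof -
  obtain U \<gamma> where \<gamma>: "Cinf U \<gamma>" "(0::real) \<in> U" "\<And>t. t \<in> U \<Longrightarrow> \<gamma> t \<in> G" "\<gamma> 0 = mat 1" "dd \<gamma> 0 1 = \<xi>"
    by (rule lieE[OF \<xi>]) (rule that)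
  have X: "X p \<xi> = dd (\<lambda>t. ac p (\<gamma> t)) 0 1" using X_curve[OF p \<gamma>(1-4)] \<gamma>(5) by simp
  have C: "Cinf U (\<lambda>t. ac p (\<gamma> t))" by (rule Cinf_pull[OF \<gamma>(1,3) act_smooth(1)[OF p]])
  have P: "ac p (\<gamma> t) \<in> P" if "t \<in> U" for t using P_facts(5)[OF p \<gamma>(3)[OF that]] .
  have 0: "ac p (\<gamma> 0) = p" using P_facts(7)[OF p] \<gamma>(4) by simp
  show "X p \<xi> \<in> tangent_space P p" unfolding X using tangent_spaceI[OF C \<gamma>(2) P] 0 by simp
  show "a p (X p \<xi>) = \<xi>" unfolding X_def by (rule connD(3)[OF p \<xi>])
  have "mdiff P pr p (X p \<xi>) = dd (\<lambda>t. pr (ac p (\<gamma> t))) 0 1"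
    unfolding X using dd_pull[OF C P P_facts(2) \<gamma>(2), of 1] 0 by simp
  also have "\<dots> = dd (\<lambda>t::real. pr p) 0 1"
    by (rule dd_cong[OF Cinf_open[OF C] \<gamma>(2)]) (rule P_facts(6)[OF p \<gamma>(3)])
  finally show "mdiff P pr p (X p \<xi>) = 0" by (simp add: frechet_derivative_const)
qed

section \<open>Local sections, vertical vectors and horizontal lifts\<close>

lemma trivialisation_inverse:
  assumes p: "p \<in> P"
  obtains U \<psi> \<tau> where "open U" "pr p \<in> U" "smooth_on {q \<in> P. pr q \<in> U} \<psi>" "smooth_on ((M \<inter> U) \<times> G) \<tau>"
    "\<And>q. q \<in> P \<Longrightarrow> pr q \<in> U \<Longrightarrow> \<psi> q \<in> G \<and> \<tau> (pr q, \<psi> q) = q"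
    "\<And>x g. x \<in> M \<Longrightarrow> x \<in> U \<Longrightarrow> g \<in> G \<Longrightarrow> \<tau> (x, g) \<in> P \<and> pr (\<tau> (x, g)) = x"
    "\<And>q g. q \<in> P \<Longrightarrow> g \<in> G \<Longrightarrow> pr q \<in> U \<Longrightarrow> \<psi> (ac q g) = \<psi> q ** g"
proof -
  obtain U \<psi> where U: "open U" "pr p \<in> U" and d: "diffeo {p \<in> P. pr p \<in> U} ((M \<inter> U) \<times> G) (\<lambda>p. (pr p, \<psi> p))"
    and eq: "\<And>p g. p \<in> P \<Longrightarrow> g \<in> G \<Longrightarrow> pr p \<in> U \<Longrightarrow> \<psi> (ac p g) = \<psi> p ** g"
    by (rule trivialisation[OF P_facts(3)[OF p]]) (rule that)
  let ?S = "{p \<in> P. pr p \<in> U}" and ?f = "\<lambda>p. (pr p, \<psi> p)"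
  define \<tau> where "\<tau> = inv_into ?S ?f"
  have bij: "bij_betw ?f ?S ((M \<inter> U) \<times> G)" and s1: "smooth_on ?S ?f" and s2: "smooth_on ((M \<inter> U) \<times> G) \<tau>"
    using d unfolding diffeo_def \<tau>_def by auto
  have "smooth_on ?S (\<lambda>p. snd (?f p))"
    by (rule smooth_on_compose[OF s1 smooth_on_linear[of snd UNIV]]) (auto intro: linear_snd)
  then have s3: "smooth_on ?S \<psi>" by simp
  have 1: "\<psi> q \<in> G \<and> \<tau> (pr q, \<psi> q) = q" if "q \<in> P" "pr q \<in> U" for q
  proof -
    have q: "q \<in> ?S" using that by simp
    have "?f q \<in> (M \<inter> U) \<times> G" using bij q unfolding bij_betw_def by blast
    moreover have "\<tau> (?f q) = q" unfolding \<tau>_def using bij q by (intro inv_into_f_f) (auto simp: bij_betw_def)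
    ultimately show ?thesis by simp
  qed
  have 2: "\<tau> (x, g) \<in> P \<and> pr (\<tau> (x, g)) = x" if "x \<in> M" "x \<in> U" "g \<in> G" for x g
  proof -
    have i: "(x, g) \<in> ?f ` ?S" using bij that unfolding bij_betw_def by simp
    then have "\<tau> (x, g) \<in> ?S" unfolding \<tau>_def by (rule inv_into_into)
    moreover have "?f (\<tau> (x, g)) = (x, g)" unfolding \<tau>_def by (rule f_inv_into_f[OF i])
    ultimately show ?thesis by simp
  qed
  show ?thesis by (rule that[OF U s3 s2 1 2 eq])
qed

lemma local_section:
  assumes p: "p \<in> P"
  obtains U s where "open U" "pr p \<in> U" "smooth_on (M \<inter> U) s" "s (pr p) = p"
    "\<And>x. x \<in> M \<Longrightarrow> x \<in> U \<Longrightarrow> s x \<in> P \<and> pr (s x) = x"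
proof -
  obtain U \<psi> \<tau> where U: "open U" "pr p \<in> U" "smooth_on {q \<in> P. pr q \<in> U} \<psi>" "smooth_on ((M \<inter> U) \<times> G) \<tau>"
    "\<And>q. q \<in> P \<Longrightarrow> pr q \<in> U \<Longrightarrow> \<psi> q \<in> G \<and> \<tau> (pr q, \<psi> q) = q"
    "\<And>x g. x \<in> M \<Longrightarrow> x \<in> U \<Longrightarrow> g \<in> G \<Longrightarrow> \<tau> (x, g) \<in> P \<and> pr (\<tau> (x, g)) = x"
    "\<And>q g. q \<in> P \<Longrightarrow> g \<in> G \<Longrightarrow> pr q \<in> U \<Longrightarrow> \<psi> (ac q g) = \<psi> q ** g"
    by (rule trivialisation_inverse[OF p]) (rule that)
  have g: "\<psi> p \<in> G" "\<tau> (pr p, \<psi> p) = p" using U(5)[OF p U(2)] by auto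
  have "smooth_on (M \<inter> U) (\<lambda>x. \<tau> (x, \<psi> p))"
    by (rule smooth_on_compose[OF smooth_on_Pair[OF smooth_on_linear[OF linear_ident] smooth_on_const] U(4)])
      (use g in auto)
  then show ?thesis using that[of U "\<lambda>x. \<tau> (x, \<psi> p)"] U(1,2,6) g by blast
qed

text \<open>In a trivialisation a curve with velocity h has a base component of velocity zero. Once
  that component is frozen, the curve lies in the fibre of p and has the form of p acted on by a
  curve in G through the identity.\<close>

lemma vertical_is_fundamental:
  assumes p: "p \<in> P" and h: "h \<in> tangent_space P p" "mdiff P pr p h = 0"
  obtains \<xi> where "\<xi> \<in> lie_algebra G" "h = X p \<xi>"
proof -
  obtain U \<psi> \<tau> where U: "open U" "pr p \<in> U" "smooth_on {q \<in> P. pr q \<in> U} \<psi>" "smooth_on ((M \<inter> U) \<times> G) \<tau>"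
    "\<And>q. q \<in> P \<Longrightarrow> pr q \<in> U \<Longrightarrow> \<psi> q \<in> G \<and> \<tau> (pr q, \<psi> q) = q"
    "\<And>x g. x \<in> M \<Longrightarrow> x \<in> U \<Longrightarrow> g \<in> G \<Longrightarrow> \<tau> (x, g) \<in> P \<and> pr (\<tau> (x, g)) = x"
    "\<And>q g. q \<in> P \<Longrightarrow> g \<in> G \<Longrightarrow> pr q \<in> U \<Longrightarrow> \<psi> (ac q g) = \<psi> q ** g"
    by (rule trivialisation_inverse[OF p]) (rule that)
  obtain T c where c: "Cinf T c" "(0::real) \<in> T" "\<And>t. t \<in> T \<Longrightarrow> c t \<in> P" "c 0 = p" "dd c 0 1 = h"
    by (rule tangent_spaceE[OF h(1)]) (rule that)
  define g0 where "g0 = \<psi> p"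
  have g0: "g0 \<in> G" using U(5)[OF p U(2)] by (simp add: g0_def)
  have xC: "Cinf T (\<lambda>t. pr (c t))" by (rule Cinf_pull[OF c(1,3) P_facts(2)])
  define T' where "T' = T \<inter> (\<lambda>t. pr (c t)) -` U"
  have oT': "open T'" unfolding T'_def
    by (rule continuous_open_preimage[OF Cinf_continuous_on[OF xC] Cinf_open[OF xC] U(1)])
  have sub: "T' \<subseteq> T" by (auto simp: T'_def)
  have 0: "0 \<in> T'" using c U(2) by (simp add: T'_def)
  have cS: "c t \<in> {q \<in> P. pr q \<in> U}" if "t \<in> T'" for t using c(3) that by (auto simp: T'_def)
  have c': "Cinf T' c" by (rule Cinf_subset[OF c(1) oT' sub])
  have x': "Cinf T' (\<lambda>t. pr (c t))" by (rule Cinf_subset[OF xC oT' sub])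
  have \<gamma>: "Cinf T' (\<lambda>t. \<psi> (c t))" by (rule Cinf_pull[OF c' cS U(3)])
  have \<gamma>G: "\<psi> (c t) \<in> G" if "t \<in> T'" for t using U(5) cS[OF that] by blast
  have dx: "dd (\<lambda>t. pr (c t)) 0 1 = 0"
    using dd_pull[OF c(1,3) P_facts(2) c(2), of 1] h(2) c(4,5) by simp
  define D where "D = mdiff ((M \<inter> U) \<times> G) \<tau> (pr p, g0)"
  have pair: "dd (\<lambda>t. (f t, \<psi> (c t))) 0 1 = (dd f 0 1, dd (\<lambda>t. \<psi> (c t)) 0 1)" if "f differentiable (at 0)" for f :: "real \<Rightarrow> 'm"
    by (rule dd_eqI) (rule has_derivative_Pair[OF that[unfolded frechet_derivative_works] Cinf_has_derivative[OF \<gamma> 0]])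
  have along: "dd (\<lambda>t. \<tau> (f t, \<psi> (c t))) 0 1 = D (dd f 0 1, dd (\<lambda>t. \<psi> (c t)) 0 1)"
    if f: "Cinf T' f" "\<And>t. t \<in> T' \<Longrightarrow> f t \<in> M \<inter> U" "f 0 = pr p" for f
  proof -
    have "dd (\<lambda>t. \<tau> (f t, \<psi> (c t))) 0 1 = mdiff ((M \<inter> U) \<times> G) \<tau> (f 0, \<psi> (c 0)) (dd (\<lambda>t. (f t, \<psi> (c t))) 0 1)"
      by (rule dd_pull[OF Cinf_Pair[OF f(1) \<gamma>] _ U(4) 0]) (use f(2) \<gamma>G in auto)
    then show ?thesis using pair[OF Cinf_differentiable[OF f(1) 0]] f(3) c(4) by (simp add: D_def g0_def)
  qed
  have prM: "pr p \<in> M \<inter> U" using P_facts(3)[OF p] U(2) by simp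
  have "h = dd c 0 1" using c(5) by simp
  also have "\<dots> = dd (\<lambda>t. \<tau> (pr (c t), \<psi> (c t))) 0 1"
    by (rule dd_cong[OF oT' 0]) (use U(5) cS in auto)
  also have "\<dots> = D (0, dd (\<lambda>t. \<psi> (c t)) 0 1)"
    using along[OF x'] P_facts(3) cS c(4) dx by auto
  \<comment> \<open>Freezing the base component changes the curve but not its velocity.\<close>
  also have "\<dots> = dd (\<lambda>t. \<tau> (pr p, \<psi> (c t))) 0 1"
    using along[OF Cinf_const[OF oT'], of "pr p"] prM by (simp add: frechet_derivative_const)
  also have "\<dots> = dd (\<lambda>t. ac p (cadj g0 ** \<psi> (c t))) 0 1"
  proof (rule dd_cong[OF oT' 0])
    fix t assume t: "t \<in> T'"
    let ?g = "cadj g0 ** \<psi> (c t)"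
    have g: "?g \<in> G" using grp(4,5) g0 \<gamma>G[OF t] by blast
    have "\<psi> (ac p ?g) = g0 ** (cadj g0 ** \<psi> (c t))" using U(7)[OF p g U(2)] by (simp add: g0_def)
    also have "\<dots> = \<psi> (c t)" using grp(3)[OF g0] by (simp add: matrix_mul_assoc)
    finally have e: "\<psi> (ac p ?g) = \<psi> (c t)" .
    have "\<tau> (pr (ac p ?g), \<psi> (ac p ?g)) = ac p ?g"
      using U(5)[of "ac p ?g"] P_facts(5,6)[OF p g] U(2) by simp
    then show "\<tau> (pr p, \<psi> (c t)) = ac p ?g" using e P_facts(6)[OF p g] by simp
  qed
  also have "\<dots> = X p (dd (\<lambda>t. cadj g0 ** \<psi> (c t)) 0 1)"
  proof (rule X_curve[OF p, symmetric])
    show "Cinf T' (\<lambda>t. cadj g0 ** \<psi> (c t))" by (rule Cinf_blinear[OF mat.bounded_linear_right \<gamma>])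
    show "cadj g0 ** \<psi> (c 0) = mat 1" using c(4) grp(2)[OF g0] by (simp add: g0_def)
  qed (use 0 grp(4,5) g0 \<gamma>G in auto)
  finally have hX: "h = X p (dd (\<lambda>t. cadj g0 ** \<psi> (c t)) 0 1)" .
  have "dd (\<lambda>t. cadj g0 ** \<psi> (c t)) 0 1 \<in> tangent_space G (cadj g0 ** \<psi> (c 0))"
    by (rule tangent_spaceI[OF Cinf_blinear[OF mat.bounded_linear_right \<gamma>] 0]) (use grp(4,5) g0 \<gamma>G in auto)
  then have "dd (\<lambda>t. cadj g0 ** \<psi> (c t)) 0 1 \<in> lie_algebra G"
    using c(4) grp(2)[OF g0] by (simp add: lie_algebra_def g0_def)
  then show ?thesis using hX that by blast
qed

text \<open>Any lift h becomes horizontal after subtracting the fundamental vector of its connection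
  value. Uniqueness holds because the difference of two horizontal lifts is fundamental, with
  connection value zero.\<close>

lemma hlift_eq:
  assumes p: "p \<in> P" and h: "h \<in> tangent_space P p"
  shows "hlift Q A p (mdiff P pr p h) = h - X p (a p h)" "h - X p (a p h) \<in> tangent_space P p"
proof -
  let ?h = "h - X p (a p h)"
  have l: "a p h \<in> lie_algebra G" by (rule connD(2)[OF p h])
  note X = X_props[OF p l]
  show T: "?h \<in> tangent_space P p" by (rule subspace_diff[OF tangent_P_subspace[OF p] h X(1)])
  have 1: "a p ?h = 0" using X(2) by (simp add: linear_diff[OF a_linear[OF p]])
  have 2: "mdiff P pr p ?h = mdiff P pr p h"
    using X(3) linear_diff[OF mdiff_linear[OF P_facts(2) p], of h "X p (a p h)"] by simp
  have "k = ?h" if k: "k \<in> tangent_space P p" "a p k = 0" "mdiff P pr p k = mdiff P pr p h" for k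
  proof -
    have kT: "k - ?h \<in> tangent_space P p" by (rule subspace_diff[OF tangent_P_subspace[OF p] k(1) T])
    have k0: "mdiff P pr p (k - ?h) = 0" using linear_diff[OF mdiff_linear[OF P_facts(2) p], of k ?h] 2 k(3) by simp
    obtain \<xi> where \<xi>: "\<xi> \<in> lie_algebra G" "k - ?h = X p \<xi>"
      by (rule vertical_is_fundamental[OF p kT k0]) (rule that)
    have "\<xi> = a p (k - ?h)" unfolding \<xi>(2) using X_props(2)[OF p \<xi>(1)] by simp
    also have "\<dots> = a p k - a p ?h" by (rule linear_diff[OF a_linear[OF p]])
    finally have "\<xi> = 0" using 1 k(2) by simp
    then have "k - ?h = 0" using \<xi>(2) linear_0[OF X_linear[OF p]] by simp
    then show ?thesis by simp
  qed
  then have uniq: "k = ?h" if "k \<in> tangent_space P p \<and> a p k = 0 \<and> mdiff P pr p k = mdiff P pr p h" for k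
    using that by blast
  show "hlift Q A p (mdiff P pr p h) = ?h"
    unfolding hlift_def by (rule the_equality, intro conjI T 1 2, rule uniq)
qed

lemma lift_exists:
  assumes p: "p \<in> P" and u: "u \<in> tangent_space M (pr p)"
  obtains h where "h \<in> tangent_space P p" "mdiff P pr p h = u"
proof -
  obtain U s where s: "open U" "pr p \<in> U" "smooth_on (M \<inter> U) s" "s (pr p) = p"
    "\<And>x. x \<in> M \<Longrightarrow> x \<in> U \<Longrightarrow> s x \<in> P \<and> pr (s x) = x"
    by (rule local_section[OF p]) (rule that)
  obtain T c where c: "Cinf T c" "(0::real) \<in> T" "\<And>t. t \<in> T \<Longrightarrow> c t \<in> M" "c 0 = pr p" "dd c 0 1 = u"
    by (rule tangent_spaceE[OF u]) (rule that)
  define T' where "T' = T \<inter> c -` U"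
  have oT': "open T'" unfolding T'_def
    by (rule continuous_open_preimage[OF Cinf_continuous_on[OF c(1)] Cinf_open[OF c(1)] s(1)])
  have c': "Cinf T' c" by (rule Cinf_subset[OF c(1) oT']) (simp add: T'_def)
  have cM: "c t \<in> M \<inter> U" if "t \<in> T'" for t using that c(3) by (simp add: T'_def)
  have 0: "0 \<in> T'" using c s(2) by (simp add: T'_def)
  have C: "Cinf T' (\<lambda>t. s (c t))" by (rule Cinf_pull[OF c' cM s(3)])
  have sP: "s (c t) \<in> P" if "t \<in> T'" for t using cM[OF that] s(5) by blast
  have 1: "dd (\<lambda>t. s (c t)) 0 1 \<in> tangent_space P p" using tangent_spaceI[OF C 0 sP] c(4) s(4) by simp
  have "mdiff P pr p (dd (\<lambda>t. s (c t)) 0 1) = dd (\<lambda>t. pr (s (c t))) 0 1"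
    using dd_pull[OF C sP P_facts(2) 0, of 1] c(4) s(4) by simp
  also have "\<dots> = dd c 0 1" by (rule dd_cong[OF oT' 0]) (use cM s(5) in blast)
  finally show ?thesis using that[OF 1] c(5) by simp
qed

text \<open>Differentiate \<open>cadj g ** g = mat 1\<close> along a curve in G. Skewness makes the
  bracket with a Lie algebra element skew for the real inner product of matrices.\<close>

lemma lie_skew:
  assumes "\<xi> \<in> lie_algebra G" shows "cadj \<xi> = - \<xi>"
proof -
  obtain U \<gamma> where \<gamma>: "Cinf U \<gamma>" "(0::real) \<in> U" "\<And>t. t \<in> U \<Longrightarrow> \<gamma> t \<in> G" "\<gamma> 0 = mat 1" "dd \<gamma> 0 1 = \<xi>"
    by (rule lieE[OF assms]) (rule that)
  have C: "Cinf U (\<lambda>t. cadj (\<gamma> t))" by (rule Cinf_blinear[OF bounded_linear_cadj \<gamma>(1)])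
  have d: "dd (\<lambda>t. cadj (\<gamma> t)) 0 1 = cadj \<xi>"
    using frechet_derivative_bounded_linear_compose[OF bounded_linear_cadj Cinf_differentiable[OF \<gamma>(1,2)]] \<gamma>(5) by simp
  have "0 = dd (\<lambda>t. mat 1 :: complex^'n^'n) (0::real) 1" by (simp add: frechet_derivative_const)
  also have "\<dots> = dd (\<lambda>t. cadj (\<gamma> t) ** \<gamma> t) 0 1"
    by (rule dd_cong[OF Cinf_open[OF C] \<gamma>(2)]) (use grp(2) \<gamma>(3) in simp)
  also have "\<dots> = \<xi> + cadj \<xi>"
    using dd_bilinear[OF bounded_bilinear_matrix_mult Cinf_differentiable[OF C \<gamma>(2)] Cinf_differentiable[OF \<gamma>(1,2)], of 1]
    by (simp add: \<gamma>(4,5) d cadj_one)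
  finally show ?thesis by (metis add_eq_0_iff)
qed

lemma ad_derivative:
  assumes \<gamma>: "Cinf U \<gamma>" "(0::real) \<in> U" "\<And>t. t \<in> U \<Longrightarrow> \<gamma> t \<in> G" "\<gamma> 0 = mat 1"
  shows "dd (\<lambda>t. cadj (\<gamma> t) ** Y ** \<gamma> t) 0 1 = - bracket (dd \<gamma> 0 1) Y"
proof -
  have \<xi>: "dd \<gamma> 0 1 \<in> lie_algebra G" using tangent_spaceI[OF \<gamma>(1,2,3)] \<gamma>(4) by (simp add: lie_algebra_def)
  have C1: "Cinf U (\<lambda>t. cadj (\<gamma> t) ** Y)"
    by (rule Cinf_blinear[OF mat.bounded_linear_left Cinf_blinear[OF bounded_linear_cadj \<gamma>(1)]])
  have d: "dd (\<lambda>t. cadj (\<gamma> t) ** Y) 0 1 = cadj (dd \<gamma> 0 1) ** Y"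
    using frechet_derivative_bounded_linear_compose[OF bounded_linear_compose[OF mat.bounded_linear_left bounded_linear_cadj] Cinf_differentiable[OF \<gamma>(1,2)], of Y 1] by simp
  show ?thesis
    using dd_bilinear[OF bounded_bilinear_matrix_mult Cinf_differentiable[OF C1 \<gamma>(2)] Cinf_differentiable[OF \<gamma>(1,2)], of 1]
    by (simp add: \<gamma>(4) d cadj_one lie_skew[OF \<xi>] bracket_def mat.minus_left)
qed

text \<open>The derivative of the equivariance of \<Phi> at the identity of G.\<close>

lemma cov_deriv_vertical:
  assumes \<Phi>: "higgs_field Q \<Phi>" and p: "p \<in> P" and \<xi>: "\<xi> \<in> lie_algebra G"
  shows "mdiff P \<Phi> p (X p \<xi>) = - bracket \<xi> (\<Phi> p)"
proof -
  obtain U \<gamma> where \<gamma>: "Cinf U \<gamma>" "(0::real) \<in> U" "\<And>t. t \<in> U \<Longrightarrow> \<gamma> t \<in> G" "\<gamma> 0 = mat 1" "dd \<gamma> 0 1 = \<xi>"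
    by (rule lieE[OF \<xi>]) (rule that)
  have s\<Phi>: "smooth_on P \<Phi>" and eq: "\<And>p g. p \<in> P \<Longrightarrow> g \<in> G \<Longrightarrow> \<Phi> (ac p g) = cadj g ** \<Phi> p ** g"
    using \<Phi> unfolding higgs_field_def by auto
  have X: "X p \<xi> = dd (\<lambda>t. ac p (\<gamma> t)) 0 1" using X_curve[OF p \<gamma>(1-4)] \<gamma>(5) by simp
  have C: "Cinf U (\<lambda>t. ac p (\<gamma> t))" by (rule Cinf_pull[OF \<gamma>(1,3) act_smooth(1)[OF p]])
  have P: "ac p (\<gamma> t) \<in> P" if "t \<in> U" for t using P_facts(5)[OF p \<gamma>(3)[OF that]] .
  have "mdiff P \<Phi> p (X p \<xi>) = dd (\<lambda>t. \<Phi> (ac p (\<gamma> t))) 0 1"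
    unfolding X using dd_pull[OF C P s\<Phi> \<gamma>(2), of 1] P_facts(7)[OF p] \<gamma>(4) by simp
  also have "\<dots> = dd (\<lambda>t. cadj (\<gamma> t) ** \<Phi> p ** \<gamma> t) 0 1"
    by (rule dd_cong[OF Cinf_open[OF C] \<gamma>(2)]) (rule eq[OF p \<gamma>(3)])
  also have "\<dots> = - bracket \<xi> (\<Phi> p)" using ad_derivative[OF \<gamma>(1-4)] \<gamma>(5) by simp
  finally show ?thesis .
qed

text \<open>Subtracting a fundamental vector from the lift changes d\<Phi> and [A, \<Phi>] by
  opposite amounts, so every lift computes the same value.\<close>

lemma cov_deriv_eq:
  assumes \<Phi>: "higgs_field Q \<Phi>" and p: "p \<in> P" and h: "h 0 \<in> tangent_space P p" and v: "v 0 = mdiff P pr p (h 0)"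
  shows "cov_deriv Q A \<Phi> p v = mdiff P \<Phi> p (h 0) + bracket (a p (h 0)) (\<Phi> p)"
proof -
  have s\<Phi>: "smooth_on P \<Phi>" using \<Phi> unfolding higgs_field_def by auto
  have l: "a p (h 0) \<in> lie_algebra G" by (rule connD(2)[OF p h])
  show ?thesis
    unfolding cov_deriv_def descend_def cov_deriv_on_P_def v hlift_eq(1)[OF p h]
    by (simp add: linear_diff[OF mdiff_linear[OF s\<Phi> p]] linear_diff[OF a_linear[OF p]] X_props(2)[OF p l]
        cov_deriv_vertical[OF \<Phi> p l] br.zero_left)
qed

section \<open>Curvature as a basic form\<close>

definition DA :: "'p \<Rightarrow> 'p \<Rightarrow> 'p \<Rightarrow> complex^'n^'n" where
  "DA p u w = mdiff P (\<lambda>q. a q w) p u"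

lemma a_smooth: "smooth_on P (\<lambda>q. a q w)"
  using form_smooth[OF connD(1)] .

lemma D_linear1: "p \<in> P \<Longrightarrow> linear (\<lambda>u. DA p u w)"
  unfolding DA_def by (rule mdiff_linear[OF a_smooth])

text \<open>As \<open>mdiff\<close> is a chosen derivative, additivity in w is not formal: for
  tangent u the derivative is computed along a curve in P, where it is unique.\<close>

lemma D_diff2:
  assumes p: "p \<in> P" and u: "u \<in> tangent_space P p"
  shows "DA p u (w - w') = DA p u w - DA p u w'"
proof -
  obtain T c where c: "Cinf T c" "(0::real) \<in> T" "\<And>t. t \<in> T \<Longrightarrow> c t \<in> P" "c 0 = p" "dd c 0 1 = u"
    by (rule tangent_spaceE[OF u]) (rule that)
  have D: "DA p u w = dd (\<lambda>t. a (c t) w) 0 1" for w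
    unfolding DA_def using dd_pull[OF c(1,3) a_smooth c(2), where v = 1] c(4,5) by simp
  have C: "Cinf T (\<lambda>t. a (c t) w)" for w by (rule Cinf_pull[OF c(1,3) a_smooth])
  have "dd (\<lambda>t. a (c t) (w - w')) 0 1 = dd (\<lambda>t. a (c t) w - a (c t) w') 0 1"
    by (rule dd_cong[OF Cinf_open[OF c(1)] c(2)]) (rule linear_diff[OF a_linear[OF c(3)]])
  also have "\<dots> = dd (\<lambda>t. a (c t) w) 0 1 - dd (\<lambda>t. a (c t) w') 0 1"
    by (rule dd_eqI) (intro has_derivative_diff Cinf_has_derivative[OF C c(2)])
  finally show ?thesis unfolding D .
qed

lemma ext_deriv_D: "p \<in> P \<Longrightarrow> ext_deriv P 1 A p v = DA p (v 0) (v 1) - DA p (v 1) (v 0)"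
proof -
  assume p: "p \<in> P"
  have tr: "(f has_derivative F) (at p within P)"
    if "\<And>y. y \<in> P \<Longrightarrow> f y = g y" "(g has_derivative F) (at p within P)" for f g :: "'p \<Rightarrow> complex^'n^'n" and F
    by (rule has_derivative_transform[OF p that])
  \<comment> \<open>The two functions agree on P, hence have the same derivatives within P, and the
    choice operator picks the same one for both.\<close>
  have "(\<lambda>F. ((\<lambda>y. A y w) has_derivative F) (at p within P)) = (\<lambda>F. ((\<lambda>y. a y (w 0)) has_derivative F) (at p within P))" for w
    using tr[of "\<lambda>y. A y w" "\<lambda>y. a y (w 0)", OF A_a] tr[of "\<lambda>y. a y (w 0)" "\<lambda>y. A y w", OF A_a[symmetric]]
    by (intro ext iffI) assumption+
  from arg_cong[where f = Eps, OF this]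
  have m: "mdiff P (\<lambda>y. A y w) p = mdiff P (\<lambda>y. a y (w 0)) p" for w
    unfolding mdiff_def frechet_derivative_def .
  show ?thesis
    unfolding ext_deriv_def DA_def by (simp add: m[of "\<lambda>j. if j < i then v j else v (Suc j)" for i])
qed

lemma curvature_bilinear:
  "p \<in> P \<Longrightarrow> curvature_on_P Q A p v = DA p (v 0) (v 1) - DA p (v 1) (v 0) + bracket (a p (v 0)) (a p (v 1))"
  by (simp add: curvature_on_P_def ext_deriv_D del: One_nat_def)

text \<open>On the surface q(s, t) = c(t) \<gamma>(s) the connection form is explicit: it is
  constantly \<xi> on the s-direction at s = 0, and at t = 0 it is
  \<open>cadj (\<gamma> s) ** a p w ** \<gamma> s\<close> on the t-direction, with derivative
  -[\<xi>, A(w)] at s = 0. Pulling dA back to this surface gives the claim.\<close>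

lemma curvature_vertical:
  assumes p: "p \<in> P" and \<xi>: "\<xi> \<in> lie_algebra G" and w: "w \<in> tangent_space P p"
  shows "DA p (X p \<xi>) w - DA p w (X p \<xi>) + bracket \<xi> (a p w) = 0"
proof -
  obtain S \<gamma> where \<gamma>: "Cinf S \<gamma>" "(0::real) \<in> S" "\<And>t. t \<in> S \<Longrightarrow> \<gamma> t \<in> G" "\<gamma> 0 = mat 1" "dd \<gamma> 0 1 = \<xi>"
    by (rule lieE[OF \<xi>]) (rule that)
  obtain T c where c: "Cinf T c" "(0::real) \<in> T" "\<And>t. t \<in> T \<Longrightarrow> c t \<in> P" "c 0 = p" "dd c 0 1 = w"
    by (rule tangent_spaceE[OF w]) (rule that)
  define q where "q z = ac (c (snd z)) (\<gamma> (fst z))" for z :: "real \<times> real"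
  have oU: "open (S \<times> T)" using Cinf_open[OF \<gamma>(1)] Cinf_open[OF c(1)] by (rule open_Times)
  have qC: "Cinf (S \<times> T) q"
  proof -
    have "Cinf (S \<times> T) (\<lambda>z. c (snd z))" by (rule Cinf_compose[OF Cinf_linear_map[OF linear_snd oU] c(1)]) auto
    moreover have "Cinf (S \<times> T) (\<lambda>z. \<gamma> (fst z))" by (rule Cinf_compose[OF Cinf_linear_map[OF linear_fst oU] \<gamma>(1)]) auto
    ultimately have "Cinf (S \<times> T) (\<lambda>z. (c (snd z), \<gamma> (fst z)))" by (rule Cinf_Pair)
    from Cinf_pull[OF this _ P_facts(4)] show ?thesis using c(3) \<gamma>(3) by (auto simp: q_def[abs_def])
  qed
  have qP: "q z \<in> P" if "z \<in> S \<times> T" for z using that P_facts(5) c(3) \<gamma>(3) by (auto simp: q_def)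
  have e1: "dd F (0, 0) (1, 0) = dd (\<lambda>s. F (s, 0)) 0 1" and e1': "t \<in> T \<Longrightarrow> dd F (0, t) (1, 0) = dd (\<lambda>s. F (s, t)) 0 1"
    and e2: "dd F (0, 0) (0, 1) = dd (\<lambda>t. F (0, t)) 0 1" and e2': "s \<in> S \<Longrightarrow> dd F (s, 0) (0, 1) = dd (\<lambda>t. F (s, t)) 0 1"
    if "Cinf (S \<times> T) F" for F :: "real \<times> real \<Rightarrow> 'z::real_normed_vector" and s t
  proof -
    have 1: "dd F (0, t) (1, 0) = dd (\<lambda>s. F (s, t)) 0 1" if "t \<in> T" for t
    proof -
      have "((\<lambda>s. (s, t)) has_derivative (\<lambda>s. (s, 0))) (at (0::real))" by (auto intro!: derivative_eq_intros)
      from has_derivative_compose[OF this Cinf_has_derivative[OF \<open>Cinf (S \<times> T) F\<close>]] show ?thesis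
        using that \<gamma>(2) dd_eqI[of "\<lambda>s. F (s, t)"] by (metis SigmaI)
    qed
    have 2: "dd F (s, 0) (0, 1) = dd (\<lambda>t. F (s, t)) 0 1" if "s \<in> S" for s
    proof -
      have "((\<lambda>t. (s, t)) has_derivative (\<lambda>t. (0, t))) (at (0::real))" by (auto intro!: derivative_eq_intros)
      from has_derivative_compose[OF this Cinf_has_derivative[OF \<open>Cinf (S \<times> T) F\<close>]] show ?thesis
        using that c(2) dd_eqI[of "\<lambda>t. F (s, t)"] by (metis SigmaI)
    qed
    show "dd F (0, 0) (1, 0) = dd (\<lambda>s. F (s, 0)) 0 1" "t \<in> T \<Longrightarrow> dd F (0, t) (1, 0) = dd (\<lambda>s. F (s, t)) 0 1"
      "dd F (0, 0) (0, 1) = dd (\<lambda>t. F (0, t)) 0 1" "s \<in> S \<Longrightarrow> dd F (s, 0) (0, 1) = dd (\<lambda>t. F (s, t)) 0 1"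
      using 1 2 c(2) \<gamma>(2) by auto
  qed
  have z0: "(0, 0) \<in> S \<times> T" using c(2) \<gamma>(2) by simp
  have q0: "q (0, 0) = p" using c(4) \<gamma>(4) P_facts(7)[OF p] by (simp add: q_def)
  have qs: "dd q (0, t) (1, 0) = X (c t) \<xi>" if t: "t \<in> T" for t
    using e1'[OF qC t] X_curve[OF c(3)[OF t] \<gamma>(1-4)] \<gamma>(5) by (simp add: q_def)
  have qt: "dd q (s, 0) (0, 1) = mdiff P (\<lambda>q. ac q (\<gamma> s)) p w" if s: "s \<in> S" for s
    using e2'[OF qC s] dd_pull[OF c(1,3) act_smooth(2)[OF \<gamma>(3)[OF s]] c(2), of 1] c(4,5) by (simp add: q_def)
  have FC: "Cinf (S \<times> T) (\<lambda>z. a (q z) (dd q z v))" for v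
    by (rule form_pull_Cinf[OF connD(1) qC qP]) (auto intro: Cinf_deriv[OF qC])
  have 1: "dd (\<lambda>z. a (q z) (dd q z (0, 1))) (0, 0) (1, 0) = - bracket \<xi> (a p w)"
  proof -
    have "dd (\<lambda>z. a (q z) (dd q z (0, 1))) (0, 0) (1, 0) = dd (\<lambda>s. a (q (s, 0)) (dd q (s, 0) (0, 1))) 0 1"
      by (rule e1[OF FC])
    also have "\<dots> = dd (\<lambda>s. cadj (\<gamma> s) ** a p w ** \<gamma> s) 0 1"
    proof (rule dd_cong[OF Cinf_open[OF \<gamma>(1)] \<gamma>(2)])
      fix s assume s: "s \<in> S"
      show "a (q (s, 0)) (dd q (s, 0) (0, 1)) = cadj (\<gamma> s) ** a p w ** \<gamma> s"
        unfolding qt[OF s] using connD(4)[OF p \<gamma>(3)[OF s] w] c(4) by (simp add: q_def)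
    qed
    also have "\<dots> = - bracket \<xi> (a p w)" using ad_derivative[OF \<gamma>(1-4)] \<gamma>(5) by simp
    finally show ?thesis .
  qed
  have 2: "dd (\<lambda>z. a (q z) (dd q z (1, 0))) (0, 0) (0, 1) = 0"
  proof -
    have "dd (\<lambda>z. a (q z) (dd q z (1, 0))) (0, 0) (0, 1) = dd (\<lambda>t. a (q (0, t)) (dd q (0, t) (1, 0))) 0 1"
      by (rule e2[OF FC])
    also have "\<dots> = dd (\<lambda>t::real. \<xi>) 0 1"
    proof (rule dd_cong[OF Cinf_open[OF c(1)] c(2)])
      fix t assume t: "t \<in> T"
      show "a (q (0, t)) (dd q (0, t) (1, 0)) = \<xi>"
        unfolding qs[OF t] using X_props(2)[OF c(3)[OF t] \<xi>] \<gamma>(4) P_facts(7)[OF c(3)[OF t]] by (simp add: q_def)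
    qed
    finally show ?thesis by (simp add: frechet_derivative_const)
  qed
  define u :: "nat \<Rightarrow> real \<times> real" where "u i = (if i = 0 then (1, 0) else (0, 1))" for i
  have Au: "A (q z) (\<lambda>j. dd q z (w j)) = a (q z) (dd q z (w 0))" if "z \<in> S \<times> T" for z w
    by (rule A_a[OF qP[OF that]])
  have 3: "dd (\<lambda>z. A (q z) (\<lambda>j. dd q z (w j))) (0, 0) v = dd (\<lambda>z. a (q z) (dd q z (w 0))) (0, 0) v" for w v
    by (rule dd_cong[OF oU z0]) (rule Au)
  have "ext_deriv P 1 A (q (0, 0)) (\<lambda>j. dd q (0, 0) (u j)) =
      (\<Sum>i\<le>1. (-1) ^ i *\<^sub>R dd (\<lambda>z. A (q z) (\<lambda>j. dd q z (if j < i then u j else u (Suc j)))) (0, 0) (u i))"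
    by (rule ext_deriv_pullback[OF connD(1) qC qP z0, symmetric])
  also have "\<dots> = (\<Sum>i\<le>1. (-1) ^ i *\<^sub>R dd (\<lambda>z. a (q z) (dd q z (if 0 < i then u 0 else u (Suc 0)))) (0, 0) (u i))"
    by (rule sum.cong[OF refl], subst 3, rule refl)
  also have "\<dots> = - bracket \<xi> (a p w)" by (simp add: u_def 1 2)
  finally have "ext_deriv P 1 A (q (0, 0)) (\<lambda>j. dd q (0, 0) (u j)) = - bracket \<xi> (a p w)" .
  moreover have "dd q (0, 0) (u 0) = X p \<xi>" using qs[OF c(2)] c(4) by (simp add: u_def)
  moreover have "dd q (0, 0) (u 1) = w"
  proof -
    have "dd q (0, 0) (0, 1) = dd (\<lambda>t. q (0, t)) 0 1" by (rule e2[OF qC])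
    also have "\<dots> = dd c 0 1"
      by (rule dd_cong[OF Cinf_open[OF c(1)] c(2)]) (simp add: q_def \<gamma>(4) P_facts(7)[OF c(3)])
    finally show ?thesis using c(5) by (simp add: u_def)
  qed
  ultimately show ?thesis unfolding q0 ext_deriv_D[OF p] by simp
qed

text \<open>The bilinear curvature expression vanishes when one entry is fundamental, so the
  corrections that make the lifts horizontal drop out.\<close>

lemma curvature_eq:
  assumes p: "p \<in> P" and h: "h 0 \<in> tangent_space P p" "h 1 \<in> tangent_space P p"
    and v: "v 0 = mdiff P pr p (h 0)" "v 1 = mdiff P pr p (h 1)"
  shows "curvature Q A p v = ext_deriv P 1 A p h + bracket (a p (h 0)) (a p (h 1))"
proof -
  let ?B = "\<lambda>u w. DA p u w - DA p w u + bracket (a p u) (a p w)"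
  have l: "a p (h 0) \<in> lie_algebra G" "a p (h 1) \<in> lie_algebra G" using connD(2)[OF p] h by auto
  have B1: "?B (u - u') w = ?B u w - ?B u' w" if "w \<in> tangent_space P p" for u u' w
    by (simp add: linear_diff[OF D_linear1[OF p]] D_diff2[OF p that] linear_diff[OF a_linear[OF p]] br.diff_left)
  have B2: "?B w (u - u') = ?B w u - ?B w u'" if "w \<in> tangent_space P p" for u u' w
    by (simp add: linear_diff[OF D_linear1[OF p]] D_diff2[OF p that] linear_diff[OF a_linear[OF p]] br.diff_right)
  have BX: "?B (X p \<xi>) w = 0" if "\<xi> \<in> lie_algebra G" "w \<in> tangent_space P p" for \<xi> w
    using curvature_vertical[OF p that] X_props(2)[OF p that(1)] by simp
  have BX': "?B w (X p \<xi>) = 0" if "\<xi> \<in> lie_algebra G" "w \<in> tangent_space P p" for \<xi> w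
    using BX[OF that] bracket_antisym[of "a p w" "a p (X p \<xi>)"] by (simp add: algebra_simps)
  have "curvature Q A p v = ?B (h 0 - X p (a p (h 0))) (h 1 - X p (a p (h 1)))"
    unfolding curvature_def descend_def curvature_bilinear[OF p] v hlift_eq(1)[OF p h(1)] hlift_eq(1)[OF p h(2)] ..
  also have "\<dots> = ?B (h 0) (h 1)"
    using B1[OF hlift_eq(2)[OF p h(2)]] B2[OF h(1)] BX[OF l(1) hlift_eq(2)[OF p h(2)]] BX'[OF l(2) h(1)] by simp
  finally show ?thesis unfolding ext_deriv_D[OF p] .
qed

lemma zero_higgs: "higgs_field Q (\<lambda>_. 0)"
proof -
  have "0 \<in> lie_algebra G" using lie_subspace by (rule subspace_0)
  then show ?thesis by (simp add: higgs_field_def smooth_on_const mat.zero_left mat.zero_right)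
qed

lemma cov_deriv_zero:
  assumes p: "p \<in> P" and v: "v 0 \<in> tangent_space M (pr p)"
  shows "cov_deriv Q A (\<lambda>_. 0) p v = 0"
proof -
  obtain h where h: "h \<in> tangent_space P p" "mdiff P pr p h = v 0" by (rule lift_exists[OF p v]) (rule that)
  obtain T c where c: "Cinf T c" "(0::real) \<in> T" "\<And>t. t \<in> T \<Longrightarrow> c t \<in> P" "c 0 = p" "dd c 0 1 = h"
    by (rule tangent_spaceE[OF h(1)]) (rule that)
  have "mdiff P (\<lambda>_. 0 :: complex^'n^'n) p h = 0"
    using dd_pull[OF c(1,3) smooth_on_const c(2), of "0 :: complex^'n^'n" 1] c(4,5) by (simp add: frechet_derivative_const)
  then show ?thesis using cov_deriv_eq[OF zero_higgs p, of "\<lambda>_. h" v] h by (simp add: br.zero_right)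
qed

end

section \<open>The geometry of an adiabatic fibration\<close>

text \<open>On ambient vectors \<open>ext_deriv\<close> involves the arbitrary part of
  \<open>mdiff\<close> and may fail to be alternating. On the image of a differential it is an
  alternation, by naturality and the coset formula.\<close>

lemma ext_deriv_altform:
  fixes S :: "'a::euclidean_space set" and \<alpha> :: "'a \<Rightarrow> (nat \<Rightarrow> 'a) \<Rightarrow> 'v::real_normed_vector"
  assumes \<alpha>: "form S k \<alpha>" and q: "Cinf U q" "\<And>y. y \<in> U \<Longrightarrow> q y \<in> S" and y: "y \<in> U"
  shows "altform (Suc k) (\<lambda>u. ext_deriv S k \<alpha> (q y) (\<lambda>j. dd q y (u j)))"
proof -
  define \<gamma> where "\<gamma> z v = \<alpha> (q z) (\<lambda>j. dd q z (v j))" for z v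
  define T where "T u = dd (\<lambda>z. \<gamma> z (\<lambda>j. u (Suc j))) y (u 0)" for u
  have oU: "open U" by (rule Cinf_open[OF q(1)])
  have alt: "altform k (\<gamma> z)" if "z \<in> U" for z
    unfolding \<gamma>_def[abs_def] by (rule altform_linear_map[OF form_altform[OF \<alpha> q(2)[OF that]] Cinf_linear[OF q(1) that]])
  have C: "Cinf U (\<lambda>z. \<gamma> z v)" for v
    unfolding \<gamma>_def by (rule form_pull_Cinf[OF \<alpha> q(1)]) (use q Cinf_deriv in auto)
  have scale: "dd (\<lambda>z. c *\<^sub>R F z) y h = c *\<^sub>R dd F y h" if "Cinf U F" for c F h
    by (rule dd_eqI) (rule has_derivative_scaleR_right[OF Cinf_has_derivative[OF that y]])
  have Tperm: "T (u \<circ> shiftp 1 \<rho>) = sgnp \<rho> *\<^sub>R T u" if "\<rho> permutes {..<k}" for u \<rho>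
  proof -
    have "(\<lambda>j. (u \<circ> shiftp 1 \<rho>) (Suc j)) = (\<lambda>j. u (Suc j)) \<circ> \<rho>" by (simp add: fun_eq_iff shiftp_def)
    then have "T (u \<circ> shiftp 1 \<rho>) = dd (\<lambda>z. \<gamma> z ((\<lambda>j. u (Suc j)) \<circ> \<rho>)) y (u 0)"
      unfolding T_def by (simp add: shiftp_def)
    also have "\<dots> = dd (\<lambda>z. sgnp \<rho> *\<^sub>R \<gamma> z (\<lambda>j. u (Suc j))) y (u 0)"
      by (rule dd_cong[OF oU y]) (rule altform_permute[OF alt that])
    finally show ?thesis using scale[OF C] by (simp add: T_def)
  qed
  have mT: "mlin (Suc k) T"
    unfolding mlin_def
  proof (intro conjI allI impI)
    fix v w :: "nat \<Rightarrow> 'b" assume vw: "\<forall>i<Suc k. v i = w i"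
    have "T v = dd (\<lambda>z. \<gamma> z (\<lambda>j. w (Suc j))) y (v 0)"
      unfolding T_def by (rule dd_cong[OF oU y]) (rule altform_cong[OF alt], use vw in auto)
    then show "T v = T w" using vw by (simp add: T_def)
  next
    fix v :: "nat \<Rightarrow> 'b" and i assume i: "i < Suc k"
    show "linear (\<lambda>u. T (v(i := u)))"
    proof (cases i)
      case 0
      then show ?thesis using Cinf_linear[OF C y] by (simp add: T_def)
    next
      case (Suc l)
      then have l: "l < k" using i by simp
      have e: "(\<lambda>j. (v(Suc l := u)) (Suc j)) = (\<lambda>j. v (Suc j))(l := u)" for u by auto
      have lin: "linear (\<lambda>u. \<gamma> z ((\<lambda>j. v (Suc j))(l := u)))" if "z \<in> U" for z by (rule altform_linear[OF alt[OF that] l])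
      show ?thesis
      proof (rule linearI)
        fix a b and c :: real
        have "T (v(i := a + b)) = dd (\<lambda>z. \<gamma> z ((\<lambda>j. v (Suc j))(l := a)) + \<gamma> z ((\<lambda>j. v (Suc j))(l := b))) y (v 0)"
          unfolding T_def Suc e by (simp, rule dd_cong[OF oU y]) (rule linear_add[OF lin])
        also have "\<dots> = T (v(i := a)) + T (v(i := b))"
          unfolding T_def Suc e by (simp, rule dd_eqI) (rule has_derivative_add[OF Cinf_has_derivative[OF C y] Cinf_has_derivative[OF C y]])
        finally show "T (v(i := a + b)) = T (v(i := a)) + T (v(i := b))" .
        have "T (v(i := c *\<^sub>R a)) = dd (\<lambda>z. c *\<^sub>R \<gamma> z ((\<lambda>j. v (Suc j))(l := a))) y (v 0)"
          unfolding T_def Suc e by (simp, rule dd_cong[OF oU y]) (rule linear_scale[OF lin])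
        then show "T (v(i := c *\<^sub>R a)) = c *\<^sub>R T (v(i := a))"
          unfolding scale[OF C] by (simp only: T_def Suc e) simp
      qed
    qed
  qed
  \<comment> \<open>The summand with coefficient 0 gives the expression the shape of
    \<open>altform_lincomb\<close>.\<close>
  have eq: "ext_deriv S k \<alpha> (q y) (\<lambda>j. dd q y (u j)) = (1 / fact k) *\<^sub>R alt_sum (Suc k) T u + 0 *\<^sub>R alt_sum (Suc k) T u" for u
  proof -
    have "T (u \<circ> cyc i) = dd (\<lambda>z. \<alpha> (q z) (\<lambda>j. dd q z (if j < i then u j else u (Suc j)))) y (u i)" for i
      unfolding T_def cyc_comp \<gamma>_def by (simp add: cyc_def)
    then have 1: "ext_deriv S k \<alpha> (q y) (\<lambda>j. dd q y (u j)) = (\<Sum>i\<le>k. (-1) ^ i *\<^sub>R T (u \<circ> cyc i))"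
      using ext_deriv_pullback[OF \<alpha> q y, of u] by simp
    have 2: "alt_sum (Suc k) T u = fact k *\<^sub>R (\<Sum>i\<le>k. (-1) ^ i *\<^sub>R T (u \<circ> cyc i))"
      by (rule alt_sum_cosets[OF Tperm])
    show ?thesis unfolding 1 2 by simp
  qed
  show ?thesis
    unfolding eq by (rule altform_lincomb[OF alt_sum_altform[OF mT] alt_sum_altform[OF mT]])
qed

text \<open>Send v to the combination of a basis of L with coefficients \<open>\<theta> i v\<close>.
  This map is injective on L, hence onto L by dimension, and preimages of the basis vectors form the
  dual frame.\<close>

lemma coframe_dual:
  fixes L :: "'a::euclidean_space set"
  assumes L: "subspace L" and \<theta>: "coframe L n \<theta>"
  obtains \<epsilon> where "\<And>j. j < n \<Longrightarrow> \<epsilon> j \<in> L" "\<And>i j. i < n \<Longrightarrow> j < n \<Longrightarrow> \<theta> i (\<epsilon> j) = (if i = j then 1 else 0)"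
    "\<And>j. n \<le> j \<Longrightarrow> \<epsilon> j = 0"
proof -
  obtain B where B: "B \<subseteq> L" "independent B" "span B = L" "card B = dim L"
    using basis_exists[of L] L by (metis span_eq_iff span_mono subset_antisym)
  have dimL: "dim L = n" and lin: "\<And>i. i < n \<Longrightarrow> linear (\<theta> i)" and inj: "\<And>v. v \<in> L \<Longrightarrow> (\<And>i. i < n \<Longrightarrow> \<theta> i v = 0) \<Longrightarrow> v = 0"
    using \<theta> unfolding coframe_def by auto
  have fB: "finite B" using B(2) independent_imp_finite by blast
  obtain b where b: "bij_betw b {..<n} B"
    using ex_bij_betw_nat_finite[OF fB] B(4) dimL by (auto simp: lessThan_atLeast0)
  define T where "T v = (\<Sum>i<n. \<theta> i v *\<^sub>R b i)" for v
  have linT: "linear T" unfolding T_def[abs_def] using lin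
    by (intro linear_compose_sum ballI) (auto intro!: linearI simp: linear_add linear_scale scaleR_add_left)
  have coeff: "c i = d i" if "(\<Sum>i<n. c i *\<^sub>R b i) = (\<Sum>i<n. d i *\<^sub>R b i)" "i < n" for c d :: "nat \<Rightarrow> real" and i
  proof -
    define u where "u x = c (inv_into {..<n} b x) - d (inv_into {..<n} b x)" for x
    have ub: "u (b i) = c i - d i" if "i < n" for i
      using b that by (simp add: u_def bij_betw_def)
    have "(\<Sum>x\<in>B. u x *\<^sub>R x) = (\<Sum>i<n. u (b i) *\<^sub>R b i)" by (rule sum.reindex_bij_betw[OF b, symmetric])
    also have "\<dots> = (\<Sum>i<n. c i *\<^sub>R b i) - (\<Sum>i<n. d i *\<^sub>R b i)"
      unfolding sum_subtractf[symmetric] by (rule sum.cong) (auto simp: ub scaleR_diff_left)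
    finally have "(\<Sum>x\<in>B. u x *\<^sub>R x) = 0" using that(1) by simp
    then have "\<forall>x\<in>B. u x = 0" using B(2) independent_explicit by blast
    moreover have "b i \<in> B" using b that(2) by (auto simp: bij_betw_def)
    ultimately have "u (b i) = 0" by blast
    then show ?thesis using ub[OF that(2)] by simp
  qed
  have injT: "inj_on T L"
  proof (rule inj_onI)
    fix v w assume vw: "v \<in> L" "w \<in> L" "T v = T w"
    have "v - w = 0"
    proof (rule inj)
      show "v - w \<in> L" using L vw by (simp add: subspace_diff)
      show "\<theta> i (v - w) = 0" if "i < n" for i
        using coeff[OF vw(3)[unfolded T_def] that] linear_diff[OF lin[OF that]] by simp
    qed
    then show "v = w" by simp
  qed
  have sub: "T ` L \<subseteq> L"
    unfolding T_def using b B(1) L by (auto simp: bij_betw_def intro!: subspace_sum subspace_scale)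
  have "dim (T ` L) = dim L" using dim_image_eq[OF linT] injT L by (simp add: span_eq_iff[THEN iffD2])
  then have TL: "T ` L = L" using subspace_dim_equal[OF linear_subspace_image[OF linT L] L sub] by simp
  define \<epsilon> where "\<epsilon> j = (if j < n then (SOME v. v \<in> L \<and> T v = b j) else 0)" for j
  have \<epsilon>: "\<epsilon> j \<in> L \<and> T (\<epsilon> j) = b j" if "j < n" for j
  proof -
    have "b j \<in> T ` L" using TL b B(1) that by (auto simp: bij_betw_def)
    then have "\<exists>v. v \<in> L \<and> T v = b j" by auto
    from someI_ex[OF this] show ?thesis using that by (simp add: \<epsilon>_def)
  qed
  have "\<theta> i (\<epsilon> j) = (if i = j then 1 else 0)" if "i < n" "j < n" for i j
  proof -
    have "(\<Sum>i<n. (if i = j then 1 else 0) *\<^sub>R b i) = b j"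
      using that by (simp add: if_distrib[of "\<lambda>x. x *\<^sub>R _"] cong: if_cong)
    then have "(\<Sum>i<n. \<theta> i (\<epsilon> j) *\<^sub>R b i) = (\<Sum>i<n. (if i = j then 1 else 0) *\<^sub>R b i)"
      using \<epsilon>[OF that(2)] by (simp add: T_def)
    from coeff[OF this that(1)] show ?thesis .
  qed
  then show ?thesis using that[of \<epsilon>] \<epsilon> by (simp add: \<epsilon>_def)
qed

locale fibration =
  fixes D :: "('m::euclidean_space, 'b::euclidean_space) adiabatic_data"
  assumes fib: "adiabatic_fibration D"
begin

abbreviation "M \<equiv> tot D"
abbreviation "B \<equiv> base D"
abbreviation "\<pi> \<equiv> proj D"
abbreviation "T \<equiv> tangent_space (tot D)"
abbreviation "d\<pi> \<equiv> mdiff (tot D) (proj D)"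

lemma fibD: "manifold 3 B" "manifold 7 M" "fibre_bundle M B K3 \<pi>" "ehresmann D"
  "lam D \<in> Omega D 3 0" "Theta D \<in> Omega D 2 2" "mu D \<in> Omega D 0 4"
  "\<And>x. x \<in> M \<Longrightarrow> \<exists>dt dx. adapted D x dt dx"
  "zero_form D (d_f D 2 2 (Theta D))" "zero_form D (d_H D 2 2 (Theta D))"
  using fib unfolding adiabatic_fibration_def by blast+

lemma forms: "form M 3 (lam D)" "form M 4 (Theta D)" "form M 4 (mu D)"
  using fibD(5,6,7) unfolding Omega_def by auto

lemma \<pi>: "smooth_on M \<pi>" "x \<in> M \<Longrightarrow> \<pi> x \<in> B"
  using fibD(3) unfolding fibre_bundle_def by auto

lemma T_subspace: "x \<in> M \<Longrightarrow> subspace (T x)"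
  using subspace_tangent_space[OF fibD(2)] .

lemma d\<pi>_linear: "x \<in> M \<Longrightarrow> linear (d\<pi> x)"
  by (rule mdiff_linear[OF \<pi>(1)])

lemma vert_subspace: "x \<in> M \<Longrightarrow> subspace (vert D x)"
  using T_subspace[of x] d\<pi>_linear[of x]
  unfolding subspace_def vert_def by (auto simp: linear_0 linear_add linear_scale)

lemma vert_T: "v \<in> vert D x \<Longrightarrow> v \<in> T x"
  by (simp add: vert_def)

lemma ehr: "x \<in> M \<Longrightarrow> subspace (horiz D x)" "x \<in> M \<Longrightarrow> horiz D x \<subseteq> T x"
  "x \<in> M \<Longrightarrow> v \<in> T x \<Longrightarrow> \<exists>!h. h \<in> horiz D x \<and> v - h \<in> vert D x"
  using fibD(4) unfolding ehresmann_def by blast+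

lemma hpart: "x \<in> M \<Longrightarrow> v \<in> T x \<Longrightarrow> hpart D x v \<in> horiz D x" "x \<in> M \<Longrightarrow> v \<in> T x \<Longrightarrow> vpart D x v \<in> vert D x"
  using theI'[OF ehr(3), of x v] unfolding hpart_def vpart_def by auto

lemma hpart_unique:
  "x \<in> M \<Longrightarrow> v \<in> T x \<Longrightarrow> h \<in> horiz D x \<Longrightarrow> v - h \<in> vert D x \<Longrightarrow> hpart D x v = h"
  using ehr(3)[of x v] hpart[of x v] unfolding vpart_def by blast

lemma hpart_vert: "x \<in> M \<Longrightarrow> v \<in> vert D x \<Longrightarrow> hpart D x v = 0"
  by (rule hpart_unique) (auto simp: vert_T ehr subspace_0)

lemma vpart_vert: "x \<in> M \<Longrightarrow> v \<in> vert D x \<Longrightarrow> vpart D x v = v"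
  by (simp add: vpart_def hpart_vert)

lemma horiz_dim: "x \<in> M \<Longrightarrow> dim (horiz D x) \<le> 3"
proof -
  assume x: "x \<in> M"
  have "\<forall>x\<in>M. \<exists>W X. open W \<and> x \<in> W \<and> (\<forall>i<3::nat. smooth_on (M \<inter> W) (X i)) \<and>
        (\<forall>y\<in>M \<inter> W. horiz D y = span {X i y | i. i < 3})"
    using fibD(4) unfolding ehresmann_def by blast
  then obtain X :: "nat \<Rightarrow> 'm \<Rightarrow> 'm" where X: "horiz D x = span {X i x | i. i < 3}" using x by blast
  have "{X i x | i. i < 3} = (\<lambda>i. X i x) ` {..<3}" by auto
  then have "dim (horiz D x) \<le> card ((\<lambda>i. X i x) ` {..<3::nat})"
    using X by (simp add: dim_le_card')
  also have "\<dots> \<le> 3" using card_image_le[of "{..<3::nat}" "\<lambda>i. X i x"] by simp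
  finally show ?thesis .
qed

text \<open>Pigeonhole: p horizontal slots and more than q slots with vertical vectors, among p + q
  slots, must meet, and the horizontal part of a vertical vector is zero.\<close>

lemma Omega_zero:
  assumes \<alpha>: "\<alpha> \<in> Omega D p q" and x: "x \<in> M" and v: "\<And>i. v i \<in> T x"
    and J: "J \<subseteq> {..<p + q}" "q < card J" "\<And>i. i \<in> J \<Longrightarrow> v i \<in> vert D x"
  shows "\<alpha> x v = 0"
proof -
  have f: "form M (p + q) \<alpha>" and b: "bicomp D x p q (\<alpha> x) v = \<alpha> x v" using \<alpha> x v unfolding Omega_def by auto
  have "bicomp D x p q (\<alpha> x) v = 0"
    unfolding bicomp_def
  proof (rule sum.neutral, rule ballI)
    fix I assume "I \<in> {I. I \<subseteq> {..<p + q} \<and> card I = p}"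
    then have I: "I \<subseteq> {..<p + q}" "card I = p" by auto
    have fin: "finite I" "finite J" using I(1) J(1) finite_subset by blast+
    have "I \<inter> J \<noteq> {}"
    proof
      assume "I \<inter> J = {}"
      then have "card (I \<union> J) = card I + card J" using fin by (simp add: card_Un_disjoint)
      moreover have "card (I \<union> J) \<le> card {..<p + q}" using I(1) J(1) by (intro card_mono) auto
      ultimately show False using I(2) J(2) by simp
    qed
    then obtain i where i: "i \<in> I" "i \<in> J" by blast
    have ip: "i < p + q" using i I by auto
    show "\<alpha> x (\<lambda>i. if i \<in> I then hpart D x (v i) else vpart D x (v i)) = 0"
      by (rule mlin_zero_slot[OF altform_mlin[OF form_altform[OF f x]] ip])
        (use i hpart_vert[OF x J(3)[OF i(2)]] in simp)
  qed
  then show ?thesis using b by simp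
qed

lemma lam_zero:
  assumes x: "x \<in> M" and v: "\<And>i. i < 3 \<Longrightarrow> v i \<in> T x" and i: "i < 3" "v i \<in> vert D x"
  shows "lam D x v = 0"
proof -
  \<comment> \<open>\<open>Omega\<close> speaks of tuples all of whose entries are tangent, so the
    entries beyond the third are set to zero.\<close>
  let ?v = "\<lambda>j. if j < 3 then v j else 0"
  have "lam D x v = lam D x ?v" by (rule altform_cong[OF form_altform[OF forms(1) x]]) simp
  also have "\<dots> = 0"
    by (rule Omega_zero[OF fibD(5) x, where J = "{i}"]) (use v i T_subspace[OF x] subspace_0 in auto)
  finally show ?thesis .
qed

lemma Theta_zero:
  assumes x: "x \<in> M" and v: "\<And>i. v i \<in> T x" and J: "J \<subseteq> {..<4}" "3 \<le> card J" "\<And>i. i \<in> J \<Longrightarrow> v i \<in> vert D x"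
  shows "Theta D x v = 0"
  by (rule Omega_zero[OF fibD(6) x v, where J = J]) (use J in auto)

subsection \<open>Adapted frames\<close>

definition metric_coframe :: "'m \<Rightarrow> nat \<Rightarrow> 'm \<Rightarrow> real" where
  "metric_coframe x = (SOME dx. \<exists>dt. adapted D x dt dx)"

lemma metric_coframe: "x \<in> M \<Longrightarrow> coframe (vert D x) 4 (metric_coframe x)"
proof -
  assume "x \<in> M"
  then have "\<exists>dx dt. adapted D x dt dx" using fibD(8) by blast
  then have "\<exists>dt. adapted D x dt (metric_coframe x)" unfolding metric_coframe_def by (rule someI_ex)
  then show ?thesis unfolding adapted_def by blast
qed

lemma metric: "fibre_metric D x u v = (\<Sum>j<4. metric_coframe x j u * metric_coframe x j v)"
  by (simp add: fibre_metric_def metric_coframe_def Let_def)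

lemma vert_dim: "x \<in> M \<Longrightarrow> dim (vert D x) = 4"
  using metric_coframe unfolding coframe_def by blast

text \<open>Names the frame selected inside \<open>star4\<close>. It is chosen separately at every
  x, so no continuity in x is available.\<close>

definition frame :: "'m \<Rightarrow> nat \<Rightarrow> 'm" where
  "frame x = (SOME e :: nat \<Rightarrow> 'm. (\<forall>j<4. e j \<in> vert D x) \<and>
                 (\<forall>i<4. \<forall>j<4. fibre_metric D x (e i) (e j) = (if i = j then 1 else 0)))"

lemma star4_frame: "star4 D x a v = (\<Sum>j<4. mu D x (case_nat (frame x j) v) *\<^sub>R a (\<lambda>_. frame x j))"
  by (simp add: star4_def frame_def Let_def)

lemma frame:
  assumes x: "x \<in> M"
  shows "j < 4 \<Longrightarrow> frame x j \<in> vert D x"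
    "i < 4 \<Longrightarrow> j < 4 \<Longrightarrow> fibre_metric D x (frame x i) (frame x j) = (if i = j then 1 else 0)"
proof -
  obtain \<epsilon> where \<epsilon>: "\<And>j. j < 4 \<Longrightarrow> \<epsilon> j \<in> vert D x"
    "\<And>i j. i < 4 \<Longrightarrow> j < 4 \<Longrightarrow> metric_coframe x i (\<epsilon> j) = (if i = j then 1 else 0)"
    by (rule coframe_dual[OF vert_subspace[OF x] metric_coframe[OF x]]) (rule that)
  have "fibre_metric D x (\<epsilon> i) (\<epsilon> j) = (if i = j then 1 else 0)" if "i < 4" "j < 4" for i j
  proof -
    have "fibre_metric D x (\<epsilon> i) (\<epsilon> j) = (\<Sum>k<4. if k = i then (if i = j then 1 else 0) else 0)"
      unfolding metric by (rule sum.cong) (use that \<epsilon>(2) in auto)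
    then show ?thesis using that by simp
  qed
  then have "\<exists>e :: nat \<Rightarrow> 'm. (\<forall>j<4. e j \<in> vert D x) \<and>
      (\<forall>i<4. \<forall>j<4. fibre_metric D x (e i) (e j) = (if i = j then 1 else 0))"
    using \<epsilon>(1) by blast
  from someI_ex[OF this] show "j < 4 \<Longrightarrow> frame x j \<in> vert D x"
    "i < 4 \<Longrightarrow> j < 4 \<Longrightarrow> fibre_metric D x (frame x i) (frame x j) = (if i = j then 1 else 0)"
    unfolding frame_def[symmetric] by auto
qed

lemma vert_span_frame:
  assumes x: "x \<in> M" shows "vert D x \<subseteq> span (frame x ` {..<4})"
proof -
  let ?e = "frame x"
  have lin: "linear (\<lambda>u. fibre_metric D x u w)" for w
    unfolding metric using metric_coframe[OF x]
    by (intro linear_compose_sum ballI) (auto intro!: linearI simp: coframe_def linear_add linear_scale algebra_simps)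
  have inj: "inj_on ?e {..<4}"
  proof (rule inj_onI)
    fix i j :: nat assume ij: "i \<in> {..<4}" "j \<in> {..<4}" "?e i = ?e j"
    then show "i = j" using frame(2)[OF x, of i j] frame(2)[OF x, of j j] by (auto split: if_splits)
  qed
  have "independent (?e ` {..<4})"
    unfolding independent_explicit
  proof (intro conjI allI impI ballI)
    fix u v assume s: "(\<Sum>v\<in>?e ` {..<4}. u v *\<^sub>R v) = 0" and "v \<in> ?e ` {..<4}"
    then obtain j where j: "j < 4" "v = ?e j" by auto
    have "(\<Sum>i<4. u (?e i) *\<^sub>R ?e i) = 0" using s by (simp add: sum.reindex[OF inj])
    then have "0 = fibre_metric D x (\<Sum>i<4. u (?e i) *\<^sub>R ?e i) (?e j)" using linear_0[OF lin] by simp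
    also have "\<dots> = (\<Sum>i<4. u (?e i) * fibre_metric D x (?e i) (?e j))"
      by (simp add: linear_sum[OF lin] linear_scale[OF lin])
    also have "\<dots> = (\<Sum>i<4. if i = j then u (?e j) else 0)"
      by (rule sum.cong) (use frame(2)[OF x] j in auto)
    finally show "u v = 0" using j by simp
  qed simp
  moreover have "?e ` {..<4} \<subseteq> vert D x" using frame(1)[OF x] by auto
  moreover have "dim (vert D x) \<le> card (?e ` {..<4})" using vert_dim[OF x] card_image[OF inj] by simp
  ultimately show ?thesis by (intro card_ge_dim_independent)
qed

text \<open>A curve in the base lifts to M by keeping the fibre coordinate of a trivialisation
  fixed.\<close>

lemma d\<pi>_surj:
  assumes x: "x \<in> M" and \<eta>: "\<eta> \<in> tangent_space B (\<pi> x)"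
  obtains v where "v \<in> T x" "d\<pi> x v = \<eta>"
proof -
  obtain U \<psi> where U: "open U" "\<pi> x \<in> U" and d: "diffeo {x \<in> M. \<pi> x \<in> U} ((B \<inter> U) \<times> K3) (\<lambda>x. (\<pi> x, \<psi> x))"
    using fibD(3) \<pi>(2)[OF x] unfolding fibre_bundle_def by blast
  let ?S = "{x \<in> M. \<pi> x \<in> U}" and ?f = "\<lambda>x. (\<pi> x, \<psi> x)"
  define \<tau> where "\<tau> = inv_into ?S ?f"
  have bij: "bij_betw ?f ?S ((B \<inter> U) \<times> K3)" and s2: "smooth_on ((B \<inter> U) \<times> K3) \<tau>"
    using d unfolding diffeo_def \<tau>_def by auto
  have xS: "x \<in> ?S" using x U by simp
  have "?f x \<in> (B \<inter> U) \<times> K3" using bij xS unfolding bij_betw_def by blast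
  then have k: "\<psi> x \<in> K3" by simp
  have \<tau>x: "\<tau> (\<pi> x, \<psi> x) = x" unfolding \<tau>_def using bij xS inv_into_f_f[of ?f ?S x] by (simp add: bij_betw_def)
  have \<tau>: "\<tau> (b, \<psi> x) \<in> M \<and> \<pi> (\<tau> (b, \<psi> x)) = b" if "b \<in> B \<inter> U" for b
  proof -
    have i: "(b, \<psi> x) \<in> ?f ` ?S" using bij that k unfolding bij_betw_def by simp
    have "\<tau> (b, \<psi> x) \<in> ?S" unfolding \<tau>_def by (rule inv_into_into[OF i])
    moreover have "?f (\<tau> (b, \<psi> x)) = (b, \<psi> x)" unfolding \<tau>_def by (rule f_inv_into_f[OF i])
    ultimately show ?thesis by simp
  qed
  obtain I c where c: "Cinf I c" "(0::real) \<in> I" "\<And>t. t \<in> I \<Longrightarrow> c t \<in> B" "c 0 = \<pi> x" "dd c 0 1 = \<eta>"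
    by (rule tangent_spaceE[OF \<eta>]) (rule that)
  define I' where "I' = I \<inter> c -` U"
  have oI: "open I'" unfolding I'_def
    by (rule continuous_open_preimage[OF Cinf_continuous_on[OF c(1)] Cinf_open[OF c(1)] U(1)])
  have c': "Cinf I' c" by (rule Cinf_subset[OF c(1) oI]) (simp add: I'_def)
  have cB: "c t \<in> B \<inter> U" if "t \<in> I'" for t using that c(3) by (simp add: I'_def)
  have 0: "0 \<in> I'" using c U(2) by (simp add: I'_def)
  have pair: "Cinf I' (\<lambda>t. (c t, \<psi> x))" by (rule Cinf_Pair[OF c' Cinf_const[OF oI]])
  have C: "Cinf I' (\<lambda>t. \<tau> (c t, \<psi> x))"
    by (rule Cinf_pull[OF pair _ s2]) (use cB k in auto)
  have CM: "\<tau> (c t, \<psi> x) \<in> M" if "t \<in> I'" for t using \<tau>[OF cB[OF that]] by blast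
  have 1: "dd (\<lambda>t. \<tau> (c t, \<psi> x)) 0 1 \<in> T x" using tangent_spaceI[OF C 0 CM] c(4) \<tau>x by simp
  have "d\<pi> x (dd (\<lambda>t. \<tau> (c t, \<psi> x)) 0 1) = dd (\<lambda>t. \<pi> (\<tau> (c t, \<psi> x))) 0 1"
    using dd_pull[OF C CM \<pi>(1) 0, of 1] c(4) \<tau>x by simp
  also have "\<dots> = dd c 0 1" by (rule dd_cong[OF oI 0]) (use \<tau> cB in blast)
  finally show ?thesis using that[OF 1] c(5) by simp
qed

text \<open>Take a vertical frame dual to the dx, followed by lifts of a base frame dual to the dt:
  there \<mu> is 1 and \<lambda> is -1. So the product of \<mu> and \<lambda> is a volume
  form.\<close>

lemma volume_frame_exists:
  assumes x: "x \<in> M"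
  obtains v where "\<And>i. v i \<in> T x" "\<And>i. i < 4 \<Longrightarrow> v i \<in> vert D x" "mu D x v \<noteq> 0" "lam D x (\<lambda>i. v (4 + i)) \<noteq> 0"
proof -
  obtain dt dx where ad: "adapted D x dt dx" using fibD(8)[OF x] by blast
  have cdt: "coframe (tangent_space B (\<pi> x)) 3 dt" and cdx: "coframe (vert D x) 4 dx"
    and std: "\<And>v. (\<And>i. v i \<in> T x) \<Longrightarrow>
      lam D x v = - wedge 2 1 (wedge 1 1 (covec (\<lambda>u. dt 0 (d\<pi> x u))) (covec (\<lambda>u. dt 1 (d\<pi> x u)))) (covec (\<lambda>u. dt 2 (d\<pi> x u))) v
      \<and> mu D x v = 1 / 2 * wedge 2 2 (hk_form dx 0) (hk_form dx 0) v"
    using ad unfolding adapted_def Let_def by blast+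
  obtain \<epsilon> where \<epsilon>: "\<And>j. j < 4 \<Longrightarrow> \<epsilon> j \<in> vert D x"
    "\<And>i j. i < 4 \<Longrightarrow> j < 4 \<Longrightarrow> dx i (\<epsilon> j) = (if i = j then 1 else 0)"
    by (rule coframe_dual[OF vert_subspace[OF x] cdx]) (rule that)
  obtain \<eta> where \<eta>: "\<And>j. j < 3 \<Longrightarrow> \<eta> j \<in> tangent_space B (\<pi> x)"
    "\<And>i j. i < 3 \<Longrightarrow> j < 3 \<Longrightarrow> dt i (\<eta> j) = (if i = j then 1 else 0)"
    by (rule coframe_dual[OF subspace_tangent_space[OF fibD(1) \<pi>(2)[OF x]] cdt]) (rule that)
  have "\<forall>j. \<exists>k. j < 3 \<longrightarrow> k \<in> T x \<and> d\<pi> x k = \<eta> j" using d\<pi>_surj[OF x \<eta>(1)] by metis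
  then obtain k where k: "\<And>j. j < 3 \<Longrightarrow> k j \<in> T x" "\<And>j. j < 3 \<Longrightarrow> d\<pi> x (k j) = \<eta> j" by metis
  define v where "v i = (if i < 4 then \<epsilon> i else if i < 7 then k (i - 4) else 0)" for i
  have vT: "v i \<in> T x" for i
    using \<epsilon>(1) vert_T k(1)[of "i - 4"] subspace_0[OF T_subspace[OF x]] by (auto simp: v_def)
  have m: "mu D x v = 1"
  proof -
    have "wedge 2 2 (hk_form dx 0) (hk_form dx 0) v = 2"
      by (rule wedge_2_2_dual) (simp add: v_def \<epsilon>(2))
    then show ?thesis using std[of v] vT by simp
  qed
  have l: "lam D x (\<lambda>i. v (4 + i)) = -1"
  proof -
    have "wedge 2 1 (wedge 1 1 (covec ((\<lambda>i u. dt i (d\<pi> x u)) 0)) (covec ((\<lambda>i u. dt i (d\<pi> x u)) 1)))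
       (covec ((\<lambda>i u. dt i (d\<pi> x u)) 2)) (\<lambda>i. v (4 + i)) = 1"
      by (rule wedge_2_1_dual) (simp add: v_def k(2) \<eta>(2))
    then show ?thesis using std[of "\<lambda>i. v (4 + i)"] vT by simp
  qed
  show ?thesis by (rule that[of v]) (use vT m l \<epsilon>(1) in \<open>auto simp: v_def\<close>)
qed

subsection \<open>The form \<open>\<Theta>\<close> is closed\<close>

lemma chart:
  assumes x: "x \<in> M" and O: "open O'" "x \<in> O'"
  obtains r W and \<phi> :: "real^7 \<Rightarrow> 'm" and g where "r > 0" "Cinf (ball (g x) r) \<phi>" "Cinf W g" "x \<in> W" "W \<subseteq> O'"
    "\<phi> ` ball (g x) r = M \<inter> W" "\<And>y. y \<in> ball (g x) r \<Longrightarrow> g (\<phi> y) = y"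
    "\<And>z. z \<in> M \<Longrightarrow> z \<in> W \<Longrightarrow> g z \<in> ball (g x) r \<and> \<phi> (g z) = z"
    "\<And>z. z \<in> M \<Longrightarrow> z \<in> W \<Longrightarrow> T z = range (dd \<phi> (g z))"
    "\<And>y. y \<in> ball (g x) r \<Longrightarrow> inj (dd \<phi> y)"
proof -
  have "manifold CARD(7) M" using fibD(2) by simp
  then show ?thesis by (rule chart_exists[OF _ x O]) (rule that)
qed

text \<open>Replaces the exterior derivative at x by a form that is alternating on the whole ambient
  space, by composing with a left inverse of the differential of a chart; tangent vectors are
  unaffected.\<close>

lemma tangential_ext_deriv:
  assumes \<alpha>: "form M k \<alpha>" and x: "x \<in> M"
  obtains E where "altform (Suc k) E" "\<And>v. (\<And>i. v i \<in> T x) \<Longrightarrow> ext_deriv M k \<alpha> x v = E v"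
proof -
  obtain r W and \<phi> :: "real^7 \<Rightarrow> 'm" and g where c: "r > 0" "Cinf (ball (g x) r) \<phi>" "Cinf W g" "x \<in> W" "W \<subseteq> UNIV"
    "\<phi> ` ball (g x) r = M \<inter> W" "\<And>y. y \<in> ball (g x) r \<Longrightarrow> g (\<phi> y) = y"
    "\<And>z. z \<in> M \<Longrightarrow> z \<in> W \<Longrightarrow> g z \<in> ball (g x) r \<and> \<phi> (g z) = z"
    "\<And>z. z \<in> M \<Longrightarrow> z \<in> W \<Longrightarrow> T z = range (dd \<phi> (g z))"
    "\<And>y. y \<in> ball (g x) r \<Longrightarrow> inj (dd \<phi> y)"
    by (rule chart[OF x open_UNIV UNIV_I]) (rule that)
  have gx: "g x \<in> ball (g x) r" "\<phi> (g x) = x" using c(8)[OF x c(4)] by auto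
  have L: "linear (dd \<phi> (g x))" by (rule Cinf_linear[OF c(2) gx(1)])
  obtain K where K: "linear K" "K \<circ> dd \<phi> (g x) = id"
    using linear_injective_left_inverse[OF L c(10)[OF gx(1)]] by blast
  have LK: "dd \<phi> (g x) (K v) = v" if "v \<in> T x" for v
  proof -
    obtain u where "v = dd \<phi> (g x) u" using \<open>v \<in> T x\<close> c(9)[OF x c(4)] by auto
    then show ?thesis using K(2) by (metis comp_apply id_apply)
  qed
  have "altform (Suc k) (\<lambda>u. ext_deriv M k \<alpha> (\<phi> (g x)) (\<lambda>j. dd \<phi> (g x) (u j)))"
    by (rule ext_deriv_altform[OF \<alpha> c(2) _ gx(1)]) (use c(6) in blast)
  from altform_linear_map[OF this K(1)] show ?thesis
    by (rule that) (simp add: LK gx(2))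
qed

lemma trivialisation:
  assumes "b \<in> B"
  obtains U \<psi> \<tau> where "open U" "b \<in> U" "smooth_on {x \<in> M. \<pi> x \<in> U} \<psi>" "smooth_on ((B \<inter> U) \<times> K3) \<tau>"
    "\<And>x. x \<in> M \<Longrightarrow> \<pi> x \<in> U \<Longrightarrow> \<psi> x \<in> K3 \<and> \<tau> (\<pi> x, \<psi> x) = x"
    "\<And>b k. b \<in> B \<Longrightarrow> b \<in> U \<Longrightarrow> k \<in> K3 \<Longrightarrow> \<tau> (b, k) \<in> M \<and> \<pi> (\<tau> (b, k)) = b"
proof -
  obtain U \<psi> where U: "open U" "b \<in> U" and d: "diffeo {x \<in> M. \<pi> x \<in> U} ((B \<inter> U) \<times> K3) (\<lambda>x. (\<pi> x, \<psi> x))"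
    using fibD(3) assms unfolding fibre_bundle_def by blast
  let ?S = "{x \<in> M. \<pi> x \<in> U}" and ?f = "\<lambda>x. (\<pi> x, \<psi> x)"
  define \<tau> where "\<tau> = inv_into ?S ?f"
  have bij: "bij_betw ?f ?S ((B \<inter> U) \<times> K3)" and s1: "smooth_on ?S ?f" and s2: "smooth_on ((B \<inter> U) \<times> K3) \<tau>"
    using d unfolding diffeo_def \<tau>_def by auto
  have "smooth_on ?S (\<lambda>p. snd (?f p))"
    by (rule smooth_on_compose[OF s1 smooth_on_linear[of snd UNIV]]) (auto intro: linear_snd)
  then have s3: "smooth_on ?S \<psi>" by simp
  have 1: "\<psi> x \<in> K3 \<and> \<tau> (\<pi> x, \<psi> x) = x" if "x \<in> M" "\<pi> x \<in> U" for x
  proof -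
    have xS: "x \<in> ?S" using that by simp
    have "?f x \<in> (B \<inter> U) \<times> K3" using bij xS unfolding bij_betw_def by blast
    moreover have "\<tau> (?f x) = x" unfolding \<tau>_def using bij xS by (intro inv_into_f_f) (auto simp: bij_betw_def)
    ultimately show ?thesis by simp
  qed
  have 2: "\<tau> (b, k) \<in> M \<and> \<pi> (\<tau> (b, k)) = b" if "b \<in> B" "b \<in> U" "k \<in> K3" for b k
  proof -
    have i: "(b, k) \<in> ?f ` ?S" using bij that unfolding bij_betw_def by simp
    have "\<tau> (b, k) \<in> ?S" unfolding \<tau>_def by (rule inv_into_into[OF i])
    moreover have "?f (\<tau> (b, k)) = (b, k)" unfolding \<tau>_def by (rule f_inv_into_f[OF i])
    ultimately show ?thesis by simp
  qed
  show ?thesis by (rule that[OF U s3 s2 1 2])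
qed

text \<open>
  The component of bidegree \<open>(1, 4)\<close> vanishes because \<open>\<Theta>\<close> pulls back to zero under maps that depend
  on one base and four fibre coordinates.
\<close>

lemma dTheta_vertical:
  assumes x: "x \<in> M" and E: "altform 5 E" "\<And>v. (\<And>i. v i \<in> T x) \<Longrightarrow> ext_deriv M 4 (Theta D) x v = E v"
    and w: "\<And>i. w i \<in> T x" "i0 < 5" "\<And>i. i \<noteq> i0 \<Longrightarrow> w i \<in> vert D x"
  shows "E w = 0"
proof -
  obtain U \<psi> \<tau> where U: "open U" "\<pi> x \<in> U" "smooth_on {x \<in> M. \<pi> x \<in> U} \<psi>" "smooth_on ((B \<inter> U) \<times> K3) \<tau>"
    "\<And>x. x \<in> M \<Longrightarrow> \<pi> x \<in> U \<Longrightarrow> \<psi> x \<in> K3 \<and> \<tau> (\<pi> x, \<psi> x) = x"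
    "\<And>b k. b \<in> B \<Longrightarrow> b \<in> U \<Longrightarrow> k \<in> K3 \<Longrightarrow> \<tau> (b, k) \<in> M \<and> \<pi> (\<tau> (b, k)) = b"
    by (rule trivialisation[OF \<pi>(2)[OF x]]) (rule that)
  \<comment> \<open>Charts are cut down to open sets of the ambient space, whereas the preimage of U
    is open relative to M.\<close>
  obtain O' where O': "open O'" "M \<inter> O' = {x \<in> M. \<pi> x \<in> U}"
  proof -
    have "openin (top_of_set M) (M \<inter> \<pi> -` U)"
      by (rule continuous_openin_preimage_gen[OF smooth_on_continuous[OF \<pi>(1)] U(1)])
    then obtain O' where "open O'" "M \<inter> \<pi> -` U = M \<inter> O'" by (auto simp: openin_open)
    then show ?thesis using that[of O'] by auto
  qed
  have xO: "x \<in> O'" using O'(2) x U(2) by auto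
  obtain r W and \<phi> :: "real^7 \<Rightarrow> 'm" and g where c: "r > 0" "Cinf (ball (g x) r) \<phi>" "Cinf W g" "x \<in> W" "W \<subseteq> O'"
    "\<phi> ` ball (g x) r = M \<inter> W" "\<And>y. y \<in> ball (g x) r \<Longrightarrow> g (\<phi> y) = y"
    "\<And>z. z \<in> M \<Longrightarrow> z \<in> W \<Longrightarrow> g z \<in> ball (g x) r \<and> \<phi> (g z) = z"
    "\<And>z. z \<in> M \<Longrightarrow> z \<in> W \<Longrightarrow> T z = range (dd \<phi> (g z))"
    "\<And>y. y \<in> ball (g x) r \<Longrightarrow> inj (dd \<phi> y)"
    by (rule chart[OF x O'(1) xO]) (rule that)
  define V where "V = ball (g x) r"
  define y0 where "y0 = g x"
  have y0: "y0 \<in> V" "\<phi> y0 = x" using c(8)[OF x c(4)] by (auto simp: V_def y0_def)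
  have \<phi>: "Cinf V \<phi>" using c(2) by (simp add: V_def)
  have \<phi>M: "\<phi> y \<in> M" "\<pi> (\<phi> y) \<in> U" if "y \<in> V" for y
  proof -
    have "\<phi> y \<in> M \<inter> W" using c(6) that unfolding V_def by blast
    then have "\<phi> y \<in> M \<inter> O'" using c(5) by blast
    then show "\<phi> y \<in> M" "\<pi> (\<phi> y) \<in> U" using O'(2) by auto
  qed
  have \<pi>\<phi>: "Cinf V (\<lambda>y. \<pi> (\<phi> y))" by (rule Cinf_pull[OF \<phi> \<phi>M(1) \<pi>(1)])
  have \<psi>\<phi>: "Cinf V (\<lambda>y. \<psi> (\<phi> y))" by (rule Cinf_pull[OF \<phi> _ U(3)]) (use \<phi>M in auto)
  \<comment> \<open>The base coordinate comes from the first argument and the fibre coordinate from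
    the second. On the diagonal q is the chart \<phi>, and moving the second argument alone is a
    vertical motion.\<close>
  define q where "q z = \<tau> (\<pi> (\<phi> (fst z)), \<psi> (\<phi> (snd z)))" for z :: "(real^7) \<times> (real^7)"
  have oV: "open (V \<times> V)" using Cinf_open[OF \<phi>] by (simp add: open_Times)
  have dom: "(\<pi> (\<phi> (fst z)), \<psi> (\<phi> (snd z))) \<in> (B \<inter> U) \<times> K3" if "z \<in> V \<times> V" for z
    using that \<phi>M \<pi>(2) U(5) by auto
  have C1: "Cinf (V \<times> V) (\<lambda>z. \<pi> (\<phi> (fst z)))"
    by (rule Cinf_compose[OF Cinf_linear_map[OF linear_fst oV] \<pi>\<phi>]) auto
  have C2: "Cinf (V \<times> V) (\<lambda>z. \<psi> (\<phi> (snd z)))"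
    by (rule Cinf_compose[OF Cinf_linear_map[OF linear_snd oV] \<psi>\<phi>]) auto
  have qC: "Cinf (V \<times> V) q"
    unfolding q_def[abs_def] by (rule Cinf_pull[OF Cinf_Pair[OF C1 C2] dom U(4)])
  have qM: "q z \<in> M" and \<pi>q: "\<pi> (q z) = \<pi> (\<phi> (fst z))" if "z \<in> V \<times> V" for z
    using U(6) dom[OF that] unfolding q_def by auto
  have z0: "(y0, y0) \<in> V \<times> V" using y0 by simp
  have qx: "q (y0, y0) = x" using U(5)[OF x U(2)] by (simp add: q_def y0)
  have vert: "dd q z (0, u) \<in> vert D (q z)" if z: "z \<in> V \<times> V" for z u
  proof -
    have "d\<pi> (q z) (dd q z (0, u)) = dd (\<lambda>z. \<pi> (q z)) z (0, u)"
      by (rule dd_pull[OF qC qM \<pi>(1) z, symmetric])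
    also have "\<dots> = dd (\<lambda>z. \<pi> (\<phi> (fst z))) z (0, u)" by (rule dd_cong[OF oV z]) (rule \<pi>q)
    also have "\<dots> = dd (\<lambda>y. \<pi> (\<phi> y)) (fst z) (dd fst z (0, u))"
      by (rule dd_compose) (use z Cinf_differentiable[OF \<pi>\<phi>] linear_fst linear_imp_differentiable in auto)
    also have "dd fst z (0, u) = 0"
      using dd_eqI[OF bounded_linear_imp_has_derivative[OF bounded_linear_fst], of z "(0, u)"] by simp
    also have "dd (\<lambda>y. \<pi> (\<phi> y)) (fst z) 0 = 0"
      using linear_0[OF Cinf_linear[OF \<pi>\<phi>]] z by auto
    finally show ?thesis using tangent_push[OF qC qM z] by (simp add: vert_def)
  qed
  have Tx: "T x = range (dd \<phi> y0)" using c(9)[OF x c(4)] by (simp add: y0_def)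
  define u where "u i = (SOME u. dd \<phi> y0 u = w i)" for i
  have u: "dd \<phi> y0 (u i) = w i" for i
  proof -
    have "w i \<in> range (dd \<phi> y0)" using w(1) Tx by metis
    then have "\<exists>u. dd \<phi> y0 u = w i" by auto
    then show ?thesis unfolding u_def by (rule someI_ex)
  qed
  have diag: "dd q (y0, y0) (a, 0) + dd q (y0, y0) (0, a) = dd \<phi> y0 a" for a
  proof -
    have d: "((\<lambda>y. (y, y)) has_derivative (\<lambda>a. (a, a))) (at y0)" by (auto intro!: derivative_eq_intros)
    have "dd (\<lambda>y. q (y, y)) y0 a = dd q (y0, y0) (a, a)"
      using dd_eqI[OF has_derivative_compose[OF d Cinf_has_derivative[OF qC z0]]] .
    moreover have "dd (\<lambda>y. q (y, y)) y0 a = dd \<phi> y0 a"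
      by (rule dd_cong[OF Cinf_open[OF \<phi>] y0(1)]) (use U(5) \<phi>M in \<open>simp add: q_def\<close>)
    moreover have "dd q (y0, y0) ((a, 0) + (0, a)) = dd q (y0, y0) (a, 0) + dd q (y0, y0) (0, a)"
      by (rule linear_add[OF Cinf_linear[OF qC z0]])
    ultimately show ?thesis by simp
  qed
  \<comment> \<open>To first order the base coordinate stays fixed because the vector is vertical,
    and the fibre coordinate is not moved at all.\<close>
  have horiz: "dd q (y0, y0) (a, 0) = 0" if "dd \<phi> y0 a \<in> vert D x" for a
  proof -
    have 1: "dd (\<lambda>y. \<pi> (\<phi> y)) y0 a = 0"
      using dd_pull[OF \<phi> \<phi>M(1) \<pi>(1) y0(1), of a] that by (simp add: vert_def y0(2))
    have d: "((\<lambda>z. (\<pi> (\<phi> (fst z)), \<psi> (\<phi> (snd z)))) has_derivative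
        (\<lambda>v. (dd (\<lambda>y. \<pi> (\<phi> y)) y0 (fst v), dd (\<lambda>y. \<psi> (\<phi> y)) y0 (snd v)))) (at (y0, y0))"
    proof (rule has_derivative_Pair)
      show "((\<lambda>z. \<pi> (\<phi> (fst z))) has_derivative (\<lambda>v. dd (\<lambda>y. \<pi> (\<phi> y)) y0 (fst v))) (at (y0, y0))"
        using has_derivative_compose[OF bounded_linear_imp_has_derivative[OF bounded_linear_fst], of "\<lambda>y. \<pi> (\<phi> y)" _ "(y0, y0)" UNIV]
          Cinf_has_derivative[OF \<pi>\<phi> y0(1)] by simp
      show "((\<lambda>z. \<psi> (\<phi> (snd z))) has_derivative (\<lambda>v. dd (\<lambda>y. \<psi> (\<phi> y)) y0 (snd v))) (at (y0, y0))"
        using has_derivative_compose[OF bounded_linear_imp_has_derivative[OF bounded_linear_snd], of "\<lambda>y. \<psi> (\<phi> y)" _ "(y0, y0)" UNIV]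
          Cinf_has_derivative[OF \<psi>\<phi> y0(1)] by simp
    qed
    have "dd (\<lambda>z. (\<pi> (\<phi> (fst z)), \<psi> (\<phi> (snd z)))) (y0, y0) (a, 0) = (0, dd (\<lambda>y. \<psi> (\<phi> y)) y0 0)"
      using dd_eqI[OF d, of "(a, 0)"] 1 by simp
    also have "\<dots> = 0" using linear_0[OF Cinf_linear[OF \<psi>\<phi> y0(1)]] by (simp add: zero_prod_def)
    finally have 2: "dd (\<lambda>z. (\<pi> (\<phi> (fst z)), \<psi> (\<phi> (snd z)))) (y0, y0) (a, 0) = 0" .
    have "dd q (y0, y0) (a, 0) = mdiff ((B \<inter> U) \<times> K3) \<tau> (\<pi> (\<phi> (fst (y0, y0))), \<psi> (\<phi> (snd (y0, y0)))) 0"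
      unfolding q_def[abs_def] using dd_pull[OF Cinf_Pair[OF C1 C2] dom U(4) z0, of "(a, 0)"] 2 by simp
    also have "\<dots> = 0" by (rule linear_0[OF mdiff_linear[OF U(4) dom[OF z0]]])
    finally show ?thesis .
  qed
  \<comment> \<open>Only direction i0 moves the base. Any four of the five directions therefore push
    forward to at least three vertical vectors at every point, so the pulled back coefficients of
    \<Theta> are identically zero, and so are their derivatives.\<close>
  define U' where "U' i = (if i = i0 then (u i, 0) else (0, u i))" for i
  have "ext_deriv M 4 (Theta D) (q (y0, y0)) (\<lambda>j. dd q (y0, y0) (U' j)) =
     (\<Sum>i\<le>4. (-1) ^ i *\<^sub>R dd (\<lambda>z. Theta D (q z) (\<lambda>j. dd q z (if j < i then U' j else U' (Suc j)))) (y0, y0) (U' i))"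
    by (rule ext_deriv_pullback[OF forms(2) qC qM z0, symmetric])
  also have "\<dots> = (\<Sum>i\<le>4::nat. 0)"
  proof (rule sum.cong[OF refl])
    fix i :: nat
    let ?s = "\<lambda>j. if j < i then j else Suc j"
    have "Theta D (q z) (\<lambda>j. dd q z (if j < i then U' j else U' (Suc j))) = 0" if z: "z \<in> V \<times> V" for z
    proof (rule Theta_zero[OF qM[OF z], where J = "{j. j < 4 \<and> ?s j \<noteq> i0}"])
      show "dd q z (if j < i then U' j else U' (Suc j)) \<in> T (q z)" for j by (rule tangent_push[OF qC qM z])
      have "card {j. j < 4 \<and> ?s j = i0} \<le> 1"
        by (rule card_le_Suc0_iff_eq[THEN iffD2, unfolded One_nat_def[symmetric]]) (auto split: if_splits)
      moreover have "{j. j < 4 \<and> ?s j \<noteq> i0} = {..<4} - {j. j < 4 \<and> ?s j = i0}" by auto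
      then have "card {j. j < 4 \<and> ?s j \<noteq> i0} = 4 - card {j. j < 4 \<and> ?s j = i0}"
        by (simp add: card_Diff_subset subset_iff)
      ultimately show "3 \<le> card {j. j < 4 \<and> ?s j \<noteq> i0}" by simp
      show "dd q z (if j < i then U' j else U' (Suc j)) \<in> vert D (q z)" if "j \<in> {j. j < 4 \<and> ?s j \<noteq> i0}" for j
        using that vert[OF z] by (auto simp: U'_def split: if_splits)
    qed auto
    then have "dd (\<lambda>z. Theta D (q z) (\<lambda>j. dd q z (if j < i then U' j else U' (Suc j)))) (y0, y0) (U' i) = dd (\<lambda>z. 0) (y0, y0) (U' i)"
      by (rule dd_cong[OF oV z0])
    then show "(-1) ^ i *\<^sub>R dd (\<lambda>z. Theta D (q z) (\<lambda>j. dd q z (if j < i then U' j else U' (Suc j)))) (y0, y0) (U' i) = 0"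
      by (simp add: frechet_derivative_const)
  qed
  finally have 0: "ext_deriv M 4 (Theta D) x (\<lambda>j. dd q (y0, y0) (U' j)) = 0" by (simp add: qx)
  have wi: "dd q (y0, y0) (U' i) = w i" if "i \<noteq> i0" for i
    using diag[of "u i"] horiz[of "u i"] w(3)[OF that] u[of i] that by (simp add: U'_def)
  \<comment> \<open>The image of direction i0 differs from \<open>w i0\<close> by the vertical
    vector n. The error is E on five vertical vectors, which is zero since the vertical spaces have
    dimension four.\<close>
  define n where "n = dd q (y0, y0) (0, u i0)"
  have nv: "n \<in> vert D x" using vert[OF z0] by (simp add: n_def qx)
  have wi0: "dd q (y0, y0) (U' i0) = w i0 - n"
    using diag[of "u i0"] u[of i0] by (simp add: U'_def n_def algebra_simps)
  have e: "(\<lambda>j. dd q (y0, y0) (U' j)) = w(i0 := w i0 - n)" using wi wi0 by auto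
  have "E (\<lambda>j. dd q (y0, y0) (U' j)) = 0"
    using 0 E(2)[of "\<lambda>j. dd q (y0, y0) (U' j)"] tangent_push[OF qC qM z0] by (simp add: qx)
  then have "E (w(i0 := w i0)) - E (w(i0 := n)) = 0"
    unfolding e using linear_diff[OF altform_linear[OF E(1) w(2)], of w "w i0" n] by simp
  moreover have "E (w(i0 := n)) = 0"
    by (rule altform_dim_zero[OF E(1) order_refl, of "vert D x"]) (use vert_dim[OF x] w(3) nv in auto)
  ultimately show ?thesis by simp
qed

text \<open>The assumptions kill only the sums over all sets of two, respectively three, horizontal
  slots. Four or more such slots exceed the dimension of the horizontal spaces, and at most one is
  the case of \<open>dTheta_vertical\<close>.\<close>

theorem dTheta_zero:
  assumes x: "x \<in> M" and v: "\<And>i. v i \<in> T x"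
  shows "ext_deriv M 4 (Theta D) x v = 0"
proof -
  obtain E where E0: "altform (Suc 4) E" "\<And>v. (\<And>i. v i \<in> T x) \<Longrightarrow> ext_deriv M 4 (Theta D) x v = E v"
    by (rule tangential_ext_deriv[OF forms(2) x]) (rule that, assumption, blast)
  have E: "altform 5 E" using E0(1) by simp
  let ?h = "\<lambda>i. hpart D x (v i)" and ?v = "\<lambda>i. vpart D x (v i)"
  let ?w = "\<lambda>I i. if i \<in> I then ?h i else ?v i"
  have wT: "?w I i \<in> T x" for I i using hpart[OF x v] ehr(2)[OF x] vert_T by auto
  have comp: "(\<Sum>I | I \<subseteq> {..<5} \<and> card I = p. E (?w I)) = bicomp D x p q (ext_deriv M 4 (Theta D) x) v" if "p + q = 5" for p q
    unfolding bicomp_def that by (rule sum.cong[OF refl]) (rule E0(2)[OF wT, symmetric])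
  have c2: "(\<Sum>I | I \<subseteq> {..<5} \<and> card I = 2. E (?w I)) = 0"
    using fibD(9) x v comp[of 2 3] unfolding zero_form_def d_f_def by simp
  have c3: "(\<Sum>I | I \<subseteq> {..<5} \<and> card I = 3. E (?w I)) = 0"
    using fibD(10) x v comp[of 3 2] unfolding zero_form_def d_H_def by simp
  have other: "E (?w I) = 0" if I: "I \<subseteq> {..<5}" "card I \<noteq> 2" "card I \<noteq> 3" for I
  proof (cases "card I \<ge> 4")
    case True
    show ?thesis
      by (rule altform_dim_zero[OF E I(1), of "horiz D x"]) (use True horiz_dim[OF x] hpart(1)[OF x v] in auto)
  next
    case False
    then have le: "card I \<le> 1" using I by linarith
    have finI: "finite I" using I(1) finite_subset by blast
    obtain i0 where i0: "i0 < 5" "I \<subseteq> {i0}"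
    proof (cases "I = {}")
      case True
      then show ?thesis using that[of 0] by simp
    next
      case False
      then obtain i where "i \<in> I" by blast
      then show ?thesis using that[of i] I(1) card_le_Suc0_iff_eq[OF finI] le by auto
    qed
    show ?thesis
      by (rule dTheta_vertical[OF x E E0(2) wT i0(1)]) (use i0(2) hpart(2)[OF x v] in auto)
  qed
  have "ext_deriv M 4 (Theta D) x v = E v" by (rule E0(2)[OF v])
  also have "E v = E (\<lambda>i. ?h i + ?v i)" by (simp add: vpart_def)
  also have "\<dots> = (\<Sum>I\<in>Pow {..<5}. E (?w I))" by (rule mlin_add_expand[OF altform_mlin[OF E]])
  also have "\<dots> = (\<Sum>I\<in>{I. I \<subseteq> {..<5} \<and> card I = 2} \<union> {I. I \<subseteq> {..<5} \<and> card I = 3}. E (?w I))"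
    by (rule sum.mono_neutral_right) (use other in auto)
  also have "\<dots> = (\<Sum>I | I \<subseteq> {..<5} \<and> card I = 2. E (?w I)) + (\<Sum>I | I \<subseteq> {..<5} \<and> card I = 3. E (?w I))"
  proof (rule sum.union_disjoint)
    have "finite (Pow {..<5::nat})" by simp
    then show "finite {I. I \<subseteq> {..<5::nat} \<and> card I = 2}" "finite {I. I \<subseteq> {..<5::nat} \<and> card I = 3}"
      by (auto intro: finite_subset[OF _ \<open>finite (Pow {..<5::nat})\<close>])
  qed auto
  finally show ?thesis using c2 c3 by simp
qed

subsection \<open>Properness of the projection\<close>

lemma compact_K3: "compact K3"
proof -
  let ?Z = "{z :: complex^4. norm z = 1 \<and> (\<Sum>i\<in>UNIV. z $ i ^ 4) = 0}"
  have "closed {z :: complex^4. (\<Sum>i\<in>UNIV. z $ i ^ 4) = 0}"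
    by (intro closed_Collect_eq continuous_intros)
  moreover have "?Z = sphere 0 1 \<inter> {z. (\<Sum>i\<in>UNIV. z $ i ^ 4) = 0}" by (auto simp: dist_norm)
  ultimately have "compact ?Z" by (simp add: compact_Int_closed)
  moreover have "continuous_on ?Z (\<lambda>z. (\<chi> i j. z $ i * cnj (z $ j)) :: complex^4^4)"
    by (intro continuous_on_vec_lambda continuous_intros)
  ultimately have "compact ((\<lambda>z. (\<chi> i j. z $ i * cnj (z $ j)) :: complex^4^4) ` ?Z)" by (rule compact_continuous_image[rotated])
  moreover have "K3 = (\<lambda>z. (\<chi> i j. z $ i * cnj (z $ j)) :: complex^4^4) ` ?Z" by (auto simp: K3_def)
  ultimately show ?thesis by simp
qed

text \<open>B need not be closed in its ambient space; compactness comes from the image of a closed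
  ball under a chart.\<close>

lemma base_locally_compact:
  assumes b: "b \<in> B" and U: "open U" "b \<in> U"
  obtains r where "r > 0" "cball b r \<subseteq> U" "compact (B \<inter> cball b r)"
proof -
  have m: "manifold CARD(3) B" using fibD(1) by simp
  obtain r W and \<phi> :: "real^3 \<Rightarrow> 'b" and g where c: "r > 0" "Cinf (ball (g b) r) \<phi>" "Cinf W g" "b \<in> W" "W \<subseteq> U"
    "\<phi> ` ball (g b) r = B \<inter> W" "\<And>y. y \<in> ball (g b) r \<Longrightarrow> g (\<phi> y) = y"
    "\<And>z. z \<in> B \<Longrightarrow> z \<in> W \<Longrightarrow> g z \<in> ball (g b) r \<and> \<phi> (g z) = z"
    by (rule chart_exists[OF m b U]) (rule that)
  have "open (W \<inter> g -` ball (g b) (r / 2))"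
    by (rule continuous_open_preimage[OF Cinf_continuous_on[OF c(3)] Cinf_open[OF c(3)] open_ball])
  then obtain s where s: "s > 0" "cball b s \<subseteq> W \<inter> g -` ball (g b) (r / 2)"
    using open_contains_cball c(1,4) by (metis IntI centre_in_ball half_gt_zero vimageI)
  let ?C = "cball (g b) (r / 2)"
  have C: "?C \<subseteq> ball (g b) r" using c(1) by auto
  have "compact (\<phi> ` ?C)"
    by (rule compact_continuous_image[OF continuous_on_subset[OF Cinf_continuous_on[OF c(2)] C] compact_cball])
  moreover have "B \<inter> cball b s = \<phi> ` ?C \<inter> cball b s"
  proof
    show "B \<inter> cball b s \<subseteq> \<phi> ` ?C \<inter> cball b s"
    proof
      fix z assume z: "z \<in> B \<inter> cball b s"
      then have "z \<in> W" "g z \<in> ?C" using s(2) by (auto simp: subset_iff less_imp_le)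
      then show "z \<in> \<phi> ` ?C \<inter> cball b s" using c(8)[of z] z by (metis IntD1 IntD2 IntI image_eqI)
    qed
    show "\<phi> ` ?C \<inter> cball b s \<subseteq> B \<inter> cball b s" using c(6) C by blast
  qed
  ultimately have "compact (B \<inter> cball b s)" by (simp add: compact_Int_closed)
  then show ?thesis using that[OF s(1)] s(2) c(5) by blast
qed

lemma proper:
  assumes b: "b \<in> B"
  obtains r where "r > 0" "compact {x \<in> M. \<pi> x \<in> cball b r}"
proof -
  obtain U \<psi> \<tau> where U: "open U" "b \<in> U" "smooth_on {x \<in> M. \<pi> x \<in> U} \<psi>" "smooth_on ((B \<inter> U) \<times> K3) \<tau>"
    "\<And>x. x \<in> M \<Longrightarrow> \<pi> x \<in> U \<Longrightarrow> \<psi> x \<in> K3 \<and> \<tau> (\<pi> x, \<psi> x) = x"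
    "\<And>b k. b \<in> B \<Longrightarrow> b \<in> U \<Longrightarrow> k \<in> K3 \<Longrightarrow> \<tau> (b, k) \<in> M \<and> \<pi> (\<tau> (b, k)) = b"
    by (rule trivialisation[OF b]) (rule that)
  obtain r where r: "r > 0" "cball b r \<subseteq> U" "compact (B \<inter> cball b r)"
    by (rule base_locally_compact[OF b U(1,2)]) (rule that)
  let ?C = "(B \<inter> cball b r) \<times> K3"
  have "compact ?C" by (rule compact_Times[OF r(3) compact_K3])
  moreover have "continuous_on ?C \<tau>"
    by (rule continuous_on_subset[OF smooth_on_continuous[OF U(4)]]) (use r(2) in auto)
  ultimately have "compact (\<tau> ` ?C)" by (rule compact_continuous_image[rotated])
  moreover have "\<tau> ` ?C = {x \<in> M. \<pi> x \<in> cball b r}"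
  proof
    show "\<tau> ` ?C \<subseteq> {x \<in> M. \<pi> x \<in> cball b r}"
    proof
      fix x assume "x \<in> \<tau> ` ?C"
      then obtain b' k where bk: "x = \<tau> (b', k)" "b' \<in> B" "b' \<in> cball b r" "k \<in> K3" by auto
      then have "x \<in> M \<and> \<pi> x = b'" using U(6)[of b' k] r(2) by blast
      then show "x \<in> {x \<in> M. \<pi> x \<in> cball b r}" using bk(3) by simp
    qed
    show "{x \<in> M. \<pi> x \<in> cball b r} \<subseteq> \<tau> ` ?C"
    proof
      fix x assume "x \<in> {x \<in> M. \<pi> x \<in> cball b r}"
      then have x: "x \<in> M" "\<pi> x \<in> cball b r" by auto
      then have "\<psi> x \<in> K3" "\<tau> (\<pi> x, \<psi> x) = x" using U(5)[of x] r(2) by auto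
      moreover have "(\<pi> x, \<psi> x) \<in> ?C" using x \<pi>(2)[OF x(1)] calculation(1) by simp
      ultimately show "x \<in> \<tau> ` ?C" by (metis image_eqI)
    qed
  qed
  ultimately show ?thesis using that[OF r(1)] by simp
qed

end

section \<open>The monopole equation in a chart\<close>

lemma inner_matrix_mult_left: "(a ** x) \<bullet> y = x \<bullet> (cadj a ** y)" for a x y :: "complex^'n^'n"
proof -
  have c: "(p * q) \<bullet> r = q \<bullet> (cnj p * r)" for p q r :: complex
    by (simp add: inner_complex_def algebra_simps)
  have "(a ** x) \<bullet> y = (\<Sum>i\<in>UNIV. \<Sum>j\<in>UNIV. \<Sum>k\<in>UNIV. (a $ i $ k * x $ k $ j) \<bullet> (y $ i $ j))"
    by (simp add: inner_vec_def matrix_matrix_mult_def inner_sum_left)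
  also have "\<dots> = (\<Sum>i\<in>UNIV. \<Sum>k\<in>UNIV. \<Sum>j\<in>UNIV. (a $ i $ k * x $ k $ j) \<bullet> (y $ i $ j))"
    by (intro sum.cong refl sum.swap)
  also have "\<dots> = (\<Sum>k\<in>UNIV. \<Sum>i\<in>UNIV. \<Sum>j\<in>UNIV. (a $ i $ k * x $ k $ j) \<bullet> (y $ i $ j))"
    by (rule sum.swap)
  also have "\<dots> = (\<Sum>k\<in>UNIV. \<Sum>j\<in>UNIV. \<Sum>i\<in>UNIV. (a $ i $ k * x $ k $ j) \<bullet> (y $ i $ j))"
    by (intro sum.cong refl sum.swap)
  also have "\<dots> = x \<bullet> (cadj a ** y)"
    by (simp add: inner_vec_def matrix_matrix_mult_def inner_sum_right cadj_def c)
  finally show ?thesis .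
qed

lemma inner_matrix_mult_right: "(x ** a) \<bullet> y = x \<bullet> (y ** cadj a)" for a x y :: "complex^'n^'n"
proof -
  have c: "(p * q) \<bullet> r = p \<bullet> (r * cnj q)" for p q r :: complex
    by (simp add: inner_complex_def algebra_simps)
  have "(x ** a) \<bullet> y = (\<Sum>i\<in>UNIV. \<Sum>j\<in>UNIV. \<Sum>k\<in>UNIV. (x $ i $ k * a $ k $ j) \<bullet> (y $ i $ j))"
    by (simp add: inner_vec_def matrix_matrix_mult_def inner_sum_left)
  also have "\<dots> = (\<Sum>i\<in>UNIV. \<Sum>k\<in>UNIV. \<Sum>j\<in>UNIV. (x $ i $ k * a $ k $ j) \<bullet> (y $ i $ j))"
    by (intro sum.cong refl sum.swap)
  also have "\<dots> = x \<bullet> (y ** cadj a)"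
    by (simp add: inner_vec_def matrix_matrix_mult_def inner_sum_right cadj_def c)
  finally show ?thesis .
qed

text \<open>The infinitesimal form of the invariance of the real inner product under conjugation by
  unitary matrices.\<close>

lemma bracket_skew:
  fixes a :: "complex^'n^'n"
  assumes "cadj a = - a" shows "bracket a x \<bullet> y + x \<bullet> bracket a y = 0"
proof -
  have "(a ** x) \<bullet> y = - (x \<bullet> (a ** y))" "(x ** a) \<bullet> y = - (x \<bullet> (y ** a))"
    unfolding inner_matrix_mult_left[of a x y] inner_matrix_mult_right[of x a y] assms
    by (simp_all add: mat.minus_left mat.minus_right)
  then show ?thesis by (simp add: bracket_def inner_diff_left inner_diff_right)
qed

lemma norm_conjugate:
  fixes g :: "complex^'n^'n"
  assumes "g ** cadj g = mat 1" shows "norm (cadj g ** x ** g) = norm x"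
proof -
  have cc: "cadj (cadj g) = g" by (simp add: cadj_def vec_eq_iff)
  have "(cadj g ** x ** g) \<bullet> (cadj g ** x ** g) = (cadj g ** x) \<bullet> (cadj g ** x ** (g ** cadj g))"
    by (simp add: inner_matrix_mult_right matrix_mul_assoc)
  also have "\<dots> = x \<bullet> ((g ** cadj g) ** x)"
    by (simp add: assms inner_matrix_mult_left cc matrix_mul_assoc)
  finally show ?thesis by (simp add: norm_eq_sqrt_inner assms)
qed

lemma wedge_map: "wedge p q a b (\<lambda>i. L (v i)) = wedge p q (\<lambda>w. a (\<lambda>i. L (w i))) (\<lambda>w. b (\<lambda>i. L (w i))) v"
  by (simp add: wedge_def)

lemma alt_sum_map: "alt_sum n t (\<lambda>i. L (v i)) = alt_sum n (\<lambda>w. t (\<lambda>i. L (w i))) v"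
  by (simp add: alt_sum_def comp_def)

context fibration
begin

text \<open>The volume form \<mu> \<and> \<lambda> multiplied by 4! 3!, the factor left by the
  unnormalised alternation.\<close>

definition volf :: "'m \<Rightarrow> (nat \<Rightarrow> 'm) \<Rightarrow> real" where
  "volf x v = alt_sum 7 (\<lambda>w. mu D x w * lam D x (\<lambda>i. w (4 + i))) v"

end

locale monopole = fibration D + bundle_connection Q "tot D" A
  for D :: "('m::euclidean_space, 'b::euclidean_space) adiabatic_data"
    and Q :: "('p::euclidean_space, 'm, 'n::finite) bundle_data"
    and A :: "'p \<Rightarrow> (nat \<Rightarrow> 'p) \<Rightarrow> complex^'n^'n" +
  fixes \<Phi> :: "'p \<Rightarrow> complex^'n^'n"
  assumes mono: "adiabatic_monopole D Q A \<Phi>"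
begin

lemma higgs: "higgs_field Q \<Phi>"
  using mono by (simp add: adiabatic_monopole_def)

lemma \<Phi>_smooth: "smooth_on P \<Phi>"
  using higgs by (simp add: higgs_field_def)

lemma equation:
  assumes "p \<in> P" "\<And>i. v i \<in> T (pr p)"
  shows "wedge 2 4 (curvature Q A p) (Theta D (pr p)) v +
    wedge 3 3 (star4 D (pr p) (vert_cov_deriv D Q A \<Phi> p)) (lam D (pr p)) v = 0"
  using mono assms unfolding adiabatic_monopole_def zero_ad_form_def by blast

lemma vert_cov_deriv_eq: "vert_cov_deriv D Q A \<Phi> p v = cov_deriv Q A \<Phi> p (\<lambda>i. vpart D (pr p) (v i))"
proof -
  have "{I. I \<subseteq> {..<0 + 1::nat} \<and> card I = 0} = {{}}"
    by (auto dest: finite_subset)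
  then show ?thesis unfolding vert_cov_deriv_def bicomp_def by simp
qed

end

text \<open>A chart together with a local gauge s: connection, curvature and Higgs field become
  matrix valued functions on an open subset of \<open>real^7\<close>.\<close>

locale monopole_chart = monopole D Q A \<Phi>
  for D :: "('m::euclidean_space, 'b::euclidean_space) adiabatic_data"
    and Q :: "('p::euclidean_space, 'm, 'n::finite) bundle_data"
    and A :: "'p \<Rightarrow> (nat \<Rightarrow> 'p) \<Rightarrow> complex^'n^'n"
    and \<Phi> :: "'p \<Rightarrow> complex^'n^'n" +
  fixes V :: "(real^7) set" and \<phi> :: "real^7 \<Rightarrow> 'm" and s :: "real^7 \<Rightarrow> 'p" and e :: "nat \<Rightarrow> 7"
  assumes e: "bij_betw e {..<CARD(7)} UNIV"
    and \<phi>: "Cinf V \<phi>" "\<And>y. y \<in> V \<Longrightarrow> \<phi> y \<in> M" "\<And>y. y \<in> V \<Longrightarrow> T (\<phi> y) = range (dd \<phi> y)"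
    and s: "Cinf V s" "\<And>y. y \<in> V \<Longrightarrow> s y \<in> P" "\<And>y. y \<in> V \<Longrightarrow> pr (s y) = \<phi> y"
begin

definition b :: "nat \<Rightarrow> real^7" where "b i = axis (e i) 1"

lemma b: "bij_betw b {..<7} Basis"
proof -
  have "inj_on b {..<7}" using e by (auto simp: b_def inj_on_def axis_eq_axis bij_betw_def)
  moreover have "b ` {..<7} = Basis"
  proof
    show "b ` {..<7} \<subseteq> Basis" by (auto simp: b_def Basis_vec_def)
    show "Basis \<subseteq> b ` {..<7}"
    proof
      fix u :: "real^7" assume "u \<in> Basis"
      then obtain k where k: "u = axis k 1" by (auto simp: Basis_vec_def)
      have "k \<in> e ` {..<7}" using e by (auto simp: bij_betw_def)
      then show "u \<in> b ` {..<7}" using k by (auto simp: b_def)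
    qed
  qed
  ultimately show ?thesis by (simp add: bij_betw_def)
qed

lemma sum_b: "(\<Sum>i<7. (w \<bullet> b i) *\<^sub>R b i) = w"
  using euclidean_representation[of w] sum.reindex_bij_betw[OF b, of "\<lambda>x. (w \<bullet> x) *\<^sub>R x"] by simp

text \<open>The gauge potential: the pullback of the connection form along s, evaluated on the
  constant vector u.\<close>

definition aA :: "real^7 \<Rightarrow> real^7 \<Rightarrow> complex^'n^'n" where
  "aA u y = a (s y) (dd s y u)"

definition F :: "real^7 \<Rightarrow> real^7 \<Rightarrow> real^7 \<Rightarrow> complex^'n^'n" where
  "F u w y = curvature Q A (s y) (\<lambda>i. dd \<phi> y (if i = 0 then u else w))"

definition nab :: "real^7 \<Rightarrow> (real^7 \<Rightarrow> complex^'n^'n) \<Rightarrow> real^7 \<Rightarrow> complex^'n^'n" where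
  "nab u \<psi> y = dd \<psi> y u + bracket (aA u y) (\<psi> y)"

definition ph :: "real^7 \<Rightarrow> complex^'n^'n" where "ph y = \<Phi> (s y)"

lemma oV: "open V" using Cinf_open[OF \<phi>(1)] .

lemma pr_s: "y \<in> V \<Longrightarrow> mdiff P pr (s y) (dd s y u) = dd \<phi> y u"
proof -
  assume y: "y \<in> V"
  have "mdiff P pr (s y) (dd s y u) = dd (\<lambda>z. pr (s z)) y u" by (rule dd_pull[OF s(1,2) P_facts(2) y, symmetric])
  also have "\<dots> = dd \<phi> y u" by (rule dd_cong[OF oV y]) (rule s(3))
  finally show ?thesis .
qed

lemma ds_T: "y \<in> V \<Longrightarrow> dd s y u \<in> tangent_space P (s y)"
  by (rule tangent_push[OF s(1,2)])

lemma d\<phi>_T: "y \<in> V \<Longrightarrow> dd \<phi> y u \<in> T (\<phi> y)"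
  by (rule tangent_push[OF \<phi>(1,2)])

lemma aA_Cinf: "Cinf V (aA u)"
  unfolding aA_def[abs_def] by (rule form_pull_Cinf[OF connD(1) s(1,2)]) (auto intro: Cinf_deriv[OF s(1)])

lemma ph_Cinf: "Cinf V ph"
  unfolding ph_def[abs_def] by (rule Cinf_pull[OF s(1,2) \<Phi>_smooth])

lemma aA_skew: "y \<in> V \<Longrightarrow> cadj (aA u y) = - aA u y"
  unfolding aA_def by (rule lie_skew, rule connD(2)[OF s(2) ds_T])

lemma F_form:
  assumes y: "y \<in> V"
  shows "F u w y = dd (aA w) y u - dd (aA u) y w + bracket (aA u y) (aA w y)"
proof -
  define U where "U i = (if i = 0 then u else w)" for i :: nat
  have "F u w y = ext_deriv P 1 A (s y) (\<lambda>j. dd s y (U j)) + bracket (a (s y) (dd s y (U 0))) (a (s y) (dd s y (U 1)))"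
    unfolding F_def by (rule curvature_eq[OF s(2)[OF y] ds_T[OF y] ds_T[OF y]]) (simp_all add: pr_s[OF y] U_def)
  also have "ext_deriv P 1 A (s y) (\<lambda>j. dd s y (U j)) =
      (\<Sum>i\<le>1. (-1) ^ i *\<^sub>R dd (\<lambda>z. A (s z) (\<lambda>j. dd s z (if j < i then U j else U (Suc j)))) y (U i))"
    by (rule ext_deriv_pullback[OF connD(1) s(1,2) y, symmetric])
  also have "\<dots> = (\<Sum>i\<le>1. (-1) ^ i *\<^sub>R dd (aA (if 0 < i then U 0 else U (Suc 0))) y (U i))"
  proof (rule sum.cong[OF refl])
    fix i :: nat
    have "dd (\<lambda>z. A (s z) (\<lambda>j. dd s z (if j < i then U j else U (Suc j)))) y (U i) = dd (aA (if 0 < i then U 0 else U (Suc 0))) y (U i)"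
      by (rule dd_cong[OF oV y], unfold aA_def) (rule A_a[OF s(2)])
    then show "(-1) ^ i *\<^sub>R dd (\<lambda>z. A (s z) (\<lambda>j. dd s z (if j < i then U j else U (Suc j)))) y (U i)
        = (-1) ^ i *\<^sub>R dd (aA (if 0 < i then U 0 else U (Suc 0))) y (U i)" by simp
  qed
  finally show ?thesis by (simp add: U_def aA_def)
qed

lemma F_Cinf: "Cinf V (F u w)"
proof -
  have "Cinf V (\<lambda>y. dd (aA w) y u - dd (aA u) y w + bracket (aA u y) (aA w y))"
    by (intro Cinf_add Cinf_diff Cinf_deriv aA_Cinf Cinf_bilinear[OF bounded_bilinear_bracket])
  then show ?thesis by (rule Cinf_cong[THEN iffD2, rotated]) (rule F_form)
qed

lemma F_eq: "y \<in> V \<Longrightarrow> curvature Q A (s y) (\<lambda>i. dd \<phi> y (u i)) = F (u 0) (u 1) y"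
proof -
  assume y: "y \<in> V"
  have "curvature Q A (s y) v = ext_deriv P 1 A (s y) (\<lambda>i. dd s y (u i)) + bracket (a (s y) (dd s y (u 0))) (a (s y) (dd s y (u 1)))"
    if "v 0 = dd \<phi> y (u 0)" "v 1 = dd \<phi> y (u 1)" for v
    by (rule curvature_eq[OF s(2)[OF y] ds_T[OF y] ds_T[OF y]]) (simp_all add: pr_s[OF y] that del: One_nat_def)
  then have "curvature Q A (s y) (\<lambda>i. dd \<phi> y (u i)) = curvature Q A (s y) (\<lambda>i. dd \<phi> y (if i = 0 then u 0 else u 1))"
    by simp
  then show ?thesis unfolding F_def .
qed

lemma cov: "y \<in> V \<Longrightarrow> v 0 = dd \<phi> y u \<Longrightarrow> cov_deriv Q A \<Phi> (s y) v = nab u ph y"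
proof -
  assume y: "y \<in> V" and v: "v 0 = dd \<phi> y u"
  have "cov_deriv Q A \<Phi> (s y) v = mdiff P \<Phi> (s y) (dd s y u) + bracket (a (s y) (dd s y u)) (\<Phi> (s y))"
    using cov_deriv_eq[OF higgs s(2)[OF y], of "\<lambda>_. dd s y u" v] ds_T[OF y] pr_s[OF y] v by simp
  also have "mdiff P \<Phi> (s y) (dd s y u) = dd ph y u"
    unfolding ph_def[abs_def] by (rule dd_pull[OF s(1,2) \<Phi>_smooth y, symmetric])
  finally show ?thesis by (simp add: nab_def ph_def aA_def)
qed

lemma nab_linear: "y \<in> V \<Longrightarrow> linear (\<lambda>u. nab u ph y)"
proof -
  assume y: "y \<in> V"
  have l1: "linear (dd ph y)" by (rule Cinf_linear[OF ph_Cinf y])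
  have l2: "linear (\<lambda>u. aA u y)"
    unfolding aA_def using linear_compose[OF Cinf_linear[OF s(1) y] a_linear[OF s(2)[OF y]]] by (simp add: comp_def)
  show ?thesis
    unfolding nab_def by (rule linearI)
      (simp_all add: linear_add[OF l1] linear_scale[OF l1] linear_add[OF l2] linear_scale[OF l2] br.add_left br.scaleR_left scaleR_add_right)
qed

text \<open>The second derivatives of the potential cancel in pairs by symmetry; the terms cubic in
  the potential cancel by the Jacobi identity, once brackets are expanded into matrix
  products.\<close>

lemma bianchi:
  assumes y: "y \<in> V"
  shows "nab u (F v w) y - nab v (F u w) y + nab w (F u v) y = 0"
proof -
  have d: "dd (F v w) y u = dd (\<lambda>z. dd (aA w) z v) y u - dd (\<lambda>z. dd (aA v) z w) y u
      + (bracket (aA v y) (dd (aA w) y u) + bracket (dd (aA v) y u) (aA w y))" for u v w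
  proof -
    have "dd (F v w) y u = dd (\<lambda>z. dd (aA w) z v - dd (aA v) z w + bracket (aA v z) (aA w z)) y u"
      by (rule dd_cong[OF oV y]) (rule F_form)
    also have "\<dots> = dd (\<lambda>z. dd (aA w) z v) y u - dd (\<lambda>z. dd (aA v) z w) y u
      + (bracket (aA v y) (dd (aA w) y u) + bracket (dd (aA v) y u) (aA w y))"
      by (rule dd_eqI) (intro has_derivative_add has_derivative_diff br.FDERIV Cinf_has_derivative[OF _ y] Cinf_deriv aA_Cinf)
    finally show ?thesis .
  qed
  have sym: "dd (\<lambda>z. dd (aA w) z v) y u = dd (\<lambda>z. dd (aA w) z u) y v" for u v w
    by (rule second_derivative_symmetric[OF aA_Cinf y])
  show ?thesis
    unfolding nab_def d F_form[OF y]
    using sym[of w v u] sym[of v w u] sym[of u w v]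
    by (simp add: bracket_def mat.add_left mat.add_right mat.diff_left mat.diff_right matrix_mul_assoc algebra_simps)
qed

section \<open>The top-degree pairing of curvature and \<Theta>\<close>

definition Th :: "(nat \<Rightarrow> real^7) \<Rightarrow> real^7 \<Rightarrow> real" where
  "Th v y = Theta D (\<phi> y) (\<lambda>j. dd \<phi> y (v j))"

lemma Th_Cinf: "Cinf V (Th v)"
  unfolding Th_def[abs_def] by (rule form_pull_Cinf[OF forms(2) \<phi>(1,2)]) (auto intro: Cinf_deriv[OF \<phi>(1)])

lemma Th_closed:
  assumes y: "y \<in> V"
  shows "(\<Sum>i\<le>4. (-1) ^ i *\<^sub>R dd (Th (\<lambda>j. if j < i then u j else u (Suc j))) y (u i)) = 0"
proof -
  have "(\<Sum>i\<le>4. (-1) ^ i *\<^sub>R dd (\<lambda>z. Theta D (\<phi> z) (\<lambda>j. dd \<phi> z (if j < i then u j else u (Suc j)))) y (u i))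
     = ext_deriv M 4 (Theta D) (\<phi> y) (\<lambda>j. dd \<phi> y (u j))"
    by (rule ext_deriv_pullback[OF forms(2) \<phi>(1,2) y])
  also have "\<dots> = 0" by (rule dTheta_zero[OF \<phi>(2)[OF y] d\<phi>_T[OF y]])
  finally show ?thesis by (simp only: Th_def[abs_def])
qed

text \<open>The coefficient of \<kappa> \<and> F \<and> \<Theta> in the chart, multiplied by 2! 4!
  and with matrix values paired by the inner product. \<kappa> is kept general because both \<Phi>
  dx_i and d_A \<Phi> are inserted later.\<close>

definition S :: "(real^7 \<Rightarrow> complex^'n^'n) \<Rightarrow> real^7 \<Rightarrow> real" where
  "S \<kappa> y = alt_sum 7 (\<lambda>u. Th (\<lambda>j. u (3 + j)) y * (\<kappa> (u 0) \<bullet> F (u 1) (u 2) y)) b"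

definition \<beta> :: "real^7 \<Rightarrow> real" where "\<beta> y = volf (\<phi> y) (\<lambda>i. dd \<phi> y (b i))"

definition \<epsilon> :: "real^7 \<Rightarrow> nat \<Rightarrow> real^7" where
  "\<epsilon> y j = (SOME u. dd \<phi> y u = frame (\<phi> y) j)"

lemma \<epsilon>: "y \<in> V \<Longrightarrow> j < 4 \<Longrightarrow> dd \<phi> y (\<epsilon> y j) = frame (\<phi> y) j"
proof -
  assume "y \<in> V" "j < 4"
  then have "frame (\<phi> y) j \<in> range (dd \<phi> y)" using frame(1) vert_T \<phi>(2,3) by metis
  then have "\<exists>u. dd \<phi> y u = frame (\<phi> y) j" by auto
  then show ?thesis unfolding \<epsilon>_def by (rule someI_ex)
qed

text \<open>
  The monopole equation expresses \<open>\<kappa> \<and> F \<and> \<Theta>\<close> through \<open>\<kappa> \<and> *d\<^sub>A\<Phi> \<and> \<lambda>\<close>, and the latter is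
  \<open>\<langle>\<kappa>, d\<^sub>A\<Phi>\<rangle>\<close> times the volume form, in terms of the fibre metric.
\<close>

lemma S_eq:
  assumes y: "y \<in> V" and \<kappa>: "linear \<kappa>"
  shows "3 * S \<kappa> y = - \<beta> y * (\<Sum>j<4. \<kappa> (\<epsilon> y j) \<bullet> nab (\<epsilon> y j) ph y)"
proof -
  let ?L = "dd \<phi> y" and ?x = "\<phi> y" and ?p = "s y"
  have x: "?x \<in> M" and p: "?p \<in> P" and prp: "pr ?p = ?x" using \<phi>(2) s(2,3) y by auto
  have lin: "linear ?L" by (rule Cinf_linear[OF \<phi>(1) y])
  let ?c = "\<lambda>w. curvature Q A ?p (\<lambda>i. ?L (w i))"
  let ?th = "\<lambda>w. Theta D ?x (\<lambda>i. ?L (w i))"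
  let ?mu = "\<lambda>w. mu D ?x (\<lambda>i. ?L (w i))" and ?la = "\<lambda>w. lam D ?x (\<lambda>i. ?L (w i))"
  let ?st = "\<lambda>w. star4 D ?x (vert_cov_deriv D Q A \<Phi> ?p) (\<lambda>i. ?L (w i))"
  have alt: "altform (Suc 3) ?mu" "altform 3 ?la"
    using altform_linear_map[OF form_altform[OF forms(3) x] lin] altform_linear_map[OF form_altform[OF forms(1) x] lin] by simp_all
  have eq: "wedge 2 4 ?c ?th w + wedge 3 3 ?st ?la w = 0" for w
    using equation[OF p, of "\<lambda>i. ?L (w i)"] d\<phi>_T[OF y] unfolding prp wedge_map by simp
  have vcd: "vert_cov_deriv D Q A \<Phi> ?p (\<lambda>_. frame ?x j) = nab (\<epsilon> y j) ph y" if j: "j < 4" for j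
    unfolding vert_cov_deriv_eq prp vpart_vert[OF x frame(1)[OF x j]]
    by (rule cov[OF y]) (simp add: \<epsilon>[OF y j])
  have st: "?st w = (\<Sum>j<4. ?mu (case_nat (\<epsilon> y j) w) *\<^sub>R nab (\<epsilon> y j) ph y)" for w
    unfolding star4_frame
  proof (rule sum.cong[OF refl])
    fix j :: nat assume "j \<in> {..<4}"
    then have j: "j < 4" by simp
    have "case_nat (frame ?x j) (\<lambda>i. ?L (w i)) = (\<lambda>i. ?L (case_nat (\<epsilon> y j) w i))"
      using \<epsilon>[OF y j] by (auto simp: fun_eq_iff split: nat.split)
    then show "mu D ?x (case_nat (frame ?x j) (\<lambda>i. ?L (w i))) *\<^sub>R vert_cov_deriv D Q A \<Phi> ?p (\<lambda>_. frame ?x j)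
        = ?mu (case_nat (\<epsilon> y j) w) *\<^sub>R nab (\<epsilon> y j) ph y" using vcd[OF j] by simp
  qed
  let ?in = "\<lambda>u w. \<kappa> u \<bullet> w"
  \<comment> \<open>The monopole equation is paired with \<kappa> in an additional first slot and
    alternated over all seven slots; \<open>inlin\<close> lets this pairing pass through the wedge
    products. It splits into a curvature part and a Higgs part.\<close>
  have inlin: "linear (?in u)" for u by (simp add: linear_iff inner_add_right)
  have 0: "alt_sum 7 (\<lambda>u. ?in (u 0) (wedge 2 4 ?c ?th (\<lambda>i. u (Suc i)))) b
      + alt_sum 7 (\<lambda>u. ?in (u 0) (wedge 3 3 ?st ?la (\<lambda>i. u (Suc i)))) b = 0"
    unfolding alt_sum_add[symmetric] inner_add_right[symmetric] eq by (simp add: alt_sum_def)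
  have "alt_sum 7 (\<lambda>u. ?in (u 0) (wedge 2 4 ?c ?th (\<lambda>i. u (Suc i)))) b
    = (fact 6 / (fact 2 * fact 4)) *\<^sub>R alt_sum 7 (\<lambda>u. ?th (\<lambda>i. u (1 + 2 + i)) *\<^sub>R ?in (u 0) (?c (\<lambda>i. u (1 + i)))) b"
    using alt_sum_wedge[of ?in 2 4 ?c ?th b, OF inlin] by simp
  also have "alt_sum 7 (\<lambda>u. ?th (\<lambda>i. u (1 + 2 + i)) *\<^sub>R ?in (u 0) (?c (\<lambda>i. u (1 + i)))) b = S \<kappa> y"
    unfolding S_def Th_def F_eq[OF y] by (simp add: eval_nat_numeral)
  also have "fact 6 / (fact 2 * fact 4) = (15 :: real)" by (simp add: fact_numeral)
  finally have 1: "alt_sum 7 (\<lambda>u. ?in (u 0) (wedge 2 4 ?c ?th (\<lambda>i. u (Suc i)))) b = 15 * S \<kappa> y" by simp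
  have "alt_sum 7 (\<lambda>u. ?in (u 0) (wedge 3 3 ?st ?la (\<lambda>i. u (Suc i)))) b
    = (fact 6 / (fact 3 * fact 3)) *\<^sub>R alt_sum 7 (\<lambda>u. ?la (\<lambda>i. u (1 + 3 + i)) *\<^sub>R ?in (u 0) (?st (\<lambda>i. u (1 + i)))) b"
    using alt_sum_wedge[of ?in 3 3 ?st ?la b, OF inlin] by simp
  also have "fact 6 / (fact 3 * fact 3) = (20 :: real)" by (simp add: fact_numeral)
  also have "alt_sum 7 (\<lambda>u. ?la (\<lambda>i. u (1 + 3 + i)) *\<^sub>R ?in (u 0) (?st (\<lambda>i. u (1 + i)))) b
    = (\<Sum>j<4. alt_sum 7 (\<lambda>u. ?in (u 0) (nab (\<epsilon> y j) ph y) * (?mu (case_nat (\<epsilon> y j) (\<lambda>i. u (Suc i))) * ?la (\<lambda>i. u (Suc 3 + i)))) b)"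
    unfolding alt_sum_sum[symmetric] st plus_1_eq_Suc by (rule alt_sum_cong) (simp add: inner_sum_right sum_distrib_left mult_ac)
  \<comment> \<open>20 is split as 5 times 4: the 4 is what \<open>alt_sum_contract\<close> provides
    for the 4-form \<mu>, and the 5 cancels against 15, which leaves the 3 of the statement.\<close>
  also have "20 *\<^sub>R \<dots> = 5 * (\<Sum>j<4. 4 * alt_sum 7 (\<lambda>u. ?in (u 0) (nab (\<epsilon> y j) ph y) * (?mu (case_nat (\<epsilon> y j) (\<lambda>i. u (Suc i))) * ?la (\<lambda>i. u (Suc 3 + i)))) b)"
    by (simp only: sum_distrib_left[symmetric]) simp
  also have "\<dots> = 5 * (\<Sum>j<4. (\<kappa> (\<epsilon> y j) \<bullet> nab (\<epsilon> y j) ph y) * \<beta> y)"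
  proof -
    have "4 * alt_sum 7 (\<lambda>u. ?in (u 0) (nab (\<epsilon> y j) ph y) * (?mu (case_nat (\<epsilon> y j) (\<lambda>i. u (Suc i))) * ?la (\<lambda>i. u (Suc 3 + i)))) b
      = (\<kappa> (\<epsilon> y j) \<bullet> nab (\<epsilon> y j) ph y) * \<beta> y" if j: "j < 4" for j
    proof -
      have lk: "linear (\<lambda>u. ?in u (nab (\<epsilon> y j) ph y))"
        by (rule linearI) (simp_all add: linear_add[OF \<kappa>] linear_scale[OF \<kappa>] inner_add_left)
      \<comment> \<open>The frame vector is vertical, so \<lambda> annihilates it; this is the
        condition on the contracted vector.\<close>
      have z: "?la u = 0" if "i < 3" "u i = \<epsilon> y j" for u i
        by (rule lam_zero[OF x d\<phi>_T[OF y] that(1)]) (simp add: that(2) \<epsilon>[OF y j] frame(1)[OF x j])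
      have b': "bij_betw b {..<Suc 3 + 3} Basis" using b by simp
      have \<beta>y: "\<beta> y = alt_sum 7 (\<lambda>u. ?mu u * ?la (\<lambda>i. u (Suc 3 + i))) b"
        unfolding \<beta>_def volf_def alt_sum_map by simp
      show ?thesis
        using alt_sum_contract[OF b' lk alt z] unfolding \<beta>y by simp
    qed
    then show ?thesis by simp
  qed
  also have "\<dots> = 5 * (\<beta> y * (\<Sum>j<4. \<kappa> (\<epsilon> y j) \<bullet> nab (\<epsilon> y j) ph y))" by (simp add: sum_distrib_left mult.commute)
  finally have 2: "alt_sum 7 (\<lambda>u. ?in (u 0) (wedge 3 3 ?st ?la (\<lambda>i. u (Suc i)))) b
     = 5 * (\<beta> y * (\<Sum>j<4. \<kappa> (\<epsilon> y j) \<bullet> nab (\<epsilon> y j) ph y))" .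
  show ?thesis using 0 unfolding 1 2 by simp
qed

text \<open>Up to a constant, the vector field whose contraction with the coordinate volume form is
  the 6-form obtained by pairing \<Phi> with F and wedging with \<Theta>; wedging with dx_i reads
  off component i. Its definition contains neither frames nor the metric, whence its
  smoothness.\<close>

definition Xc :: "real^7 \<Rightarrow> real^7" where
  "Xc y = (\<Sum>i<7. S (\<lambda>u. (u \<bullet> b i) *\<^sub>R ph y) y *\<^sub>R b i)"

definition hh :: "(nat \<Rightarrow> real^7) \<Rightarrow> real^7 \<Rightarrow> real" where
  "hh u z = Th (\<lambda>j. u (3 + j)) z * (ph z \<bullet> F (u 1) (u 2) z)"

lemma hh_Cinf: "Cinf V (hh u)"
  unfolding hh_def[abs_def] by (intro Cinf_mult Cinf_inner Th_Cinf ph_Cinf F_Cinf)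

lemma S_component: "S (\<lambda>u. (u \<bullet> b i) *\<^sub>R ph y) y = alt_sum 7 (\<lambda>u. (u 0 \<bullet> b i) * hh u y) b"
  unfolding S_def by (rule alt_sum_cong) (simp add: hh_def mult_ac)

lemma S_component_Cinf: "Cinf V (\<lambda>y. S (\<lambda>u. (u \<bullet> b i) *\<^sub>R ph y) y)"
  unfolding S_component alt_sum_def
  by (intro Cinf_sum oV Cinf_scaleR Cinf_mult hh_Cinf Cinf_const)

lemma Xc_Cinf: "Cinf V Xc"
  unfolding Xc_def[abs_def] by (intro Cinf_sum oV Cinf_scaleR S_component_Cinf Cinf_const)

lemma Xc_eq:
  assumes y: "y \<in> V"
  shows "3 *\<^sub>R Xc y = (- \<beta> y) *\<^sub>R (\<Sum>j<4. (ph y \<bullet> nab (\<epsilon> y j) ph y) *\<^sub>R \<epsilon> y j)"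
proof -
  have "3 * S (\<lambda>u. (u \<bullet> b i) *\<^sub>R ph y) y = - \<beta> y * (\<Sum>j<4. (\<epsilon> y j \<bullet> b i) * (ph y \<bullet> nab (\<epsilon> y j) ph y))" for i
    using S_eq[OF y, of "\<lambda>u. (u \<bullet> b i) *\<^sub>R ph y"] by (simp add: linear_iff inner_add_left scaleR_add_left)
  then have "3 *\<^sub>R Xc y = (\<Sum>i<7. (- \<beta> y * (\<Sum>j<4. (\<epsilon> y j \<bullet> b i) * (ph y \<bullet> nab (\<epsilon> y j) ph y))) *\<^sub>R b i)"
    by (simp only: Xc_def scaleR_sum_right scaleR_scaleR)
  also have "\<dots> = (- \<beta> y) *\<^sub>R (\<Sum>i<7. \<Sum>j<4. (ph y \<bullet> nab (\<epsilon> y j) ph y) *\<^sub>R (\<epsilon> y j \<bullet> b i) *\<^sub>R b i)"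
    by (simp only: scaleR_sum_right scaleR_sum_left scaleR_scaleR sum_distrib_left mult_ac)
  also have "(\<Sum>i<7. \<Sum>j<4. (ph y \<bullet> nab (\<epsilon> y j) ph y) *\<^sub>R (\<epsilon> y j \<bullet> b i) *\<^sub>R b i) = (\<Sum>j<4. (ph y \<bullet> nab (\<epsilon> y j) ph y) *\<^sub>R (\<Sum>i<7. (\<epsilon> y j \<bullet> b i) *\<^sub>R b i))"
    unfolding scaleR_sum_right by (rule sum.swap)
  finally show ?thesis by (simp only: sum_b)
qed

text \<open>The potential takes skew values, so the two bracket terms cancel.\<close>

lemma metric_connection:
  assumes y: "y \<in> V" and C: "Cinf V \<psi>" "Cinf V \<xi>"
  shows "dd (\<lambda>z. \<psi> z \<bullet> \<xi> z) y u = nab u \<psi> y \<bullet> \<xi> y + \<psi> y \<bullet> nab u \<xi> y"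
  using dd_bilinear[OF bounded_bilinear_inner Cinf_differentiable[OF C(1) y] Cinf_differentiable[OF C(2) y], of u]
    bracket_skew[OF aA_skew[OF y], of u "\<psi> y" "\<xi> y"]
  by (simp add: nab_def inner_add_left inner_add_right)

text \<open>The divergence is the coefficient of the exterior derivative of the 6-form. Leibniz
  distributes it over \<Phi>, F and \<Theta>, with covariant derivatives on the first two since the
  connection is metric. The Bianchi identity removes the second part and closedness of \<Theta> the
  third.\<close>

lemma div_Xc:
  assumes y: "y \<in> V"
  shows "(\<Sum>c\<in>Basis. dd Xc y c \<bullet> c) = S (\<lambda>u. nab u ph y) y"
proof -
  have comp: "Xc z \<bullet> b i = S (\<lambda>u. (u \<bullet> b i) *\<^sub>R ph z) z" if "i < 7" for i z
  proof -
    have bB: "b k \<in> Basis" if "k < 7" for k using b that by (auto simp: bij_betw_def)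
    have "b j \<bullet> b i = (if j = i then 1 else 0)" if "j < 7" for j
      using b that \<open>i < 7\<close> inner_Basis[OF bB bB, of j i] by (auto simp: bij_betw_def inj_on_def)
    then have "Xc z \<bullet> b i = (\<Sum>j<7. if j = i then S (\<lambda>u. (u \<bullet> b i) *\<^sub>R ph z) z else 0)"
      unfolding Xc_def inner_sum_left by (intro sum.cong) auto
    then show ?thesis using that by simp
  qed
  \<comment> \<open>Summing partial derivatives against the coordinates of the vector in slot 0
    gives the derivative along that vector, which turns the divergence into an alternation.\<close>
  have dh: "(\<Sum>i<7. (w \<bullet> b i) * dd (hh u) y (b i)) = dd (hh u) y w" for u w
  proof -
    have l: "linear (dd (hh u) y)" by (rule Cinf_linear[OF hh_Cinf y])
    have "dd (hh u) y (\<Sum>i<7. (w \<bullet> b i) *\<^sub>R b i) = (\<Sum>i<7. (w \<bullet> b i) * dd (hh u) y (b i))"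
      by (simp only: linear_sum[OF l] linear_scale[OF l] real_scaleR_def)
    then show ?thesis by (simp only: sum_b)
  qed
  have "(\<Sum>c\<in>Basis. dd Xc y c \<bullet> c) = (\<Sum>i<7. dd Xc y (b i) \<bullet> b i)"
    by (rule sum.reindex_bij_betw[OF b, symmetric])
  also have "\<dots> = (\<Sum>i<7. alt_sum 7 (\<lambda>u. (u 0 \<bullet> b i) * dd (hh u) y (b i)) b)"
  proof (rule sum.cong[OF refl])
    fix i :: nat assume "i \<in> {..<7}"
    then have i: "i < 7" by simp
    have "dd Xc y (b i) \<bullet> b i = dd (\<lambda>z. Xc z \<bullet> b i) y (b i)"
      by (rule frechet_derivative_bounded_linear_compose[OF bounded_linear_inner_left Cinf_differentiable[OF Xc_Cinf y], symmetric])
    also have "\<dots> = dd (\<lambda>z. \<Sum>\<sigma> | \<sigma> permutes {..<7}. sgnp \<sigma> *\<^sub>R (((b \<circ> \<sigma>) 0 \<bullet> b i) * hh (b \<circ> \<sigma>) z)) y (b i)"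
      unfolding comp[OF i] S_component alt_sum_def ..
    also have "\<dots> = (\<Sum>\<sigma> | \<sigma> permutes {..<7}. sgnp \<sigma> *\<^sub>R (((b \<circ> \<sigma>) 0 \<bullet> b i) * dd (hh (b \<circ> \<sigma>)) y (b i)))"
      by (rule dd_eqI) (intro has_derivative_sum has_derivative_scaleR_right has_derivative_mult_right Cinf_has_derivative[OF hh_Cinf y])
    finally show "dd Xc y (b i) \<bullet> b i = alt_sum 7 (\<lambda>u. (u 0 \<bullet> b i) * dd (hh u) y (b i)) b"
      unfolding alt_sum_def .
  qed
  also have "\<dots> = alt_sum 7 (\<lambda>u. dd (hh u) y (u 0)) b"
    unfolding alt_sum_sum[symmetric] dh ..
  also have "\<dots> = alt_sum 7 (\<lambda>u. (Th (\<lambda>j. u (3 + j)) y * (nab (u 0) ph y \<bullet> F (u 1) (u 2) y)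
      + Th (\<lambda>j. u (3 + j)) y * (ph y \<bullet> nab (u 0) (F (u 1) (u 2)) y))
      + dd (Th (\<lambda>j. u (3 + j))) y (u 0) * (ph y \<bullet> F (u 1) (u 2) y)) b"
  proof (rule alt_sum_cong)
    fix \<sigma>
    show "dd (hh (b \<circ> \<sigma>)) y ((b \<circ> \<sigma>) 0) = (Th (\<lambda>j. (b \<circ> \<sigma>) (3 + j)) y * (nab ((b \<circ> \<sigma>) 0) ph y \<bullet> F ((b \<circ> \<sigma>) 1) ((b \<circ> \<sigma>) 2) y)
      + Th (\<lambda>j. (b \<circ> \<sigma>) (3 + j)) y * (ph y \<bullet> nab ((b \<circ> \<sigma>) 0) (F ((b \<circ> \<sigma>) 1) ((b \<circ> \<sigma>) 2)) y))
      + dd (Th (\<lambda>j. (b \<circ> \<sigma>) (3 + j))) y ((b \<circ> \<sigma>) 0) * (ph y \<bullet> F ((b \<circ> \<sigma>) 1) ((b \<circ> \<sigma>) 2) y)"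
      unfolding hh_def[abs_def]
      using dd_bilinear[OF bounded_bilinear_mult Cinf_differentiable[OF Th_Cinf y] Cinf_differentiable[OF Cinf_inner[OF ph_Cinf F_Cinf] y]]
        metric_connection[OF y ph_Cinf F_Cinf]
      by (simp add: distrib_left)
  qed
  also have "\<dots> = S (\<lambda>u. nab u ph y) y
      + alt_sum 7 (\<lambda>u. Th (\<lambda>j. u (3 + j)) y * (ph y \<bullet> nab (u 0) (F (u 1) (u 2)) y)) b
      + alt_sum 7 (\<lambda>u. dd (Th (\<lambda>j. u (3 + j))) y (u 0) * (ph y \<bullet> F (u 1) (u 2) y)) b"
    unfolding alt_sum_add S_def ..
  also have "alt_sum 7 (\<lambda>u. Th (\<lambda>j. u (3 + j)) y * (ph y \<bullet> nab (u 0) (F (u 1) (u 2)) y)) b = 0"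
  proof (rule alt_sum_closed[of 2])
    fix u :: "nat \<Rightarrow> real^7"
    have s2: "{..2::nat} = {0, 1, 2}" by auto
    have "ph y \<bullet> (nab (u 0) (F (u 1) (u 2)) y - nab (u 1) (F (u 0) (u 2)) y + nab (u 2) (F (u 0) (u 1)) y) = 0"
      using bianchi[OF y] by simp
    then have "Th (\<lambda>j. u (3 + j)) y * (ph y \<bullet> nab (u 0) (F (u 1) (u 2)) y - ph y \<bullet> nab (u 1) (F (u 0) (u 2)) y + ph y \<bullet> nab (u 2) (F (u 0) (u 1)) y) = 0"
      by (simp add: inner_add_right inner_diff_right)
    then show "(\<Sum>i\<le>2. (-1) ^ i *\<^sub>R (Th (\<lambda>j. (u \<circ> cyc i) (3 + j)) y * (ph y \<bullet> nab ((u \<circ> cyc i) 0) (F ((u \<circ> cyc i) 1) ((u \<circ> cyc i) 2)) y))) = 0"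
      unfolding s2 by (simp add: cyc_def algebra_simps)
  qed simp
  \<comment> \<open>The slots are regrouped so that those of d\<Theta> come first; the curvature
    factor then reads slots 5 and 6, which the cycles leave fixed.\<close>
  also have "alt_sum 7 (\<lambda>u. dd (Th (\<lambda>j. u (3 + j))) y (u 0) * (ph y \<bullet> F (u 1) (u 2) y)) b = 0"
  proof (rule alt_sum_blockp, rule alt_sum_closed[of 4])
    fix u :: "nat \<Rightarrow> real^7"
    let ?G = "\<lambda>u. dd (Th (\<lambda>j. (u \<circ> blockp) (3 + j))) y ((u \<circ> blockp) 0) * (ph y \<bullet> F ((u \<circ> blockp) 1) ((u \<circ> blockp) 2) y)"
    have cong: "dd (Th v) y w = dd (Th v') y w" if "\<And>j. j < 4 \<Longrightarrow> v j = v' j" for v v' w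
    proof (rule dd_cong[OF oV y])
      fix z assume z: "z \<in> V"
      show "Th v z = Th v' z"
        unfolding Th_def by (rule altform_cong[OF form_altform[OF forms(2) \<phi>(2)[OF z]]]) (simp add: that)
    qed
    have "?G (u \<circ> cyc i) = dd (Th (\<lambda>j. if j < i then u j else u (Suc j))) y (u i) * (ph y \<bullet> F (u 5) (u 6) y)" if "i \<le> 4" for i
    proof -
      have "dd (Th (\<lambda>j. ((u \<circ> cyc i) \<circ> blockp) (3 + j))) y (u i) = dd (Th (\<lambda>j. if j < i then u j else u (Suc j))) y (u i)"
        by (rule cong) (auto simp: blockp_def cyc_def)
      moreover have "((u \<circ> cyc i) \<circ> blockp) 0 = u i" "((u \<circ> cyc i) \<circ> blockp) 1 = u 5" "((u \<circ> cyc i) \<circ> blockp) 2 = u 6"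
        using that by (auto simp: blockp_def cyc_def)
      ultimately show ?thesis by simp
    qed
    then have "(\<Sum>i\<le>4. (-1) ^ i *\<^sub>R ?G (u \<circ> cyc i)) = (\<Sum>i\<le>4. (-1) ^ i *\<^sub>R dd (Th (\<lambda>j. if j < i then u j else u (Suc j))) y (u i)) * (ph y \<bullet> F (u 5) (u 6) y)"
      unfolding sum_distrib_right by (intro sum.cong refl) simp
    also have "\<dots> = 0" by (simp only: Th_closed[OF y] mult_zero_left)
    finally show "(\<Sum>i\<le>4. (-1) ^ i *\<^sub>R ?G (u \<circ> cyc i)) = 0" .
  qed simp
  finally show ?thesis by simp
qed

lemma volf_altform: "y \<in> V \<Longrightarrow> altform 7 (\<lambda>u. volf (\<phi> y) (\<lambda>i. dd \<phi> y (u i)))"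
proof -
  assume y: "y \<in> V"
  have x: "\<phi> y \<in> M" by (rule \<phi>(2)[OF y])
  have "mlin (4 + 3) (\<lambda>v. lam D (\<phi> y) (\<lambda>i. v (4 + i)) *\<^sub>R mu D (\<phi> y) v)"
    by (rule mlin_prod[OF altform_mlin[OF form_altform[OF forms(3) x]] altform_mlin[OF form_altform[OF forms(1) x]]])
  then have "altform 7 (volf (\<phi> y))"
    unfolding volf_def[abs_def] by (intro alt_sum_altform) (simp add: mult.commute)
  from altform_linear_map[OF this Cinf_linear[OF \<phi>(1) y]] show ?thesis .
qed

lemma \<beta>_Cinf: "Cinf V \<beta>"
  unfolding \<beta>_def[abs_def] volf_def alt_sum_map alt_sum_def
  by (intro Cinf_sum oV Cinf_scaleR Cinf_mult Cinf_const form_pull_Cinf[OF forms(3) \<phi>(1,2)] form_pull_Cinf[OF forms(1) \<phi>(1,2)] Cinf_deriv[OF \<phi>(1)])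

text \<open>If \<beta> vanished at y, the alternating form \<open>volf\<close> would vanish on all
  tangent vectors there, against its value on an adapted frame.\<close>

lemma \<beta>_nonzero: "y \<in> V \<Longrightarrow> \<beta> y \<noteq> 0"
proof
  assume y: "y \<in> V" and z: "\<beta> y = 0"
  have x: "\<phi> y \<in> M" by (rule \<phi>(2)[OF y])
  have inj: "inj_on b {..<7}" and sp: "span (b ` {..<7}) = UNIV" using b by (auto simp: bij_betw_def)
  have 0: "volf (\<phi> y) (\<lambda>i. dd \<phi> y (u i)) = 0" for u
    by (rule altform_top_zero[OF volf_altform[OF y] inj sp z[unfolded \<beta>_def]])
  obtain v where v: "\<And>i. v i \<in> T (\<phi> y)" "\<And>i. i < 4 \<Longrightarrow> v i \<in> vert D (\<phi> y)" "mu D (\<phi> y) v \<noteq> 0" "lam D (\<phi> y) (\<lambda>i. v (4 + i)) \<noteq> 0"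
    by (rule volume_frame_exists[OF x]) (rule that)
  have "\<forall>i. \<exists>u. v i = dd \<phi> y u" using v(1) \<phi>(3)[OF y] by auto
  then obtain u where u: "\<And>i. v i = dd \<phi> y (u i)" by metis
  have L: "linear (dd \<phi> y)" by (rule Cinf_linear[OF \<phi>(1) y])
  have "alt_sum (4 + 3) (\<lambda>w. mu D (\<phi> y) (\<lambda>i. dd \<phi> y (w i)) * lam D (\<phi> y) (\<lambda>i. dd \<phi> y (w (4 + i)))) u \<noteq> 0"
  proof (rule alt_sum_block_nonzero[OF altform_linear_map[OF form_altform[OF forms(3) x] L] altform_linear_map[OF form_altform[OF forms(1) x] L]])
    show "lam D (\<phi> y) (\<lambda>i. dd \<phi> y (w i)) = 0" if "j < 3" "i < 4" "w j = u i" for w j i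
      by (rule lam_zero[OF x d\<phi>_T[OF y] that(1)]) (use that(2,3) v(2) u in metis)
    have ev: "(\<lambda>i. dd \<phi> y (u i)) = v" by (rule ext) (rule u[symmetric])
    show "mu D (\<phi> y) (\<lambda>i. dd \<phi> y (u i)) \<noteq> 0" unfolding ev by (rule v(3))
    have ev': "(\<lambda>i. dd \<phi> y (u (4 + i))) = (\<lambda>i. v (4 + i))" by (rule ext) (rule u[symmetric])
    show "lam D (\<phi> y) (\<lambda>i. dd \<phi> y (u (4 + i))) \<noteq> 0" unfolding ev' by (rule v(4))
  qed
  then show False using 0[of u] by (simp add: volf_def alt_sum_map)
qed

end

section \<open>Vanishing of the vertical covariant derivative\<close>

text \<open>The square of a positive part is continuously differentiable, which is the regularity
  asked of the weights in the divergence argument.\<close>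

definition bump :: "'a::real_inner \<Rightarrow> real \<Rightarrow> 'a \<Rightarrow> real" where
  "bump c r z = (max 0 (r\<^sup>2 - (norm (z - c))\<^sup>2))\<^sup>2"

definition dbump :: "'a::real_inner \<Rightarrow> real \<Rightarrow> 'a \<Rightarrow> 'a \<Rightarrow> real" where
  "dbump c r z v = - 4 * max 0 (r\<^sup>2 - (norm (z - c))\<^sup>2) * ((z - c) \<bullet> v)"

lemma has_real_derivative_max_square:
  "((\<lambda>t::real. (max 0 t)\<^sup>2) has_real_derivative 2 * max 0 t) (at t)"
proof (cases t "0 :: real" rule: linorder_cases)
  case less
  have "((\<lambda>t::real. 0) has_real_derivative 0) (at t)" by simp
  then have "((\<lambda>t::real. (max 0 t)\<^sup>2) has_real_derivative 0) (at t)"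
    by (rule has_field_derivative_transform_within_open[where S = "{..<0}"]) (use less in auto)
  then show ?thesis using less by simp
next
  case greater
  have "((\<lambda>t::real. t\<^sup>2) has_real_derivative 2 * t) (at t)" by (auto intro!: derivative_eq_intros)
  then have "((\<lambda>t::real. (max 0 t)\<^sup>2) has_real_derivative 2 * t) (at t)"
    by (rule has_field_derivative_transform_within_open[where S = "{0<..}"]) (use greater in auto)
  then show ?thesis using greater by simp
next
  case equal
  \<comment> \<open>At the gluing point 0 the difference quotient is bounded by |h|.\<close>
  have "((\<lambda>h. (max 0 h)\<^sup>2 / h) \<longlongrightarrow> 0) (at (0::real))"
  proof (rule Lim_null_comparison[of _ "\<lambda>h. \<bar>h\<bar>"])
    show "\<forall>\<^sub>F h in at (0::real). norm ((max 0 h)\<^sup>2 / h) \<le> \<bar>h\<bar>"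
      by (rule always_eventually) (auto simp: max_def power2_eq_square)
    show "((\<lambda>h. \<bar>h\<bar>) \<longlongrightarrow> 0) (at (0::real))" by (rule tendsto_rabs_zero) (rule tendsto_ident_at)
  qed
  then show ?thesis using equal by (simp add: has_field_derivative_def[symmetric] DERIV_def)
qed

lemma bump_has_derivative: "(bump c r has_derivative dbump c r z) (at z)"
proof -
  have "((\<lambda>z. r\<^sup>2 - (z - c) \<bullet> (z - c)) has_derivative (\<lambda>v. - 2 * ((z - c) \<bullet> v))) (at z)"
    by (auto intro!: derivative_eq_intros simp: inner_commute)
  from has_derivative_compose[OF this has_real_derivative_max_square[THEN has_field_derivative_imp_has_derivative]]
  show ?thesis unfolding bump_def[abs_def] dbump_def power2_norm_eq_inner
    by (simp add: mult_ac)
qed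

lemma bump_nonneg: "bump c r z \<ge> 0"
  by (simp add: bump_def)

lemma bump_zero: "r > 0 \<Longrightarrow> z \<notin> cball c r \<Longrightarrow> bump c r z = 0"
  by (simp add: bump_def dist_norm norm_minus_commute max_def)

lemma bump_pos: "z \<in> ball c r \<Longrightarrow> bump c r z > 0"
  using power_strict_mono[of "norm (z - c)" r 2] by (simp add: bump_def dist_norm norm_minus_commute)

lemma continuous_on_dbump:
  assumes "continuous_on S q" "continuous_on S w" shows "continuous_on S (\<lambda>x. dbump c r (q x) (w x))"
  unfolding dbump_def using assms by (intro continuous_intros)

section \<open>The squared norm of the Higgs field as a function on M\<close>

context bundle_connection
begin

lemma fibre_nonempty:
  assumes "x \<in> M" obtains p where "p \<in> P" "pr p = x"
proof -
  obtain U \<psi> where U: "open U" "x \<in> U" and d: "diffeo {p \<in> P. pr p \<in> U} ((M \<inter> U) \<times> G) (\<lambda>p. (pr p, \<psi> p))"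
    by (rule trivialisation[OF assms]) (rule that)
  have "(x, mat 1) \<in> (\<lambda>p. (pr p, \<psi> p)) ` {p \<in> P. pr p \<in> U}"
    using d assms U(2) grp(1) unfolding diffeo_def bij_betw_def by simp
  then show ?thesis using that by auto
qed

lemma fibre_transitive:
  assumes p: "p \<in> P" and q: "q \<in> P" "pr q = pr p"
  obtains g where "g \<in> G" "q = ac p g"
proof -
  obtain U \<psi> \<tau> where U: "open U" "pr p \<in> U" "smooth_on {q \<in> P. pr q \<in> U} \<psi>" "smooth_on ((M \<inter> U) \<times> G) \<tau>"
    "\<And>q. q \<in> P \<Longrightarrow> pr q \<in> U \<Longrightarrow> \<psi> q \<in> G \<and> \<tau> (pr q, \<psi> q) = q"
    "\<And>x g. x \<in> M \<Longrightarrow> x \<in> U \<Longrightarrow> g \<in> G \<Longrightarrow> \<tau> (x, g) \<in> P \<and> pr (\<tau> (x, g)) = x"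
    "\<And>q g. q \<in> P \<Longrightarrow> g \<in> G \<Longrightarrow> pr q \<in> U \<Longrightarrow> \<psi> (ac q g) = \<psi> q ** g"
    by (rule trivialisation_inverse[OF p]) (rule that)
  let ?g = "cadj (\<psi> p) ** \<psi> q"
  have \<psi>p: "\<psi> p \<in> G" and \<psi>q: "\<psi> q \<in> G" using U(5)[OF p U(2)] U(5)[OF q(1)] q(2) U(2) by auto
  have g: "?g \<in> G" using grp(4,5) \<psi>p \<psi>q by blast
  have "\<psi> (ac p ?g) = \<psi> q" using U(7)[OF p g U(2)] grp(3)[OF \<psi>p] by (simp add: matrix_mul_assoc)
  moreover have "\<tau> (pr (ac p ?g), \<psi> (ac p ?g)) = ac p ?g"
    using U(5)[of "ac p ?g"] P_facts(5,6)[OF p g] U(2) by simp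
  moreover have "\<tau> (pr q, \<psi> q) = q" using U(5)[OF q(1)] q(2) U(2) by simp
  ultimately have "q = ac p ?g" using P_facts(6)[OF p g] q(2) by simp
  then show ?thesis by (rule that[OF g])
qed

text \<open>Any point over x gives the same value, since conjugation by unitary matrices preserves
  the norm; smoothness can therefore be read off along local sections.\<close>

definition higgs_norm :: "('p \<Rightarrow> complex^'n^'n) \<Rightarrow> 'm \<Rightarrow> real" where
  "higgs_norm \<Phi> x = (norm (\<Phi> (SOME p. p \<in> P \<and> pr p = x)))\<^sup>2"

lemma higgs_norm_eq:
  assumes \<Phi>: "higgs_field Q \<Phi>" and p: "p \<in> P"
  shows "higgs_norm \<Phi> (pr p) = \<Phi> p \<bullet> \<Phi> p"
proof -
  let ?q = "SOME q. q \<in> P \<and> pr q = pr p"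
  have q: "?q \<in> P \<and> pr ?q = pr p" by (rule someI[of _ p]) (simp add: p)
  obtain g where g: "g \<in> G" "?q = ac p g"
    by (rule fibre_transitive[OF p conjunct1[OF q] conjunct2[OF q]]) (rule that)
  have "\<Phi> (ac p g) = cadj g ** \<Phi> p ** g" using \<Phi> p g(1) unfolding higgs_field_def by blast
  then show ?thesis
    unfolding higgs_norm_def g(2) using norm_conjugate[OF grp(3)[OF g(1)]] by (simp add: power2_norm_eq_inner)
qed

lemma higgs_norm_smooth:
  assumes \<Phi>: "higgs_field Q \<Phi>" shows "smooth_on M (higgs_norm \<Phi>)"
proof (rule smooth_onI)
  fix x assume x: "x \<in> M"
  obtain p where p: "p \<in> P" "pr p = x" by (rule fibre_nonempty[OF x]) (rule that)
  obtain U s where U: "open U" "pr p \<in> U" "smooth_on (M \<inter> U) s" "s (pr p) = p"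
    "\<And>x. x \<in> M \<Longrightarrow> x \<in> U \<Longrightarrow> s x \<in> P \<and> pr (s x) = x"
    by (rule local_section[OF p(1)]) (rule that)
  have s\<Phi>: "smooth_on P \<Phi>" using \<Phi> unfolding higgs_field_def by blast
  have "smooth_on (M \<inter> U) (\<lambda>x. \<Phi> (s x))"
    by (rule smooth_on_compose[OF U(3) s\<Phi>]) (use U(5) in blast)
  moreover have "smooth_on UNIV (\<lambda>z :: complex^'n^'n. z \<bullet> z)"
    by (rule Cinf_smooth_on[OF Cinf_inner[OF Cinf_ident[OF open_UNIV] Cinf_ident[OF open_UNIV]]]) simp
  ultimately have sm: "smooth_on (M \<inter> U) (\<lambda>x. \<Phi> (s x) \<bullet> \<Phi> (s x))" by (rule smooth_on_compose) simp
  have xU: "x \<in> M \<inter> U" using x U(2) p(2) by simp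
  obtain W h where W: "x \<in> W" "Cinf W h" "\<And>y. y \<in> M \<inter> U \<Longrightarrow> y \<in> W \<Longrightarrow> h y = \<Phi> (s y) \<bullet> \<Phi> (s y)"
    by (rule smooth_onE[OF sm xU]) (rule that)
  have "Cinf (W \<inter> U) h" by (rule Cinf_subset[OF W(2) open_Int[OF Cinf_open[OF W(2)] U(1)]]) simp
  moreover have "h y = higgs_norm \<Phi> y" if y: "y \<in> M \<inter> (W \<inter> U)" for y
  proof -
    have sy: "s y \<in> P" "pr (s y) = y" using U(5)[of y] y by auto
    show ?thesis using W(3)[of y] higgs_norm_eq[OF \<Phi> sy(1)] sy(2) y by simp
  qed
  ultimately show "\<exists>W h. x \<in> W \<and> Cinf W h \<and> (\<forall>y\<in>M \<inter> W. h y = higgs_norm \<Phi> y)"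
    using W(1) xU by blast
qed

end

context monopole
begin

text \<open>The gradient of |\<Phi>|^2 along the fibres for the fibre metric. Being vertical, it
  annihilates functions pulled back from the base.\<close>

definition vgrad :: "'m \<Rightarrow> 'm" where
  "vgrad x = (\<Sum>j<4. mdiff M (higgs_norm \<Phi>) x (frame x j) *\<^sub>R frame x j)"

lemma vgrad_vert: "x \<in> M \<Longrightarrow> vgrad x \<in> vert D x"
  unfolding vgrad_def by (intro subspace_sum subspace_scale vert_subspace frame(1)) auto

end

context monopole_chart
begin

text \<open>The 6 combines the 3 of \<open>Xc_eq\<close> with the 2 from differentiating a
  square.\<close>

lemma dd_Xc:
  assumes y: "y \<in> V"
  shows "6 *\<^sub>R dd \<phi> y (Xc y) = (- \<beta> y) *\<^sub>R vgrad (\<phi> y)"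
proof -
  have l: "linear (dd \<phi> y)" by (rule Cinf_linear[OF \<phi>(1) y])
  have d: "mdiff M (higgs_norm \<Phi>) (\<phi> y) (frame (\<phi> y) j) = 2 * (ph y \<bullet> nab (\<epsilon> y j) ph y)" if j: "j < 4" for j
  proof -
    have "mdiff M (higgs_norm \<Phi>) (\<phi> y) (frame (\<phi> y) j) = dd (\<lambda>z. higgs_norm \<Phi> (\<phi> z)) y (\<epsilon> y j)"
      unfolding \<epsilon>[OF y j, symmetric] by (rule dd_pull[OF \<phi>(1,2) higgs_norm_smooth[OF higgs] y, symmetric])
    also have "\<dots> = dd (\<lambda>z. ph z \<bullet> ph z) y (\<epsilon> y j)"
    proof (rule dd_cong[OF oV y])
      fix z assume z: "z \<in> V"
      show "higgs_norm \<Phi> (\<phi> z) = ph z \<bullet> ph z"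
        using higgs_norm_eq[OF higgs s(2)[OF z]] s(3)[OF z] by (simp add: ph_def)
    qed
    also have "\<dots> = 2 * (ph y \<bullet> nab (\<epsilon> y j) ph y)"
      using metric_connection[OF y ph_Cinf ph_Cinf] by (simp add: inner_commute)
    finally show ?thesis .
  qed
  have "6 *\<^sub>R dd \<phi> y (Xc y) = 2 *\<^sub>R dd \<phi> y (3 *\<^sub>R Xc y)" by (simp add: linear_scale[OF l])
  also have "\<dots> = (- \<beta> y) *\<^sub>R (\<Sum>j<4. (2 * (ph y \<bullet> nab (\<epsilon> y j) ph y)) *\<^sub>R dd \<phi> y (\<epsilon> y j))"
    unfolding Xc_eq[OF y] by (simp add: linear_scale[OF l] linear_sum[OF l] linear_neg[OF l] scaleR_sum_right mult_ac)
  also have "(\<Sum>j<4. (2 * (ph y \<bullet> nab (\<epsilon> y j) ph y)) *\<^sub>R dd \<phi> y (\<epsilon> y j)) = vgrad (\<phi> y)"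
    unfolding vgrad_def by (rule sum.cong) (simp_all add: d \<epsilon>[OF y])
  finally show ?thesis .
qed

text \<open>By connectedness, passing to the absolute value is multiplication by a constant, which
  commutes with taking the divergence.\<close>

lemma \<beta>_sign:
  assumes "connected V"
  obtains c where "\<bar>c\<bar> = 1" "\<And>y. y \<in> V \<Longrightarrow> c * \<beta> y = \<bar>\<beta> y\<bar>"
proof -
  have con: "connected (\<beta> ` V)" by (rule connected_continuous_image[OF Cinf_continuous_on[OF \<beta>_Cinf] assms])
  have "(\<forall>y\<in>V. \<beta> y > 0) \<or> (\<forall>y\<in>V. \<beta> y < 0)"
  proof (rule ccontr)
    assume "\<not> ?thesis"
    then obtain y z where "y \<in> V" "z \<in> V" "\<beta> y < 0" "0 < \<beta> z"
      using \<beta>_nonzero by (metis linorder_neqE_linordered_idom)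
    then have "0 \<in> \<beta> ` V" using connectedD_interval[OF con, of "\<beta> y" "\<beta> z" 0] by auto
    then show False using \<beta>_nonzero by auto
  qed
  then show ?thesis
  proof
    assume "\<forall>y\<in>V. \<beta> y > 0" then show ?thesis by (intro that[of 1]) (simp_all add: less_imp_le)
  next
    assume "\<forall>y\<in>V. \<beta> y < 0" then show ?thesis by (intro that[of "-1"]) (simp_all add: less_imp_le)
  qed
qed

text \<open>The last property is the equality case: zero divergence makes d_A \<Phi> vanish on the
  frame, hence on all vertical vectors by linearity.\<close>

lemma divergence_field:
  assumes "connected V"
  obtains X where "Cinf V X" "\<And>y. y \<in> V \<Longrightarrow> dd \<phi> y (X y) = \<bar>volf (\<phi> y) (\<lambda>k. dd \<phi> y (axis (e k) 1))\<bar> *\<^sub>R vgrad (\<phi> y)"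
    "\<And>y. y \<in> V \<Longrightarrow> 0 \<le> (\<Sum>c\<in>Basis. dd X y c \<bullet> c)"
    "\<And>y w. y \<in> V \<Longrightarrow> (\<Sum>c\<in>Basis. dd X y c \<bullet> c) = 0 \<Longrightarrow> w \<in> vert D (\<phi> y) \<Longrightarrow> cov_deriv Q A \<Phi> (s y) (\<lambda>_. w) = 0"
proof -
  obtain c where c: "\<bar>c\<bar> = 1" "\<And>y. y \<in> V \<Longrightarrow> c * \<beta> y = \<bar>\<beta> y\<bar>" by (rule \<beta>_sign[OF assms]) (rule that)
  \<comment> \<open>The factor turns \<open>dd_Xc\<close> into density times \<open>vgrad\<close>
    and, through \<open>S_eq\<close>, makes the divergence 2 |\<beta>| times a sum of
    squares.\<close>
  define X where "X y = (- 6 * c) *\<^sub>R Xc y" for y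
  have \<beta>: "\<beta> y = volf (\<phi> y) (\<lambda>k. dd \<phi> y (axis (e k) 1))" for y by (simp add: \<beta>_def b_def)
  have 1: "Cinf V X" unfolding X_def[abs_def] by (rule Cinf_scaleR[OF Cinf_const[OF oV] Xc_Cinf])
  have 2: "dd \<phi> y (X y) = \<bar>\<beta> y\<bar> *\<^sub>R vgrad (\<phi> y)" if y: "y \<in> V" for y
  proof -
    have l: "linear (dd \<phi> y)" by (rule Cinf_linear[OF \<phi>(1) y])
    have "dd \<phi> y (X y) = (- c) *\<^sub>R (6 *\<^sub>R dd \<phi> y (Xc y))" by (simp add: X_def linear_scale[OF l] linear_neg[OF l] mult.commute)
    also have "\<dots> = (c * \<beta> y) *\<^sub>R vgrad (\<phi> y)" unfolding dd_Xc[OF y] by simp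
    finally show ?thesis by (simp only: c(2)[OF y])
  qed
  have 3: "(\<Sum>c\<in>Basis. dd X y c \<bullet> c) = 2 * \<bar>\<beta> y\<bar> * (\<Sum>j<4. nab (\<epsilon> y j) ph y \<bullet> nab (\<epsilon> y j) ph y)" if y: "y \<in> V" for y
  proof -
    have "dd X y v = (- 6 * c) *\<^sub>R dd Xc y v" for v
      unfolding X_def[abs_def] by (rule dd_eqI) (rule has_derivative_scaleR_right[OF Cinf_has_derivative[OF Xc_Cinf y]])
    then have "(\<Sum>c\<in>Basis. dd X y c \<bullet> c) = (- 6 * c) * (\<Sum>c\<in>Basis. dd Xc y c \<bullet> c)"
      by (simp only: inner_scaleR_left sum_distrib_left)
    also have "\<dots> = - 2 * c * (3 * S (\<lambda>u. nab u ph y) y)" unfolding div_Xc[OF y] by simp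
    also have "\<dots> = 2 * (c * \<beta> y) * (\<Sum>j<4. nab (\<epsilon> y j) ph y \<bullet> nab (\<epsilon> y j) ph y)"
      unfolding S_eq[OF y nab_linear[OF y]] by simp
    finally show ?thesis by (simp only: c(2)[OF y])
  qed
  have 4: "cov_deriv Q A \<Phi> (s y) (\<lambda>_. w) = 0"
    if y: "y \<in> V" and z: "(\<Sum>c\<in>Basis. dd X y c \<bullet> c) = 0" and w: "w \<in> vert D (\<phi> y)" for y w
  proof -
    have x: "\<phi> y \<in> M" by (rule \<phi>(2)[OF y])
    have "(\<Sum>j<4. nab (\<epsilon> y j) ph y \<bullet> nab (\<epsilon> y j) ph y) = 0"
      using z \<beta>_nonzero[OF y] unfolding 3[OF y] by simp
    then have n0: "nab (\<epsilon> y j) ph y = 0" if "j < 4" for j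
      using that by (simp add: sum_nonneg_eq_0_iff)
    have l: "linear (dd \<phi> y)" and ln: "linear (\<lambda>u. nab u ph y)"
      by (rule Cinf_linear[OF \<phi>(1) y], rule nab_linear[OF y])
    have "frame (\<phi> y) ` {..<4} = dd \<phi> y ` (\<epsilon> y ` {..<4})"
      by (simp add: image_image) (rule image_cong, simp_all add: \<epsilon>[OF y])
    then have "w \<in> dd \<phi> y ` span (\<epsilon> y ` {..<4})"
      using vert_span_frame[OF x] w linear_span_image[OF l] by auto
    then obtain u where u: "u \<in> span (\<epsilon> y ` {..<4})" "w = dd \<phi> y u" by blast
    have "nab u ph y = 0"
      by (rule linear_eq_0_on_span[OF ln _ u(1)]) (use n0 in auto)
    then show ?thesis using cov[OF y, of "\<lambda>_. w" u] u(2) by simp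
  qed
  have 5: "0 \<le> (\<Sum>c\<in>Basis. dd X y c \<bullet> c)" if y: "y \<in> V" for y
    unfolding 3[OF y] by (intro mult_nonneg_nonneg sum_nonneg) auto
  show ?thesis by (rule that[OF 1, unfolded \<beta>[symmetric], OF 2 5 4])
qed

end

section \<open>From charts to the total space\<close>

context monopole
begin

definition section_chart ::
  "(real^7) set \<Rightarrow> (real^7 \<Rightarrow> 'm) \<Rightarrow> 'm set \<Rightarrow> ('m \<Rightarrow> real^7) \<Rightarrow> (real^7 \<Rightarrow> 'p) \<Rightarrow> bool" where
  "section_chart V \<phi> W g s \<longleftrightarrow> connected V \<and> Cinf V \<phi> \<and> Cinf W g \<and> \<phi> ` V = M \<inter> W \<and>
     (\<forall>y\<in>V. g (\<phi> y) = y \<and> T (\<phi> y) = range (dd \<phi> y)) \<and>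
     Cinf V s \<and> (\<forall>y\<in>V. s y \<in> P \<and> pr (s y) = \<phi> y)"

lemma section_chart_exists:
  "\<exists>V \<phi> W g s. section_chart V \<phi> W g s \<and> (p \<in> P \<longrightarrow> pr p \<in> W \<and> g (pr p) \<in> V \<and> s (g (pr p)) = p)"
proof (cases "p \<in> P")
  case False
  \<comment> \<open>Charts are indexed by all elements of the ambient type of P; points outside P
    receive an empty chart.\<close>
  have "section_chart {} (\<lambda>_. 0) {} (\<lambda>_. 0) (\<lambda>_. 0)"
    by (simp add: section_chart_def Cinf_const)
  then show ?thesis using False by blast
next
  case p: True
  obtain U \<sigma> where U: "open U" "pr p \<in> U" "smooth_on (M \<inter> U) \<sigma>" "\<sigma> (pr p) = p"
    "\<And>x. x \<in> M \<Longrightarrow> x \<in> U \<Longrightarrow> \<sigma> x \<in> P \<and> pr (\<sigma> x) = x"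
    by (rule local_section[OF p]) (rule that)
  have x: "pr p \<in> M" by (rule P_facts(3)[OF p])
  obtain r W and \<phi> :: "real^7 \<Rightarrow> 'm" and g where c: "r > 0" "Cinf (ball (g (pr p)) r) \<phi>" "Cinf W g" "pr p \<in> W" "W \<subseteq> U"
    "\<phi> ` ball (g (pr p)) r = M \<inter> W" "\<And>y. y \<in> ball (g (pr p)) r \<Longrightarrow> g (\<phi> y) = y"
    "\<And>z. z \<in> M \<Longrightarrow> z \<in> W \<Longrightarrow> g z \<in> ball (g (pr p)) r \<and> \<phi> (g z) = z"
    "\<And>z. z \<in> M \<Longrightarrow> z \<in> W \<Longrightarrow> T z = range (dd \<phi> (g z))"
    by (rule chart[OF x U(1,2)]) (rule that)
  let ?V = "ball (g (pr p)) r"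
  have \<phi>: "\<phi> y \<in> M \<and> \<phi> y \<in> W \<and> \<phi> y \<in> U" if "y \<in> ?V" for y using c(5,6) that by blast
  have "T (\<phi> y) = range (dd \<phi> y)" if y: "y \<in> ?V" for y
    using c(9)[of "\<phi> y"] \<phi>[OF y] c(7)[OF y] by simp
  moreover have "Cinf ?V (\<lambda>y. \<sigma> (\<phi> y))" by (rule Cinf_pull[OF c(2) _ U(3)]) (use \<phi> in blast)
  moreover have "\<sigma> (\<phi> y) \<in> P \<and> pr (\<sigma> (\<phi> y)) = \<phi> y" if y: "y \<in> ?V" for y
    using U(5)[of "\<phi> y"] \<phi>[OF y] by blast
  ultimately have "section_chart ?V \<phi> W g (\<lambda>y. \<sigma> (\<phi> y))"
    unfolding section_chart_def using c(2,3,6,7) by simp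
  moreover have "\<sigma> (\<phi> (g (pr p))) = p" using c(8)[OF x c(4)] U(4) by simp
  ultimately show ?thesis using c(1,4) by (metis centre_in_ball)
qed

text \<open>The charts are indexed by points of P, the section of chart p passing through p.
  Finitely many bump functions cover the compact preimage of a ball in the base, and the weight N is
  a bump function on the base composed with \<pi>.\<close>

theorem cov_deriv_vert_zero:
  assumes p0: "p0 \<in> P" and w: "w \<in> vert D (pr p0)"
  shows "cov_deriv Q A \<Phi> p0 (\<lambda>_. w) = 0"
proof -
  have "\<forall>p. \<exists>V \<phi> W g s. section_chart V \<phi> W g s \<and> (p \<in> P \<longrightarrow> pr p \<in> W \<and> g (pr p) \<in> V \<and> s (g (pr p)) = p)"
    using section_chart_exists by blast
  then obtain V \<phi> W g s where sc: "\<And>p. section_chart (V p) (\<phi> p) (W p) (g p) (s p)"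
    and base: "\<And>p. p \<in> P \<Longrightarrow> pr p \<in> W p \<and> g p (pr p) \<in> V p \<and> s p (g p (pr p)) = p"
    by metis
  have chart: "connected (V p)" "Cinf (V p) (\<phi> p)" "Cinf (W p) (g p)" "\<phi> p ` V p = M \<inter> W p"
    "y \<in> V p \<Longrightarrow> g p (\<phi> p y) = y" "y \<in> V p \<Longrightarrow> T (\<phi> p y) = range (dd (\<phi> p) y)"
    "Cinf (V p) (s p)" "y \<in> V p \<Longrightarrow> s p y \<in> P" "y \<in> V p \<Longrightarrow> pr (s p y) = \<phi> p y" for p y
    using sc[of p] unfolding section_chart_def by blast+
  have \<phi>M: "\<phi> p y \<in> M" if "y \<in> V p" for p y using chart(4)[of p] that by blast
  obtain e :: "nat \<Rightarrow> 7" where e: "bij_betw e {..<CARD(7)} UNIV"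
    using ex_bij_betw_nat_finite[of "UNIV :: 7 set"] by (auto simp: lessThan_atLeast0)
  have mc: "monopole_chart D Q A \<Phi> (V p) (\<phi> p) (s p) e" for p
    by unfold_locales (use e chart \<phi>M in auto)
  have "\<forall>p. \<exists>X. Cinf (V p) X
    \<and> (\<forall>y\<in>V p. dd (\<phi> p) y (X y) = \<bar>volf (\<phi> p y) (\<lambda>k. dd (\<phi> p) y (axis (e k) 1))\<bar> *\<^sub>R vgrad (\<phi> p y))
    \<and> (\<forall>y\<in>V p. 0 \<le> (\<Sum>c\<in>Basis. dd X y c \<bullet> c))
    \<and> (\<forall>y\<in>V p. \<forall>w\<in>vert D (\<phi> p y). (\<Sum>c\<in>Basis. dd X y c \<bullet> c) = 0 \<longrightarrow> cov_deriv Q A \<Phi> (s p y) (\<lambda>_. w) = 0)"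
  proof
    fix p
    interpret C: monopole_chart D Q A \<Phi> "V p" "\<phi> p" "s p" e by (rule mc)
    show "\<exists>X. Cinf (V p) X
      \<and> (\<forall>y\<in>V p. dd (\<phi> p) y (X y) = \<bar>volf (\<phi> p y) (\<lambda>k. dd (\<phi> p) y (axis (e k) 1))\<bar> *\<^sub>R vgrad (\<phi> p y))
      \<and> (\<forall>y\<in>V p. 0 \<le> (\<Sum>c\<in>Basis. dd X y c \<bullet> c))
      \<and> (\<forall>y\<in>V p. \<forall>w\<in>vert D (\<phi> p y). (\<Sum>c\<in>Basis. dd X y c \<bullet> c) = 0 \<longrightarrow> cov_deriv Q A \<Phi> (s p y) (\<lambda>_. w) = 0)"
      by (rule C.divergence_field[OF chart(1)]) blast
  qed
  from choice[OF this] obtain X where X_all: "\<forall>p. Cinf (V p) (X p)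
    \<and> (\<forall>y\<in>V p. dd (\<phi> p) y (X p y) = \<bar>volf (\<phi> p y) (\<lambda>k. dd (\<phi> p) y (axis (e k) 1))\<bar> *\<^sub>R vgrad (\<phi> p y))
    \<and> (\<forall>y\<in>V p. 0 \<le> (\<Sum>c\<in>Basis. dd (X p) y c \<bullet> c))
    \<and> (\<forall>y\<in>V p. \<forall>w\<in>vert D (\<phi> p y). (\<Sum>c\<in>Basis. dd (X p) y c \<bullet> c) = 0 \<longrightarrow> cov_deriv Q A \<Phi> (s p y) (\<lambda>_. w) = 0)"
    by (rule exE)
  have X: "Cinf (V p) (X p)"
    "y \<in> V p \<Longrightarrow> dd (\<phi> p) y (X p y) = \<bar>volf (\<phi> p y) (\<lambda>k. dd (\<phi> p) y (axis (e k) 1))\<bar> *\<^sub>R vgrad (\<phi> p y)"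
    "y \<in> V p \<Longrightarrow> 0 \<le> (\<Sum>c\<in>Basis. dd (X p) y c \<bullet> c)"
    "y \<in> V p \<Longrightarrow> u \<in> vert D (\<phi> p y) \<Longrightarrow> (\<Sum>c\<in>Basis. dd (X p) y c \<bullet> c) = 0 \<Longrightarrow> cov_deriv Q A \<Phi> (s p y) (\<lambda>_. u) = 0" for p y u
    using spec[OF X_all, of p] by simp_all
  interpret atlas: density_atlas M V \<phi> "\<lambda>p. dd (\<phi> p)" W g volf e
  proof
    fix p
    interpret C: monopole_chart D Q A \<Phi> "V p" "\<phi> p" "s p" e by (rule mc)
    have \<beta>: "C.\<beta> = (\<lambda>y. volf (\<phi> p y) (\<lambda>k. dd (\<phi> p) y (axis (e k) 1)))"
      by (simp add: C.\<beta>_def C.b_def fun_eq_iff)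
    show "bij_betw e {..<CARD(7)} UNIV" by (rule e)
    show "open (V p)" "open (W p)" by (rule Cinf_open[OF chart(2)], rule Cinf_open[OF chart(3)])
    show "\<phi> p ` V p = M \<inter> W p" by (rule chart(4))
    show "g p (\<phi> p y) = y" if "y \<in> V p" for y by (rule chart(5)[OF that])
    show "(\<phi> p has_derivative dd (\<phi> p) y) (at y)" if "y \<in> V p" for y
      by (rule Cinf_has_derivative[OF chart(2) that])
    show "g p differentiable (at z)" if "z \<in> W p" for z by (rule Cinf_differentiable[OF chart(3) that])
    show "altform CARD(7) (\<lambda>u. volf (\<phi> p y) (\<lambda>k. dd (\<phi> p) y (u k)))" if "y \<in> V p" for y
      using C.volf_altform[OF that] by simp
    show "volf (\<phi> p y) (\<lambda>k. dd (\<phi> p) y (axis (e k) 1)) \<noteq> 0" if "y \<in> V p" for y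
      using C.\<beta>_nonzero[OF that] unfolding \<beta> .
    show "continuous_on (V p) (\<lambda>y. volf (\<phi> p y) (\<lambda>k. dd (\<phi> p) y (axis (e k) 1)))"
      using Cinf_continuous_on[OF C.\<beta>_Cinf] unfolding \<beta> .
  qed
  define x0 where "x0 = pr p0"
  have x0: "x0 \<in> M" unfolding x0_def by (rule P_facts(3)[OF p0])
  obtain r where r: "r > 0" "compact {x \<in> M. \<pi> x \<in> cball (\<pi> x0) r}"
    by (rule proper[OF \<pi>(2)[OF x0]]) (rule that)
  let ?K = "{x \<in> M. \<pi> x \<in> cball (\<pi> x0) r}"
  have "\<forall>p. \<exists>\<rho>. p \<in> P \<longrightarrow> \<rho> > 0 \<and> cball (pr p) \<rho> \<subseteq> W p"
    using base Cinf_open[OF chart(3)] open_contains_cball by metis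
  then obtain \<rho> where \<rho>: "\<And>p. p \<in> P \<Longrightarrow> \<rho> p > 0" "\<And>p. p \<in> P \<Longrightarrow> cball (pr p) (\<rho> p) \<subseteq> W p" by metis
  have "?K \<subseteq> (\<Union>p\<in>P. ball (pr p) (\<rho> p))"
  proof
    fix x assume "x \<in> ?K"
    then obtain p where "p \<in> P" "pr p = x" using fibre_nonempty[of x] by blast
    then show "x \<in> (\<Union>p\<in>P. ball (pr p) (\<rho> p))" using \<rho>(1) by force
  qed
  then obtain J0 where J0: "J0 \<subseteq> P" "finite J0" "?K \<subseteq> (\<Union>p\<in>J0. ball (pr p) (\<rho> p))"
    by (rule compactE_image[OF r(2) open_ball]) (rule that)
  \<comment> \<open>With p0 included, its own chart takes part and the conclusion can be read off at
    p0, where the section takes exactly that value.\<close>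
  define J where "J = insert p0 J0"
  have JP: "J \<subseteq> P" using J0(1) p0 by (simp add: J_def)
  define N where "N x = bump (\<pi> x0) r (\<pi> x)" for x
  define N' where "N' x v = dbump (\<pi> x0) r (\<pi> x) (d\<pi> x v)" for x v
  define y0 where "y0 = g p0 x0"
  have y0: "y0 \<in> V p0" "s p0 y0 = p0" using base[OF p0] by (simp_all add: y0_def x0_def)
  have \<phi>y0: "\<phi> p0 y0 = x0" using chart(9)[OF y0(1)] y0(2) by (simp add: x0_def)
  have "bump (pr p0) (\<rho> p0) (\<phi> p0 y0) * N (\<phi> p0 y0) * (\<Sum>c\<in>Basis. dd (X p0) y0 c \<bullet> c) = 0"
  proof (rule atlas.divergence_nonneg_imp_zero[where J = J and K = ?K and Cl = "\<lambda>p. cball (pr p) (\<rho> p)"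
      and \<zeta> = "\<lambda>p. bump (pr p) (\<rho> p)" and \<zeta>' = "\<lambda>p. dbump (pr p) (\<rho> p)" and N' = N' and Y = vgrad and X' = "\<lambda>p. dd (X p)"])
    show "finite J" using J0(2) by (simp add: J_def)
    show "compact ?K" by (rule r(2))
    show "?K \<subseteq> M" by blast
    show "p0 \<in> J" by (simp add: J_def)
    show "y0 \<in> V p0" by (rule y0(1))
    show "closed (cball (pr p) (\<rho> p))" for p by (rule closed_cball)
    show "cball (pr p) (\<rho> p) \<subseteq> W p" if "p \<in> J" for p using \<rho>(2) JP that by blast
    show "bump (pr p) (\<rho> p) x = 0" if "p \<in> J" "x \<notin> cball (pr p) (\<rho> p)" for p x
      by (rule bump_zero) (use \<rho>(1) JP that in auto)
    show "(bump (pr p) (\<rho> p) has_derivative dbump (pr p) (\<rho> p) x) (at x)" for p x by (rule bump_has_derivative)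
    show "continuous_on UNIV (\<lambda>x. dbump (pr p) (\<rho> p) x v)" for p v
      by (intro continuous_on_dbump continuous_intros)
    show "bump (pr p) (\<rho> p) x \<ge> 0" for p x by (rule bump_nonneg)
    show "\<exists>p\<in>J. bump (pr p) (\<rho> p) x > 0" if x: "x \<in> ?K" for x
    proof -
      obtain p where "p \<in> J0" "x \<in> ball (pr p) (\<rho> p)" using J0(3) x by blast
      then show ?thesis using bump_pos[of x "pr p" "\<rho> p"] by (auto simp: J_def)
    qed
    show "(N has_derivative N' x) (at x within M)" if x: "x \<in> M" for x
      unfolding N_def[abs_def] N'_def[abs_def]
      by (rule has_derivative_compose[OF smooth_on_has_derivative[OF \<pi>(1) x] bump_has_derivative])
    show "N x \<ge> 0" for x unfolding N_def by (rule bump_nonneg)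
    show "N x = 0" if "x \<in> M" "x \<notin> ?K" for x
      unfolding N_def by (rule bump_zero[OF r(1)]) (use that in blast)
    show "N' x (vgrad x) = 0" if "x \<in> M" for x
      using vgrad_vert[OF that] by (simp add: N'_def vert_def dbump_def)
    show "continuous_on (V p) (\<lambda>y. N' (\<phi> p y) (dd (\<phi> p) y v))" for p v
    proof -
      have C: "Cinf (V p) (\<lambda>y. \<pi> (\<phi> p y))" by (rule Cinf_pull[OF chart(2) \<phi>M \<pi>(1)])
      have "continuous_on (V p) (\<lambda>y. dbump (\<pi> x0) r (\<pi> (\<phi> p y)) (dd (\<lambda>y. \<pi> (\<phi> p y)) y v))"
        by (rule continuous_on_dbump[OF Cinf_continuous_on[OF C] Cinf_continuous_on[OF Cinf_deriv[OF C]]])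
      moreover have "N' (\<phi> p y) (dd (\<phi> p) y v) = dbump (\<pi> x0) r (\<pi> (\<phi> p y)) (dd (\<lambda>y. \<pi> (\<phi> p y)) y v)" if "y \<in> V p" for y
        unfolding N'_def by (rule arg_cong[OF dd_pull[OF chart(2) \<phi>M \<pi>(1) that, symmetric]])
      ultimately show ?thesis by (simp cong: continuous_on_cong)
    qed
    show "continuous_on (V p) (\<lambda>y. dd (\<phi> p) y v)" for p v
      by (rule Cinf_continuous_on[OF Cinf_deriv[OF chart(2)]])
    show "(X p has_derivative dd (X p) y) (at y)" if "y \<in> V p" for p y
      by (rule Cinf_has_derivative[OF X(1) that])
    show "continuous_on (V p) (\<lambda>y. dd (X p) y v)" for p v
      by (rule Cinf_continuous_on[OF Cinf_deriv[OF X(1)]])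
    show "dd (\<phi> p) y (X p y) = atlas.\<nu> p y *\<^sub>R vgrad (\<phi> p y)" if "y \<in> V p" for p y
      unfolding atlas.\<nu>_def by (rule X(2)[OF that])
    show "0 \<le> (\<Sum>c\<in>Basis. dd (X p) y c \<bullet> c)" if "y \<in> V p" for p y by (rule X(3)[OF that])
  qed
  moreover have "bump (pr p0) (\<rho> p0) (\<phi> p0 y0) > 0"
    by (rule bump_pos) (simp add: \<phi>y0 x0_def \<rho>(1)[OF p0])
  moreover have "N (\<phi> p0 y0) > 0" unfolding N_def by (rule bump_pos) (simp add: \<phi>y0 r(1))
  ultimately have "(\<Sum>c\<in>Basis. dd (X p0) y0 c \<bullet> c) = 0" by simp
  from X(4)[OF y0(1) _ this, of w] show ?thesis using w by (simp add: \<phi>y0 y0(2) x0_def)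
qed

lemma vert_cov_deriv_zero: "zero_ad_form Q M (vert_cov_deriv D Q A \<Phi>)"
  unfolding zero_ad_form_def
proof (intro ballI allI impI)
  fix p and v :: "nat \<Rightarrow> 'm" assume p: "p \<in> P" and v: "\<forall>i. v i \<in> T (pr p)"
  \<comment> \<open>d_A \<Phi> reads slot 0 only, so the tuple may be replaced by a constant
    one.\<close>
  have "vert_cov_deriv D Q A \<Phi> p v = cov_deriv Q A \<Phi> p (\<lambda>_. vpart D (pr p) (v 0))"
    unfolding vert_cov_deriv_eq by (simp add: cov_deriv_def descend_def cov_deriv_on_P_def)
  also have "\<dots> = 0"
    by (rule cov_deriv_vert_zero[OF p hpart(2)[OF P_facts(3)[OF p]]]) (use v in blast)
  finally show "vert_cov_deriv D Q A \<Phi> p v = 0" .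
qed

end

section \<open>Comparison of monopoles and instantons\<close>

context fibration
begin

lemma star4_zero:
  assumes v: "zero_ad_form Q M \<alpha>" and p: "p \<in> ptot Q" "pproj Q p \<in> M"
  shows "star4 D (pproj Q p) (\<alpha> p) u = 0"
  unfolding star4_frame
proof (rule sum.neutral, rule ballI)
  fix j :: nat assume "j \<in> {..<4}"
  then have "frame (pproj Q p) j \<in> T (pproj Q p)" using vert_T[OF frame(1)[OF p(2)]] by simp
  then have "\<alpha> p (\<lambda>_. frame (pproj Q p) j) = 0" using v[unfolded zero_ad_form_def, rule_format, OF p(1), of "\<lambda>_. frame (pproj Q p) j"] by simp
  then show "mu D (pproj Q p) (case_nat (frame (pproj Q p) j) u) *\<^sub>R \<alpha> p (\<lambda>_. frame (pproj Q p) j) = 0" by simp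
qed

lemma monopole_iff_instanton:
  assumes Q: "principal_bundle Q M" and z: "zero_ad_form Q M (vert_cov_deriv D Q A \<Phi>)"
  shows "adiabatic_monopole D Q A \<Phi> \<longleftrightarrow> adiabatic_instanton D Q A \<and> higgs_field Q \<Phi>"
proof -
  have "pproj Q p \<in> M" if "p \<in> ptot Q" for p using Q that unfolding principal_bundle_def by blast
  then have "wedge 3 3 (star4 D (pproj Q p) (vert_cov_deriv D Q A \<Phi> p)) (lam D (pproj Q p)) v = 0" if "p \<in> ptot Q" for p v
    using star4_zero[OF z that] that by (simp add: wedge_def)
  then show ?thesis
    unfolding adiabatic_monopole_def adiabatic_instanton_def zero_ad_form_def by auto
qed

end

theorem proposition2p4:
  fixes D :: "('m::euclidean_space, 'b::euclidean_space) adiabatic_data"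
    and Q :: "('p::euclidean_space, 'm, 'n::finite) bundle_data"
  assumes "adiabatic_fibration D"
    and "principal_bundle Q (tot D)"
  shows "(\<forall>A \<Phi>. adiabatic_monopole D Q A \<Phi> \<longrightarrow> zero_ad_form Q (tot D) (vert_cov_deriv D Q A \<Phi>)) \<and>
    (\<forall>A \<Phi>. adiabatic_monopole D Q A \<Phi> \<longleftrightarrow>
       adiabatic_instanton D Q A \<and> higgs_field Q \<Phi> \<and>
       zero_ad_form Q (tot D) (vert_cov_deriv D Q A \<Phi>)) \<and>
    (\<forall>A. adiabatic_instanton D Q A \<longleftrightarrow> (\<exists>\<Phi>. adiabatic_monopole D Q A \<Phi>))"
proof -
  interpret fibration D by unfold_locales (rule assms(1))
  have vanish: "zero_ad_form Q M (vert_cov_deriv D Q A \<Phi>)" if m: "adiabatic_monopole D Q A \<Phi>" for A \<Phi>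
  proof -
    interpret monopole D Q A \<Phi>
      by unfold_locales (use assms m in \<open>auto simp: adiabatic_monopole_def\<close>)
    show ?thesis by (rule vert_cov_deriv_zero)
  qed
  have iff: "adiabatic_monopole D Q A \<Phi> \<longleftrightarrow>
       adiabatic_instanton D Q A \<and> higgs_field Q \<Phi> \<and> zero_ad_form Q M (vert_cov_deriv D Q A \<Phi>)" for A \<Phi>
    using vanish monopole_iff_instanton[OF assms(2)] by blast
  \<comment> \<open>The zero Higgs field serves as the witness. Its covariant derivative is computed
    on tangent vectors, where the chosen derivative of a constant map is known to vanish.\<close>
  have "\<exists>\<Phi>. adiabatic_monopole D Q A \<Phi>" if i: "adiabatic_instanton D Q A" for A
  proof -
    interpret bundle_connection Q M A
      by unfold_locales (use assms(2) i in \<open>auto simp: adiabatic_instanton_def\<close>)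
    have "zero_ad_form Q M (vert_cov_deriv D Q A (\<lambda>_. 0))"
      unfolding zero_ad_form_def
    proof (intro ballI allI impI)
      fix p and v :: "nat \<Rightarrow> 'm" assume p: "p \<in> ptot Q" and v: "\<forall>i. v i \<in> T (pproj Q p)"
      have "{I. I \<subseteq> {..<0 + 1::nat} \<and> card I = 0} = {{}}" by (auto dest: finite_subset)
      moreover have "cov_deriv Q A (\<lambda>_. 0) p (\<lambda>i. vpart D (pproj Q p) (v i)) = 0"
        by (rule cov_deriv_zero[OF p vert_T[OF hpart(2)[OF P_facts(3)[OF p]]]]) (use v in blast)
      ultimately show "vert_cov_deriv D Q A (\<lambda>_. 0) p v = 0"
        unfolding vert_cov_deriv_def bicomp_def by simp
    qed
    then show ?thesis using i zero_higgs iff by blast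
  qed
  then show ?thesis using vanish iff by blast
qed

end
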